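(* Let $M\in\mathbb{N}$, let $L$ be an even lattice of full rank in the quadratic space $V$ below, let $k\in\mathbb{N}_{\ge2}$, fix $X_0\in L'$ with $q(X_0)>0$, let $z_{\mathcal A}\in\mathbb{H}$ correspond to the positive line $\mathbb{R}X_0$, and put $P=L\cap\mathbb{R}X_0$, $N=L\cap X_0^\perp$. Let $f$ be a weakly holomorphic modular form of weight $\frac32-k$ for $\rho_L$. If $k$ is even, then \[\Lambda^{\mathrm{reg}}(f,z_{\mathcal A})=\frac{\pi^{\frac12}\Gamma\left(\frac k2\right)}{2(4\pi)^{1-\frac k2}\Gamma\left(\frac{k+1}{2}\right)}\,\mathrm{CT}\left(\left\langle f_{P\oplus N}(\tau),\left[\mathcal G_P^+(\tau),\Theta_{N^-}(\tau)\right]_{\frac k2-1}\right\rangle\right).\] If $k$ is odd, then \[\Lambda^{\mathrm{reg}}(f,z_{\mathcal A})=\frac{\pi^{\frac12}\Gamma\left(\frac{k+1}{2}\right)}{(4\pi)^{\frac{1-k}{2}}\Gamma\left(\frac k2\right)}\,\mathrm{CT}\left(\left\langle f_{P\oplus N}(\tau),\left[\mathcal G_P^{*,+}(\tau),\Theta_{N^-}(\tau)\right]_{\frac{k-1}{2}}\right\rangle\right).\] Here $\mathcal G_P$ is any harmonic Maass form of weight $\frac32$ for $\rho_{P^-}$ with $\xi_{3/2}(\mathcal G_P)=\Theta_P$, and $\mathcal G_P^*$ is any harmonic Maass form of weight $\frac12$ for $\rho_{P^-}$ with $\xi_{1/2}(\mathcal G_P^* )=\Theta_P^*$.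
   Context: $V=\left\{X=\left(\begin{smallmatrix}-\frac{b}{2M}&-\frac cM\\ a&\frac{b}{2M}\end{smallmatrix}\right):a,b,c\in\mathbb{Q}\right\}$, $q(X)=M\det X$, $(X,Y)=-M\,\mathrm{tr}(XY)$, signature $(1,2)$; $\mathbb{H}$ is identified with the Grassmannian of positive lines in $V\otimes\mathbb{R}$ via $z=x+iy\mapsto\mathbb{R}X_1(z)$, $X_1(z)=\frac{1}{\sqrt{2M}y}\left(\begin{smallmatrix}-x&x^2+y^2\\-1&x\end{smallmatrix}\right)$. For $X\in V\otimes\mathbb{R}$: $p_X(z)=-\sqrt{2M}(X,X_1(z))$; $X_z,X_{z^\perp}$ are orthogonal projections onto $\mathbb{R}X_1(z)$ and its complement. $e(w)=e^{2\pi iw}$, $\tau=u+iv$. For an even lattice $K$ of signature $(r,s)$, $\mathbb{C}[K'/K]$ has basis $\mathfrak e_\mu$ and bilinear form $\langle\mathfrak e_\mu,\mathfrak e_\nu\rangle=\delta_{\mu\nu}$; the Weil representation $\rho_K$ of $\mathrm{Mp}_2(\mathbb{Z})$ is $\rho_K(T)\mathfrak e_\mu=e(q(\mu))\mathfrak e_\mu$, $\rho_K(S)\mathfrak e_\mu=\frac{e((s-r)/8)}{\sqrt{|K'/K|}}\sum_\nu e(-(\nu,\mu))\mathfrak e_\nu$; $K^-=(K,-q)$. Modular forms of weight $\kappa$ for $\rho_K$ satisfy $f(\gamma\tau)=\phi(\tau)^{2\kappa}\rho_K(\gamma,\phi)f(\tau)$. A harmonic Maass form of weight $\kappa$ for $\rho_K$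 is a smooth such function annihilated by $\Delta_\kappa=-v^2(\partial_u^2+\partial_v^2)+i\kappa v(\partial_u+i\partial_v)$ with a Fourier polynomial $P_f$ such that $f-P_f=O(e^{-\varepsilon v})$; it decomposes as $f=f^++f^-$ with holomorphic part $f^+=\sum_\mu\sum_{n\gg-\infty}c^+(\mu,n)e(n\tau)\mathfrak e_\mu$ and $f^-=\sum_\mu\sum_{n<0}c^-(\mu,n)\Gamma(1-\kappa,4\pi|n|v)e(n\tau)\mathfrak e_\mu$. $\xi_\kappa=2iv^\kappa\overline{\partial/\partial\bar\tau}$. Weakly holomorphic = holomorphic harmonic Maass form. Theta functions: for positive definite $K$, $\Theta_K(\tau)=\sum_{\mu\in K'/K}\sum_{X\in K+\mu}e(q(X)\tau)\mathfrak e_\mu$; $\Theta_P^*(\tau)=\sum_{\mu\in P'/P}\sum_{X\in P+\mu}p_X(z_{\mathcal A})e(q(X)\tau)\mathfrak e_\mu$; $N^-=(N,-q)$ is positive definite of rank 2. Siegel theta $\Theta_L(\tau,z)=v\sum_\mu\sum_{X\in L+\mu}e(q(X_z)\tau+q(X_{z^\perp})\bar\tau)\mathfrak e_\mu$, Millson theta $\Theta_L^*(\tau,z)=v\sum_\mu\sum_{X\in L+\mu}p_X(z)e(q(X_z)\tau+q(X_{z^\perp})\bar\tau)\mathfrak e_\mu$. $R_\kappa=2i\partial_\tau+\kappa/v$, $R^n_\kappa=R_{\kappa+2n-2}\circ\cdots\circ R_\kappa$, $R^0_\kappa=\mathrm{id}$. Lift: $\Lambda^{\mathrm{reg}}(f,z)=\int^{\mathrm{reg}}_{\mathcal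 F}\langle R^{\frac k2-1}_{\frac32-k}(f),\overline{\Theta_L(\tau,z)}\rangle v^{-1/2}\frac{du\,dv}{v^2}$ for $k$ even and $\int^{\mathrm{reg}}_{\mathcal F}\langle R^{\frac{k-1}2}_{\frac32-k}(f),\overline{\Theta^*_L(\tau,z)}\rangle v^{1/2}\frac{du\,dv}{v^2}$ for $k$ odd, where $\int^{\mathrm{reg}}_{\mathcal F}=\lim_{T\to\infty}\int_{\mathcal F_T}$, $\mathcal F_T$ the standard fundamental domain of $\mathrm{SL}_2(\mathbb{Z})$ truncated at height $T$. Restriction: for the finite-index sublattice $K=P\oplus N\subset L$ (so $L'/K\subset K'/K$ with natural map $L'/K\to L'/L$, $\mu\mapsto\bar\mu$), $(f_K)_\mu=f_{\bar\mu}$ if $\mu\in L'/K$ and $0$ otherwise. Rankin–Cohen bracket: for $f$ of weight $\kappa$ (lattice $K_1$) and $g$ of weight $\ell$ (lattice $K_2$), $[f,g]_n=\frac{1}{(2\pi i)^n}\sum_{r+s=n}(-1)^r\frac{\Gamma(\kappa+n)\Gamma(\ell+n)}{\Gamma(s+1)\Gamma(\kappa+n-s)\Gamma(r+1)\Gamma(\ell+n-r)}f^{(r)}\otimes g^{(s)}$, with $f^{(r)}$ the $r$-th $\tau$-derivative and $f\otimes g=\sum_{\mu,\nu}f_\mu g_\nu\mathfrak e_{\mu+\nu}$ valued in $\mathbb{C}[(K_1\oplus K_2)'/(K_1\oplus K_2)]$ (here $P'/P\oplus N'/N=(P\oplus N)'/(P\oplus N)$). $\mathrm{CT}$ denotes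 the constant term of the Fourier expansion in $\tau$. *)

theory Defs
  imports "HOL-Analysis.Analysis" "HOL-Library.Landau_Symbols" "HOL-Library.Set_Algebras"
begin

section \<open>Even lattices and their discriminant groups\<close>

text \<open>A quadratic space is given by a quadratic form \<open>q\<close> on an ambient Euclidean space; a lattice \<open>K\<close> is
  a subset of it and carries the restriction of \<open>q\<close> to \<open>span K\<close>.  Thus \<open>K\<^sup>-\<close> is the same set \<open>K\<close>
  taken with the form \<open>\<lambda>X. - q X\<close>.\<close>

definition polar :: "('a::real_vector \<Rightarrow> real) \<Rightarrow> 'a \<Rightarrow> 'a \<Rightarrow> real" where
  "polar q X Y = q (X + Y) - q X - q Y"

definition int_span :: "'a::real_vector set \<Rightarrow> 'a set" where
  "int_span B = {\<Sum>b\<in>B. of_int (c b) *\<^sub>R b |c. True}"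

definition even_lattice :: "('a::euclidean_space \<Rightarrow> real) \<Rightarrow> 'a set \<Rightarrow> bool" where
  "even_lattice q K \<longleftrightarrow>
     (\<exists>B. finite B \<and> independent B \<and> K = int_span B) \<and> (\<forall>X\<in>K. q X \<in> \<int>)"

definition dual_lattice :: "('a::euclidean_space \<Rightarrow> real) \<Rightarrow> 'a set \<Rightarrow> 'a set" where
  "dual_lattice q K = {X \<in> span K. \<forall>Y\<in>K. polar q X Y \<in> \<int>}"

text \<open>\<open>K'/K\<close>, consisting of the cosets \<open>X + K\<close>, which are honest subsets of \<open>K'\<close>.\<close>

definition disc_group :: "('a::euclidean_space \<Rightarrow> real) \<Rightarrow> 'a set \<Rightarrow> 'a set set" where
  "disc_group q K = (\<lambda>X. X +o K) ` dual_lattice q K"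

text \<open>\<open>q(\<mu>)\<close> modulo 1 and \<open>(\<mu>,\<nu>)\<close> modulo 1 are evaluated on arbitrary representatives.\<close>

definition rep :: "'a set \<Rightarrow> 'a" where
  "rep \<mu> = (SOME X. X \<in> \<mu>)"

definition pos_index :: "('a::euclidean_space \<Rightarrow> real) \<Rightarrow> 'a set \<Rightarrow> nat" where
  "pos_index q U = Max {dim W |W. subspace W \<and> W \<subseteq> U \<and> (\<forall>X\<in>W. X \<noteq> 0 \<longrightarrow> q X > 0)}"

definition signature :: "('a::euclidean_space \<Rightarrow> real) \<Rightarrow> 'a set \<Rightarrow> nat \<times> nat" where
  "signature q K = (pos_index q (span K), pos_index (\<lambda>X. - q X) (span K))"

section \<open>Vector-valued functions and the Weil representation\<close>

text \<open>An element of \<open>\<complex>[K'/K]\<close> is a function on cosets; only its values on \<open>disc_group q K\<close> matter.\<close>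

type_synonym 'a grpring = "'a set \<Rightarrow> complex"
type_synonym 'a vvfun = "complex \<Rightarrow> 'a grpring"

definition uhp :: "complex set" where
  "uhp = {\<tau>. Im \<tau> > 0}"

definition e :: "complex \<Rightarrow> complex" where
  "e w = exp (2 * of_real pi * \<i> * w)"

definition pairing ::
    "('a::euclidean_space \<Rightarrow> real) \<Rightarrow> 'a set \<Rightarrow> 'a grpring \<Rightarrow> 'a grpring \<Rightarrow> complex" where
  "pairing q K \<phi> \<psi> = (\<Sum>\<mu>\<in>disc_group q K. \<phi> \<mu> * \<psi> \<mu>)"

definition weil_T ::
    "('a::euclidean_space \<Rightarrow> real) \<Rightarrow> 'a set \<Rightarrow> 'a grpring \<Rightarrow> 'a grpring" where
  "weil_T q K \<phi> \<mu> = e (of_real (q (rep \<mu>))) * \<phi> \<mu>"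

definition weil_S ::
    "('a::euclidean_space \<Rightarrow> real) \<Rightarrow> 'a set \<Rightarrow> 'a grpring \<Rightarrow> 'a grpring" where
  "weil_S q K \<phi> \<nu> =
     (case signature q K of (r, s) \<Rightarrow>
        e (of_real ((real s - real r) / 8)) / of_real (sqrt (real (card (disc_group q K)))) *
        (\<Sum>\<mu>\<in>disc_group q K. e (- of_real (polar q (rep \<nu>) (rep \<mu>))) * \<phi> \<mu>))"

type_synonym mp2 = "(int^2^2) \<times> (complex \<Rightarrow> complex)"

definition moebius :: "int^2^2 \<Rightarrow> complex \<Rightarrow> complex" where
  "moebius A \<tau> =
     (of_int (A$1$1) * \<tau> + of_int (A$1$2)) / (of_int (A$2$1) * \<tau> + of_int (A$2$2))"

text \<open>The second components live on the upper half-plane only, hence \<open>extensional\<close> and \<open>restrict\<close>.\<close>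

definition Mp2Z :: "mp2 set" where
  "Mp2Z = {(A, \<phi>). det A = 1 \<and> \<phi> \<in> extensional uhp \<and> \<phi> holomorphic_on uhp \<and>
             (\<forall>\<tau>\<in>uhp. (\<phi> \<tau>)\<^sup>2 = of_int (A$2$1) * \<tau> + of_int (A$2$2))}"

definition mp_mult :: "mp2 \<Rightarrow> mp2 \<Rightarrow> mp2" where
  "mp_mult g h =
     (fst g ** fst h, restrict (\<lambda>\<tau>. snd g (moebius (fst h) \<tau>) * snd h \<tau>) uhp)"

definition mp_T :: mp2 where
  "mp_T = (vector [vector [1, 1], vector [0, 1]], restrict (\<lambda>_. 1) uhp)"

definition mp_S :: mp2 where
  "mp_S = (vector [vector [0, - 1], vector [1, 0]], restrict csqrt uhp)"

text \<open>\<open>weil_rep q K g U\<close> means \<open>\<rho>\<^sub>K(g) = U\<close>: this is the graph of the homomorphism with the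
  prescribed values on the generators \<open>T\<close> and \<open>S\<close>.  Inverses need no rule of their own, because
  \<open>T\<close> and \<open>S\<close> generate \<open>Mp\<^sub>2(\<int>)\<close> already as a monoid.\<close>

inductive weil_rep ::
    "('a::euclidean_space \<Rightarrow> real) \<Rightarrow> 'a set \<Rightarrow> mp2 \<Rightarrow> ('a grpring \<Rightarrow> 'a grpring) \<Rightarrow> bool"
  for q K where
  T: "weil_rep q K mp_T (weil_T q K)"
| S: "weil_rep q K mp_S (weil_S q K)"
| mult: "weil_rep q K g U \<Longrightarrow> weil_rep q K h W \<Longrightarrow> weil_rep q K (mp_mult g h) (U \<circ> W)"

text \<open>Weights \<open>\<kappa>\<close> are half-integers, so \<open>\<lfloor>2\<kappa>\<rfloor>\<close> is just \<open>2\<kappa>\<close> as an integer.\<close>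

definition transforms_with_weight ::
    "real \<Rightarrow> ('a::euclidean_space \<Rightarrow> real) \<Rightarrow> 'a set \<Rightarrow> 'a vvfun \<Rightarrow> bool" where
  "transforms_with_weight \<kappa> q K f \<longleftrightarrow>
     (\<forall>g\<in>Mp2Z. \<forall>U. weil_rep q K g U \<longrightarrow>
        (\<forall>\<tau>\<in>uhp. \<forall>\<mu>\<in>disc_group q K.
           f (moebius (fst g) \<tau>) \<mu> = (snd g \<tau>) powi \<lfloor>2 * \<kappa>\<rfloor> * U (f \<tau>) \<mu>))"

section \<open>Differential operators, with \<open>\<tau> = u + iv\<close>\<close>

definition d_u :: "(complex \<Rightarrow> complex) \<Rightarrow> complex \<Rightarrow> complex" where
  "d_u F \<tau> = vector_derivative (\<lambda>t::real. F (\<tau> + of_real t)) (at 0)"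

definition d_v :: "(complex \<Rightarrow> complex) \<Rightarrow> complex \<Rightarrow> complex" where
  "d_v F \<tau> = vector_derivative (\<lambda>t::real. F (\<tau> + \<i> * of_real t)) (at 0)"

definition d_tau :: "(complex \<Rightarrow> complex) \<Rightarrow> complex \<Rightarrow> complex" where
  "d_tau F \<tau> = (d_u F \<tau> - \<i> * d_v F \<tau>) / 2"

definition d_taubar :: "(complex \<Rightarrow> complex) \<Rightarrow> complex \<Rightarrow> complex" where
  "d_taubar F \<tau> = (d_u F \<tau> + \<i> * d_v F \<tau>) / 2"

primrec n_times_differentiable :: "nat \<Rightarrow> (complex \<Rightarrow> complex) \<Rightarrow> bool" where
  "n_times_differentiable 0 F \<longleftrightarrow> continuous_on uhp F"
| "n_times_differentiable (Suc n) F \<longleftrightarrow>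
     F differentiable_on uhp \<and> n_times_differentiable n (d_u F) \<and> n_times_differentiable n (d_v F)"

definition smooth :: "(complex \<Rightarrow> complex) \<Rightarrow> bool" where
  "smooth F \<longleftrightarrow> (\<forall>n. n_times_differentiable n F)"

definition laplace :: "real \<Rightarrow> (complex \<Rightarrow> complex) \<Rightarrow> complex \<Rightarrow> complex" where
  "laplace \<kappa> F \<tau> =
     - of_real ((Im \<tau>)\<^sup>2) * (d_u (d_u F) \<tau> + d_v (d_v F) \<tau>)
     + \<i> * of_real (\<kappa> * Im \<tau>) * (d_u F \<tau> + \<i> * d_v F \<tau>)"

definition xi :: "real \<Rightarrow> (complex \<Rightarrow> complex) \<Rightarrow> complex \<Rightarrow> complex" where
  "xi \<kappa> F \<tau> = 2 * \<i> * of_real (Im \<tau> powr \<kappa>) * cnj (d_taubar F \<tau>)"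

definition raise :: "real \<Rightarrow> (complex \<Rightarrow> complex) \<Rightarrow> complex \<Rightarrow> complex" where
  "raise \<kappa> F \<tau> = 2 * \<i> * d_tau F \<tau> + of_real (\<kappa> / Im \<tau>) * F \<tau>"

primrec raise_iter :: "nat \<Rightarrow> real \<Rightarrow> (complex \<Rightarrow> complex) \<Rightarrow> complex \<Rightarrow> complex" where
  "raise_iter 0 \<kappa> F = F"
| "raise_iter (Suc n) \<kappa> F = raise (\<kappa> + 2 * real n) (raise_iter n \<kappa> F)"

section \<open>Harmonic Maass forms\<close>

text \<open>The exponents \<open>n\<close> in the \<open>\<mu>\<close>-component of a Fourier expansion: by the transformation under \<open>T\<close>
  these lie in \<open>q(\<mu>) + \<int>\<close>.\<close>

definition exponents :: "('a \<Rightarrow> real) \<Rightarrow> 'a set \<Rightarrow> real set" where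
  "exponents q \<mu> = {n. n - q (rep \<mu>) \<in> \<int>}"

definition fourier_polynomial ::
    "('a::euclidean_space \<Rightarrow> real) \<Rightarrow> 'a set \<Rightarrow> 'a vvfun \<Rightarrow> bool" where
  "fourier_polynomial q K P \<longleftrightarrow>
     (\<exists>I c. \<forall>\<mu>\<in>disc_group q K. finite (I \<mu>) \<and> I \<mu> \<subseteq> exponents q \<mu> \<and>
        (\<forall>\<tau>\<in>uhp. P \<tau> \<mu> = (\<Sum>n\<in>I \<mu>. c \<mu> n * e (of_real n * \<tau>))))"

definition harmonic_of_weight ::
    "real \<Rightarrow> ('a::euclidean_space \<Rightarrow> real) \<Rightarrow> 'a set \<Rightarrow> 'a vvfun \<Rightarrow> bool" where
  "harmonic_of_weight \<kappa> q K f \<longleftrightarrow>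
     (\<forall>\<mu>\<in>disc_group q K. smooth (\<lambda>\<tau>. f \<tau> \<mu>)) \<and>
     transforms_with_weight \<kappa> q K f \<and>
     (\<forall>\<mu>\<in>disc_group q K. \<forall>\<tau>\<in>uhp. laplace \<kappa> (\<lambda>\<tau>. f \<tau> \<mu>) \<tau> = 0)"

text \<open>The filter \<open>filtercomap Im at_top\<close> describes \<open>v \<rightarrow> \<infinity>\<close>, uniformly in \<open>u\<close>.\<close>

definition harmonic_maass_form ::
    "real \<Rightarrow> ('a::euclidean_space \<Rightarrow> real) \<Rightarrow> 'a set \<Rightarrow> 'a vvfun \<Rightarrow> bool" where
  "harmonic_maass_form \<kappa> q K f \<longleftrightarrow>
     harmonic_of_weight \<kappa> q K f \<and>
     (\<exists>P \<epsilon>. fourier_polynomial q K P \<and> \<epsilon> > 0 \<and>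
        (\<forall>\<mu>\<in>disc_group q K.
           (\<lambda>\<tau>. f \<tau> \<mu> - P \<tau> \<mu>) \<in> O[filtercomap Im at_top](\<lambda>\<tau>. of_real (exp (- \<epsilon> * Im \<tau>)))))"

text \<open>The growth condition above forces \<open>\<xi>\<^sub>\<kappa> f\<close> to be a cusp form.  A preimage of a form with nonzero
  constant term, such as \<open>\<Theta>\<^sub>P\<close>, has an additional multiple of \<open>v\<^bsup>1-\<kappa>\<^esup>\<close> in its Fourier
  expansion; the following class allows this term and contains \<open>harmonic_maass_form\<close>.\<close>

definition harmonic_maass_form_ext ::
    "real \<Rightarrow> ('a::euclidean_space \<Rightarrow> real) \<Rightarrow> 'a set \<Rightarrow> 'a vvfun \<Rightarrow> bool" where
  "harmonic_maass_form_ext \<kappa> q K f \<longleftrightarrow>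
     harmonic_of_weight \<kappa> q K f \<and>
     (\<exists>P d \<epsilon>. fourier_polynomial q K P \<and> \<epsilon> > 0 \<and>
        (\<forall>\<mu>\<in>disc_group q K.
           (\<lambda>\<tau>. f \<tau> \<mu> - P \<tau> \<mu> - d \<mu> * of_real (Im \<tau> powr (1 - \<kappa>)))
             \<in> O[filtercomap Im at_top](\<lambda>\<tau>. of_real (exp (- \<epsilon> * Im \<tau>)))))"

lemma harmonic_maass_form_imp_ext:
  "harmonic_maass_form \<kappa> q K f \<Longrightarrow> harmonic_maass_form_ext \<kappa> q K f"
  unfolding harmonic_maass_form_def harmonic_maass_form_ext_def
  by (elim conjE exE, intro conjI, assumption, rule exI, rule exI[of _ "\<lambda>_. 0"], rule exI) auto

definition weakly_holomorphic ::
    "real \<Rightarrow> ('a::euclidean_space \<Rightarrow> real) \<Rightarrow> 'a set \<Rightarrow> 'a vvfun \<Rightarrow> bool" where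
  "weakly_holomorphic \<kappa> q K f \<longleftrightarrow>
     harmonic_maass_form \<kappa> q K f \<and> (\<forall>\<mu>\<in>disc_group q K. (\<lambda>\<tau>. f \<tau> \<mu>) holomorphic_on uhp)"

definition upper_Gamma :: "real \<Rightarrow> real \<Rightarrow> real" where
  "upper_Gamma a x = integral {x..} (\<lambda>t. t powr (a - 1) * exp (- t))"

text \<open>\<open>f = f\<^sup>+ + f\<^sup>-\<close>; the coefficients \<open>d \<mu>\<close> vanish if \<open>f\<close> is a \<open>harmonic_maass_form\<close>.\<close>

definition maass_decomposition ::
    "real \<Rightarrow> ('a::euclidean_space \<Rightarrow> real) \<Rightarrow> 'a set \<Rightarrow> 'a vvfun \<Rightarrow> 'a vvfun \<Rightarrow> 'a vvfun \<Rightarrow> bool" where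
  "maass_decomposition \<kappa> q K f fp fm \<longleftrightarrow>
     (\<exists>cp cm d. \<exists>n0::real. \<forall>\<mu>\<in>disc_group q K. \<forall>\<tau>\<in>uhp.
        f \<tau> \<mu> = fp \<tau> \<mu> + fm \<tau> \<mu> \<and>
        ((\<lambda>n. cp \<mu> n * e (of_real n * \<tau>)) has_sum fp \<tau> \<mu>) {n \<in> exponents q \<mu>. n \<ge> n0} \<and>
        ((\<lambda>n. cm \<mu> n * of_real (upper_Gamma (1 - \<kappa>) (4 * pi * \<bar>n\<bar> * Im \<tau>)) * e (of_real n * \<tau>))
           has_sum (fm \<tau> \<mu> - d \<mu> * of_real (Im \<tau> powr (1 - \<kappa>)))) {n \<in> exponents q \<mu>. n < 0})"

definition holomorphic_part ::
    "real \<Rightarrow> ('a::euclidean_space \<Rightarrow> real) \<Rightarrow> 'a set \<Rightarrow> 'a vvfun \<Rightarrow> 'a vvfun" where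
  "holomorphic_part \<kappa> q K f = (SOME fp. \<exists>fm. maass_decomposition \<kappa> q K f fp fm)"

section \<open>Restriction, Rankin--Cohen brackets, constant terms\<close>

text \<open>For \<open>\<mu> \<in> K'/K\<close> with \<open>\<mu> \<subseteq> L'\<close>, the sum of sets \<open>\<mu> + L\<close> is the image of \<open>\<mu>\<close> in \<open>L'/L\<close>.\<close>

definition restrict_to_sublattice ::
    "('a::euclidean_space \<Rightarrow> real) \<Rightarrow> 'a set \<Rightarrow> 'a vvfun \<Rightarrow> 'a vvfun" where
  "restrict_to_sublattice q L f \<tau> \<mu> = (if \<mu> \<subseteq> dual_lattice q L then f \<tau> (\<mu> + L) else 0)"

definition tensor ::
    "('a::euclidean_space \<Rightarrow> real) \<Rightarrow> 'a set \<Rightarrow> 'a set \<Rightarrow> 'a grpring \<Rightarrow> 'a grpring \<Rightarrow> 'a grpring" where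
  "tensor q K1 K2 \<phi> \<psi> \<gamma> =
     (\<Sum>(\<mu>, \<nu>) \<in> {(\<mu>, \<nu>). \<mu> \<in> disc_group q K1 \<and> \<nu> \<in> disc_group q K2 \<and> \<mu> + \<nu> = \<gamma>}. \<phi> \<mu> * \<psi> \<nu>)"

definition vv_deriv :: "nat \<Rightarrow> 'a vvfun \<Rightarrow> 'a vvfun" where
  "vv_deriv r f \<tau> \<mu> = (deriv ^^ r) (\<lambda>\<tau>. f \<tau> \<mu>) \<tau>"

definition rankin_cohen ::
    "('a::euclidean_space \<Rightarrow> real) \<Rightarrow> 'a set \<Rightarrow> 'a set \<Rightarrow> real \<Rightarrow> real \<Rightarrow> nat \<Rightarrow>
     'a vvfun \<Rightarrow> 'a vvfun \<Rightarrow> 'a vvfun" where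
  "rankin_cohen q K1 K2 \<kappa> l n f g \<tau> \<gamma> =
     1 / (2 * of_real pi * \<i>) ^ n *
     (\<Sum>(r, s) \<in> {(r, s). r + s = n}.
        (- 1) ^ r *
        of_real (Gamma (\<kappa> + real n) * Gamma (l + real n) /
          (Gamma (real s + 1) * Gamma (\<kappa> + real n - real s) *
           Gamma (real r + 1) * Gamma (l + real n - real r))) *
        tensor q K1 K2 (vv_deriv r f \<tau>) (vv_deriv s g \<tau>) \<gamma>)"

definition constant_term :: "(complex \<Rightarrow> complex) \<Rightarrow> complex" where
  "constant_term h =
     (THE a0. \<exists>a::int \<Rightarrow> complex. a 0 = a0 \<and>
        (\<forall>\<tau>\<in>uhp. ((\<lambda>n. a n * e (of_int n * \<tau>)) has_sum h \<tau>) UNIV))"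

section \<open>The space of signature (1,2), theta functions and the lift\<close>

definition V :: "nat \<Rightarrow> (real^2^2) set" where
  "V M = {vector [vector [- b / (2 * real M), - c / real M], vector [a, b / (2 * real M)]] |a b c.
            a \<in> \<rat> \<and> b \<in> \<rat> \<and> c \<in> \<rat>}"

definition qV :: "nat \<Rightarrow> real^2^2 \<Rightarrow> real" where
  "qV M X = real M * det X"

abbreviation qV_neg :: "nat \<Rightarrow> real^2^2 \<Rightarrow> real" where
  "qV_neg M \<equiv> (\<lambda>X. - qV M X)"

definition bV :: "nat \<Rightarrow> real^2^2 \<Rightarrow> real^2^2 \<Rightarrow> real" where
  "bV M X Y = - real M * trace (X ** Y)"

lemma polar_qV:
  assumes "trace X = 0" "trace Y = 0"
  shows "polar (qV M) X Y = bV M X Y"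
proof -
  have *: "X$2$2 = - X$1$1" "Y$2$2 = - Y$1$1"
    using assms by (simp_all add: trace_def UNIV_2)
  show ?thesis
    by (simp add: polar_def qV_def bV_def det_2 trace_def UNIV_2 matrix_matrix_mult_def *
        algebra_simps)
qed

definition X1 :: "nat \<Rightarrow> complex \<Rightarrow> real^2^2" where
  "X1 M z = (1 / (sqrt (2 * real M) * Im z)) *\<^sub>R
     vector [vector [- Re z, (Re z)\<^sup>2 + (Im z)\<^sup>2], vector [- 1, Re z]]"

definition pX :: "nat \<Rightarrow> real^2^2 \<Rightarrow> complex \<Rightarrow> real" where
  "pX M X z = - sqrt (2 * real M) * bV M X (X1 M z)"

definition proj_pos :: "nat \<Rightarrow> complex \<Rightarrow> real^2^2 \<Rightarrow> real^2^2" where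
  "proj_pos M z X = (bV M X (X1 M z) / bV M (X1 M z) (X1 M z)) *\<^sub>R X1 M z"

definition proj_neg :: "nat \<Rightarrow> complex \<Rightarrow> real^2^2 \<Rightarrow> real^2^2" where
  "proj_neg M z X = X - proj_pos M z X"

text \<open>A coset \<open>\<mu>\<close> of \<open>K\<close> is the set of all \<open>X \<in> K + \<mu>\<close>, so the theta series sum over \<open>X \<in> \<mu>\<close>.\<close>

definition theta :: "('a::euclidean_space \<Rightarrow> real) \<Rightarrow> 'a vvfun" where
  "theta q \<tau> \<mu> = (\<Sum>\<^sub>\<infinity>X\<in>\<mu>. e (of_real (q X) * \<tau>))"

definition theta_star :: "nat \<Rightarrow> complex \<Rightarrow> (real^2^2) vvfun" where
  "theta_star M z \<tau> \<mu> = (\<Sum>\<^sub>\<infinity>X\<in>\<mu>. of_real (pX M X z) * e (of_real (qV M X) * \<tau>))"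

definition siegel_theta :: "nat \<Rightarrow> complex \<Rightarrow> (real^2^2) vvfun" where
  "siegel_theta M z \<tau> \<mu> = of_real (Im \<tau>) *
     (\<Sum>\<^sub>\<infinity>X\<in>\<mu>. e (of_real (qV M (proj_pos M z X)) * \<tau> + of_real (qV M (proj_neg M z X)) * cnj \<tau>))"

definition millson_theta :: "nat \<Rightarrow> complex \<Rightarrow> (real^2^2) vvfun" where
  "millson_theta M z \<tau> \<mu> = of_real (Im \<tau>) *
     (\<Sum>\<^sub>\<infinity>X\<in>\<mu>. of_real (pX M X z) *
        e (of_real (qV M (proj_pos M z X)) * \<tau> + of_real (qV M (proj_neg M z X)) * cnj \<tau>))"

definition fund_dom :: "real \<Rightarrow> complex set" where
  "fund_dom T = {\<tau>. \<bar>Re \<tau>\<bar> \<le> 1 / 2 \<and> 1 \<le> cmod \<tau> \<and> 0 < Im \<tau> \<and> Im \<tau> \<le> T}"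

definition truncated_integral :: "(complex \<Rightarrow> complex) \<Rightarrow> real \<Rightarrow> complex" where
  "truncated_integral h T =
     set_lebesgue_integral lborel (fund_dom T) (\<lambda>\<tau>. h \<tau> / of_real ((Im \<tau>)\<^sup>2))"

definition reg_integrable :: "(complex \<Rightarrow> complex) \<Rightarrow> bool" where
  "reg_integrable h \<longleftrightarrow>
     (\<forall>T. set_integrable lborel (fund_dom T) (\<lambda>\<tau>. h \<tau> / of_real ((Im \<tau>)\<^sup>2))) \<and>
     (\<exists>I. (truncated_integral h \<longlongrightarrow> I) at_top)"

definition reg_integral :: "(complex \<Rightarrow> complex) \<Rightarrow> complex" where
  "reg_integral h = Lim at_top (truncated_integral h)"

definition lift_integrand ::
    "nat \<Rightarrow> (real^2^2) set \<Rightarrow> nat \<Rightarrow> (real^2^2) vvfun \<Rightarrow> complex \<Rightarrow> complex \<Rightarrow> complex" where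
  "lift_integrand M L k f z \<tau> =
     (if even k
      then pairing (qV M) L
             (\<lambda>\<mu>. raise_iter (k div 2 - 1) (3 / 2 - real k) (\<lambda>\<tau>. f \<tau> \<mu>) \<tau>)
             (\<lambda>\<mu>. cnj (siegel_theta M z \<tau> \<mu>)) * of_real (Im \<tau> powr (- 1 / 2))
      else pairing (qV M) L
             (\<lambda>\<mu>. raise_iter ((k - 1) div 2) (3 / 2 - real k) (\<lambda>\<tau>. f \<tau> \<mu>) \<tau>)
             (\<lambda>\<mu>. cnj (millson_theta M z \<tau> \<mu>)) * of_real (Im \<tau> powr (1 / 2)))"

definition reg_lift ::
    "nat \<Rightarrow> (real^2^2) set \<Rightarrow> nat \<Rightarrow> (real^2^2) vvfun \<Rightarrow> complex \<Rightarrow> complex" where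
  "reg_lift M L k f z = reg_integral (lift_integrand M L k f z)"

end

theory Submission
  imports Defs "HOL-Complex_Analysis.Complex_Analysis" "HOL-Probability.Probability" "HOL-Real_Asymp.Real_Asymp"
begin

text \<open>At the special point the kernel of the lift splits, over finitely many residue classes modulo a frame of three
  pairwise orthogonal lattice vectors, into products of the complex conjugate of a theta series of \<open>P\<close> and a theta series of
  \<open>N\<^sup>-\<close>.  Since the theta series of \<open>P\<close> is \<open>\<xi>\<^sub>\<kappa> G\<close>, the integrand is the \<open>\<tau>\<close>-antiholomorphic derivative of a sum of
  products \<open>R\<^bsup>n-j\<^esup> f \<cdot> R\<^sup>j G \<cdot> \<theta>\<close> with suitable weights.  Stokes' theorem on the truncated fundamental domain leaves the
  mean value of this primitive at height \<open>T\<close>.  As \<open>T \<rightarrow> \<infinity>\<close> the non-holomorphic part of \<open>G\<close> drops out, and integration by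
  parts turns the constant term of what remains into a Rankin-Cohen bracket with \<open>G\<^sup>+\<close>.

  The boundary terms on the unit arc cancel because the primitive has weight 2.  Its behaviour under \<open>S\<close> follows from Poisson
  summation and the character sums of \<open>L'\<close> modulo the frame.\<close>

text \<open>Both parities are one computation with a parameter \<open>wt\<close>, equal to 3/2 for
  even and 1/2 for odd k, and n raising steps: f has weight 1 - 2n - \<open>wt\<close>, so R^(n-j)
  f, R^j G and the theta series of the binary lattice N^- always have total weight 2. The lattice N
  need not have an orthogonal basis. Passing to residue classes modulo an orthogonal frame makes
  every theta series a finite sum of products of unary ones, so one-dimensional Poisson summation
  suffices. The holomorphic part of G is defined by a choice, so its existence and uniqueness have
  to be proved: G minus an explicit Eichler integral of the theta series is holomorphic and has a
  q-expansion, and comparing Fourier coefficients at all heights separates the two halves. In weight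
  3/2 the expansion of G contains a multiple of v^(-1/2), which decays at the cusp; in weight 1/2
  the corresponding term would be a growing v^(1/2), and it does not occur because p_0 = 0. Since f
  may grow exponentially at the cusp, the decay of the non-holomorphic part has to be seen after
  integration over u, one Fourier coefficient at a time.\<close>

abbreviation "ri \<equiv> real_of_int"
abbreviation er :: "real \<Rightarrow> complex" where "er x \<equiv> e (of_real x)"
abbreviation gq :: "real \<Rightarrow> int \<Rightarrow> real" where "gq d x \<equiv> (ri x)\<^sup>2 / (2 * d)"
abbreviation ab :: "int \<Rightarrow> real" where "ab x \<equiv> 1 + ri \<bar>x\<bar>"

section \<open>Wirtinger derivatives and Stokes' theorem on the fundamental domain\<close>

text \<open>Real differentiability with the differential expanded in h and its conjugate:
  \<open>a\<close> is the holomorphic and \<open>b\<close> the antiholomorphic Wirtinger derivative.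
  Unlike \<open>d_tau\<close> and \<open>d_taubar\<close>, which only mention partial derivatives,
  this notion obeys sum, product and chain rules.\<close>

definition has_wirtinger :: "(complex \<Rightarrow> complex) \<Rightarrow> complex \<Rightarrow> complex \<Rightarrow> complex \<Rightarrow> bool" where
 "has_wirtinger F a b z \<longleftrightarrow> (F has_derivative (\<lambda>h. a * h + b * cnj h)) (at z)"

lemma has_wirtinger_const: "has_wirtinger (\<lambda>_. c) 0 0 z"
 by (simp add: has_wirtinger_def)

lemma has_wirtinger_add:
 "has_wirtinger F a b z \<Longrightarrow> has_wirtinger G c d z \<Longrightarrow> has_wirtinger (\<lambda>w. F w + G w) (a + c) (b + d) z"
 unfolding has_wirtinger_def by (drule (1) has_derivative_add) (simp add: algebra_simps)

lemma has_wirtinger_diff: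
 "has_wirtinger F a b z \<Longrightarrow> has_wirtinger G c d z \<Longrightarrow> has_wirtinger (\<lambda>w. F w - G w) (a - c) (b - d) z"
 unfolding has_wirtinger_def by (drule (1) has_derivative_diff) (simp add: algebra_simps)

lemma has_wirtinger_mult:
 "has_wirtinger F a b z \<Longrightarrow> has_wirtinger G c d z \<Longrightarrow>
  has_wirtinger (\<lambda>w. F w * G w) (a * G z + F z * c) (b * G z + F z * d) z"
 unfolding has_wirtinger_def by (drule (1) has_derivative_mult) (simp add: algebra_simps)

lemma has_wirtinger_cmult:
 "has_wirtinger F a b z \<Longrightarrow> has_wirtinger (\<lambda>w. c * F w) (c * a) (c * b) z"
 using has_wirtinger_mult[OF has_wirtinger_const, of F a b z c] by simp

lemma has_wirtinger_sum:
 assumes "\<And>i. i \<in> I \<Longrightarrow> has_wirtinger (F i) (a i) (b i) z"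
 shows "has_wirtinger (\<lambda>w. \<Sum>i\<in>I. F i w) (\<Sum>i\<in>I. a i) (\<Sum>i\<in>I. b i) z"
proof (cases "finite I")
 case True
 then show ?thesis using assms
  by (induction I rule: finite_induct) (auto intro: has_wirtinger_add has_wirtinger_const)
qed (simp add: has_wirtinger_const)

lemma has_wirtinger_holomorphic:
 "(F has_field_derivative a) (at z) \<Longrightarrow> has_wirtinger F a 0 z"
 by (simp add: has_wirtinger_def has_field_derivative_def)

lemma has_wirtinger_cnj:
 assumes "(F has_field_derivative a) (at z)"
 shows "has_wirtinger (\<lambda>w. cnj (F w)) 0 (cnj a) z"
 using has_derivative_cnj[OF assms[unfolded has_field_derivative_def]]
 by (simp add: has_wirtinger_def)

text \<open>The coefficients come from v = (z - cnj z) / (2i).\<close>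

lemma has_wirtinger_Im:
 assumes "(g has_real_derivative g') (at (Im z))"
 shows "has_wirtinger (\<lambda>w. of_real (g (Im w))) (of_real g' / (2 * \<i>)) (- of_real g' / (2 * \<i>)) z"
proof -
 have "(Im has_derivative Im) (at z)"
  by (rule bounded_linear.has_derivative[OF bounded_linear_Im has_derivative_ident])
 from has_derivative_compose[OF this assms[unfolded has_field_derivative_def]]
 have "((\<lambda>w. g (Im w)) has_derivative (\<lambda>h. g' * Im h)) (at z)" .
 then have "((\<lambda>w. complex_of_real (g (Im w))) has_derivative (\<lambda>h. of_real (g' * Im h))) (at z)"
  by (rule has_derivative_of_real)
 moreover have "of_real (g' * Im h) =
   of_real g' / (2 * \<i>) * h + - of_real g' / (2 * \<i>) * cnj h" for h
  by (cases h) (simp add: complex_eq_iff Re_divide Im_divide power2_eq_square)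
 ultimately show ?thesis by (simp add: has_wirtinger_def)
qed

lemma has_wirtinger_Im_powr:
 assumes "Im z > 0"
 shows "has_wirtinger (\<lambda>w. of_real (Im w powr s))
   (of_real (s * Im z powr (s - 1)) / (2 * \<i>)) (- of_real (s * Im z powr (s - 1)) / (2 * \<i>)) z"
 by (rule has_wirtinger_Im) (use assms in \<open>auto intro!: derivative_eq_intros\<close>)

lemma has_wirtinger_cong:
 assumes "has_wirtinger F a b z" "open S" "z \<in> S" "\<And>w. w \<in> S \<Longrightarrow> F w = G w"
 shows "has_wirtinger G a b z"
 using assms has_derivative_transform_within_open unfolding has_wirtinger_def by blast

text \<open>The link to the operators of the statement. It also shows that \<open>a\<close> and
  \<open>b\<close> are determined by F, which is how two computations of one derivative are compared
  later.\<close>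

lemma has_wirtinger_d:
 assumes "has_wirtinger F a b z"
 shows "d_u F z = a + b" "d_v F z = \<i> * (a - b)" "d_tau F z = a" "d_taubar F z = b"
proof -
 have F: "(F has_derivative (\<lambda>h. a * h + b * cnj h)) (at (z + c * of_real 0))" for c
  using assms by (simp add: has_wirtinger_def)
 have L: "((\<lambda>t::real. z + c * of_real t) has_derivative (\<lambda>t. c * of_real t)) (at 0)" for c
  by (auto intro!: derivative_eq_intros)
 have "((\<lambda>t::real. F (z + c * of_real t)) has_vector_derivative (a * c + b * cnj c)) (at 0)" for c
 proof -
  have "(\<lambda>t. a * (c * of_real t) + b * cnj (c * of_real t)) = (\<lambda>t::real. t *\<^sub>R (a * c + b * cnj c))"
   by (simp add: fun_eq_iff scaleR_conv_of_real algebra_simps)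
  then show ?thesis
   using has_derivative_compose[OF L[of c] F[of c]] by (simp only: has_vector_derivative_def)
 qed
 from this[of 1] this[of \<i>]
 show u: "d_u F z = a + b" and v: "d_v F z = \<i> * (a - b)"
  by (auto simp: d_u_def d_v_def algebra_simps dest!: vector_derivative_at)
 show "d_tau F z = a" "d_taubar F z = b"
  unfolding d_tau_def d_taubar_def u v by (simp_all add: algebra_simps flip: mult.assoc)
qed

text \<open>A real-linear map of the plane is determined by its values at 1 and \<i>; solving for
  the coefficients of h and cnj h gives \<open>a\<close> and \<open>b\<close>.\<close>

lemma differentiable_imp_has_wirtinger:
 assumes "F differentiable (at z)"
 shows "has_wirtinger F (d_tau F z) (d_taubar F z) z"
proof -
 obtain D where D: "(F has_derivative D) (at z)" using assms by (auto simp: differentiable_def)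
 interpret D: bounded_linear D using D by (rule has_derivative_bounded_linear)
 define a b where "a = (D 1 - \<i> * D \<i>) / 2" and "b = (D 1 + \<i> * D \<i>) / 2"
 have "D h = a * h + b * cnj h" for h
 proof -
  have "h = Re h *\<^sub>R 1 + Im h *\<^sub>R \<i>" by (simp add: complex_eq_iff)
  then have "D h = D (Re h *\<^sub>R 1 + Im h *\<^sub>R \<i>)" by (rule arg_cong)
  also have "\<dots> = Re h *\<^sub>R D 1 + Im h *\<^sub>R D \<i>" by (simp only: D.add D.scaleR)
  also have "\<dots> = a * h + b * cnj h"
   unfolding a_def b_def by (simp add: complex_eq_iff field_simps)
  finally show ?thesis .
 qed
 then have "D = (\<lambda>h. a * h + b * cnj h)" by blast
 then have "has_wirtinger F a b z" using D by (simp add: has_wirtinger_def)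
 then show ?thesis using has_wirtinger_d(3,4) by metis
qed

lemma has_wirtinger_imp_continuous: "has_wirtinger F a b z \<Longrightarrow> isCont F z"
 unfolding has_wirtinger_def by (rule has_derivative_continuous)

lemma open_uhp: "open uhp"
 unfolding uhp_def by (simp add: open_halfspace_Im_gt)

lemma convex_uhp: "convex uhp"
 unfolding uhp_def by (simp add: convex_halfspace_Im_gt)

lemma wirtinger_continuous_on:
 "(\<And>z. z \<in> uhp \<Longrightarrow> has_wirtinger F (a z) (b z) z) \<Longrightarrow> continuous_on uhp F"
 using continuous_at_imp_continuous_on has_wirtinger_imp_continuous by blast

lemma has_wirtinger_path:
 assumes "has_wirtinger F a b (g x)" "(g has_vector_derivative g') (at x)"
 shows "((\<lambda>x. F (g x)) has_vector_derivative (a * g' + b * cnj g')) (at x)"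
 using has_derivative_compose[OF assms(2)[unfolded has_vector_derivative_def] assms(1)[unfolded has_wirtinger_def]]
 by (simp add: has_vector_derivative_def scaleR_conv_of_real algebra_simps)

section \<open>Integration over the truncated fundamental domain\<close>

lemma lborel_complex: "lborel = distr (lborel \<Otimes>\<^sub>M lborel) borel (\<lambda>(x, y). Complex x y)"
proof (rule lborel_eqI)
 have meas: "(\<lambda>(x, y). Complex x y) \<in> borel_measurable (lborel \<Otimes>\<^sub>M lborel)"
  unfolding Complex_eq split_beta by measurable
 fix l u :: complex assume "\<And>b. b \<in> Basis \<Longrightarrow> l \<bullet> b \<le> u \<bullet> b"
 then have le: "Re l \<le> Re u" "Im l \<le> Im u" using Basis_complex_def[THEN equalityD2] by (force simp: Basis_complex_def inner_complex_def)+
 have eq: "(\<lambda>(x, y). Complex x y) -` box l u \<inter> space (lborel \<Otimes>\<^sub>M lborel) = box (Re l) (Re u) \<times> box (Im l) (Im u)"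
  by (auto simp: in_box_complex_iff space_pair_measure)
 show "emeasure (distr (lborel \<Otimes>\<^sub>M lborel) borel (\<lambda>(x, y). Complex x y)) (box l u) = (\<Prod>b\<in>Basis. (u - l) \<bullet> b)"
  by (subst emeasure_distr[OF meas]) (use le in \<open>auto simp: eq lborel.emeasure_pair_measure_Times
     Basis_complex_def inner_complex_def ennreal_mult box_real\<close>)
qed auto

lemma integrable_complex_iff:
 fixes h :: "complex \<Rightarrow> complex"
 assumes "h \<in> borel_measurable borel"
 shows "integrable lborel h \<longleftrightarrow> integrable (lborel \<Otimes>\<^sub>M lborel) (\<lambda>(x, y). h (Complex x y))"
  and "integral\<^sup>L lborel h = integral\<^sup>L (lborel \<Otimes>\<^sub>M lborel) (\<lambda>(x, y). h (Complex x y))"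
proof -
 have meas: "(\<lambda>(x, y). Complex x y) \<in> borel_measurable (lborel \<Otimes>\<^sub>M lborel)"
  unfolding Complex_eq split_beta by measurable
 show "integrable lborel h \<longleftrightarrow> integrable (lborel \<Otimes>\<^sub>M lborel) (\<lambda>(x, y). h (Complex x y))"
  by (subst lborel_complex, subst integrable_distr_eq[OF meas]) (use assms in \<open>simp_all add: split_beta'\<close>)
 show "integral\<^sup>L lborel h = integral\<^sup>L (lborel \<Otimes>\<^sub>M lborel) (\<lambda>(x, y). h (Complex x y))"
  by (subst lborel_complex, subst integral_distr[OF meas]) (use assms in \<open>simp_all add: split_beta'\<close>)
qed

lemma compact_fund_dom: "compact (fund_dom T)"
proof -
 \<comment> \<open>Closedness is clear once the strict inequality 0 < Im z is relaxed; this adds no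
   point, since a real z with |Re z| at most 1/2 violates 1 <= |z|.\<close>
 have eq: "fund_dom T = {z. \<bar>Re z\<bar> \<le> 1 / 2} \<inter> {z. 1 \<le> cmod z} \<inter> {z. 0 \<le> Im z} \<inter> {z. Im z \<le> T}"
  unfolding fund_dom_def
 proof (intro set_eqI iffI; clarsimp)
  fix z assume a: "\<bar>Re z\<bar> * 2 \<le> 1" "1 \<le> cmod z" "0 \<le> Im z" "Im z \<le> T"
  show "0 < Im z"
  proof (rule ccontr)
   assume "\<not> 0 < Im z"
   then have "cmod z = \<bar>Re z\<bar>" using a by (simp add: cmod_eq_Re)
   then show False using a by linarith
  qed
 qed
 have "closed (fund_dom T)"
  unfolding eq by (intro closed_Int closed_Collect_le continuous_intros)
 moreover have "fund_dom T \<subseteq> cball 0 (1 + \<bar>T\<bar>)"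
 proof
  fix z assume "z \<in> fund_dom T"
  then have "\<bar>Re z\<bar> \<le> 1/2" "\<bar>Im z\<bar> \<le> \<bar>T\<bar>" by (auto simp: fund_dom_def)
  then show "z \<in> cball 0 (1 + \<bar>T\<bar>)" using cmod_le[of z] by simp
 qed
 ultimately show ?thesis by (meson bounded_cball bounded_subset compact_eq_bounded_closed)
qed

lemma fund_dom_subset_uhp: "fund_dom T \<subseteq> uhp"
 by (auto simp: fund_dom_def uhp_def)

lemma set_integrable_fund_dom:
 fixes b :: "complex \<Rightarrow> complex"
 assumes "continuous_on uhp b"
 shows "set_integrable lborel (fund_dom T) b"
 unfolding set_integrable_def
 by (rule borel_integrable_compact[OF compact_fund_dom])
   (use continuous_on_subset[OF assms fund_dom_subset_uhp] in auto)

definition arc_height :: "real \<Rightarrow> real" where "arc_height u = sqrt (1 - u\<^sup>2)"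

lemma arc_height_bounds:
 assumes "\<bar>u\<bar> \<le> 1 / 2" shows "1 / 2 \<le> arc_height u" "arc_height u \<le> 1" "arc_height u > 0"
proof -
 have "u\<^sup>2 \<le> (1/2)\<^sup>2" using assms by (metis abs_ge_zero power2_abs power_mono)
 then have "(1/2)\<^sup>2 \<le> 1 - u\<^sup>2" by (simp add: power2_eq_square)
 then show a: "1 / 2 \<le> arc_height u" unfolding arc_height_def by (rule real_le_rsqrt)
 show "arc_height u \<le> 1" unfolding arc_height_def by simp
 show "arc_height u > 0" using a by linarith
qed

lemma fund_dom_Complex:
 "Complex u v \<in> fund_dom T \<longleftrightarrow> \<bar>u\<bar> \<le> 1 / 2 \<and> arc_height u \<le> v \<and> v \<le> T"
proof (cases "\<bar>u\<bar> \<le> 1 / 2")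
 case True
 have "1 \<le> cmod (Complex u v) \<and> 0 < v \<longleftrightarrow> arc_height u \<le> v"
 proof
  assume a: "1 \<le> cmod (Complex u v) \<and> 0 < v"
  then have "1 - u\<^sup>2 \<le> v\<^sup>2" by (simp add: cmod_def)
  then show "arc_height u \<le> v" unfolding arc_height_def using a by (intro real_le_lsqrt) auto
 next
  assume a: "arc_height u \<le> v"
  then have "0 < v" using arc_height_bounds(3)[OF True] by linarith
  moreover have "1 - u\<^sup>2 \<le> v\<^sup>2" using a unfolding arc_height_def by (rule sqrt_le_D)
  ultimately show "1 \<le> cmod (Complex u v) \<and> 0 < v" by (simp add: cmod_def)
 qed
 then show ?thesis using True by (auto simp: fund_dom_def)
qed (auto simp: fund_dom_def)

lemma integral_fund_dom_iterated:
 fixes b :: "complex \<Rightarrow> complex"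
 assumes "continuous_on uhp b"
 shows "set_lebesgue_integral lborel (fund_dom T) b =
  (LINT u|lborel. indicator {-1/2..1/2} u *\<^sub>R (LINT v:{arc_height u..T}|lborel. b (Complex u v)))"
proof -
 define h where "h = (\<lambda>z. indicator (fund_dom T) z *\<^sub>R b z)"
 have int: "integrable lborel h"
  using set_integrable_fund_dom[OF assms] by (simp add: h_def set_integrable_def)
 have meas: "h \<in> borel_measurable borel"
  using borel_measurable_integrable[OF int] by simp
 have "set_lebesgue_integral lborel (fund_dom T) b = integral\<^sup>L lborel h"
  by (simp add: h_def set_lebesgue_integral_def)
 also have "\<dots> = integral\<^sup>L (lborel \<Otimes>\<^sub>M lborel) (\<lambda>(x, y). h (Complex x y))"
  by (rule integrable_complex_iff(2)[OF meas])
 also have "\<dots> = (LINT u|lborel. LINT v|lborel. h (Complex u v))"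
  using lborel_pair.integral_fst'[of "\<lambda>(x, y). h (Complex x y)"] integrable_complex_iff(1)[OF meas] int by simp
 also have "\<dots> = (LINT u|lborel. indicator {-1/2..1/2} u *\<^sub>R (LINT v:{arc_height u..T}|lborel. b (Complex u v)))"
 proof (rule Bochner_Integration.integral_cong[OF refl])
  fix u
  show "(LINT v|lborel. h (Complex u v)) = indicator {-1/2..1/2} u *\<^sub>R (LINT v:{arc_height u..T}|lborel. b (Complex u v))"
   unfolding set_lebesgue_integral_def integral_scaleR_right[symmetric] h_def
   by (rule Bochner_Integration.integral_cong[OF refl])
     (auto simp: indicator_def fund_dom_Complex)
 qed
 finally show ?thesis .
qed

lemma wirtinger_strip_path:
 assumes A: "\<And>z. z \<in> uhp \<Longrightarrow> has_wirtinger A (a z) (b z) z"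
  and "(p has_real_derivative p') (at x)" "(y has_real_derivative y') (at x)" "y x > 0"
 shows "((\<lambda>x. A (Complex (p x) (y x))) has_vector_derivative
   (of_real p' * (a (Complex (p x) (y x)) + b (Complex (p x) (y x)))
   + of_real y' * (\<i> * (a (Complex (p x) (y x)) - b (Complex (p x) (y x)))))) (at x)"
proof -
 have "((\<lambda>x. Complex (p x) (y x)) has_vector_derivative (of_real p' + \<i> * of_real y')) (at x)"
  unfolding Complex_eq
  using assms(2,3) by (auto intro!: derivative_eq_intros simp flip: has_real_derivative_iff_has_vector_derivative)
 from has_wirtinger_path[OF A this] assms(4) show ?thesis
  by (simp add: uhp_def algebra_simps)
qed

lemma continuous_on_Complex [continuous_intros]:
 "continuous_on S f \<Longrightarrow> continuous_on S g \<Longrightarrow> continuous_on S (\<lambda>x. Complex (f x) (g x))"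
 unfolding Complex_eq by (intro continuous_intros)

lemma arc_height_derivative:
 assumes "\<bar>u\<bar> \<le> 1 / 2"
 shows "(arc_height has_real_derivative (- u / arc_height u)) (at u)"
proof -
 have "1 - u\<^sup>2 > 0" using arc_height_bounds(3)[OF assms] by (simp add: arc_height_def)
 then have "((\<lambda>u. sqrt (1 - u\<^sup>2)) has_real_derivative (- u / sqrt (1 - u\<^sup>2))) (at u)"
  by (auto intro!: derivative_eq_intros simp: field_simps)
 then show ?thesis by (simp add: arc_height_def[abs_def])
qed

text \<open>\<open>\<Phi> u\<close> is the integral of A over the vertical segment above u, rescaled
  to a fixed interval so that differentiation under the integral sign applies. With A_u = a + b and
  A_v = \<i>(a - b) one has A_u = 2b - \<i> A_v; the second term integrates to the values of A at
  the two ends, and the moving lower end contributes the slope -u /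
  \<open>arc_height u\<close>.\<close>

lemma stokes_inner:
 assumes A: "\<And>y. y \<in> uhp \<Longrightarrow> has_wirtinger A (a y) (b y) y"
  and ca: "continuous_on uhp a" and cb: "continuous_on uhp b" and T: "T \<ge> 1"
 defines "\<Phi> \<equiv> \<lambda>u. integral {0..1} (\<lambda>t. A (Complex u (arc_height u + t * (T - arc_height u))) * of_real (T - arc_height u))"
 assumes u: "u \<in> {-1/2..1/2}"
 shows "(\<Phi> has_vector_derivative
   \<i> * (integral {arc_height u..T} (\<lambda>v. - 2 * \<i> * b (Complex u v)) - A (Complex u T)
   + A (Complex u (arc_height u)) * (1 + \<i> * of_real (- u / arc_height u)))) (at u within {-1/2..1/2})"
proof -
 let ?U = "{-1/2..1/2::real}"
 let ?s = arc_height
 define s' where "s' u = - u / ?s u" for u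
 define \<sigma> where "\<sigma> u t = ?s u + t * (T - ?s u)" for u t :: real
 let ?z = "\<lambda>u t. Complex u (\<sigma> u t)"
 have cA: "continuous_on uhp A" using wirtinger_continuous_on A by blast
 have s: "1/2 \<le> ?s u" "?s u \<le> 1" if "u \<in> ?U" for u
  using that arc_height_bounds[of u] by auto
 have ds: "(?s has_real_derivative s' u) (at u)" if "u \<in> ?U" for u
  unfolding s'_def using that by (intro arc_height_derivative) auto
 have cs: "continuous_on ?U ?s" by (intro continuous_at_imp_continuous_on ballI DERIV_isCont[OF ds])
 have cs': "continuous_on ?U s'" unfolding s'_def
  using s by (intro continuous_intros cs) force
 have \<sigma>pos: "\<sigma> u t > 0" if "u \<in> ?U" "t \<in> {0..1}" for u t
 proof -
  have "t * (T - ?s u) \<ge> 0" using that s[OF that(1)] T by auto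
  then show ?thesis using s[OF that(1)] by (simp add: \<sigma>_def)
 qed
 have z: "?z u t \<in> uhp" if "u \<in> ?U" "t \<in> {0..1}" for u t
  using \<sigma>pos[OF that] by (simp add: uhp_def)
 have cz: "continuous_on (?U \<times> {0..1}) (\<lambda>x. ?z (fst x) (snd x))"
  unfolding \<sigma>_def by (intro continuous_intros continuous_on_compose2[OF cs]) auto
 have czu: "continuous_on {0..1} (\<lambda>t. ?z u t)" if "u \<in> ?U" for u
  unfolding \<sigma>_def by (intro continuous_intros)
 define fx where "fx u t =
   ((a (?z u t) + b (?z u t)) + of_real (s' u * (1 - t)) * (\<i> * (a (?z u t) - b (?z u t)))) * of_real (T - ?s u)
   - A (?z u t) * of_real (s' u)" for u t
 have d\<sigma>: "((\<lambda>u. \<sigma> u t) has_real_derivative s' u * (1 - t)) (at u)" if "u \<in> ?U" for u t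
  unfolding \<sigma>_def by (auto intro!: derivative_eq_intros ds[OF that] simp: algebra_simps)
 have fx: "((\<lambda>u. A (?z u t) * of_real (T - ?s u)) has_vector_derivative fx u t) (at u within ?U)"
  if "u \<in> ?U" "t \<in> cbox 0 1" for u t
 proof -
  have 1: "((\<lambda>u. A (?z u t)) has_vector_derivative
    of_real 1 * (a (?z u t) + b (?z u t)) + of_real (s' u * (1 - t)) * (\<i> * (a (?z u t) - b (?z u t)))) (at u)"
   by (rule wirtinger_strip_path[OF A]) (use that \<sigma>pos[of u t] d\<sigma> in \<open>auto intro!: derivative_eq_intros\<close>)
  have 2: "((\<lambda>u. complex_of_real (T - ?s u)) has_vector_derivative of_real (- s' u)) (at u)"
   by (rule has_vector_derivative_of_real)
     (use ds[OF that(1)] in \<open>auto intro!: derivative_eq_intros simp flip: has_real_derivative_iff_has_vector_derivative\<close>)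
  show ?thesis
   by (rule has_vector_derivative_at_within)
     (use has_vector_derivative_mult[OF 1 2] in \<open>simp add: fx_def algebra_simps\<close>)
 qed
 have cfx: "continuous_on (?U \<times> cbox 0 1) (\<lambda>(u, t). fx u t)"
 proof -
  have zz: "(\<lambda>x. ?z (fst x) (snd x)) ` (?U \<times> {0..1}) \<subseteq> uhp" using z by auto
  have "continuous_on (?U \<times> {0..1}) (\<lambda>x. ?s (fst x))" "continuous_on (?U \<times> {0..1}) (\<lambda>x. s' (fst x))"
   by (rule continuous_on_compose2[OF cs] continuous_on_compose2[OF cs']; auto intro: continuous_intros)+
  then show ?thesis
   unfolding fx_def split_beta box_real
   using continuous_on_compose2[OF ca cz zz] continuous_on_compose2[OF cb cz zz] continuous_on_compose2[OF cA cz zz]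
   by (intro continuous_intros) auto
 qed
 have "(\<Phi> has_vector_derivative integral (cbox 0 1) (fx u)) (at u within ?U)" 
  unfolding \<Phi>_def \<sigma>_def[symmetric] box_real(2)[of 0 1, symmetric]
 proof (rule leibniz_rule_vector_derivative[OF fx _ cfx])
  show "(\<lambda>t. A (?z u t) * complex_of_real (T - ?s u)) integrable_on cbox 0 1" if "u \<in> ?U" for u
   by (rule integrable_continuous)
     (use that z in \<open>auto intro!: continuous_intros continuous_on_compose2[OF cA] czu\<close>)
 qed (use u in auto)
 moreover have "integral (cbox 0 1) (fx u) =
  \<i> * (integral {?s u..T} (\<lambda>v. - 2 * \<i> * b (Complex u v)) - A (Complex u T)
   + A (Complex u (?s u)) * (1 + \<i> * of_real (s' u)))"
 proof -
  have sT: "?s u \<le> T" using s[OF u] T by linarith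
  have line: "Complex u v \<in> uhp" if "v \<in> {?s u..T}" for v
   using that s[OF u] by (auto simp: uhp_def)
  \<comment> \<open>The part of \<open>fx\<close> that stems from the moving lower edge is the
    t-derivative of s'(u) (1 - t) A, so it integrates to -s'(u) times the value of A at the lower
    edge.\<close>
  have 1: "((\<lambda>t. - of_real (s' u) * A (?z u t) + of_real (s' u * (1 - t)) *
    (of_real (T - ?s u) * (\<i> * (a (?z u t) - b (?z u t))))) has_integral
    (of_real (s' u * (1 - 1)) * A (?z u 1) - of_real (s' u * (1 - 0)) * A (?z u 0))) {0..1}"
  proof (rule fundamental_theorem_of_calculus)
   fix t :: real assume t: "t \<in> {0..1}"
   have a: "((\<lambda>t. A (?z u t)) has_vector_derivative
     of_real 0 * (a (?z u t) + b (?z u t)) + of_real (T - ?s u) * (\<i> * (a (?z u t) - b (?z u t)))) (at t)"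
    by (rule wirtinger_strip_path[OF A]) (use u t \<sigma>pos[of u t] in \<open>auto simp: \<sigma>_def intro!: derivative_eq_intros\<close>)
   have b: "((\<lambda>t. complex_of_real (s' u * (1 - t))) has_vector_derivative of_real (- s' u)) (at t)"
    by (rule has_vector_derivative_of_real)
      (auto intro!: derivative_eq_intros simp flip: has_real_derivative_iff_has_vector_derivative)
   show "((\<lambda>t. of_real (s' u * (1 - t)) * A (?z u t)) has_vector_derivative
     - of_real (s' u) * A (?z u t) + of_real (s' u * (1 - t)) *
    (of_real (T - ?s u) * (\<i> * (a (?z u t) - b (?z u t))))) (at t within {0..1})"
    by (rule has_vector_derivative_at_within)
      (use has_vector_derivative_mult[OF b a] in \<open>simp add: algebra_simps\<close>)
  qed auto
  have le: "?s u + t * (T - ?s u) \<le> T" if "0 \<le> t" "t \<le> 1" for t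
   using mult_left_le_one_le[of "T - ?s u" t] that sT by linarith
  have 2: "((\<lambda>t. (T - ?s u) *\<^sub>R (a (Complex u (\<sigma> u t)) + b (Complex u (\<sigma> u t)))) has_integral
    integral {\<sigma> u 0..\<sigma> u 1} (\<lambda>v. a (Complex u v) + b (Complex u v))) {0..1}"
   by (rule has_integral_substitution[where c = "?s u" and d = T])
     (use sT line \<sigma>_def le in \<open>auto simp: \<sigma>_def intro!: derivative_eq_intros continuous_intros
      continuous_on_compose2[OF ca] continuous_on_compose2[OF cb] has_real_derivative_iff_has_vector_derivative[THEN iffD1]\<close>)
  have 3: "((\<lambda>v. \<i> * (a (Complex u v) - b (Complex u v))) has_integral (A (Complex u T) - A (Complex u (?s u)))) {?s u..T}"
  proof (rule fundamental_theorem_of_calculus[OF sT])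
   fix v assume v: "v \<in> {?s u..T}"
   have "((\<lambda>v. A (Complex u v)) has_vector_derivative
     of_real 0 * (a (Complex u v) + b (Complex u v)) + of_real 1 * (\<i> * (a (Complex u v) - b (Complex u v)))) (at v)"
    by (rule wirtinger_strip_path[OF A]) (use v s[OF u] in \<open>auto intro!: derivative_eq_intros\<close>)
   then show "((\<lambda>v. A (Complex u v)) has_vector_derivative \<i> * (a (Complex u v) - b (Complex u v))) (at v within {?s u..T})"
    by (auto intro: has_vector_derivative_at_within)
  qed
  have int: "(\<lambda>v. a (Complex u v)) integrable_on {?s u..T}" "(\<lambda>v. b (Complex u v)) integrable_on {?s u..T}"
   by (rule integrable_continuous_interval;
     use line in \<open>auto intro!: continuous_intros continuous_on_compose2[OF ca] continuous_on_compose2[OF cb]\<close>)+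
  have "integral {0..1} (fx u) = integral {?s u..T} (\<lambda>v. a (Complex u v) + b (Complex u v)) - of_real (s' u) * A (Complex u (?s u))"
   using has_integral_add[OF 2 1] unfolding fx_def
   by (intro integral_unique) (simp add: \<sigma>_def scaleR_conv_of_real algebra_simps)
  moreover have "\<i> * integral {?s u..T} (\<lambda>v. a (Complex u v)) - \<i> * integral {?s u..T} (\<lambda>v. b (Complex u v))
    = A (Complex u T) - A (Complex u (?s u))"
   using integral_unique[OF 3] int by (simp add: Henstock_Kurzweil_Integration.integral_diff algebra_simps integrable_on_mult_right)
  then have "integral {?s u..T} (\<lambda>v. a (Complex u v)) = integral {?s u..T} (\<lambda>v. b (Complex u v))
    - \<i> * (A (Complex u T) - A (Complex u (?s u)))"
   by (simp add: complex_eq_iff)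
  ultimately show ?thesis
   using int by (simp add: Henstock_Kurzweil_Integration.integral_add algebra_simps)
 qed
 ultimately show ?thesis by (simp add: s'_def)
qed

text \<open>Integration of \<open>stokes_inner\<close> over u. Both vertical sides drop out because
  \<open>\<Phi>\<close> takes the same value at -1/2 and 1/2 by periodicity. The arc integral is
  kept, so the formula also applies to a function A that does not transform under S.\<close>

lemma green_fund_dom:
 assumes A: "\<And>z. z \<in> uhp \<Longrightarrow> has_wirtinger A (a z) (b z) z"
  and ca: "continuous_on uhp a" and cb: "continuous_on uhp b" and T: "T \<ge> 1"
  and per: "\<And>z. z \<in> uhp \<Longrightarrow> A (z + 1) = A z"
 shows "set_lebesgue_integral lborel (fund_dom T) (\<lambda>z. - 2 * \<i> * b z) = integral {-1/2..1/2} (\<lambda>u. A (Complex u T))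
  - integral {-1/2..1/2} (\<lambda>u. A (Complex u (arc_height u)) * (1 + \<i> * of_real (- u / arc_height u)))"
proof -
 let ?U = "{-1/2..1/2::real}"
 let ?s = arc_height
 define \<Phi> where "\<Phi> u = integral {0..1} (\<lambda>t. A (Complex u (?s u + t * (T - ?s u))) * of_real (T - ?s u))" for u
 define I where "I u = integral {?s u..T} (\<lambda>v. - 2 * \<i> * b (Complex u v))" for u
 define g where "g u = A (Complex u (?s u)) * (1 + \<i> * of_real (- u / ?s u))" for u
 have cA: "continuous_on uhp A" using wirtinger_continuous_on A by blast
 have s: "1/2 \<le> ?s u" "?s u \<le> 1" "?s u > 0" if "u \<in> ?U" for u
  using that arc_height_bounds[of u] by auto
 have cs: "continuous_on ?U ?s"
  by (intro continuous_at_imp_continuous_on ballI DERIV_isCont[OF arc_height_derivative]) auto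
 have d\<Phi>: "(\<Phi> has_vector_derivative \<i> * (I u - A (Complex u T) + g u)) (at u within ?U)" if "u \<in> ?U" for u
  unfolding \<Phi>_def I_def g_def by (rule stokes_inner[OF A ca cb T that])
 have cg: "continuous_on ?U g" unfolding g_def
  by (intro continuous_intros continuous_on_compose2[OF cA] cs) (use s in \<open>force simp: uhp_def\<close>)+
 have cT: "continuous_on ?U (\<lambda>u. A (Complex u T))"
  by (intro continuous_intros continuous_on_compose2[OF cA]) (use T in \<open>auto simp: uhp_def\<close>)
 have ft: "((\<lambda>u. \<i> * (I u - A (Complex u T) + g u)) has_integral (\<Phi> (1/2) - \<Phi> (-1/2))) ?U"
  by (rule fundamental_theorem_of_calculus) (use d\<Phi> in auto)
 have \<Phi>eq: "\<Phi> (1/2) = \<Phi> (-1/2)"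
 proof -
  have su: "?s (1/2) = ?s (-1/2)" by (simp add: arc_height_def)
  have "A (Complex (1/2) (?s (-1/2) + t * (T - ?s (-1/2)))) = A (Complex (-1/2) (?s (-1/2) + t * (T - ?s (-1/2))))"
   if "t \<in> {0..1}" for t
  proof -
   have "t * (T - ?s (-1/2)) \<ge> 0" using that s[of "-1/2"] T by auto
   then have "Complex (-1/2) (?s (-1/2) + t * (T - ?s (-1/2))) \<in> uhp" using s[of "-1/2"] by (auto simp: uhp_def)
   from per[OF this] show ?thesis by (simp add: complex_eq_iff plus_complex.code one_complex.code)
  qed
  then show ?thesis unfolding \<Phi>_def su
   by (intro Henstock_Kurzweil_Integration.integral_cong) auto
 qed
 have "((\<lambda>u. - \<i> * (\<i> * (I u - A (Complex u T) + g u)) + A (Complex u T) - g u) has_integral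
   (- \<i> * (\<Phi> (1/2) - \<Phi> (-1/2)) + integral ?U (\<lambda>u. A (Complex u T)) - integral ?U g)) ?U"
  by (intro has_integral_diff has_integral_add has_integral_mult_right ft integrable_integral
     integrable_continuous_interval cT cg)
 from this[unfolded \<Phi>eq] have hI: "(I has_integral integral ?U (\<lambda>u. A (Complex u T)) - integral ?U g) ?U"
  by (simp flip: mult.assoc)
 \<comment> \<open>Rescaled to a fixed interval, the inner integral is seen to depend continuously
   on u; this identifies the outer Lebesgue integral with the gauge integral.\<close>
 have cI: "continuous_on ?U I"
 proof -
  have I_eq: "I u = integral {0..1} (\<lambda>t. (T - ?s u) *\<^sub>R (- 2 * \<i> * b (Complex u (?s u + t * (T - ?s u)))))" if u: "u \<in> ?U" for u
  proof -
   have sT: "?s u \<le> T" using s[OF u] T by linarith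
   have le: "?s u + t * (T - ?s u) \<le> T" if "0 \<le> t" "t \<le> 1" for t
    using mult_left_le_one_le[of "T - ?s u" t] that sT by linarith
   have "((\<lambda>t. (T - ?s u) *\<^sub>R (- 2 * \<i> * b (Complex u (?s u + t * (T - ?s u))))) has_integral
     integral {?s u + 0 * (T - ?s u)..?s u + 1 * (T - ?s u)} (\<lambda>v. - 2 * \<i> * b (Complex u v))) {0..1}"
    by (rule has_integral_substitution[where c = "?s u" and d = T])
     (use sT s[OF u] le in \<open>auto intro!: derivative_eq_intros continuous_intros
      continuous_on_compose2[OF cb] has_real_derivative_iff_has_vector_derivative[THEN iffD1] simp: uhp_def\<close>)
   moreover have "?s u + 0 * (T - ?s u) = ?s u" "?s u + 1 * (T - ?s u) = T" by simp_all
   ultimately show ?thesis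
    unfolding I_def by (intro integral_unique[symmetric]) (simp only:)
  qed
  have pos: "0 < ?s u + t * (T - ?s u)" if "u \<in> ?U" "t \<in> {0..1}" for u t
  proof -
   have "t * (T - ?s u) \<ge> 0" using that s[OF that(1)] T by auto
   then show ?thesis using s[OF that(1)] by simp
  qed
  have "continuous_on ?U (\<lambda>u. integral (cbox 0 1) (\<lambda>t. (T - ?s u) *\<^sub>R (- 2 * \<i> * b (Complex u (?s u + t * (T - ?s u))))))"
   by (rule integral_continuous_on_param, unfold split_beta)
     (use pos in \<open>auto intro!: continuous_intros continuous_on_compose2[OF cb] continuous_on_compose2[OF cs] simp: uhp_def\<close>)
  then show ?thesis by (rule continuous_on_eq) (simp only: I_eq box_real)
 qed
 have "set_lebesgue_integral lborel (fund_dom T) (\<lambda>z. - 2 * \<i> * b z) =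
   (LINT u|lborel. indicator ?U u *\<^sub>R (LINT v:{?s u..T}|lborel. - 2 * \<i> * b (Complex u v)))"
  by (rule integral_fund_dom_iterated) (intro continuous_intros cb)
 also have "\<dots> = (LINT u:?U|lborel. I u)"
  unfolding set_lebesgue_integral_def[of _ ?U]
 proof (rule Bochner_Integration.integral_cong[OF refl])
  fix u
  show "indicator ?U u *\<^sub>R (LINT v:{?s u..T}|lborel. - 2 * \<i> * b (Complex u v)) = indicator ?U u *\<^sub>R I u"
  proof (cases "u \<in> ?U")
   case True
   have "set_integrable lborel {?s u..T} (\<lambda>v. - 2 * \<i> * b (Complex u v))"
    unfolding set_integrable_def
    by (rule borel_integrable_compact)
      (use s[OF True] in \<open>auto intro!: continuous_intros continuous_on_compose2[OF cb] simp: uhp_def\<close>)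
   then show ?thesis unfolding I_def
    using set_borel_integral_eq_integral(2)[of "{?s u..T}" "\<lambda>v. - 2 * \<i> * b (Complex u v)"] by simp
  qed auto
 qed
 also have "\<dots> = integral ?U I"
  by (rule set_borel_integral_eq_integral(2))
    (unfold set_integrable_def, rule borel_integrable_compact, use cI in auto)
 finally show ?thesis using hI unfolding g_def by (simp add: integral_unique)
qed

text \<open>On the unit circle -1/z is the reflection u to -u. Together with the weight 2 rule this
  makes the integrand of the arc term an odd function of u.\<close>

lemma stokes_fund_dom:
 assumes A: "\<And>z. z \<in> uhp \<Longrightarrow> has_wirtinger A (a z) (b z) z"
  and ca: "continuous_on uhp a" and cb: "continuous_on uhp b" and T: "T \<ge> 1"
  and per: "\<And>z. z \<in> uhp \<Longrightarrow> A (z + 1) = A z"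
  and inv: "\<And>z. z \<in> uhp \<Longrightarrow> A (- 1 / z) = z\<^sup>2 * A z"
 shows "set_lebesgue_integral lborel (fund_dom T) (\<lambda>z. - 2 * \<i> * b z) = integral {-1/2..1/2} (\<lambda>u. A (Complex u T))"
proof -
 let ?U = "{-1/2..1/2::real}"
 let ?s = arc_height
 define g where "g u = A (Complex u (?s u)) * (1 + \<i> * of_real (- u / ?s u))" for u
 have s: "1/2 \<le> ?s u" "?s u \<le> 1" "?s u > 0" if "u \<in> ?U" for u
  using that arc_height_bounds[of u] by auto
 have odd: "g (- u) = - g u" if u: "u \<in> ?U" for u
 proof -
  define z where "z = Complex u (?s u)"
  have su: "?s (- u) = ?s u" by (simp add: arc_height_def)
  have sq: "(?s u)\<^sup>2 = 1 - u\<^sup>2"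
   using s(3)[OF u] by (simp add: arc_height_def)
  have z: "z \<in> uhp" using s[OF u] by (simp add: z_def uhp_def)
  have nz: "z \<noteq> 0" using s[OF u] by (auto simp: z_def complex_eq_iff)
  have "cnj z * z = 1"
   using sq by (simp add: z_def complex_eq_iff power2_eq_square)
  moreover have "Complex (- u) (?s u) = - cnj z" by (simp add: z_def complex_eq_iff)
  ultimately have "Complex (- u) (?s u) = - 1 / z"
   using nz by (simp add: eq_divide_eq)
  then have "g (- u) = z\<^sup>2 * A z * (1 + \<i> * of_real (u / ?s u))"
   using inv[OF z] by (simp add: g_def su)
  moreover have "z\<^sup>2 * (1 + \<i> * of_real (u / ?s u)) = - (1 + \<i> * of_real (- u / ?s u))"
   using sq s[OF u] by (simp add: z_def complex_eq_iff power2_eq_square field_simps) algebra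
  ultimately have "g (- u) = A z * - (1 + \<i> * of_real (- u / ?s u))"
   by (metis mult.commute mult.assoc)
  then show ?thesis by (simp only: g_def z_def mult_minus_right)
 qed
 have int_g: "integral ?U g = 0"
 proof -
  have "integral ?U g = integral {-(1/2)..-(-1/2)} (\<lambda>u. g (- u))"
   by (rule Henstock_Kurzweil_Integration.integral_reflect_real[symmetric])
  also have "\<dots> = integral {-(1/2)..-(-1/2)} (\<lambda>u. - g u)"
   by (rule Henstock_Kurzweil_Integration.integral_cong) (use odd in auto)
  finally show ?thesis by simp
 qed
 then show ?thesis using green_fund_dom[OF A ca cb T per] unfolding g_def[abs_def] by (simp only: diff_0_right)
qed

section \<open>Fourier expansions on the upper half-plane\<close>

lemma e_add: "e (a + b) = e a * e b"
 by (simp add: e_def exp_add algebra_simps)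

lemma e_0 [simp]: "e 0 = 1"
 by (simp add: e_def)

lemma e_neq_0 [simp]: "e w \<noteq> 0"
 by (simp add: e_def)

lemma e_minus: "e (- a) = inverse (e a)"
 by (simp add: e_def exp_minus)

lemma norm_e: "cmod (e w) = exp (- 2 * pi * Im w)"
 by (simp add: e_def)

lemma cnj_e: "cnj (e w) = e (- cnj w)"
 by (simp add: e_def exp_cnj)

lemma e_eq_1_iff: "e w = 1 \<longleftrightarrow> w \<in> \<int>"
proof -
 have "e w = 1 \<longleftrightarrow> (\<exists>n::int. Re w = of_int n \<and> Im w = 0)"
  unfolding e_def exp_eq_1 by (auto simp: field_simps)
 also have "\<dots> \<longleftrightarrow> w \<in> \<int>"
  by (auto simp: Ints_def complex_eq_iff)
 finally show ?thesis .
qed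

lemma e_of_real_eq_1_iff: "er x = 1 \<longleftrightarrow> x \<in> \<int>"
proof -
 have "complex_of_real x \<in> \<int> \<longleftrightarrow> x \<in> \<int>"
  by (metis Ints_cases Ints_of_int Re_complex_of_real complex_Re_of_int of_real_of_int_eq)
 then show ?thesis by (simp add: e_eq_1_iff)
qed

lemma e_of_real_cong: "x - y \<in> \<int> \<Longrightarrow> er x = er y"
 using e_add[of "of_real (x - y)" "of_real y"] e_of_real_eq_1_iff[of "x - y"] by simp

lemma e_of_int [simp]: "e (of_int n) = 1"
 by (simp add: e_eq_1_iff)

lemma has_field_derivative_e [derivative_intros]:
 "(f has_field_derivative f') (at x within S) \<Longrightarrow>
  ((\<lambda>x. e (f x)) has_field_derivative (2 * of_real pi * \<i> * e (f x) * f')) (at x within S)"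
 unfolding e_def by (auto intro!: derivative_eq_intros)

lemma holomorphic_on_e [holomorphic_intros]: "f holomorphic_on S \<Longrightarrow> (\<lambda>x. e (f x)) holomorphic_on S"
 unfolding e_def by (intro holomorphic_intros)

lemma continuous_on_e [continuous_intros]: "continuous_on S f \<Longrightarrow> continuous_on S (\<lambda>x. e (f x))"
 unfolding e_def by (intro continuous_intros)

lemma integral_infsum:
 fixes h :: "'i \<Rightarrow> real \<Rightarrow> complex"
 assumes cont: "\<And>i. i \<in> I \<Longrightarrow> continuous_on {a..b} (h i)"
  and bound: "\<And>i x. i \<in> I \<Longrightarrow> x \<in> {a..b} \<Longrightarrow> norm (h i x) \<le> B i"
  and B: "B summable_on I"
  and g: "\<And>x. x \<in> {a..b} \<Longrightarrow> ((\<lambda>i. h i x) has_sum g x) I"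
 shows "((\<lambda>i. integral {a..b} (h i)) has_sum integral {a..b} g) I"
proof -
 \<comment> \<open>Intersecting with I makes the partial sums continuous for every index set X, not
   only for the subsets of I.\<close>
 have u: "uniform_limit {a..b} (\<lambda>X x. \<Sum>i\<in>X \<inter> I. h i x) g (finite_subsets_at_top I)"
 proof -
  have "uniform_limit {a..b} (\<lambda>X x. \<Sum>i\<in>X. h i x) g (finite_subsets_at_top I)"
   by (rule Weierstrass_m_test_general'[OF bound g B])
  also have "?this \<longleftrightarrow> ?thesis"
   by (intro uniform_limit_cong eventually_finite_subsets_at_top_weakI) (auto simp: Int_absorb2)
  finally show ?thesis .
 qed
 obtain J K where J: "\<And>X. ((\<lambda>x. \<Sum>i\<in>X \<inter> I. h i x) has_integral J X) {a..b}"
  and K: "(g has_integral K) {a..b}" and lim: "(J \<longlongrightarrow> K) (finite_subsets_at_top I)"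
  by (rule uniform_limit_integral[OF u]) (auto intro!: continuous_on_sum cont)
 have "J X = (\<Sum>i\<in>X. integral {a..b} (h i))" if "finite X" "X \<subseteq> I" for X
 proof -
  have "((\<lambda>x. \<Sum>i\<in>X. h i x) has_integral (\<Sum>i\<in>X. integral {a..b} (h i))) {a..b}"
   by (intro has_integral_sum that integrable_integral integrable_continuous_interval cont) (use that in auto)
  then show ?thesis using J[of X] that by (metis Int_absorb2 has_integral_unique)
 qed
 then have "((\<lambda>X. \<Sum>i\<in>X. integral {a..b} (h i)) \<longlongrightarrow> K) (finite_subsets_at_top I)"
  by (intro Lim_transform_eventually[OF lim] eventually_finite_subsets_at_top_weakI) auto
 then show ?thesis using K by (simp add: has_sum_def integral_unique)
qed

lemma integral_e_period:
 assumes "t \<in> \<int>"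
 shows "integral {-1/2..1/2} (\<lambda>u. er (t * u)) = (if t = 0 then 1 else 0)"
proof (cases "t = 0")
 case False
 define F where "F u = er (t * u) / (2 * of_real pi * \<i> * of_real t)" for u
 have "((\<lambda>u. er (t * u)) has_integral (F (1/2) - F (-1/2))) {-1/2..1/2}"
 proof (rule fundamental_theorem_of_calculus)
  fix u :: real
  have "((\<lambda>z. e (of_real t * z) / (2 * of_real pi * \<i> * of_real t)) has_field_derivative e (of_real t * of_real u)) (at (of_real u))"
   using False by (auto intro!: derivative_eq_intros)
  from has_vector_derivative_real_field[OF this]
  show "(F has_vector_derivative er (t * u)) (at u within {-1/2..1/2})"
   by (simp add: F_def[abs_def])
 qed auto
 moreover have "er (t * (1/2)) = er (t * (-1/2))"
  by (rule e_of_real_cong) (use assms in simp)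
 ultimately show ?thesis using False by (simp add: F_def integral_unique)
qed auto

text \<open>\<open>has_sum\<close> is unconditional convergence, so convergence at the single point
  u = 0 already makes the coefficients absolutely summable. They dominate the series for all u, and
  orthogonality can be applied term by term.\<close>

lemma fourier_coeff_has_sum:
 fixes a :: "real \<Rightarrow> complex"
 assumes g: "\<And>u. u \<in> {-1/2..1/2} \<Longrightarrow> ((\<lambda>n. a n * er (n * u)) has_sum g u) S"
  and S: "\<And>n. n \<in> S \<Longrightarrow> n - m \<in> \<int>"
 shows "integral {-1/2..1/2} (\<lambda>u. g u * er (- m * u)) = (if m \<in> S then a m else 0)"
proof -
 have "((\<lambda>n. a n * er (n * 0)) has_sum g 0) S" using g[of 0] by simp
 then have "a summable_on S" by (auto simp: summable_on_def)
 then have abs: "(\<lambda>n. norm (a n)) summable_on S"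
  by (simp add: summable_on_iff_abs_summable_on_complex)
 have "((\<lambda>n. integral {-1/2..1/2} (\<lambda>u. a n * er (n * u) * er (- m * u))) has_sum
   integral {-1/2..1/2} (\<lambda>u. g u * er (- m * u))) S"
  by (rule integral_infsum[OF _ _ abs])
    (use g in \<open>auto intro!: continuous_intros has_sum_cmult_left simp: norm_mult norm_e\<close>)
 moreover have "integral {-1/2..1/2} (\<lambda>u. a n * er (n * u) * er (- m * u)) = (if n = m then a m else 0)"
  if "n \<in> S" for n
 proof -
  have "(\<lambda>u. a n * er (n * u) * er (- m * u)) = (\<lambda>u. a n * er ((n - m) * u))"
   by (simp add: fun_eq_iff algebra_simps flip: e_add)
  then show ?thesis using integral_e_period[OF S[OF that]] by simp
 qed
 ultimately have "((\<lambda>n. if n = m then a m else 0) has_sum integral {-1/2..1/2} (\<lambda>u. g u * er (- m * u))) S"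
  by (simp cong: has_sum_cong)
 moreover have "((\<lambda>n. if n = m then a m else 0) has_sum (if m \<in> S then a m else 0)) S"
 proof (cases "m \<in> S")
  case True
  then show ?thesis
   using has_sum_finite_neutralI[of "{m}" S "\<lambda>n. if n = m then a m else 0" "a m"] by auto
 next
  case False
  then show ?thesis by (auto intro!: has_sum_0)
 qed
 ultimately show ?thesis by (rule has_sum_unique)
qed

section \<open>Mean values over a period, growth at the cusp and q-expansions\<close>

lemma Complex_in_uhp [simp]: "Complex u v \<in> uhp \<longleftrightarrow> v > 0"
 by (simp add: uhp_def)

lemma uhp_add [simp]: "z \<in> uhp \<Longrightarrow> z + of_int n \<in> uhp" "z \<in> uhp \<Longrightarrow> z + 1 \<in> uhp"
 by (simp_all add: uhp_def)

lemma continuous_on_horizontal: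
 "continuous_on uhp h \<Longrightarrow> v > 0 \<Longrightarrow> continuous_on S (\<lambda>u. h (Complex u v))"
 by (rule continuous_on_compose2[of uhp h]) (auto intro!: continuous_intros)

lemma Complex_shift: "Complex (1/2) v = Complex (-1/2) v + 1"
 by (simp add: complex_eq_iff)

text \<open>The v-derivative of h is \<i>(a - b), and the u-derivative a + b has mean 0 by
  periodicity. Hence the means of a and -b agree, and only b survives.\<close>

lemma periodic_mean_derivative:
 assumes h: "\<And>z. z \<in> uhp \<Longrightarrow> has_wirtinger h (a z) (b z) z"
  and ca: "continuous_on uhp a" and cb: "continuous_on uhp b"
  and per: "\<And>z. z \<in> uhp \<Longrightarrow> h (z + 1) = h z" and v: "v > 0"
 shows "((\<lambda>v. integral {-1/2..1/2} (\<lambda>u. h (Complex u v))) has_vector_derivative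
   - 2 * \<i> * integral {-1/2..1/2} (\<lambda>u. b (Complex u v))) (at v)"
proof -
 have ch: "continuous_on uhp h" using wirtinger_continuous_on h by blast

 have "((\<lambda>v. integral (cbox (-1/2) (1/2)) (\<lambda>u. h (Complex u v))) has_vector_derivative
   integral (cbox (-1/2) (1/2)) (\<lambda>u. \<i> * (a (Complex u v) - b (Complex u v)))) (at v within {0<..})"
 proof (rule leibniz_rule_vector_derivative)
  fix x t :: real assume "x \<in> {0<..}"
  then have "((\<lambda>x. h (Complex t x)) has_vector_derivative
   (of_real 0 * (a (Complex t x) + b (Complex t x)) + of_real 1 * (\<i> * (a (Complex t x) - b (Complex t x))))) (at x)"
   by (intro wirtinger_strip_path[OF h]) (auto intro!: derivative_eq_intros)
  then show "((\<lambda>x. h (Complex t x)) has_vector_derivative \<i> * (a (Complex t x) - b (Complex t x))) (at x within {0<..})"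
   by (auto intro: has_vector_derivative_at_within)
 next
  show "(\<lambda>u. h (Complex u x)) integrable_on cbox (-1/2) (1/2)" if "x \<in> {0<..}" for x
   using that by (auto intro!: integrable_continuous_interval continuous_on_horizontal[OF ch])
  have c: "continuous_on ({0<..} \<times> cbox (-1/2) (1/2::real)) (\<lambda>p. Complex (snd p) (fst p))"
   by (intro continuous_intros)
  have im: "(\<lambda>p. Complex (snd p) (fst p)) ` ({0<..} \<times> cbox (-1/2) (1/2::real)) \<subseteq> uhp" by auto
  show "continuous_on ({0<..} \<times> cbox (-1/2) (1/2)) (\<lambda>(x, t). \<i> * (a (Complex t x) - b (Complex t x)))"
   unfolding split_beta
   by (intro continuous_intros continuous_on_compose2[OF ca c im] continuous_on_compose2[OF cb c im])
 qed (use v in auto)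
 then have D: "((\<lambda>v. integral {-1/2..1/2} (\<lambda>u. h (Complex u v))) has_vector_derivative
   integral {-1/2..1/2} (\<lambda>u. \<i> * (a (Complex u v) - b (Complex u v)))) (at v)"
  using at_within_open[of v "{0<..}"] v by simp
 have int: "(\<lambda>u. a (Complex u v)) integrable_on {-1/2..1/2}" "(\<lambda>u. b (Complex u v)) integrable_on {-1/2..1/2}"
  using v by (auto intro!: integrable_continuous_interval continuous_on_horizontal[OF ca] continuous_on_horizontal[OF cb])
 have "((\<lambda>u. a (Complex u v) + b (Complex u v)) has_integral (h (Complex (1/2) v) - h (Complex (-1/2) v))) {-1/2..1/2}"
 proof (rule fundamental_theorem_of_calculus)
  fix x :: real
  have "((\<lambda>x. h (Complex x v)) has_vector_derivative
   (of_real 1 * (a (Complex x v) + b (Complex x v)) + of_real 0 * (\<i> * (a (Complex x v) - b (Complex x v))))) (at x)"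
   by (rule wirtinger_strip_path[OF h]) (use v in \<open>auto intro!: derivative_eq_intros\<close>)
  then show "((\<lambda>x. h (Complex x v)) has_vector_derivative (a (Complex x v) + b (Complex x v))) (at x within {-1/2..1/2})"
   by (auto intro: has_vector_derivative_at_within)
 qed auto
 moreover have "h (Complex (1/2) v) = h (Complex (-1/2) v)"
  unfolding Complex_shift using v by (intro per) simp
 ultimately have "integral {-1/2..1/2} (\<lambda>u. a (Complex u v)) + integral {-1/2..1/2} (\<lambda>u. b (Complex u v)) = 0"
  using int by (simp add: integral_unique flip: Henstock_Kurzweil_Integration.integral_add)
 then have "integral {-1/2..1/2} (\<lambda>u. \<i> * (a (Complex u v) - b (Complex u v))) =
   - 2 * \<i> * integral {-1/2..1/2} (\<lambda>u. b (Complex u v))"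
 proof -
  assume "integral {-1/2..1/2} (\<lambda>u. a (Complex u v)) + integral {-1/2..1/2} (\<lambda>u. b (Complex u v)) = 0"
  then have "integral {-1/2..1/2} (\<lambda>u. a (Complex u v)) = - integral {-1/2..1/2} (\<lambda>u. b (Complex u v))"
   by (rule eq_neg_iff_add_eq_0[THEN iffD2])
  moreover have "integral {-1/2..1/2} (\<lambda>u. \<i> * (a (Complex u v) - b (Complex u v))) =
   \<i> * (integral {-1/2..1/2} (\<lambda>u. a (Complex u v)) - integral {-1/2..1/2} (\<lambda>u. b (Complex u v)))"
   by (subst integral_mult_right, subst Henstock_Kurzweil_Integration.integral_diff[OF int], rule refl)
  ultimately show ?thesis by simp
 qed
 then show ?thesis using D by simp
qed

lemma periodic_mean_const:
 assumes h: "h holomorphic_on uhp" and per: "\<And>z. z \<in> uhp \<Longrightarrow> h (z + 1) = h z"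
  and v: "v > 0" "w > 0"
 shows "integral {-1/2..1/2} (\<lambda>u. h (Complex u v)) = integral {-1/2..1/2} (\<lambda>u. h (Complex u w))"
proof -
 have "((\<lambda>v. integral {-1/2..1/2} (\<lambda>u. h (Complex u v))) has_vector_derivative 0) (at x within {0<..})" if "x > 0" for x
 proof -
  have "((\<lambda>v. integral {-1/2..1/2} (\<lambda>u. h (Complex u v))) has_vector_derivative
    - 2 * \<i> * integral {-1/2..1/2::real} (\<lambda>u. 0)) (at x)"
   by (rule periodic_mean_derivative[where a = "deriv h" and b = "\<lambda>_. 0"])
     (use that per h open_uhp in \<open>auto intro!: has_wirtinger_holomorphic holomorphic_derivI[of h uhp] holomorphic_on_imp_continuous_on holomorphic_deriv\<close>)
  then show ?thesis by (auto intro: has_vector_derivative_at_within)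
 qed
 then obtain c where "\<And>x. x \<in> {0<..} \<Longrightarrow> integral {-1/2..1/2} (\<lambda>u. h (Complex u x)) = c"
  using has_vector_derivative_zero_constant[of "{0::real<..}" "\<lambda>v. integral {-1/2..1/2} (\<lambda>u. h (Complex u v))"]
  by (auto simp: convex_real_interval)
 then show ?thesis using v by simp
qed

text \<open>At most exponential growth in v, uniformly in u: the condition at the cusp under which a
  quasi-periodic holomorphic function has a q-expansion with exponents bounded below. A single
  constant serves as threshold and as rate.\<close>

definition moderate_growth :: "(complex \<Rightarrow> complex) \<Rightarrow> bool" where
 "moderate_growth F \<longleftrightarrow> (\<exists>C\<ge>0. \<forall>z. Im z \<ge> C \<longrightarrow> cmod (F z) \<le> exp (C * Im z))"

lemma moderate_growthI:
 assumes "\<And>z. Im z \<ge> B \<Longrightarrow> cmod (F z) \<le> D * exp (C * Im z)"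
 shows "moderate_growth F"
proof -
 let ?C = "max B (\<bar>C\<bar> + max 1 \<bar>D\<bar>)"
 have "cmod (F z) \<le> exp (?C * Im z)" if t: "Im z \<ge> ?C" for z
 proof -
  have ge1: "Im z \<ge> 1" using t by linarith
  have "D \<le> exp (max 1 \<bar>D\<bar>)" using exp_ge_add_one_self[of "max 1 \<bar>D\<bar>"] by linarith
  also have "\<dots> \<le> exp (max 1 \<bar>D\<bar> * Im z)" using mult_left_mono[OF ge1, of "max 1 \<bar>D\<bar>"] by simp
  finally have D: "D \<le> exp (max 1 \<bar>D\<bar> * Im z)" .
  have C: "exp (C * Im z) \<le> exp (\<bar>C\<bar> * Im z)" using ge1 by (simp add: mult_right_mono)
  have "cmod (F z) \<le> D * exp (C * Im z)" using t by (intro assms) simp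
  also have "\<dots> \<le> exp (max 1 \<bar>D\<bar> * Im z) * exp (\<bar>C\<bar> * Im z)"
   using D C by (intro mult_mono) auto
  also have "\<dots> = exp ((\<bar>C\<bar> + max 1 \<bar>D\<bar>) * Im z)" by (simp add: algebra_simps flip: exp_add)
  also have "\<dots> \<le> exp (?C * Im z)" using ge1 by (simp add: mult_right_mono)
  finally show ?thesis .
 qed
 then show ?thesis unfolding moderate_growth_def by (intro exI[of _ ?C]) auto
qed

lemma moderate_growth_mult:
 assumes "moderate_growth F" "moderate_growth G"
 shows "moderate_growth (\<lambda>z. F z * G z)"
proof -
 obtain C D where "C \<ge> 0" "D \<ge> 0" and C: "\<And>z. Im z \<ge> C \<Longrightarrow> cmod (F z) \<le> exp (C * Im z)"
  and D: "\<And>z. Im z \<ge> D \<Longrightarrow> cmod (G z) \<le> exp (D * Im z)"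
  using assms unfolding moderate_growth_def by metis
 show ?thesis
  by (rule moderate_growthI[where B = "max C D" and D = 1 and C = "C + D"])
    (use C D in \<open>auto simp: norm_mult exp_add algebra_simps intro!: mult_mono\<close>)
qed

lemma moderate_growth_add:
 assumes "moderate_growth F" "moderate_growth G"
 shows "moderate_growth (\<lambda>z. F z + G z)"
proof -
 obtain C D where *: "C \<ge> 0" "D \<ge> 0" and C: "\<And>z. Im z \<ge> C \<Longrightarrow> cmod (F z) \<le> exp (C * Im z)"
  and D: "\<And>z. Im z \<ge> D \<Longrightarrow> cmod (G z) \<le> exp (D * Im z)"
  using assms unfolding moderate_growth_def by metis
 show ?thesis
 proof (rule moderate_growthI[where B = "max C D" and D = 2 and C = "C + D"])
  fix z assume t: "max C D \<le> Im z"
  then have "exp (C * Im z) \<le> exp ((C + D) * Im z)" "exp (D * Im z) \<le> exp ((C + D) * Im z)"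
   using * by (auto intro!: mult_right_mono)
  then show "cmod (F z + G z) \<le> 2 * exp ((C + D) * Im z)"
   using C[of z] D[of z] t norm_triangle_ineq[of "F z" "G z"] by linarith
 qed
qed

lemma moderate_growth_const: "moderate_growth (\<lambda>_. c)"
 by (rule moderate_growthI[where B = 0 and D = "cmod c" and C = 0]) auto

lemma moderate_growth_sum:
 "(\<And>i. i \<in> I \<Longrightarrow> moderate_growth (F i)) \<Longrightarrow> moderate_growth (\<lambda>z. \<Sum>i\<in>I. F i z)"
 by (induction I rule: infinite_finite_induct) (auto intro: moderate_growth_add moderate_growth_const)

lemma moderate_growth_e: "moderate_growth (\<lambda>z. e (of_real n * z))"
 by (rule moderate_growthI[where B = 0 and D = 1 and C = "- 2 * pi * n"]) (simp add: norm_e mult.assoc)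

text \<open>Cauchy's inequality on the disc of radius 1, on which heights vary by at most 1.\<close>

lemma moderate_growth_deriv:
 assumes "moderate_growth F" and hol: "F holomorphic_on uhp"
 shows "moderate_growth (deriv F)"
proof -
 obtain C where *: "C \<ge> 0" and C: "\<And>z. Im z \<ge> C \<Longrightarrow> cmod (F z) \<le> exp (C * Im z)"
  using assms unfolding moderate_growth_def by metis
 show ?thesis
 proof (rule moderate_growthI[where B = "C + 2" and D = "exp C" and C = C])
  fix z assume t: "C + 2 \<le> Im z"
  have ball: "Im z - 1 \<le> Im w \<and> Im w \<le> Im z + 1" if "w \<in> cball z 1" for w
   using abs_Im_le_cmod[of "z - w"] that by (simp add: dist_norm) linarith
  have sub: "cball z 1 \<subseteq> uhp" using ball t * by (fastforce simp: uhp_def)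
  have "cmod ((deriv ^^ 1) F z) \<le> fact 1 * exp (C * (Im z + 1)) / 1 ^ 1"
  proof (rule Cauchy_inequality)
   show "F holomorphic_on ball z 1"
    using hol by (rule holomorphic_on_subset) (use sub in auto)
   show "continuous_on (cball z 1) F"
    using hol sub continuous_on_subset holomorphic_on_imp_continuous_on by blast
   fix x assume "cmod (z - x) = 1"
   then have x: "x \<in> cball z 1" by (simp add: dist_norm)
   then have "cmod (F x) \<le> exp (C * Im x)" using ball[OF x] t by (intro C) linarith
   also have "\<dots> \<le> exp (C * (Im z + 1))" using ball[OF x] * by (simp add: mult_left_mono)
   finally show "cmod (F x) \<le> exp (C * (Im z + 1))" .
  qed auto
  then show "cmod (deriv F z) \<le> exp C * exp (C * Im z)" by (simp add: algebra_simps exp_add)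
 qed
qed

text \<open>A periodic function factors through e(t) as a function g on the punctured unit disc, and
  the bound makes the singularity at 0 removable. The principal logarithm shows that g is
  holomorphic only off the negative ray; off the positive ray a logarithm shifted by a half turn is
  used, and periodicity shows that both give the same g.\<close>

lemma q_expansion_bounded:
 assumes hol: "h holomorphic_on uhp" and per: "\<And>t. t \<in> uhp \<Longrightarrow> h (t + 1) = h t"
  and bdd: "\<And>t. Im t \<ge> B \<Longrightarrow> cmod (h t) \<le> D"
 shows "\<exists>c. \<forall>t\<in>uhp. ((\<lambda>n::nat. c n * e (of_nat n * t)) has_sum h t) UNIV"
proof -
 have perZ: "h (t + of_int n) = h t" if "t \<in> uhp" for t n
 proof (induction n rule: int_induct[where k = 0])
  case (step1 i)
  have "h (t + of_int i + 1) = h (t + of_int i)" by (rule per) (use that in simp)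
  then show ?case using step1 by (simp add: add.assoc)
 next
  case (step2 i)
  have "h (t + of_int (i - 1) + 1) = h (t + of_int (i - 1))" by (rule per) (use that uhp_add(1) in blast)
  then show ?case using step2 by simp
 qed simp
 define g where "g w = h (Ln w / (2 * of_real pi * \<i>))" for w
 let ?D = "ball 0 1 - {0::complex}"
 have Imw: "Im (Ln w / (2 * of_real pi * \<i>)) = - ln (cmod w) / (2 * pi)" if "w \<noteq> 0" for w
  using that by (simp add: Im_divide power2_eq_square field_simps)
 have inu: "Ln w / (2 * of_real pi * \<i>) \<in> uhp" if "w \<in> ?D" for w
  using that Imw[of w] by (auto simp: uhp_def divide_neg_pos)
 have eLn: "e (Ln w / (2 * of_real pi * \<i>)) = w" if "w \<noteq> 0" for w
  using that by (simp add: e_def)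
 have same: "h t = h s" if "t \<in> uhp" "s \<in> uhp" "e t = e s" for t s
 proof -
  have "e (t - s) = 1" using that(3) e_add[of "t - s" s] by simp
  then obtain n where "t - s = of_int n" by (auto simp: e_eq_1_iff elim: Ints_cases)
  then have "t = s + of_int n" by (simp add: algebra_simps)
  then show ?thesis using perZ that by simp
 qed
 have g_e: "g (e t) = h t" if "t \<in> uhp" for t
 proof -
  have "e t \<in> ?D" using that by (simp add: norm_e uhp_def)
  then show ?thesis unfolding g_def using that by (intro same inu eLn) auto
 qed
 have hol1: "g holomorphic_on (?D - \<real>\<^sub>\<le>\<^sub>0)"
  unfolding g_def
 proof (rule holomorphic_on_compose_gen[OF _ hol, unfolded o_def])
  show "(\<lambda>w. Ln w / (2 * of_real pi * \<i>)) holomorphic_on (?D - \<real>\<^sub>\<le>\<^sub>0)"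
   by (auto intro!: holomorphic_intros)
 qed (use inu in blast)
 have hol2: "g holomorphic_on (?D - uminus ` \<real>\<^sub>\<le>\<^sub>0)"
 proof -
  have inu2: "Ln (- w) / (2 * of_real pi * \<i>) + 1/2 \<in> uhp" if "w \<in> ?D" for w
   using inu[of "- w"] that by (simp add: uhp_def)
  have nn: "- w \<notin> \<real>\<^sub>\<le>\<^sub>0" if "w \<notin> uminus ` (\<real>\<^sub>\<le>\<^sub>0 :: complex set)" for w
   using that image_eqI[of w uminus "- w"] by auto
  have "(\<lambda>w. h (Ln (- w) / (2 * of_real pi * \<i>) + 1/2)) holomorphic_on (?D - uminus ` \<real>\<^sub>\<le>\<^sub>0)"
  proof (rule holomorphic_on_compose_gen[OF _ hol, unfolded o_def])
   show "(\<lambda>w. Ln (- w) / (2 * of_real pi * \<i>) + 1/2) holomorphic_on (?D - uminus ` \<real>\<^sub>\<le>\<^sub>0)"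
    by (intro holomorphic_intros) (use nn in auto)
  qed (use inu2 in blast)
  moreover have "h (Ln (- w) / (2 * of_real pi * \<i>) + 1/2) = g w" if "w \<in> ?D" for w
   unfolding g_def
  proof (rule same)
   have "e (1/2) = -1" by (simp add: e_def)
   then show "e (Ln (- w) / (2 * of_real pi * \<i>) + 1/2) = e (Ln w / (2 * of_real pi * \<i>))"
    using that eLn[of w] eLn[of "- w"] by (simp add: e_add)
  qed (use that inu inu2 in auto)
  ultimately show ?thesis by (elim holomorphic_transform) auto
 qed
 have clo: "closed (uminus ` (\<real>\<^sub>\<le>\<^sub>0 :: complex set))" by (intro closed_negations closed_nonpos_Reals_complex)
 have "g holomorphic_on ((?D - \<real>\<^sub>\<le>\<^sub>0) \<union> (?D - uminus ` \<real>\<^sub>\<le>\<^sub>0))"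
  by (intro holomorphic_on_Un hol1 hol2 open_Diff open_ball closed_nonpos_Reals_complex clo) auto
 moreover have "(?D - \<real>\<^sub>\<le>\<^sub>0) \<union> (?D - uminus ` \<real>\<^sub>\<le>\<^sub>0) = ?D"
  by (auto simp: complex_nonpos_Reals_iff complex_eq_iff)
 ultimately have holg: "g holomorphic_on ball 0 1 - {0}" by simp
 have "\<exists>B. eventually (\<lambda>z. norm (g z) \<le> B) (at 0)"
 proof (intro exI[of _ D])
  define r where "r = min 1 (exp (- 2 * pi * B))"
  have "r > 0" by (simp add: r_def)
  moreover have "norm (g w) \<le> D" if "w \<noteq> 0" "dist w 0 < r" for w
  proof -
   have "cmod w < exp (- 2 * pi * B)" using that by (simp add: r_def)
   then have "ln (cmod w) < ln (exp (- 2 * pi * B))" using that by (subst ln_less_cancel_iff) auto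
   then have "ln (cmod w) < - 2 * pi * B" by simp
   then have "B \<le> - ln (cmod w) / (2 * pi)" by (simp add: field_simps)
   then show ?thesis unfolding g_def using that by (intro bdd) (simp add: Imw)
  qed
  ultimately show "eventually (\<lambda>z. norm (g z) \<le> D) (at 0)"
   unfolding eventually_at by auto
 qed
 then obtain g' where g': "g' holomorphic_on ball 0 1" "\<And>z. z \<in> ball 0 1 - {0} \<Longrightarrow> g' z = g z"
  using holomorphic_on_extend_bounded[OF holg] by auto
 define c where "c n = (deriv ^^ n) g' 0 / fact n" for n
 have sums: "(\<lambda>n. c n * w ^ n) sums g' w" if "w \<in> ball 0 1" for w
  using holomorphic_power_series[OF g'(1) that] by (simp add: c_def)
 have "((\<lambda>n::nat. c n * e (of_nat n * t)) has_sum h t) UNIV" if "t \<in> uhp" for t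
 proof -
  have w: "e t \<in> ?D" using that by (simp add: norm_e uhp_def)
  obtain z where z: "cmod (e t) < z" "z < 1" using w dense[of "cmod (e t)" 1] by auto
  have "summable (\<lambda>n. c n * of_real z ^ n)"
   using sums[of "of_real z"] z norm_ge_zero[of "e t"] by (auto simp: sums_iff simp del: norm_ge_zero)
  then have "summable (\<lambda>n. norm (c n * e t ^ n))"
   by (rule powser_insidea) (use z norm_ge_zero[of "e t"] in \<open>auto simp del: norm_ge_zero\<close>)
  then have "((\<lambda>n. c n * e t ^ n) has_sum g' (e t)) UNIV"
   using sums[of "e t"] w by (intro norm_summable_imp_has_sum) auto
  moreover have "e t ^ n = e (of_nat n * t)" for n
   by (simp add: e_def algebra_simps flip: exp_of_nat_mult)
  ultimately show ?thesis using g'(2)[OF w] g_e[OF that] by simp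
 qed
 then show ?thesis by blast
qed

text \<open>\<open>n0\<close> is congruent to \<alpha> modulo 1 and so negative that e(-n0 z) F(z)
  is periodic and bounded near the cusp, although F may grow like exp(C v).\<close>

lemma q_expansion:
 assumes hol: "F holomorphic_on uhp" and per: "\<And>z. z \<in> uhp \<Longrightarrow> F (z + 1) = e (of_real \<alpha>) * F z"
  and mg: "moderate_growth F"
 shows "\<exists>n0 c. \<forall>z\<in>uhp. ((\<lambda>n. c n * e (of_real n * z)) has_sum F z) {n. n - \<alpha> \<in> \<int> \<and> n \<ge> n0}"
proof -
 obtain C where *: "C \<ge> 0" and C: "\<And>z. Im z \<ge> C \<Longrightarrow> cmod (F z) \<le> exp (C * Im z)"
  using mg unfolding moderate_growth_def by metis
 define m where "m = \<lceil>\<alpha> + C\<rceil>"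
 define n0 where "n0 = \<alpha> - of_int m"
 have n0: "n0 \<le> - C" unfolding n0_def m_def by linarith
 have "2 * pi * n0 \<le> 1 * n0" using n0 * pi_ge_two by (intro mult_right_mono_neg) auto
 then have n0': "2 * pi * n0 \<le> - C" using n0 by linarith
 define h where "h z = F z * e (- of_real n0 * z)" for z
 have "\<exists>c. \<forall>z\<in>uhp. ((\<lambda>n::nat. c n * e (of_nat n * z)) has_sum h z) UNIV"
 proof (rule q_expansion_bounded)
  show "h holomorphic_on uhp" unfolding h_def by (intro holomorphic_intros hol)
  fix z assume t: "z \<in> uhp"
  have "e (of_real \<alpha>) * e (- of_real n0) = 1"
   using e_of_int[of m] by (simp add: n0_def flip: e_add)
  then show "h (z + 1) = h z"
  proof -
   have "e (- of_real n0 * (z + 1)) = e (- of_real n0) * e (- of_real n0 * z)"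
    by (simp add: algebra_simps flip: e_add)
   then have "h (z + 1) = (e (of_real \<alpha>) * e (- of_real n0)) * h z"
    unfolding h_def per[OF t] by (simp only: mult_ac)
   then show ?thesis using \<open>e (of_real \<alpha>) * e (- of_real n0) = 1\<close> by simp
  qed
 next
  fix z assume t: "C \<le> Im z"
  have "cmod (h z) \<le> exp (C * Im z) * exp (2 * pi * n0 * Im z)"
   unfolding h_def norm_mult using C[OF t] by (simp add: norm_e mult_right_mono mult.assoc)
  also have "\<dots> = exp ((C + 2 * pi * n0) * Im z)" by (simp add: algebra_simps flip: exp_add)
  also have "\<dots> \<le> exp 0" using n0' t * by (simp add: mult_nonpos_nonneg del: exp_zero)
  finally show "cmod (h z) \<le> exp 0" .
 qed
 then obtain c where c: "\<And>z. z \<in> uhp \<Longrightarrow> ((\<lambda>n::nat. c n * e (of_nat n * z)) has_sum h z) UNIV" by blast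
 have bij: "bij_betw (\<lambda>n::nat. n0 + of_nat n) UNIV {n. n - \<alpha> \<in> \<int> \<and> n \<ge> n0}"
 proof (intro bij_betwI[where g = "\<lambda>x. nat \<lfloor>x - n0\<rfloor>"])
  show "(\<lambda>n::nat. n0 + of_nat n) \<in> UNIV \<rightarrow> {n. n - \<alpha> \<in> \<int> \<and> n \<ge> n0}" by (auto simp: n0_def)
  fix y assume "y \<in> {n. n - \<alpha> \<in> \<int> \<and> n \<ge> n0}"
  then have y: "y - n0 \<in> \<int>" "y - n0 \<ge> 0"
   using Ints_add[of "y - \<alpha>" "of_int m"] by (auto simp: n0_def algebra_simps)
  then obtain k where "y - n0 = of_int k" by (auto elim: Ints_cases)
  with y show "n0 + real (nat \<lfloor>y - n0\<rfloor>) = y" by simp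
 qed auto
 show ?thesis
 proof (intro exI ballI)
  fix z assume t: "z \<in> uhp"
  have "((\<lambda>n::nat. e (of_real n0 * z) * (c n * e (of_nat n * z))) has_sum e (of_real n0 * z) * h z) UNIV"
   by (intro has_sum_cmult_right c t)
  moreover have "e (of_real n0 * z) * h z = F z"
   by (simp add: h_def e_minus)
  moreover have "e (of_real n0 * z) * (c n * e (of_nat n * z)) = c (nat \<lfloor>(n0 + of_nat n) - n0\<rfloor>) * e (of_real (n0 + of_nat n) * z)" for n
   by (simp add: algebra_simps e_add)
  ultimately have "((\<lambda>n::nat. c (nat \<lfloor>(n0 + of_nat n) - n0\<rfloor>) * e (of_real (n0 + of_nat n) * z)) has_sum F z) UNIV" by simp
  then show "((\<lambda>n. c (nat \<lfloor>n - n0\<rfloor>) * e (of_real n * z)) has_sum F z) {n. n - \<alpha> \<in> \<int> \<and> n \<ge> n0}"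
   using has_sum_reindex_bij_betw[OF bij, of "\<lambda>n. c (nat \<lfloor>n - n0\<rfloor>) * e (of_real n * z)"] by simp
 qed
qed

text \<open>The definite description calls for existence, which is the q-expansion, and for
  uniqueness, which holds because the coefficient of index 0 is the mean over any horizontal
  line.\<close>

lemma constant_term_eq:
 assumes hol: "h holomorphic_on uhp" and per: "\<And>z. z \<in> uhp \<Longrightarrow> h (z + 1) = h z"
  and mg: "moderate_growth h" and v: "v > 0"
 shows "constant_term h = integral {-1/2..1/2} (\<lambda>u. h (Complex u v))"
 unfolding constant_term_def
proof (rule the_equality)
 have coeff: "a (0::int) = integral {-1/2..1/2} (\<lambda>u. h (Complex u v))"
  if a: "\<forall>z\<in>uhp. ((\<lambda>n. a n * e (of_int n * z)) has_sum h z) UNIV" for a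
 proof -
  \<comment> \<open>On the line of height v the factor e(n \<i> v) belongs to the coefficient, which
    leaves a Fourier series in u alone.\<close>
  define a' where "a' x = a \<lfloor>x\<rfloor> * e (of_real x * (\<i> * of_real v))" for x
  have bij: "bij_betw (of_int :: int \<Rightarrow> real) UNIV \<int>"
   by (auto simp: bij_betw_def inj_on_def Ints_def)
  have "((\<lambda>x. a' x * er (x * u)) has_sum h (Complex u v)) \<int>" for u
  proof -
   have "((\<lambda>n. a n * e (of_int n * Complex u v)) has_sum h (Complex u v)) UNIV" using a v by simp
   moreover have "a n * e (of_int n * Complex u v) = a' (of_int n) * er (of_int n * u)" for n
    by (simp add: a'_def Complex_eq algebra_simps e_add)
   ultimately show ?thesis
    using has_sum_reindex_bij_betw[OF bij, of "\<lambda>x. a' x * er (x * u)"] by simp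
  qed
  from fourier_coeff_has_sum[where m = 0, OF this] show ?thesis
   by (simp add: a'_def)
 qed
 obtain n0 c where c: "\<And>z. z \<in> uhp \<Longrightarrow> ((\<lambda>n. c n * e (of_real n * z)) has_sum h z) {n. n - 0 \<in> \<int> \<and> n \<ge> n0}"
  using q_expansion[of h 0] hol per mg by auto
 define a where "a n = (if of_int n \<ge> n0 then c (of_int n) else 0)" for n :: int
 have "\<forall>z\<in>uhp. ((\<lambda>n. a n * e (of_int n * z)) has_sum h z) UNIV"
 proof
  fix z assume "z \<in> uhp"
  have bij: "bij_betw (of_int :: int \<Rightarrow> real) {n. of_int n \<ge> n0} {n. n - 0 \<in> \<int> \<and> n \<ge> n0}"
   by (auto simp: bij_betw_def inj_on_def Ints_def)
  have "((\<lambda>n. c (of_int n) * e (of_real (of_int n) * z)) has_sum h z) {n. of_int n \<ge> n0}"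
   using has_sum_reindex_bij_betw[OF bij, of "\<lambda>n. c n * e (of_real n * z)"] c[OF \<open>z \<in> uhp\<close>] by simp
  then show "((\<lambda>n. a n * e (of_int n * z)) has_sum h z) UNIV"
   by (rule has_sum_cong_neutral[THEN iffD1, rotated -1]) (auto simp: a_def)
 qed
 then show "\<exists>a. a 0 = integral {-1/2..1/2} (\<lambda>u. h (Complex u v)) \<and>
   (\<forall>z\<in>uhp. ((\<lambda>n. a n * e (of_int n * z)) has_sum h z) UNIV)"
  using coeff by blast
 show "a0 = integral {-1/2..1/2} (\<lambda>u. h (Complex u v))"
  if "\<exists>a. a 0 = a0 \<and> (\<forall>z\<in>uhp. ((\<lambda>n. a n * e (of_int n * z)) has_sum h z) UNIV)" for a0
  using that coeff by blast
qed

section \<open>Raising operators and the primitive of the integrand\<close>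

text \<open>\<open>Rcoeff wt m i\<close> is the coefficient of \<open>v\<^bsup>i-m\<^esup> (2i \<partial>/\<partial>\<tau>)\<^sup>i\<close> in \<open>R\<^sup>m\<close>.  Below \<open>D i\<close> stands for the
  \<open>i\<close>-th \<open>\<tau>\<close>-derivative of a function that need not be holomorphic.\<close>

definition Rcoeff :: "real \<Rightarrow> nat \<Rightarrow> nat \<Rightarrow> real" where
 "Rcoeff wt m i = real (m choose i) * pochhammer (wt + real i) (m - i)"

lemma choose_Suc_mult: "(real m - real i) * real (m choose i) = real (Suc i) * real (m choose Suc i)"
proof (cases "i \<le> m")
 case True
 have "(m - i) * (m choose i) = Suc i * (m choose Suc i)"
  using binomial_absorb_comp[of m i] binomial_absorption[of i "m"] by simp
 then have "real ((m - i) * (m choose i)) = real (Suc i * (m choose Suc i))" by (rule arg_cong)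
 then show ?thesis using True by (simp only: of_nat_mult of_nat_diff)
qed (simp add: binomial_eq_0)

lemma Rcoeff_eq_0: "i > m \<Longrightarrow> Rcoeff wt m i = 0"
 by (simp add: Rcoeff_def binomial_eq_0)

lemma Rcoeff_self [simp]: "Rcoeff wt m m = 1"
 by (simp add: Rcoeff_def)

lemma Rcoeff_Suc_0: "Rcoeff wt (Suc m) 0 = Rcoeff wt m 0 * (wt + real m)"
 by (simp add: Rcoeff_def pochhammer_Suc)

text \<open>R is 2\<i> d/d\<tau> plus the weight over v. The factor \<open>wt\<close> + m + (i + 1)
  is the sum of the weight \<open>wt\<close> + 2m and of the exponent (i + 1) - m of the power of v
  being differentiated; the other term arises from differentiating \<open>D i\<close>.\<close>

lemma Rcoeff_Suc_Suc:
 "Rcoeff wt (Suc m) (Suc i) = Rcoeff wt m (Suc i) * (wt + real m + real (Suc i)) + Rcoeff wt m i"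
proof (cases "Suc i \<le> m")
 case True
 define q where "q = pochhammer (wt + real (Suc i)) (m - Suc i)"
 have mi: "m - i = Suc (m - Suc i)" using True by simp
 have 1: "pochhammer (wt + real (Suc i)) (m - i) = q * (wt + real m)"
  unfolding mi pochhammer_Suc q_def using True by (simp add: of_nat_diff)
 have 2: "pochhammer (wt + real i) (m - i) = (wt + real i) * q"
  unfolding mi pochhammer_rec q_def by (simp add: add_ac)
 have 3: "real (m choose i) * (real m - real i) = real (m choose Suc i) * real (Suc i)"
  using choose_Suc_mult[of m i] by (simp add: mult_ac)
 have "real (Suc m choose Suc i) * (wt + real m) = real (m choose Suc i) * (wt + real m + real (Suc i)) + real (m choose i) * (wt + real i)"
  using 3 by (simp add: algebra_simps)
 then have "real (Suc m choose Suc i) * (q * (wt + real m)) = real (m choose Suc i) * q * (wt + real m + real (Suc i)) + real (m choose i) * ((wt + real i) * q)"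
  by algebra
 then show ?thesis unfolding Rcoeff_def diff_Suc_Suc 1 2 q_def[symmetric] .
next
 case False
 then consider "i = m" | "i > m" by linarith
 then show ?thesis by cases (auto simp: Rcoeff_eq_0)
qed

text \<open>The source of the lowering relation: the factor m - i comes from the antiholomorphic
  derivative of v^(i-m), and the right-hand side shows that it turns R^m into a multiple of
  R^(m-1).\<close>

lemma Rcoeff_lower:
 assumes "i \<le> m"
 shows "Rcoeff wt m i * (real m - real i) = real m * (wt + real m - 1) * Rcoeff wt (m - 1) i"
proof (cases "i = m")
 case False
 then obtain l where l: "m = Suc l" "i \<le> l" using assms by (cases m) auto
 have "real (Suc l - i) * real (Suc l choose i) = real (Suc l) * real (l choose i)"
  using binomial_absorb_comp[of "Suc l" i] by (simp flip: of_nat_mult del: of_nat_Suc of_nat_diff)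
 moreover have "pochhammer (wt + real i) (Suc l - i) = pochhammer (wt + real i) (l - i) * (wt + real l)"
  using l by (simp add: Suc_diff_le pochhammer_Suc of_nat_diff)
 moreover have "real (Suc l - i) = real m - real i" using l by simp
 ultimately show ?thesis unfolding Rcoeff_def l(1) by simp algebra
qed (cases m; simp add: Rcoeff_eq_0)

text \<open>In other words R^m kills v^(-\<open>wt\<close>) for m > 0, since the i-th
  \<tau>-derivative of this power is (-1)^i \<open>pochhammer wt i\<close> v^(-\<open>wt\<close>-i)
  / (2\<i>)^i.\<close>

lemma Rcoeff_alternating_sum:
 assumes "m > 0"
 shows "(\<Sum>i\<le>m. Rcoeff wt m i * ((- 1) ^ i * pochhammer wt i)) = 0"
proof -
 have "(\<Sum>i\<le>m. Rcoeff wt m i * ((- 1) ^ i * pochhammer wt i)) = (\<Sum>i\<le>m. pochhammer wt m * ((- 1) ^ i * of_nat (m choose i)))"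
  by (rule sum.cong) (auto simp: Rcoeff_def pochhammer_product[of _ m])
 then show ?thesis using choose_alternating_sum[OF assms, where 'a = real] by (simp flip: sum_distrib_left)
qed

definition Rpow :: "real \<Rightarrow> (nat \<Rightarrow> complex \<Rightarrow> complex) \<Rightarrow> nat \<Rightarrow> complex \<Rightarrow> complex" where
 "Rpow wt D m z = (\<Sum>i\<le>m. of_real (Rcoeff wt m i * Im z powr (real i - real m)) * (2 * \<i>) ^ i * D i z)"

lemma Rpow_0 [simp]: "Im z > 0 \<Longrightarrow> Rpow wt D 0 z = D 0 z"
 by (simp add: Rpow_def)

lemma Rpow_Suc:
 assumes v: "Im z > 0"
 shows "Rpow wt D (Suc m) z =
  2 * \<i> * (\<Sum>i\<le>m. of_real (Rcoeff wt m i) * (2 * \<i>) ^ i *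
    (of_real ((real i - real m) * Im z powr (real i - real m - 1)) / (2 * \<i>) * D i z
     + of_real (Im z powr (real i - real m)) * D (Suc i) z))
  + of_real ((wt + 2 * real m) / Im z) * Rpow wt D m z"
proof -
 let ?p = "\<lambda>i. complex_of_real (Im z powr (real i - real (Suc m))) * (2 * \<i>) ^ i * D i z"
 have v1: "Im z powr (real i - real m - 1) = Im z powr (real i - real (Suc m))" for i
  by (simp add: algebra_simps)
 have v2: "Im z powr (real i - real m) / Im z = Im z powr (real i - real (Suc m))" for i
  using v by (simp add: powr_diff powr_add)
 have v3: "Im z powr (real i - real m) = Im z powr (real (Suc i) - real (Suc m))" for i by simp
 have "Rpow wt D (Suc m) z = (\<Sum>i\<le>Suc m. of_real (Rcoeff wt (Suc m) i) * ?p i)"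
  by (simp add: Rpow_def mult_ac)
 also have "\<dots> = of_real (Rcoeff wt m 0 * (wt + real m)) * ?p 0 +
   (\<Sum>i\<le>m. of_real (Rcoeff wt m (Suc i) * (wt + real m + real (Suc i)) + Rcoeff wt m i) * ?p (Suc i))"
  by (simp only: sum.atMost_Suc_shift Rcoeff_Suc_0 Rcoeff_Suc_Suc)
 also have "\<dots> = (of_real (Rcoeff wt m 0 * (wt + real m + real 0)) * ?p 0 +
   (\<Sum>i\<le>m. of_real (Rcoeff wt m (Suc i) * (wt + real m + real (Suc i))) * ?p (Suc i))) +
   (\<Sum>i\<le>m. of_real (Rcoeff wt m i) * ?p (Suc i))"
  by (simp add: sum.distrib ring_distribs)
 also have "of_real (Rcoeff wt m 0 * (wt + real m + real 0)) * ?p 0 +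
   (\<Sum>i\<le>m. of_real (Rcoeff wt m (Suc i) * (wt + real m + real (Suc i))) * ?p (Suc i)) =
   (\<Sum>i\<le>Suc m. of_real (Rcoeff wt m i * (wt + real m + real i)) * ?p i)"
  by (simp only: sum.atMost_Suc_shift)
 also have "\<dots> = (\<Sum>i\<le>m. of_real (Rcoeff wt m i * (wt + real m + real i)) * ?p i)"
  by (simp add: Rcoeff_eq_0)
 finally have L: "Rpow wt D (Suc m) z = (\<Sum>i\<le>m. of_real (Rcoeff wt m i * (wt + real m + real i)) * ?p i) +
   (\<Sum>i\<le>m. of_real (Rcoeff wt m i) * ?p (Suc i))" .
 have R1: "of_real ((wt + 2 * real m) / Im z) * Rpow wt D m z = (\<Sum>i\<le>m. of_real (Rcoeff wt m i * (wt + 2 * real m)) * ?p i)"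
  unfolding Rpow_def sum_distrib_left v2[symmetric] by (rule sum.cong) (auto simp: field_simps)
 have R2: "2 * \<i> * (\<Sum>i\<le>m. of_real (Rcoeff wt m i) * (2 * \<i>) ^ i *
    (of_real ((real i - real m) * Im z powr (real i - real m - 1)) / (2 * \<i>) * D i z
     + of_real (Im z powr (real i - real m)) * D (Suc i) z)) =
   (\<Sum>i\<le>m. of_real (Rcoeff wt m i * (real i - real m)) * ?p i) + (\<Sum>i\<le>m. of_real (Rcoeff wt m i) * ?p (Suc i))"
  unfolding sum_distrib_left sum.distrib[symmetric] v1
  by (rule sum.cong) (auto simp: field_simps)
 show ?thesis unfolding L R1 R2 by (simp add: sum.distrib[symmetric] algebra_simps)
qed

text \<open>Besides the raising relation this contains the lowering relation: differentiating the
  powers of v in the antiholomorphic direction turns R^m into m (\<open>wt\<close> + m - 1) R^(m-1),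
  up to the factor v^(-2) / (2\<i>). The remaining sum is R^m applied to the antiholomorphic
  derivatives \<open>E\<close>.\<close>

lemma has_wirtinger_Rpow:
 assumes v: "Im z > 0" and D: "\<And>i. has_wirtinger (D i) (D (Suc i) z) (E i) z"
 shows "has_wirtinger (Rpow wt D m) ((Rpow wt D (Suc m) z - of_real ((wt + 2 * real m) / Im z) * Rpow wt D m z) / (2 * \<i>))
   (of_real (real m * (wt + real m - 1) / (Im z)\<^sup>2) / (2 * \<i>) * Rpow wt D (m - 1) z
    + (\<Sum>i\<le>m. of_real (Rcoeff wt m i * Im z powr (real i - real m)) * (2 * \<i>) ^ i * E i)) z"
proof -
 let ?v = "\<lambda>s. complex_of_real (Im z powr s)"
 have tm: "has_wirtinger (\<lambda>w. of_real (Rcoeff wt m i) * (2 * \<i>) ^ i * (of_real (Im w powr (real i - real m)) * D i w))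
  (of_real (Rcoeff wt m i) * (2 * \<i>) ^ i * (of_real ((real i - real m) * Im z powr (real i - real m - 1)) / (2 * \<i>) * D i z
    + ?v (real i - real m) * D (Suc i) z))
  (of_real (Rcoeff wt m i) * (2 * \<i>) ^ i * (- of_real ((real i - real m) * Im z powr (real i - real m - 1)) / (2 * \<i>) * D i z
    + ?v (real i - real m) * E i)) z" for i
  by (intro has_wirtinger_cmult has_wirtinger_mult has_wirtinger_Im_powr v D)
 have F: "Rpow wt D m = (\<lambda>w. \<Sum>i\<le>m. of_real (Rcoeff wt m i) * (2 * \<i>) ^ i * (of_real (Im w powr (real i - real m)) * D i w))"
  by (simp add: Rpow_def fun_eq_iff mult_ac)
 have a: "(\<Sum>i\<le>m. of_real (Rcoeff wt m i) * (2 * \<i>) ^ i * (of_real ((real i - real m) * Im z powr (real i - real m - 1)) / (2 * \<i>) * D i z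
    + ?v (real i - real m) * D (Suc i) z)) = (Rpow wt D (Suc m) z - of_real ((wt + 2 * real m) / Im z) * Rpow wt D m z) / (2 * \<i>)"
  unfolding Rpow_Suc[OF v] by simp
 have b1: "(\<Sum>i\<le>m. of_real (Rcoeff wt m i) * (2 * \<i>) ^ i * (- of_real ((real i - real m) * Im z powr (real i - real m - 1)) / (2 * \<i>) * D i z))
   = of_real (real m * (wt + real m - 1) / (Im z)\<^sup>2) / (2 * \<i>) * Rpow wt D (m - 1) z"
 proof (cases m)
  case (Suc l)
  have "(\<Sum>i\<le>m. of_real (Rcoeff wt m i) * (2 * \<i>) ^ i * (- of_real ((real i - real m) * Im z powr (real i - real m - 1)) / (2 * \<i>) * D i z))
   = (\<Sum>i\<le>m. of_real (Rcoeff wt m i * (real m - real i)) * of_real (Im z powr (real i - real m - 1)) / (2 * \<i>) * (2 * \<i>) ^ i * D i z)"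
   by (rule sum.cong) (auto simp: field_simps)
  also have "\<dots> = (\<Sum>i\<le>m. of_real (real m * (wt + real m - 1) * Rcoeff wt (m - 1) i) * of_real (Im z powr (real i - real m - 1)) / (2 * \<i>) * (2 * \<i>) ^ i * D i z)"
   by (rule sum.cong) (auto simp: Rcoeff_lower)
  also have "\<dots> = (\<Sum>i\<le>l. of_real (real m * (wt + real m - 1) * Rcoeff wt (m - 1) i) * of_real (Im z powr (real i - real m - 1)) / (2 * \<i>) * (2 * \<i>) ^ i * D i z)"
   unfolding Suc by (simp add: Rcoeff_eq_0)
  also have "\<dots> = of_real (real m * (wt + real m - 1) / (Im z)\<^sup>2) / (2 * \<i>) * Rpow wt D (m - 1) z"
   unfolding Rpow_def sum_distrib_left
  proof (rule sum.cong)
   fix i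
   have "Im z powr (real i - real m - 1) = Im z powr (real i - real (m - 1)) * Im z powr (- 2)"
    unfolding powr_add[symmetric] Suc by simp
   also have "Im z powr (- 2) = 1 / (Im z)\<^sup>2" using v by (simp add: powr_minus divide_inverse)
   finally have *: "Im z powr (real i - real m - 1) = Im z powr (real i - real (m - 1)) * (1 / (Im z)\<^sup>2)" .
   show "of_real (real m * (wt + real m - 1) * Rcoeff wt (m - 1) i) * of_real (Im z powr (real i - real m - 1)) / (2 * \<i>) * (2 * \<i>) ^ i * D i z =
    of_real (real m * (wt + real m - 1) / (Im z)\<^sup>2) / (2 * \<i>) * (of_real (Rcoeff wt (m - 1) i * Im z powr (real i - real (m - 1))) * (2 * \<i>) ^ i * D i z)"
    unfolding * by simp
  qed (simp add: Suc)
  finally show ?thesis .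
 qed simp
 have "has_wirtinger (Rpow wt D m)
  (\<Sum>i\<le>m. of_real (Rcoeff wt m i) * (2 * \<i>) ^ i * (of_real ((real i - real m) * Im z powr (real i - real m - 1)) / (2 * \<i>) * D i z
    + ?v (real i - real m) * D (Suc i) z))
  (\<Sum>i\<le>m. of_real (Rcoeff wt m i) * (2 * \<i>) ^ i * (- of_real ((real i - real m) * Im z powr (real i - real m - 1)) / (2 * \<i>) * D i z
    + ?v (real i - real m) * E i)) z"
  unfolding F by (intro has_wirtinger_sum tm)
 moreover have "(\<Sum>i\<le>m. of_real (Rcoeff wt m i) * (2 * \<i>) ^ i * (- of_real ((real i - real m) * Im z powr (real i - real m - 1)) / (2 * \<i>) * D i z
    + ?v (real i - real m) * E i)) = of_real (real m * (wt + real m - 1) / (Im z)\<^sup>2) / (2 * \<i>) * Rpow wt D (m - 1) z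
    + (\<Sum>i\<le>m. of_real (Rcoeff wt m i * Im z powr (real i - real m)) * (2 * \<i>) ^ i * E i)"
  unfolding b1[symmetric] sum.distrib[symmetric] by (rule sum.cong) (auto simp: ring_distribs)
 ultimately show ?thesis unfolding a by simp
qed

lemma raise_Rpow:
 assumes "Im z > 0" "\<And>i. has_wirtinger (D i) (D (Suc i) z) (E i) z"
 shows "raise (wt + 2 * real m) (Rpow wt D m) z = Rpow wt D (Suc m) z"
 using has_wirtinger_d(3)[OF has_wirtinger_Rpow[where D = D and E = E, OF assms]] by (simp add: raise_def)

lemma raise_cong:
 assumes "z \<in> uhp" "has_wirtinger G a b z" "\<And>w. w \<in> uhp \<Longrightarrow> F w = G w"
 shows "raise wt F z = raise wt G z"
proof -
 have "has_wirtinger F a b z"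
  by (rule has_wirtinger_cong[OF assms(2) open_uhp assms(1)]) (simp add: assms(3))
 then show ?thesis
  using has_wirtinger_d(3) assms by (simp add: raise_def)
qed

lemma raise_iter_Rpow:
 assumes D: "\<And>i z. z \<in> uhp \<Longrightarrow> has_wirtinger (D i) (D (Suc i) z) (E i z) z"
  and F: "\<And>z. z \<in> uhp \<Longrightarrow> F z = D 0 z" and z: "z \<in> uhp"
 shows "raise_iter m wt F z = Rpow wt D m z"
 using z
proof (induction m arbitrary: z)
 case (Suc m)
 have v: "Im z > 0" using Suc.prems by (simp add: uhp_def)
 have "raise (wt + 2 * real m) (raise_iter m wt F) z = raise (wt + 2 * real m) (Rpow wt D m) z"
  by (rule raise_cong[OF Suc.prems has_wirtinger_Rpow[where D = D and E = "\<lambda>i. E i z", OF v D[OF Suc.prems]]]) (rule Suc.IH)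
 then show ?case using raise_Rpow[where D = D and E = "\<lambda>i. E i z", OF v D[OF Suc.prems]] by simp
qed (use F in \<open>simp add: uhp_def\<close>)

lemma continuous_on_Rpow:
 assumes "\<And>i. continuous_on uhp (D i)"
 shows "continuous_on uhp (Rpow wt D m)"
 unfolding Rpow_def by (intro continuous_intros assms) (auto simp: uhp_def)

text \<open>The solution with value 1 at j = 0 of the recursion \<open>acoeff_Suc\<close>, which is
  the condition for the lowering terms of consecutive summands of \<open>primitive_form\<close> to
  cancel.\<close>

definition acoeff :: "nat \<Rightarrow> real \<Rightarrow> nat \<Rightarrow> real" where
 "acoeff n wt j = real (n choose j) * pochhammer (real n + wt) j / pochhammer wt j"

lemma acoeff_0 [simp]: "acoeff n wt 0 = 1"
 by (simp add: acoeff_def)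

lemma acoeff_Suc:
 assumes "wt > 0"
 shows "acoeff n wt (Suc j) * (real (Suc j) * (wt + real j)) = acoeff n wt j * ((real n - real j) * (real n + wt + real j))"
proof -
 have p: "pochhammer wt j > 0" "wt + real j > 0" using assms by (auto intro: pochhammer_pos)
 have "acoeff n wt (Suc j) * (real (Suc j) * (wt + real j)) =
  (real (Suc j) * real (n choose Suc j)) * pochhammer (real n + wt) j * (real n + wt + real j) / pochhammer wt j"
 proof -
  have gen: "A * (q * s) / (p * c) * (k * c) = (k * A) * q * s / p" if "c \<noteq> 0" for A q s p c k :: real
   using that by simp
  show ?thesis
   unfolding acoeff_def pochhammer_Suc by (rule gen) (use p in simp)
 qed
 also have "\<dots> = acoeff n wt j * ((real n - real j) * (real n + wt + real j))"
  unfolding choose_Suc_mult[symmetric] acoeff_def by simp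
 finally show ?thesis .
qed

text \<open>A primitive for \<open>\<partial>/\<partial>\<tau>\<bar>\<close>: the lowering operator sends \<open>R\<^sup>m f\<close> and \<open>R\<^sup>j G\<close> to multiples of
  \<open>R\<^bsup>m-1\<^esup> f\<close> and \<open>R\<^bsup>j-1\<^esup> G\<close>, and the coefficients are chosen such that everything
  telescopes except for the term containing \<open>\<partial>G/\<partial>\<tau>\<bar>\<close>.\<close>

definition primitive_form ::
  "nat \<Rightarrow> real \<Rightarrow> (nat \<Rightarrow> complex \<Rightarrow> complex) \<Rightarrow> (nat \<Rightarrow> complex \<Rightarrow> complex) \<Rightarrow> (complex \<Rightarrow> complex) \<Rightarrow> complex \<Rightarrow> complex" where
 "primitive_form n wt f G \<theta> z =
   (\<Sum>j\<le>n. of_real (acoeff n wt j) * (Rpow (1 - 2 * real n - wt) f (n - j) z * Rpow wt G j z * \<theta> z))"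

text \<open>If \<xi> G = \<theta>, then the antiholomorphic derivative of G is \<i>/2
  v^(-\<open>wt\<close>) cnj \<theta>. This is its i-th \<tau>-derivative, in which only the power
  of v is differentiated because cnj \<theta> is antiholomorphic.\<close>

definition shadow_deriv :: "real \<Rightarrow> (complex \<Rightarrow> complex) \<Rightarrow> nat \<Rightarrow> complex \<Rightarrow> complex" where
 "shadow_deriv wt \<theta> i z = \<i> / 2 * cnj (\<theta> z) * of_real ((- 1) ^ i * pochhammer wt i * Im z powr (- wt - real i)) / (2 * \<i>) ^ i"

lemma shadow_deriv_sum:
 assumes v: "Im z > 0"
 shows "(\<Sum>i\<le>m. of_real (Rcoeff wt m i * Im z powr (real i - real m)) * (2 * \<i>) ^ i * shadow_deriv wt \<theta> i z)
   = (if m = 0 then \<i> / 2 * cnj (\<theta> z) * of_real (Im z powr (- wt)) else 0)"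
proof -
 have "(\<Sum>i\<le>m. of_real (Rcoeff wt m i * Im z powr (real i - real m)) * (2 * \<i>) ^ i * shadow_deriv wt \<theta> i z)
  = (\<Sum>i\<le>m. \<i> / 2 * cnj (\<theta> z) * of_real (Im z powr (- wt - real m)) * of_real (Rcoeff wt m i * ((- 1) ^ i * pochhammer wt i)))"
 proof (rule sum.cong)
  fix i
  have "Im z powr (- wt - real m) = Im z powr (real i - real m) * Im z powr (- wt - real i)"
   by (subst powr_add[symmetric]) (simp add: algebra_simps)
  then show "of_real (Rcoeff wt m i * Im z powr (real i - real m)) * (2 * \<i>) ^ i * shadow_deriv wt \<theta> i z =
    \<i> / 2 * cnj (\<theta> z) * of_real (Im z powr (- wt - real m)) * of_real (Rcoeff wt m i * ((- 1) ^ i * pochhammer wt i))"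
   by (simp add: shadow_deriv_def)
 qed simp
 also have "\<dots> = \<i> / 2 * cnj (\<theta> z) * of_real (Im z powr (- wt - real m)) * of_real (\<Sum>i\<le>m. Rcoeff wt m i * ((- 1) ^ i * pochhammer wt i))"
  by (simp only: sum_distrib_left of_real_sum)
 also have "\<dots> = (if m = 0 then \<i> / 2 * cnj (\<theta> z) * of_real (Im z powr (- wt)) else 0)"
  using Rcoeff_alternating_sum[of m wt] by (cases "m = 0") simp_all
 finally show ?thesis .
qed

lemma primitive_form_wirtinger:
 assumes f: "\<And>i z. z \<in> uhp \<Longrightarrow> has_wirtinger (f i) (f (Suc i) z) 0 z"
  and G: "\<And>i z. z \<in> uhp \<Longrightarrow> has_wirtinger (G i) (G (Suc i) z) (shadow_deriv wt \<theta>P i z) z"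
  and \<theta>: "\<theta> holomorphic_on uhp" and wt: "wt > 0"
 shows "\<exists>a. continuous_on uhp a \<and> (\<forall>z\<in>uhp. has_wirtinger (primitive_form n wt f G \<theta>) (a z)
   (\<i> / 2 * of_real (Im z powr (- wt)) * Rpow (1 - 2 * real n - wt) f n z * cnj (\<theta>P z) * \<theta> z) z)"
proof -
 define lam where "lam = 1 - 2 * real n - wt"
 let ?Rf = "Rpow lam f" and ?RG = "Rpow wt G"
 define af where "af m z = (?Rf (Suc m) z - of_real ((lam + 2 * real m) / Im z) * ?Rf m z) / (2 * \<i>)" for m z
 define aG where "aG m z = (?RG (Suc m) z - of_real ((wt + 2 * real m) / Im z) * ?RG m z) / (2 * \<i>)" for m z
 define bf where "bf m z = of_real (real m * (lam + real m - 1) / (Im z)\<^sup>2) / (2 * \<i>) * ?Rf (m - 1) z" for m z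
 define bG where "bG m z = of_real (real m * (wt + real m - 1) / (Im z)\<^sup>2) / (2 * \<i>) * ?RG (m - 1) z
   + (if m = 0 then \<i> / 2 * cnj (\<theta>P z) * of_real (Im z powr (- wt)) else 0)" for m z
 have cf: "continuous_on uhp (f i)" and cG: "continuous_on uhp (G i)" for i
  by (rule wirtinger_continuous_on[OF f] wirtinger_continuous_on[OF G]; assumption)+
 have c\<theta>: "continuous_on uhp \<theta>" "continuous_on uhp (deriv \<theta>)"
  using \<theta> open_uhp by (auto intro!: holomorphic_on_imp_continuous_on holomorphic_deriv)
 define a where "a z = (\<Sum>j\<le>n. of_real (acoeff n wt j) * ((af (n - j) z * ?RG j z + ?Rf (n - j) z * aG j z) * \<theta> z
   + (?Rf (n - j) z * ?RG j z) * deriv \<theta> z))" for z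
 have "continuous_on uhp a"
  unfolding a_def af_def aG_def
  by (intro continuous_intros continuous_on_Rpow cf cG c\<theta>) (auto simp: uhp_def)
 moreover have "has_wirtinger (primitive_form n wt f G \<theta>) (a z)
   (\<i> / 2 * of_real (Im z powr (- wt)) * ?Rf n z * cnj (\<theta>P z) * \<theta> z) z" if z: "z \<in> uhp" for z
 proof -
  have v: "Im z > 0" using z by (simp add: uhp_def)
  have wf: "has_wirtinger (?Rf m) (af m z) (bf m z) z" for m
   using has_wirtinger_Rpow[where D = f and E = "\<lambda>i. 0", OF v f[OF z], of lam m] by (simp add: af_def bf_def)
  have wG: "has_wirtinger (?RG m) (aG m z) (bG m z) z" for m
   using has_wirtinger_Rpow[where D = G and E = "\<lambda>i. shadow_deriv wt \<theta>P i z", OF v G[OF z], of wt m] by (simp only: aG_def bG_def shadow_deriv_sum[OF v])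
  have w\<theta>: "has_wirtinger \<theta> (deriv \<theta> z) 0 z"
   using \<theta> open_uhp z by (intro has_wirtinger_holomorphic holomorphic_derivI)
  have W: "has_wirtinger (\<lambda>z. \<Sum>j\<le>n. of_real (acoeff n wt j) * (?Rf (n - j) z * ?RG j z * \<theta> z)) (a z)
   (\<Sum>j\<le>n. of_real (acoeff n wt j) * ((bf (n - j) z * ?RG j z + ?Rf (n - j) z * bG j z) * \<theta> z
   + (?Rf (n - j) z * ?RG j z) * 0)) z"
   unfolding a_def by (intro has_wirtinger_sum has_wirtinger_cmult has_wirtinger_mult wf wG w\<theta>)
  define t where "t j = of_real (acoeff n wt j) * bf (n - j) z * ?RG j z * \<theta> z" for j
  have tn: "t n = 0" by (simp add: t_def bf_def)
  \<comment> \<open>Lowering R^(j+1) G in summand j + 1 cancels lowering R^(n-j) f in summand j: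
    with \<open>lam\<close> = 1 - 2n - \<open>wt\<close> the factor (n - j)(\<open>lam\<close> + n -
    j - 1) is -(n - j)(n + \<open>wt\<close> + j), the negative of the factor in
    \<open>acoeff_Suc\<close>.\<close>
  have tele: "of_real (acoeff n wt (Suc j)) * (?Rf (n - Suc j) z * bG (Suc j) z) * \<theta> z = - t j" if "j < n" for j
  proof -
   have "acoeff n wt (Suc j) * (real (Suc j) * (wt + real (Suc j) - 1) / (Im z)\<^sup>2) =
    - (acoeff n wt j * (real (n - j) * (lam + real (n - j) - 1) / (Im z)\<^sup>2))"
    using acoeff_Suc[OF wt, of n j] that by (simp add: lam_def of_nat_diff algebra_simps minus_divide_left flip: add_divide_distrib diff_divide_distrib)
   then have *: "complex_of_real (acoeff n wt (Suc j)) * of_real (real (Suc j) * (wt + real (Suc j) - 1) / (Im z)\<^sup>2) =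
    - (of_real (acoeff n wt j) * of_real (real (n - j) * (lam + real (n - j) - 1) / (Im z)\<^sup>2))"
    by (simp only: of_real_mult[symmetric] of_real_minus[symmetric])
   have "of_real (acoeff n wt (Suc j)) * (?Rf (n - Suc j) z * bG (Suc j) z) * \<theta> z =
     (of_real (acoeff n wt (Suc j)) * of_real (real (Suc j) * (wt + real (Suc j) - 1) / (Im z)\<^sup>2)) * (?Rf (n - Suc j) z * ?RG j z * \<theta> z / (2 * \<i>))"
    by (simp add: bG_def)
   also have "\<dots> = - t j" unfolding * t_def bf_def by simp
   finally show ?thesis .
  qed
  have "(\<Sum>j\<le>n. of_real (acoeff n wt j) * ((bf (n - j) z * ?RG j z + ?Rf (n - j) z * bG j z) * \<theta> z
   + (?Rf (n - j) z * ?RG j z) * 0)) = (\<Sum>j\<le>n. t j) + (\<Sum>j\<le>n. of_real (acoeff n wt j) * (?Rf (n - j) z * bG j z) * \<theta> z)"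
   unfolding sum.distrib[symmetric] by (rule sum.cong) (auto simp: t_def algebra_simps)
  also have "(\<Sum>j\<le>n. of_real (acoeff n wt j) * (?Rf (n - j) z * bG j z) * \<theta> z) =
   ?Rf n z * bG 0 z * \<theta> z + (\<Sum>j<n. of_real (acoeff n wt (Suc j)) * (?Rf (n - Suc j) z * bG (Suc j) z) * \<theta> z)"
   by (simp add: sum.atMost_shift)
  also have "(\<Sum>j<n. of_real (acoeff n wt (Suc j)) * (?Rf (n - Suc j) z * bG (Suc j) z) * \<theta> z) = (\<Sum>j<n. - t j)"
   by (rule sum.cong) (auto simp: tele)
  also have "(\<Sum>j\<le>n. t j) = (\<Sum>j<n. t j)"
   using tn by (simp add: lessThan_Suc_atMost[symmetric])
  finally have b: "(\<Sum>j\<le>n. of_real (acoeff n wt j) * ((bf (n - j) z * ?RG j z + ?Rf (n - j) z * bG j z) * \<theta> z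
   + (?Rf (n - j) z * ?RG j z) * 0)) = \<i> / 2 * of_real (Im z powr (- wt)) * ?Rf n z * cnj (\<theta>P z) * \<theta> z"
   by (simp add: sum_negf bG_def)
  show ?thesis using W unfolding b
   by (simp add: primitive_form_def[abs_def] lam_def)
 qed
 ultimately show ?thesis unfolding lam_def by blast
qed

section \<open>Integration by parts and the limit of the primitive\<close>

definition mean :: "(complex \<Rightarrow> complex) \<Rightarrow> real \<Rightarrow> complex" where
 "mean h v = integral {-1/2..1/2} (\<lambda>u. h (Complex u v))"

lemma mean_cong: "v > 0 \<Longrightarrow> (\<And>z. z \<in> uhp \<Longrightarrow> f z = g z) \<Longrightarrow> mean f v = mean g v"
 unfolding mean_def by (rule Henstock_Kurzweil_Integration.integral_cong) simp

lemma integrable_horizontal: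
 fixes h :: "complex \<Rightarrow> complex"
 shows "continuous_on uhp h \<Longrightarrow> v > 0 \<Longrightarrow> (\<lambda>u. h (Complex u v)) integrable_on {-1/2..1/2}"
 by (intro integrable_continuous_interval continuous_on_horizontal)

lemma mean_add:
 "continuous_on uhp f \<Longrightarrow> continuous_on uhp g \<Longrightarrow> v > 0 \<Longrightarrow> mean (\<lambda>z. f z + g z) v = mean f v + mean g v"
 unfolding mean_def by (intro Henstock_Kurzweil_Integration.integral_add integrable_horizontal)

lemma mean_cmult: "mean (\<lambda>z. c * f z) v = c * mean f v"
 unfolding mean_def by simp

lemma mean_sum:
 "finite I \<Longrightarrow> (\<And>i. i \<in> I \<Longrightarrow> continuous_on uhp (f i)) \<Longrightarrow> v > 0 \<Longrightarrow>
  mean (\<lambda>z. \<Sum>i\<in>I. f i z) v = (\<Sum>i\<in>I. mean (f i) v)"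
 unfolding mean_def by (intro Henstock_Kurzweil_Integration.integral_sum integrable_horizontal)

lemma mean_const: "h holomorphic_on uhp \<Longrightarrow> (\<And>z. z \<in> uhp \<Longrightarrow> h (z + 1) = h z) \<Longrightarrow> v > 0 \<Longrightarrow> w > 0 \<Longrightarrow> mean h v = mean h w"
 unfolding mean_def by (rule periodic_mean_const)

definition quasi_periodic :: "complex \<Rightarrow> (complex \<Rightarrow> complex) \<Rightarrow> bool" where
 "quasi_periodic c h \<longleftrightarrow> (\<forall>z\<in>uhp. h (z + 1) = c * h z)"

lemma quasi_periodicD: "quasi_periodic c h \<Longrightarrow> z \<in> uhp \<Longrightarrow> h (z + 1) = c * h z"
 by (simp add: quasi_periodic_def)

lemma quasi_periodic_mult: "quasi_periodic c f \<Longrightarrow> quasi_periodic d g \<Longrightarrow> quasi_periodic (c * d) (\<lambda>z. f z * g z)"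
 by (simp add: quasi_periodic_def)

lemma quasi_periodic_deriv:
 assumes "quasi_periodic c h" "h holomorphic_on uhp"
 shows "quasi_periodic c (deriv h)"
 unfolding quasi_periodic_def
proof
 fix z assume z: "z \<in> uhp"
 have D: "(h has_field_derivative deriv h w) (at w)" if "w \<in> uhp" for w
  using assms(2) open_uhp that by (rule holomorphic_derivI)
 have "((\<lambda>w. h (w + 1)) has_field_derivative deriv h (z + 1) * 1) (at z)"
  by (rule DERIV_chain2[OF D]) (use z in \<open>auto intro!: derivative_eq_intros\<close>)
 moreover have "((\<lambda>w. h (w + 1)) has_field_derivative c * deriv h z) (at z)"
  by (rule has_field_derivative_transform_within_open[where f = "\<lambda>w. c * h w" and S = uhp])
    (use z open_uhp assms(1) D in \<open>auto intro!: derivative_eq_intros simp: quasi_periodic_def\<close>)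
 ultimately show "deriv h (z + 1) = c * deriv h z"
  using DERIV_unique by fastforce
qed

lemma holomorphic_higher_deriv_uhp: "h holomorphic_on uhp \<Longrightarrow> (deriv ^^ s) h holomorphic_on uhp"
 using open_uhp holomorphic_higher_deriv by blast

lemma quasi_periodic_higher_deriv:
 "quasi_periodic c h \<Longrightarrow> h holomorphic_on uhp \<Longrightarrow> quasi_periodic c ((deriv ^^ s) h)"
 by (induction s) (auto intro: quasi_periodic_deriv holomorphic_higher_deriv_uhp)

lemma moderate_growth_higher_deriv:
 "moderate_growth h \<Longrightarrow> h holomorphic_on uhp \<Longrightarrow> moderate_growth ((deriv ^^ s) h)"
 by (induction s) (auto intro: moderate_growth_deriv holomorphic_higher_deriv_uhp)

lemma higher_deriv_field_derivative:
 "h holomorphic_on uhp \<Longrightarrow> z \<in> uhp \<Longrightarrow> ((deriv ^^ s) h has_field_derivative (deriv ^^ Suc s) h z) (at z)"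
 using holomorphic_derivI[OF holomorphic_higher_deriv_uhp open_uhp] by simp

lemma mean_deriv_eq_0:
 assumes h: "h holomorphic_on uhp" and per: "quasi_periodic 1 h" and v: "v > 0"
 shows "mean (deriv h) v = 0"
proof -
 have "((\<lambda>u. deriv h (Complex u v)) has_integral (h (Complex (1/2) v) - h (Complex (-1/2) v))) {-1/2..1/2}"
 proof (rule fundamental_theorem_of_calculus)
  fix x :: real
  have "((\<lambda>x. h (Complex x v)) has_vector_derivative
   (of_real 1 * (deriv h (Complex x v) + 0) + of_real 0 * (\<i> * (deriv h (Complex x v) - 0)))) (at x)"
   by (rule wirtinger_strip_path[where b = "\<lambda>_. 0"])
     (use v h open_uhp in \<open>auto intro!: derivative_eq_intros has_wirtinger_holomorphic holomorphic_derivI\<close>)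
  then show "((\<lambda>x. h (Complex x v)) has_vector_derivative deriv h (Complex x v)) (at x within {-1/2..1/2})"
   by (auto intro: has_vector_derivative_at_within)
 qed auto
 moreover have "h (Complex (1/2) v) = h (Complex (-1/2) v)"
  unfolding Complex_shift using v quasi_periodicD[OF per] by simp
 ultimately show ?thesis by (simp add: mean_def integral_unique)
qed

text \<open>Since c d = 1, products of X and Y and of their derivatives are periodic, and the
  derivative of a periodic function has mean 0.\<close>

lemma mean_ibp:
 assumes X: "X holomorphic_on uhp" "quasi_periodic c X" and Y: "Y holomorphic_on uhp" "quasi_periodic d Y"
  and cd: "c * d = 1" and v: "v > 0"
 shows "mean (\<lambda>z. X z * (deriv ^^ s) Y z) v = (- 1) ^ s * mean (\<lambda>z. (deriv ^^ s) X z * Y z) v"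
 using X
proof (induction s arbitrary: X)
 case (Suc s)
 let ?h = "\<lambda>z. X z * (deriv ^^ s) Y z"
 have hol: "(deriv ^^ s) Y holomorphic_on uhp" "(deriv ^^ Suc s) Y holomorphic_on uhp" "deriv X holomorphic_on uhp"
  using holomorphic_higher_deriv_uhp[OF Y(1)] Suc.prems open_uhp by (auto intro: holomorphic_deriv simp del: funpow.simps)
 have "0 = mean (deriv ?h) v"
  by (rule mean_deriv_eq_0[symmetric])
    (use Suc.prems hol v quasi_periodic_mult[OF Suc.prems(2) quasi_periodic_higher_deriv[OF Y(2,1)]] cd in \<open>auto intro!: holomorphic_intros\<close>)
 also have "\<dots> = mean (\<lambda>z. X z * (deriv ^^ Suc s) Y z + deriv X z * (deriv ^^ s) Y z) v"
 proof (rule mean_cong[OF v])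
  fix z assume z: "z \<in> uhp"
  show "deriv ?h z = X z * (deriv ^^ Suc s) Y z + deriv X z * (deriv ^^ s) Y z"
   by (rule DERIV_imp_deriv)
     (use DERIV_mult[OF holomorphic_derivI[OF Suc.prems(1) open_uhp z] higher_deriv_field_derivative[OF Y(1) z]] in \<open>simp add: algebra_simps\<close>)
 qed
 also have "\<dots> = mean (\<lambda>z. X z * (deriv ^^ Suc s) Y z) v + mean (\<lambda>z. deriv X z * (deriv ^^ s) Y z) v"
  by (intro mean_add holomorphic_on_imp_continuous_on holomorphic_on_mult Suc.prems hol v)
 also have "mean (\<lambda>z. deriv X z * (deriv ^^ s) Y z) v = (- 1) ^ s * mean (\<lambda>z. (deriv ^^ s) (deriv X) z * Y z) v"
  by (rule Suc.IH) (use hol quasi_periodic_deriv Suc.prems in auto)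
 finally show ?case by (simp add: funpow_swap1 eq_neg_iff_add_eq_0 add.commute)
qed simp

text \<open>The second weight is 1, that of the theta series of the binary lattice N^-. A product of
  two binomial coefficients is the form to which the summation formulas in
  \<open>bracket_identity\<close> apply.\<close>

lemma bracket_coeff:
 fixes wt :: real
 assumes wt: "wt > 0" and rs: "r + s = n"
 shows "Gamma (wt + real n) * Gamma (1 + real n) / (Gamma (real s + 1) * Gamma (wt + real n - real s) * Gamma (real r + 1) * Gamma (1 + real n - real r))
  = real (n choose s) * ((wt + real n - 1) gchoose s)"
proof -
 have e: "wt + real n - real s = wt + real r" "1 + real n - real r = 1 + real s" using rs by auto
 have nz: "wt + real r \<notin> \<int>\<^sub>\<le>\<^sub>0" using wt by (auto elim!: nonpos_Ints_cases)
 have "Gamma (wt + real n) = pochhammer (wt + real r) s * Gamma (wt + real r)"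
  using pochhammer_Gamma[OF nz, of s] rs Gamma_eq_zero_iff[of "wt + real r"] nz by (auto simp: field_simps)
 moreover have "(wt + real n - 1) gchoose s = pochhammer (wt + real r) s / fact s"
 proof -
  have "wt + real n - 1 - real s + 1 = wt + real r" using rs by auto
  then show ?thesis by (simp only: gbinomial_pochhammer')
 qed
 moreover have "real (n choose s) = fact n / (fact s * fact r)"
  using binomial_fact[of s n, where 'a = real] rs by auto
 ultimately show ?thesis
  unfolding e using Gamma_eq_zero_iff[of "wt + real r"] nz
  by (simp add: Gamma_fact[symmetric] add.commute field_simps)
qed

text \<open>Trinomial revision pulls out a factor depending on i alone, and the remaining sum over s
  is a Vandermonde convolution. The prefactor n! / \<open>pochhammer wt n\<close> compares the
  normalization of the bracket with that of \<open>acoeff\<close>, which starts with 1; it becomes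
  the quotient of Gamma values in the theorem.\<close>

lemma bracket_identity:
 fixes wt :: real
 assumes wt: "wt > 0" and i: "i \<le> n"
 shows "fact n / pochhammer wt n * (\<Sum>s=i..n. real (n choose s) * ((wt + real n - 1) gchoose s) * real (s choose i)) = acoeff n wt (n - i)"
proof -
 define x where "x = wt + real n - 1"
 have pos: "pochhammer wt j > 0" for j using wt by (rule pochhammer_pos)
 have "(\<Sum>s=i..n. real (n choose s) * (x gchoose s) * real (s choose i)) =
   (\<Sum>s=i..n. (x gchoose i) * (real (n choose (n - s)) * ((x - real i) gchoose (s - i))))"
 proof (rule sum.cong)
  fix s assume s: "s \<in> {i..n}"
  have "(x gchoose s) * real (s choose i) = (x gchoose i) * ((x - real i) gchoose (s - i))"
   using gbinomial_trinomial_revision[of i s x] s by (simp add: binomial_gbinomial)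
  moreover have "n choose s = n choose (n - s)" using s by (intro binomial_symmetric) auto
  ultimately show "real (n choose s) * (x gchoose s) * real (s choose i) = (x gchoose i) * (real (n choose (n - s)) * ((x - real i) gchoose (s - i)))"
   by (simp add: mult_ac)
 qed simp
 also have "\<dots> = (x gchoose i) * (\<Sum>k\<le>n - i. ((x - real i) gchoose k) * (real n gchoose (n - i - k)))"
  unfolding sum_distrib_left
  by (rule sum.reindex_bij_witness[of _ "\<lambda>k. k + i" "\<lambda>s. s - i"]) (use i in \<open>auto simp: binomial_gbinomial\<close>)
 also have "(\<Sum>k\<le>n - i. ((x - real i) gchoose k) * (real n gchoose (n - i - k))) = ((x - real i + real n) gchoose (n - i))"
  using gbinomial_Vandermonde[of "x - real i" "real n" "n - i"] by (simp only: atLeast0AtMost)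
 finally have S: "(\<Sum>s=i..n. real (n choose s) * (x gchoose s) * real (s choose i)) = (x gchoose i) * ((x - real i + real n) gchoose (n - i))" .
 have 1: "x gchoose i = pochhammer (wt + real (n - i)) i / fact i"
  using i by (simp add: gbinomial_pochhammer' x_def of_nat_diff algebra_simps)
 have 2: "(x - real i + real n) gchoose (n - i) = pochhammer (real n + wt) (n - i) / fact (n - i)"
  using i by (simp add: gbinomial_pochhammer' x_def of_nat_diff algebra_simps)
 have 3: "pochhammer wt n = pochhammer wt (n - i) * pochhammer (wt + real (n - i)) i"
  using pochhammer_product[of "n - i" n wt] i by simp
 have 4: "real (n choose (n - i)) = fact n / (fact (n - i) * fact i)"
  using binomial_fact[of "n - i" n, where 'a = real] i by simp
 have "pochhammer (wt + real (n - i)) i > 0" using wt by (intro pochhammer_pos) auto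
 then show ?thesis
  unfolding x_def[symmetric] S 1 2 3 acoeff_def 4 using pos[of "n - i"] by (simp add: field_simps)
qed

text \<open>Integration by parts moves all derivatives away from \<open>\<theta>\<close>.\<close>

lemma bracket_mean:
 assumes f: "f holomorphic_on uhp" "quasi_periodic cf f" and G: "G holomorphic_on uhp" "quasi_periodic cG G"
  and \<theta>: "\<theta> holomorphic_on uhp" "quasi_periodic c\<theta> \<theta>" and c: "cf * cG * c\<theta> = 1" and wt: "wt > 0" and v: "v > 0"
 shows "of_real ((4 * pi) ^ n * fact n / pochhammer wt n) *
   mean (\<lambda>z. f z * (1 / (2 * of_real pi * \<i>) ^ n * (\<Sum>(r, s)\<in>{(r, s). r + s = n}.
    (- 1) ^ r * of_real (Gamma (wt + real n) * Gamma (1 + real n) / (Gamma (real s + 1) * Gamma (wt + real n - real s) * Gamma (real r + 1) * Gamma (1 + real n - real r)))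
     * ((deriv ^^ r) G z * (deriv ^^ s) \<theta> z)))) v
   = (\<Sum>j\<le>n. of_real (acoeff n wt j) * (2 * \<i>) ^ n * mean (\<lambda>z. (deriv ^^ (n - j)) f z * (deriv ^^ j) G z * \<theta> z) v)"
proof -
 define b where "b s = real (n choose s) * ((wt + real n - 1) gchoose s)" for s
 define M where "M i = mean (\<lambda>z. (deriv ^^ i) f z * (deriv ^^ (n - i)) G z * \<theta> z) v" for i
 note hol = holomorphic_higher_deriv_uhp[OF f(1)] holomorphic_higher_deriv_uhp[OF G(1)] holomorphic_higher_deriv_uhp[OF \<theta>(1)]
 note cont = hol[THEN holomorphic_on_imp_continuous_on] f(1)[THEN holomorphic_on_imp_continuous_on] \<theta>(1)[THEN holomorphic_on_imp_continuous_on]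
 have parts: "mean (\<lambda>z. f z * ((deriv ^^ (n - s)) G z * (deriv ^^ s) \<theta> z)) v = (- 1) ^ s * (\<Sum>i\<le>s. of_nat (s choose i) * M i)" if s: "s \<le> n" for s
 proof -
  have "mean (\<lambda>z. f z * ((deriv ^^ (n - s)) G z * (deriv ^^ s) \<theta> z)) v =
    mean (\<lambda>z. (f z * (deriv ^^ (n - s)) G z) * (deriv ^^ s) \<theta> z) v" by (simp add: mult.assoc)
  also have "\<dots> = (- 1) ^ s * mean (\<lambda>z. (deriv ^^ s) (\<lambda>z. f z * (deriv ^^ (n - s)) G z) z * \<theta> z) v"
   by (rule mean_ibp[OF _ quasi_periodic_mult[OF f(2) quasi_periodic_higher_deriv[OF G(2,1)]] \<theta> c v])
     (intro holomorphic_intros f hol)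
  also have "mean (\<lambda>z. (deriv ^^ s) (\<lambda>z. f z * (deriv ^^ (n - s)) G z) z * \<theta> z) v =
    mean (\<lambda>z. \<Sum>i\<le>s. of_nat (s choose i) * ((deriv ^^ i) f z * (deriv ^^ (n - i)) G z * \<theta> z)) v"
  proof (rule mean_cong[OF v])
   fix z assume z: "z \<in> uhp"
   have "(deriv ^^ s) (\<lambda>z. f z * (deriv ^^ (n - s)) G z) z =
    (\<Sum>i = 0..s. of_nat (s choose i) * (deriv ^^ i) f z * (deriv ^^ (s - i)) ((deriv ^^ (n - s)) G) z)"
    by (rule higher_deriv_mult[OF f(1) hol(2) open_uhp z])
   also have "\<dots> = (\<Sum>i\<le>s. of_nat (s choose i) * (deriv ^^ i) f z * (deriv ^^ (n - i)) G z)"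
   proof (rule sum.cong)
    fix i assume "i \<in> {..s}"
    then have "n - i = (s - i) + (n - s)" using s by auto
    then have "(deriv ^^ (s - i)) ((deriv ^^ (n - s)) G) = (deriv ^^ (n - i)) G"
     by (simp only: funpow_add o_apply)
    then show "of_nat (s choose i) * (deriv ^^ i) f z * (deriv ^^ (s - i)) ((deriv ^^ (n - s)) G) z =
      of_nat (s choose i) * (deriv ^^ i) f z * (deriv ^^ (n - i)) G z" by simp
   qed auto
   finally show "(deriv ^^ s) (\<lambda>z. f z * (deriv ^^ (n - s)) G z) z * \<theta> z =
    (\<Sum>i\<le>s. of_nat (s choose i) * ((deriv ^^ i) f z * (deriv ^^ (n - i)) G z * \<theta> z))"
    by (simp add: sum_distrib_right mult.assoc)
  qed
  also have "\<dots> = (\<Sum>i\<le>s. mean (\<lambda>z. of_nat (s choose i) * ((deriv ^^ i) f z * (deriv ^^ (n - i)) G z * \<theta> z)) v)"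
   by (rule mean_sum) (use v in \<open>auto intro!: continuous_intros cont\<close>)
  finally show ?thesis by (simp add: mean_cmult M_def)
 qed
 have fin: "{(r, s). r + s = n} = (\<lambda>s. (n - s, s)) ` {..n}"
  by (auto simp: image_iff)
 have coeffs: "(\<Sum>(r, s)\<in>{(r, s). r + s = n}.
    (- 1) ^ r * of_real (Gamma (wt + real n) * Gamma (1 + real n) / (Gamma (real s + 1) * Gamma (wt + real n - real s) * Gamma (real r + 1) * Gamma (1 + real n - real r)))
     * ((deriv ^^ r) G z * (deriv ^^ s) \<theta> z)) =
   (\<Sum>s\<le>n. (- 1) ^ (n - s) * of_real (b s) * ((deriv ^^ (n - s)) G z * (deriv ^^ s) \<theta> z))" for z
 proof -
  have "inj_on (\<lambda>s. (n - s, s)) {..n}" by (auto simp: inj_on_def)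
  then show ?thesis
   unfolding fin
  proof (subst sum.reindex, assumption, intro sum.cong refl)
   fix s assume "s \<in> {..n}"
   then have "n - s + s = n" by simp
   from bracket_coeff[OF wt this]
   show "((\<lambda>(r, s). (- 1) ^ r * complex_of_real (Gamma (wt + real n) * Gamma (1 + real n) / (Gamma (real s + 1) * Gamma (wt + real n - real s) * Gamma (real r + 1) * Gamma (1 + real n - real r)))
     * ((deriv ^^ r) G z * (deriv ^^ s) \<theta> z)) \<circ> (\<lambda>s. (n - s, s))) s =
    (- 1) ^ (n - s) * of_real (b s) * ((deriv ^^ (n - s)) G z * (deriv ^^ s) \<theta> z)"
    by (simp only: o_apply case_prod_conv b_def)
  qed
 qed
 have "mean (\<lambda>z. f z * (1 / (2 * of_real pi * \<i>) ^ n * (\<Sum>(r, s)\<in>{(r, s). r + s = n}.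
    (- 1) ^ r * of_real (Gamma (wt + real n) * Gamma (1 + real n) / (Gamma (real s + 1) * Gamma (wt + real n - real s) * Gamma (real r + 1) * Gamma (1 + real n - real r)))
     * ((deriv ^^ r) G z * (deriv ^^ s) \<theta> z)))) v =
   mean (\<lambda>z. \<Sum>s\<le>n. (1 / (2 * of_real pi * \<i>) ^ n * (- 1) ^ (n - s) * of_real (b s)) * (f z * ((deriv ^^ (n - s)) G z * (deriv ^^ s) \<theta> z))) v"
  unfolding coeffs by (simp add: sum_distrib_left mult_ac)
 also have "\<dots> = (\<Sum>s\<le>n. (1 / (2 * of_real pi * \<i>) ^ n * (- 1) ^ (n - s) * of_real (b s)) * ((- 1) ^ s * (\<Sum>i\<le>s. of_nat (s choose i) * M i)))"
 proof -
  have "continuous_on uhp (\<lambda>z. (1 / (2 * of_real pi * \<i>) ^ n * (- 1) ^ (n - s) * of_real (b s)) * (f z * ((deriv ^^ (n - s)) G z * (deriv ^^ s) \<theta> z)))" for s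
   by (intro continuous_intros cont) auto
  then show ?thesis
   by (subst mean_sum[OF finite_atMost _ v]) (auto simp only: mean_cmult parts atMost_iff intro!: sum.cong)
 qed
 also have "\<dots> = (- 1) ^ n / (2 * of_real pi * \<i>) ^ n * (\<Sum>s\<le>n. \<Sum>i\<le>s. of_real (b s * real (s choose i)) * M i)"
  unfolding sum_distrib_left
 proof (intro sum.cong refl)
  fix s i assume "s \<in> {..n}" "i \<in> {..s}"
  then have "(- 1 :: complex) ^ n = (- 1) ^ (n - s) * (- 1) ^ s" by (simp flip: power_add)
  then show "1 / (2 * of_real pi * \<i>) ^ n * (- 1) ^ (n - s) * of_real (b s) * ((- 1) ^ s * (of_nat (s choose i) * M i)) =
    (- 1) ^ n / (2 * of_real pi * \<i>) ^ n * (of_real (b s * real (s choose i)) * M i)" by simp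
 qed
 also have "(\<Sum>s\<le>n. \<Sum>i\<le>s. of_real (b s * real (s choose i)) * M i) = (\<Sum>i\<le>n. \<Sum>s=i..n. of_real (b s * real (s choose i)) * M i)"
 proof -
  define h where "h s i = complex_of_real (b s * real (s choose i)) * M i" for s i
  have "(\<Sum>s\<le>n. \<Sum>i\<le>s. h s i) = (\<Sum>(s, i)\<in>(SIGMA s:{..n}. {..s}). h s i)" by (rule sum.Sigma) auto
  also have "\<dots> = (\<Sum>(i, s)\<in>(SIGMA i:{..n}. {i..n}). h s i)"
   by (rule sum.reindex_bij_witness[of _ "\<lambda>(i, s). (s, i)" "\<lambda>(s, i). (i, s)"]) auto
  also have "\<dots> = (\<Sum>i\<le>n. \<Sum>s=i..n. h s i)" by (rule sum.Sigma[symmetric]) auto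
  finally show ?thesis by (simp only: h_def)
 qed
 finally have main: "mean (\<lambda>z. f z * (1 / (2 * of_real pi * \<i>) ^ n * (\<Sum>(r, s)\<in>{(r, s). r + s = n}.
    (- 1) ^ r * of_real (Gamma (wt + real n) * Gamma (1 + real n) / (Gamma (real s + 1) * Gamma (wt + real n - real s) * Gamma (real r + 1) * Gamma (1 + real n - real r)))
     * ((deriv ^^ r) G z * (deriv ^^ s) \<theta> z)))) v =
   (- 1) ^ n / (2 * of_real pi * \<i>) ^ n * (\<Sum>i\<le>n. \<Sum>s=i..n. of_real (b s * real (s choose i)) * M i)" .
 have const: "of_real ((4 * pi) ^ n) * ((- 1) ^ n / (2 * of_real pi * \<i>) ^ n) = (2 * \<i>) ^ n"
 proof -
  have *: "of_real (4 * pi) * ((- 1) / (2 * of_real pi * \<i>)) = 2 * \<i>" by (simp add: complex_eq_iff field_simps)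
  show ?thesis unfolding of_real_power power_divide[symmetric] power_mult_distrib[symmetric] * ..
 qed
 have "of_real ((4 * pi) ^ n * fact n / pochhammer wt n) * ((- 1) ^ n / (2 * of_real pi * \<i>) ^ n * (\<Sum>i\<le>n. \<Sum>s=i..n. of_real (b s * real (s choose i)) * M i))
  = (of_real ((4 * pi) ^ n) * ((- 1) ^ n / (2 * of_real pi * \<i>) ^ n)) * (\<Sum>i\<le>n. of_real (fact n / pochhammer wt n * (\<Sum>s=i..n. b s * real (s choose i))) * M i)"
 proof -
  have inner: "(\<Sum>s=i..n. of_real (b s * real (s choose i)) * M i) = of_real (\<Sum>s=i..n. b s * real (s choose i)) * M i" for i
   by (simp add: sum_distrib_right)
  have "of_real ((4 * pi) ^ n * fact n / pochhammer wt n) * (c * (\<Sum>i\<le>n. of_real (S i) * M i)) =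
   (of_real ((4 * pi) ^ n) * c) * (\<Sum>i\<le>n. of_real (fact n / pochhammer wt n * S i) * M i)" for c and S :: "nat \<Rightarrow> real"
   unfolding sum_distrib_left by (intro sum.cong refl) simp
  then show ?thesis unfolding inner .
 qed
 also have "\<dots> = (2 * \<i>) ^ n * (\<Sum>i\<le>n. of_real (acoeff n wt (n - i)) * M i)"
  unfolding const b_def by (intro arg_cong2[where f = "(*)"] sum.cong refl) (simp only: atMost_iff bracket_identity[OF wt])
 also have "(\<Sum>i\<le>n. of_real (acoeff n wt (n - i)) * M i) = (\<Sum>j\<le>n. of_real (acoeff n wt j) * M (n - j))"
  by (rule sum.reindex_bij_witness[of _ "\<lambda>j. n - j" "\<lambda>j. n - j"]) auto
 finally show ?thesis unfolding main by (simp add: M_def sum_distrib_left mult_ac)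
qed

lemma tendsto_powr_indicator:
 assumes "i \<le> m"
 shows "((\<lambda>T. complex_of_real (c * T powr (real i - real m))) \<longlongrightarrow> (if i = m then of_real c else 0)) at_top"
proof (cases "i = m")
 case True
 have "eventually (\<lambda>T::real. of_real c = complex_of_real (c * T powr (real i - real m))) at_top"
  using eventually_gt_at_top[of 0] by eventually_elim (simp add: True)
 from Lim_transform_eventually[OF tendsto_const this] show ?thesis using True by simp
next
 case False
 have "((\<lambda>T. T powr (real i - real m)) \<longlongrightarrow> 0) at_top"
  by (rule tendsto_neg_powr) (use False assms in \<open>auto intro: filterlim_ident\<close>)
 then have "((\<lambda>T. complex_of_real (c * T powr (real i - real m))) \<longlongrightarrow> of_real (c * 0)) at_top"
  by (intro tendsto_intros)
 then show ?thesis using False by simp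
qed

text \<open>Expanding both raising operators at height T produces powers T^(i-(n-j)) and T^(l-j)
  times means that converge. Only the top terms i = n - j, l = j survive the limit. In them the mean
  of the holomorphic product is independent of the height, and the part with \<open>H\<close>
  vanishes by \<open>H0\<close>.\<close>

lemma primitive_form_limit:
 assumes f: "f holomorphic_on uhp" "quasi_periodic cf f" and G: "G holomorphic_on uhp" "quasi_periodic cG G"
  and \<theta>: "\<theta> holomorphic_on uhp" "quasi_periodic c\<theta> \<theta>" and c: "cf * cG * c\<theta> = 1" and v: "v > 0"
  and H: "\<And>l. continuous_on uhp (H l)"
  and H0: "\<And>i l. ((\<lambda>T. mean (\<lambda>z. (deriv ^^ i) f z * \<theta> z * H l z) T) \<longlongrightarrow> 0) at_top"
 shows "((\<lambda>T. mean (primitive_form n wt (\<lambda>i. (deriv ^^ i) f) (\<lambda>l z. (deriv ^^ l) G z + H l z) \<theta>) T) \<longlongrightarrow>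
   (\<Sum>j\<le>n. of_real (acoeff n wt j) * (2 * \<i>) ^ n * mean (\<lambda>z. (deriv ^^ (n - j)) f z * (deriv ^^ j) G z * \<theta> z) v)) at_top"
proof -
 let ?rho = "1 - 2 * real n - wt"
 define M where "M i l = mean (\<lambda>z. (deriv ^^ i) f z * (deriv ^^ l) G z * \<theta> z) v" for i l
 define D where "D l z = (deriv ^^ l) G z + H l z" for l z
 note hol = holomorphic_higher_deriv_uhp[OF f(1)] holomorphic_higher_deriv_uhp[OF G(1)] \<theta>(1)
 note cont = hol[THEN holomorphic_on_imp_continuous_on]
 have cD: "continuous_on uhp (D l)" for l unfolding D_def by (intro continuous_intros cont H)
 have lim: "((\<lambda>T. mean (\<lambda>z. (deriv ^^ i) f z * D l z * \<theta> z) T) \<longlongrightarrow> M i l) at_top" for i l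
 proof -
  have "eventually (\<lambda>T. M i l + mean (\<lambda>z. (deriv ^^ i) f z * \<theta> z * H l z) T = mean (\<lambda>z. (deriv ^^ i) f z * D l z * \<theta> z) T) at_top"
   using eventually_gt_at_top[of 0]
  proof eventually_elim
   case (elim T)
   have "mean (\<lambda>z. (deriv ^^ i) f z * D l z * \<theta> z) T =
    mean (\<lambda>z. (deriv ^^ i) f z * (deriv ^^ l) G z * \<theta> z + (deriv ^^ i) f z * \<theta> z * H l z) T"
    by (simp add: D_def algebra_simps)
   also have "\<dots> = mean (\<lambda>z. (deriv ^^ i) f z * (deriv ^^ l) G z * \<theta> z) T + mean (\<lambda>z. (deriv ^^ i) f z * \<theta> z * H l z) T"
    by (rule mean_add) (use elim in \<open>auto intro!: continuous_intros cont H\<close>)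
   also have "mean (\<lambda>z. (deriv ^^ i) f z * (deriv ^^ l) G z * \<theta> z) T = M i l"
    unfolding M_def
   proof (rule mean_const[OF _ _ elim v])
    show "(\<lambda>z. (deriv ^^ i) f z * (deriv ^^ l) G z * \<theta> z) holomorphic_on uhp"
     by (intro holomorphic_intros hol)
    have "quasi_periodic (cf * cG * c\<theta>) (\<lambda>z. (deriv ^^ i) f z * (deriv ^^ l) G z * \<theta> z)"
     by (intro quasi_periodic_mult quasi_periodic_higher_deriv f G \<theta>)
    then show "\<And>z. z \<in> uhp \<Longrightarrow> (deriv ^^ i) f (z + 1) * (deriv ^^ l) G (z + 1) * \<theta> (z + 1) = (deriv ^^ i) f z * (deriv ^^ l) G z * \<theta> z"
     by (simp add: c quasi_periodic_def)
   qed
   finally show ?case by simp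
  qed
  moreover have "((\<lambda>T. M i l + mean (\<lambda>z. (deriv ^^ i) f z * \<theta> z * H l z) T) \<longlongrightarrow> M i l + 0) at_top"
   by (intro tendsto_intros H0)
  ultimately show ?thesis using Lim_transform_eventually by fastforce
 qed
 \<comment> \<open>On the line of height T the powers of v are constants and can be taken out of the
   mean.\<close>
 define S where "S T = (\<Sum>j\<le>n. \<Sum>i\<le>n - j. \<Sum>l\<le>j. of_real (acoeff n wt j) *
   (of_real (Rcoeff ?rho (n - j) i * T powr (real i - real (n - j))) * (2 * \<i>) ^ i) *
   (of_real (Rcoeff wt j l * T powr (real l - real j)) * (2 * \<i>) ^ l) * mean (\<lambda>z. (deriv ^^ i) f z * D l z * \<theta> z) T)" for T
 have "(S \<longlongrightarrow> (\<Sum>j\<le>n. \<Sum>i\<le>n - j. \<Sum>l\<le>j. of_real (acoeff n wt j) *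
   ((if i = n - j then of_real (Rcoeff ?rho (n - j) i) else 0) * (2 * \<i>) ^ i) *
   ((if l = j then of_real (Rcoeff wt j l) else 0) * (2 * \<i>) ^ l) * M i l)) at_top"
  unfolding S_def by (intro tendsto_sum tendsto_mult tendsto_const tendsto_powr_indicator lim) auto
 also have "(\<Sum>j\<le>n. \<Sum>i\<le>n - j. \<Sum>l\<le>j. of_real (acoeff n wt j) *
   ((if i = n - j then of_real (Rcoeff ?rho (n - j) i) else 0) * (2 * \<i>) ^ i) *
   ((if l = j then of_real (Rcoeff wt j l) else 0) * (2 * \<i>) ^ l) * M i l) =
   (\<Sum>j\<le>n. \<Sum>i\<le>n - j. \<Sum>l\<le>j. if l = j then (if i = n - j then of_real (acoeff n wt j) * (2 * \<i>) ^ n * M (n - j) j else 0) else 0)"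
 proof -
  have "2 ^ (n - j) * (\<i> ^ (n - j) * (2 ^ j * \<i> ^ j)) = 2 ^ n * \<i> ^ n" if "j \<le> n" for j
  proof -
   have "(2 * \<i>) ^ (n - j) * (2 * \<i>) ^ j = (2 * \<i>) ^ n"
    unfolding power_add[symmetric] using that by simp
   then show ?thesis by (simp add: power_mult_distrib mult_ac)
  qed
  then show ?thesis by (intro sum.cong refl) auto
 qed
 also have "\<dots> = (\<Sum>j\<le>n. of_real (acoeff n wt j) * (2 * \<i>) ^ n * M (n - j) j)"
  by (simp add: sum.delta)
 finally have SL: "(S \<longlongrightarrow> (\<Sum>j\<le>n. of_real (acoeff n wt j) * (2 * \<i>) ^ n * M (n - j) j)) at_top" .
 have "eventually (\<lambda>T. S T = mean (primitive_form n wt (\<lambda>i. (deriv ^^ i) f) D \<theta>) T) at_top"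
  using eventually_gt_at_top[of 0]
 proof eventually_elim
  case (elim T)
  have "mean (primitive_form n wt (\<lambda>i. (deriv ^^ i) f) D \<theta>) T =
   mean (\<lambda>z. \<Sum>j\<le>n. \<Sum>i\<le>n - j. \<Sum>l\<le>j. (of_real (acoeff n wt j) *
   (of_real (Rcoeff ?rho (n - j) i * T powr (real i - real (n - j))) * (2 * \<i>) ^ i) *
   (of_real (Rcoeff wt j l * T powr (real l - real j)) * (2 * \<i>) ^ l)) * ((deriv ^^ i) f z * D l z * \<theta> z)) T"
   unfolding mean_def primitive_form_def Rpow_def
   by (intro Henstock_Kurzweil_Integration.integral_cong)
     (simp add: sum_product sum_distrib_left sum_distrib_right mult_ac)
  also have "\<dots> = S T" unfolding S_def
   by (simp add: mean_sum mean_cmult elim continuous_intros cont cD)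
  finally show ?case by simp
 qed
 from Lim_transform_eventually[OF SL this] show ?thesis
  unfolding D_def[abs_def] M_def .
qed

text \<open>F may grow exponentially at the cusp, so the integrand itself need not be small. But
  integration over u extracts from F one Fourier coefficient for each x, and for holomorphic F this
  can be estimated at the fixed height 1. Therefore one K serves for all v.\<close>

lemma mean_shadow_bound:
 assumes F: "F holomorphic_on uhp" "quasi_periodic c F"
 shows "\<exists>K\<ge>0. \<forall>v\<ge>1. \<forall>(q :: int \<Rightarrow> real) (g :: int \<Rightarrow> real) B. (\<forall>x. q x \<ge> 0 \<and> \<bar>g x\<bar> \<le> B x \<and> (g x \<noteq> 0 \<longrightarrow> c = er (q x))) \<longrightarrow>
   (\<lambda>x. B x * exp (- 2 * pi * q x * v)) summable_on UNIV \<longrightarrow>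
   cmod (integral {-1/2..1/2} (\<lambda>u. F (Complex u v) * (\<Sum>\<^sub>\<infinity>x. of_real (g x) * cnj (e (of_real (q x) * Complex u v)))))
    \<le> K * (\<Sum>\<^sub>\<infinity>x. B x * exp (- 2 * pi * q x * v))"
proof -
 have cF: "continuous_on uhp F" using F(1) by (rule holomorphic_on_imp_continuous_on)
 have "compact ((\<lambda>u. F (Complex u 1)) ` {-1/2..1/2})"
  by (intro compact_continuous_image continuous_on_horizontal cF) auto
 then obtain K where K: "\<And>u. u \<in> {-1/2..1/2} \<Longrightarrow> cmod (F (Complex u 1)) \<le> K"
  by (meson bounded_iff compact_imp_bounded image_eqI)
 have K0: "K \<ge> 0" using K[of 0] norm_ge_zero[of "F (Complex 0 1)"] by (auto simp del: norm_ge_zero)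
 show ?thesis
 proof (intro exI[of _ K] conjI K0 allI impI)
  fix v :: real and q g B :: "int \<Rightarrow> real"
  assume v: "1 \<le> v" and *: "\<forall>x. q x \<ge> 0 \<and> \<bar>g x\<bar> \<le> B x \<and> (g x \<noteq> 0 \<longrightarrow> c = er (q x))"
   and sB: "(\<lambda>x. B x * exp (- 2 * pi * q x * v)) summable_on UNIV"
  have v0: "v > 0" using v by simp
  define \<phi> where "\<phi> x u = F (Complex u v) * (of_real (g x) * cnj (e (of_real (q x) * Complex u v)))" for x u
  \<comment> \<open>A bound at height v, which may depend on v; it only justifies integrating term
    by term.\<close>
  have "compact ((\<lambda>u. F (Complex u v)) ` {-1/2..1/2})"
   by (intro compact_continuous_image continuous_on_horizontal cF v0) auto
  then obtain Kv where Kv: "\<And>u. u \<in> {-1/2..1/2} \<Longrightarrow> cmod (F (Complex u v)) \<le> Kv"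
   by (meson bounded_iff compact_imp_bounded image_eqI)
  have Kv0: "Kv \<ge> 0" using Kv[of 0] norm_ge_zero[of "F (Complex 0 v)"] by (auto simp del: norm_ge_zero)
  have nrm: "cmod (of_real (g x) * cnj (e (of_real (q x) * Complex u v))) \<le> B x * exp (- 2 * pi * q x * v)" for x u
   using * by (simp add: norm_mult norm_e mult_right_mono mult.assoc)
  have summ: "(\<lambda>x. of_real (g x) * cnj (e (of_real (q x) * Complex u v))) summable_on UNIV" for u
   using summable_on_comparison_test[OF sB nrm] by (rule abs_summable_summable[OF summable_on_cong[THEN iffD1, rotated]]) auto
  have bound: "cmod (\<phi> x u) \<le> Kv * (B x * exp (- 2 * pi * q x * v))" if "u \<in> {-1/2..1/2}" for x u
   unfolding \<phi>_def norm_mult[of "F _"] using Kv[OF that] nrm Kv0 by (intro mult_mono) auto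
  have hs: "((\<lambda>x. integral {-1/2..1/2} (\<phi> x)) has_sum
    integral {-1/2..1/2} (\<lambda>u. F (Complex u v) * (\<Sum>\<^sub>\<infinity>x. of_real (g x) * cnj (e (of_real (q x) * Complex u v))))) UNIV"
  proof (rule integral_infsum[OF _ bound])
   show "continuous_on {-1/2..1/2} (\<phi> x)" for x unfolding \<phi>_def
    by (intro continuous_intros continuous_on_horizontal cF v0)
   show "(\<lambda>x. Kv * (B x * exp (- 2 * pi * q x * v))) summable_on UNIV"
    by (intro summable_on_cmult_right sB)
   show "((\<lambda>x. \<phi> x u) has_sum F (Complex u v) * (\<Sum>\<^sub>\<infinity>x. of_real (g x) * cnj (e (of_real (q x) * Complex u v)))) UNIV" for u
    unfolding \<phi>_def by (intro has_sum_cmult_right has_sum_infsum summ)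
  qed auto
  have tb: "cmod (integral {-1/2..1/2} (\<phi> x)) \<le> K * (B x * exp (- 2 * pi * q x * v))" for x
  proof (cases "g x = 0")
   case True
   then have "\<phi> x = (\<lambda>u. 0)" by (simp add: \<phi>_def[abs_def])
   moreover have "0 \<le> B x" using * order_trans[OF abs_ge_zero] by blast
   ultimately show ?thesis using K0 by simp
  next
   case False
   have cq: "c = er (q x)" using * False by blast
   \<comment> \<open>cnj (e(q z)) equals e(-q z) exp(-4 pi q v), and h is periodic by the choice of
     c, so its mean can be moved from height v to height 1. The loss exp(2 pi q) there is
     compensated by half of the exponential, because v is at least 1.\<close>
   define h where "h z = F z * e (- of_real (q x) * z)" for z
   have "cnj (e (of_real (q x) * Complex u v)) = e (- of_real (q x) * Complex u v) * of_real (exp (- 4 * pi * q x * v))" for u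
   proof -
    have "of_real (exp (- 4 * pi * q x * v)) = e (2 * \<i> * of_real (q x * v))"
    proof -
     have "2 * of_real pi * \<i> * (2 * \<i> * of_real (q x * v)) = of_real (- 4 * pi * q x * v)"
      by (simp add: complex_eq_iff)
     then show ?thesis by (simp only: e_def exp_of_real)
    qed
    moreover have "- cnj (of_real (q x) * Complex u v) = - of_real (q x) * Complex u v + 2 * \<i> * of_real (q x * v)"
     by (simp add: complex_eq_iff)
    ultimately show ?thesis by (simp only: cnj_e e_add)
   qed
   then have "\<phi> x = (\<lambda>u. of_real (g x * exp (- 4 * pi * q x * v)) * h (Complex u v))"
    by (simp add: fun_eq_iff \<phi>_def h_def mult_ac)
   then have "integral {-1/2..1/2} (\<phi> x) = of_real (g x * exp (- 4 * pi * q x * v)) * mean h v"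
    unfolding mean_def by simp
   also have "mean h v = mean h 1"
   proof (rule mean_const)
    show "h holomorphic_on uhp" unfolding h_def by (intro holomorphic_intros F)
    fix z assume "z \<in> uhp"
    have "e (- of_real (q x) * (z + 1)) = e (- of_real (q x) * z) * e (- of_real (q x))"
     by (simp add: algebra_simps flip: e_add)
    then show "h (z + 1) = h z"
     unfolding h_def quasi_periodicD[OF F(2) \<open>z \<in> uhp\<close>] cq by (simp add: e_minus)
   qed (use v0 in auto)
   finally have I: "integral {-1/2..1/2} (\<phi> x) = of_real (g x * exp (- 4 * pi * q x * v)) * mean h 1" .
   have "cmod (mean h 1) \<le> K * exp (2 * pi * q x) * (1/2 - (-1/2))"
    unfolding mean_def
   proof (rule integral_bound)
    show "continuous_on {-1/2..1/2} (\<lambda>u. h (Complex u 1))"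
     by (intro continuous_on_horizontal holomorphic_on_imp_continuous_on) (auto simp: h_def intro!: holomorphic_intros F)
    show "\<And>u. u \<in> {-1/2..1/2} \<Longrightarrow> cmod (h (Complex u 1)) \<le> K * exp (2 * pi * q x)"
     unfolding h_def norm_mult using K by (simp add: norm_e mult_right_mono)
   qed auto
   then have "cmod (integral {-1/2..1/2} (\<phi> x)) \<le> (\<bar>g x\<bar> * exp (- 4 * pi * q x * v)) * (K * exp (2 * pi * q x))"
    unfolding I norm_mult by (intro mult_mono) (auto simp: norm_mult)
   also have "\<dots> = K * (\<bar>g x\<bar> * exp (2 * pi * q x - 4 * pi * q x * v))"
    by (simp add: exp_diff exp_minus field_simps)
   also have "\<dots> \<le> K * (B x * exp (- 2 * pi * q x * v))"
   proof (intro mult_left_mono mult_mono K0)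
    have "2 * pi * q x * 1 \<le> 2 * pi * q x * v" using * v by (intro mult_left_mono) auto
    then show "exp (2 * pi * q x - 4 * pi * q x * v) \<le> exp (- 2 * pi * q x * v)"
     unfolding exp_le_cancel_iff by linarith
   qed (use * order_trans[OF abs_ge_zero] in \<open>auto simp del: abs_ge_zero\<close>)
   finally show ?thesis .
  qed
  have "cmod (integral {-1/2..1/2} (\<lambda>u. F (Complex u v) * (\<Sum>\<^sub>\<infinity>x. of_real (g x) * cnj (e (of_real (q x) * Complex u v)))))
    = cmod (\<Sum>\<^sub>\<infinity>x. integral {-1/2..1/2} (\<phi> x))"
   using hs by (simp add: infsumI)
  also have "\<dots> \<le> (\<Sum>\<^sub>\<infinity>x. K * (B x * exp (- 2 * pi * q x * v)))"
   by (rule norm_infsum_le[OF has_sum_infsum has_sum_infsum tb])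
     (use hs sB in \<open>auto intro: has_sum_imp_summable summable_on_cmult_right\<close>)
  also have "\<dots> = K * (\<Sum>\<^sub>\<infinity>x. B x * exp (- 2 * pi * q x * v))"
   by (rule infsum_cmult_right') 
  finally show "cmod (integral {-1/2..1/2} (\<lambda>u. F (Complex u v) * (\<Sum>\<^sub>\<infinity>x. of_real (g x) * cnj (e (of_real (q x) * Complex u v)))))
    \<le> K * (\<Sum>\<^sub>\<infinity>x. B x * exp (- 2 * pi * q x * v))" .
 qed
qed

section \<open>Unary theta series and their Eichler integrals\<close>

lemma power_le_exp:
 fixes y \<delta> :: real
 assumes "y \<ge> 0" "\<delta> > 0"
 shows "y ^ N \<le> fact N / \<delta> ^ N * exp (\<delta> * y)"
proof -
 have s: "(\<lambda>n. (\<delta> * y) ^ n /\<^sub>R fact n) sums exp (\<delta> * y)" by (rule exp_converges)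
 have "(\<Sum>n\<in>{N}. (\<delta> * y) ^ n /\<^sub>R fact n) \<le> (\<Sum>n. (\<delta> * y) ^ n /\<^sub>R fact n)"
  by (rule sum_le_suminf) (use s assms in \<open>auto simp: sums_iff\<close>)
 then have "(\<delta> * y) ^ N / fact N \<le> exp (\<delta> * y)" using s by (simp add: sums_iff divide_inverse_commute)
 then show ?thesis using assms by (simp add: power_mult_distrib field_simps)
qed

lemma summable_on_int_abs:
 fixes h :: "nat \<Rightarrow> real"
 assumes "\<And>n. h n \<ge> 0" "summable h"
 shows "(\<lambda>x::int. h (nat \<bar>x\<bar>)) summable_on UNIV"
proof -
 have h: "h summable_on UNIV" using assms by (simp add: summable_nonneg_imp_summable_on)
 have "bij_betw int UNIV {0..}" by (intro bij_betwI[where g = nat]) auto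
 from summable_on_reindex_bij_betw[OF this, of "\<lambda>x. h (nat \<bar>x\<bar>)"] have 1: "(\<lambda>x::int. h (nat \<bar>x\<bar>)) summable_on {0..}"
  using h by simp
 have "bij_betw (\<lambda>n. - int n) UNIV {..0}" by (intro bij_betwI[where g = "\<lambda>x. nat (- x)"]) auto
 from summable_on_reindex_bij_betw[OF this, of "\<lambda>x. h (nat \<bar>x\<bar>)"] have "(\<lambda>x::int. h (nat \<bar>x\<bar>)) summable_on {..0}"
  using h by simp
 then have 2: "(\<lambda>x::int. h (nat \<bar>x\<bar>)) summable_on {..<0}"
  by (rule summable_on_subset_banach) auto
 have "(\<lambda>x::int. h (nat \<bar>x\<bar>)) summable_on ({0..} \<union> {..<0})"
  by (intro summable_on_Un_disjoint 1 2) auto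
 moreover have "{0..} \<union> {..<0} = (UNIV :: int set)" by auto
 ultimately show ?thesis by simp
qed

lemma summable_on_gauss:
 assumes "\<epsilon> > 0"
 shows "(\<lambda>x::int. (1 + ri \<bar>x\<bar>) ^ N * exp (- \<epsilon> * (ri x)\<^sup>2)) summable_on UNIV"
proof -
 define \<delta> where "\<delta> = \<epsilon> / 2"
 have \<delta>: "\<delta> > 0" using assms by (simp add: \<delta>_def)
 define K where "K = fact N / \<delta> ^ N * exp \<delta>"
 have "summable (\<lambda>n. K * exp (- \<delta>) ^ n)"
  using \<delta> by (intro summable_mult summable_geometric) auto
 then have s: "(\<lambda>x::int. K * exp (- \<delta>) ^ nat \<bar>x\<bar>) summable_on UNIV"
  by (rule summable_on_int_abs[rotated]) (use \<delta> in \<open>auto simp: K_def\<close>)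
 show ?thesis
 proof (rule summable_on_comparison_test[OF s])
  fix x :: int
  let ?y = "ri \<bar>x\<bar>"
  have "?y \<le> (ri x)\<^sup>2"
  proof (cases "x = 0")
   case False
   then have "?y * 1 \<le> ?y * ?y" by (intro mult_left_mono) auto
   then show ?thesis by (simp add: power2_eq_square abs_mult_self_eq flip: of_int_mult)
  qed auto
  then have "exp (- \<epsilon> * (ri x)\<^sup>2) \<le> exp (- \<epsilon> * ?y)" using assms by simp
  then have "(1 + ?y) ^ N * exp (- \<epsilon> * (ri x)\<^sup>2) \<le> (fact N / \<delta> ^ N * exp (\<delta> * (1 + ?y))) * exp (- \<epsilon> * ?y)"
   using power_le_exp[of "1 + ?y" \<delta> N] \<delta> by (intro mult_mono) auto
  also have "\<dots> = K * exp (- \<delta> * ?y)"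
  proof -
   have "exp (\<delta> * (1 + ?y)) * exp (- \<epsilon> * ?y) = exp \<delta> * exp (- \<delta> * ?y)"
    unfolding exp_add[symmetric] by (simp add: \<delta>_def field_simps)
   then show ?thesis by (simp add: K_def)
  qed
  also have "exp (- \<delta> * ?y) = exp (- \<delta>) ^ nat \<bar>x\<bar>"
   by (simp add: exp_of_nat_mult[symmetric] mult.commute)
  finally show "(1 + ?y) ^ N * exp (- \<epsilon> * (ri x)\<^sup>2) \<le> K * exp (- \<delta>) ^ nat \<bar>x\<bar>" .
 qed auto
qed

lemma infsum_int_eq_suminf:
 fixes F :: "int \<Rightarrow> complex"
 assumes "\<And>x. cmod (F x) \<le> B x" "B summable_on UNIV"
 shows "(\<lambda>n. F (int_decode n)) sums (\<Sum>\<^sub>\<infinity>x. F x)"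
proof -
 have "F summable_on UNIV"
  by (rule abs_summable_summable, rule summable_on_comparison_test[OF assms(2)]) (auto simp: assms(1))
 then have "(F has_sum (\<Sum>\<^sub>\<infinity>x. F x)) UNIV" by (rule has_sum_infsum)
 then have "((\<lambda>n. F (int_decode n)) has_sum (\<Sum>\<^sub>\<infinity>x. F x)) UNIV"
  by (rule has_sum_reindex_bij_betw[OF bij_int_decode, THEN iffD2])
 then show ?thesis by (rule has_sum_imp_sums)
qed

text \<open>One majorant for the terms and for both derivatives gives uniform convergence of the
  differentiated series; the enumeration \<open>int_decode\<close> of the integers reduces the claim
  to differentiation of an ordinary series.\<close>

lemma has_wirtinger_infsum_on:
 fixes F :: "int \<Rightarrow> complex \<Rightarrow> complex"
 assumes F: "\<And>x z. z \<in> S \<Longrightarrow> has_wirtinger (F x) (a x z) (b x z) z"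
  and bF: "\<And>x z. z \<in> S \<Longrightarrow> cmod (F x z) \<le> B x"
  and ba: "\<And>x z. z \<in> S \<Longrightarrow> cmod (a x z) \<le> B x"
  and bb: "\<And>x z. z \<in> S \<Longrightarrow> cmod (b x z) \<le> B x"
  and B: "B summable_on UNIV" and z: "z \<in> S" and S: "convex S" "open S"
 shows "has_wirtinger (\<lambda>z. \<Sum>\<^sub>\<infinity>x. F x z) (\<Sum>\<^sub>\<infinity>x. a x z) (\<Sum>\<^sub>\<infinity>x. b x z) z"
proof -
 let ?n = int_decode
 have "((\<lambda>n. B (?n n)) has_sum (\<Sum>\<^sub>\<infinity>x. B x)) UNIV"
  by (rule has_sum_reindex_bij_betw[OF bij_int_decode, THEN iffD2]) (rule has_sum_infsum[OF B])
 then have sB: "summable (\<lambda>n. B (?n n))" using has_sum_imp_sums sums_iff by blast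
 have lim: "uniform_limit S (\<lambda>n z. \<Sum>i<n. c (?n i) z) (\<lambda>z. \<Sum>\<^sub>\<infinity>x. c x z) sequentially"
  if c: "\<And>x z. z \<in> S \<Longrightarrow> cmod (c x z) \<le> B x" for c :: "int \<Rightarrow> complex \<Rightarrow> complex"
 proof -
  have "uniform_limit S (\<lambda>n z. \<Sum>i<n. c (?n i) z) (\<lambda>z. \<Sum>i. c (?n i) z) sequentially"
   by (rule Weierstrass_m_test[OF _ sB]) (use c in auto)
  moreover have "(\<Sum>i. c (?n i) z) = (\<Sum>\<^sub>\<infinity>x. c x z)" if "z \<in> S" for z
   using infsum_int_eq_suminf[of "\<lambda>x. c x z" B] c B that by (auto simp: sums_iff)
  ultimately show ?thesis unfolding uniform_limit_iff by simp
 qed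
 have "\<exists>g. \<forall>x\<in>S. (\<lambda>n. F (?n n) x) sums g x \<and>
   (g has_derivative (\<lambda>h. (\<Sum>\<^sub>\<infinity>k. a k x) * h + (\<Sum>\<^sub>\<infinity>k. b k x) * cnj h)) (at x within S)"
 proof (rule has_derivative_series[OF S(1), where f' = "\<lambda>n x h. a (?n n) x * h + b (?n n) x * cnj h"])
  show "(F (?n n) has_derivative (\<lambda>h. a (?n n) x * h + b (?n n) x * cnj h)) (at x within S)" if "x \<in> S" for n x
   using F[of x "?n n"] that has_derivative_at_withinI unfolding has_wirtinger_def by blast
  show "\<forall>\<^sub>F n in sequentially. \<forall>x\<in>S. \<forall>h. norm ((\<Sum>i<n. a (?n i) x * h + b (?n i) x * cnj h) -
     ((\<Sum>\<^sub>\<infinity>k. a k x) * h + (\<Sum>\<^sub>\<infinity>k. b k x) * cnj h)) \<le> \<epsilon> * norm h" if "\<epsilon> > 0" for \<epsilon>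
  proof -
   have "\<forall>\<^sub>F n in sequentially. \<forall>x\<in>S. dist (\<Sum>i<n. a (?n i) x) (\<Sum>\<^sub>\<infinity>k. a k x) < \<epsilon> / 2"
    "\<forall>\<^sub>F n in sequentially. \<forall>x\<in>S. dist (\<Sum>i<n. b (?n i) x) (\<Sum>\<^sub>\<infinity>k. b k x) < \<epsilon> / 2"
    using lim[of a, OF ba] lim[of b, OF bb] that unfolding uniform_limit_iff by (meson half_gt_zero)+
   then show ?thesis
   proof eventually_elim
    case (elim n)
    show ?case
    proof (intro ballI allI)
     fix x h assume x: "x \<in> S"
     let ?A = "(\<Sum>i<n. a (?n i) x) - (\<Sum>\<^sub>\<infinity>k. a k x)" and ?B = "(\<Sum>i<n. b (?n i) x) - (\<Sum>\<^sub>\<infinity>k. b k x)"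
     have "(\<Sum>i<n. a (?n i) x * h + b (?n i) x * cnj h) - ((\<Sum>\<^sub>\<infinity>k. a k x) * h + (\<Sum>\<^sub>\<infinity>k. b k x) * cnj h) = ?A * h + ?B * cnj h"
      by (simp add: sum.distrib sum_distrib_left sum_distrib_right algebra_simps)
     also have "norm \<dots> \<le> norm ?A * norm h + norm ?B * norm h"
      by (rule norm_triangle_le) (simp add: norm_mult)
     also have "\<dots> \<le> \<epsilon> / 2 * norm h + \<epsilon> / 2 * norm h"
      using elim x by (intro add_mono mult_right_mono) (auto simp: dist_norm intro: less_imp_le)
     finally show "norm ((\<Sum>i<n. a (?n i) x * h + b (?n i) x * cnj h) - ((\<Sum>\<^sub>\<infinity>k. a k x) * h + (\<Sum>\<^sub>\<infinity>k. b k x) * cnj h)) \<le> \<epsilon> * norm h"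
      by simp
    qed
   qed
  qed
  show "z \<in> S" using z by simp
  show "(\<lambda>n. F (?n n) z) sums (\<Sum>\<^sub>\<infinity>x. F x z)"
   by (rule infsum_int_eq_suminf[OF bF[OF z] B])
 qed
 then obtain g where g: "\<And>x. x \<in> S \<Longrightarrow> (\<lambda>n. F (?n n) x) sums g x"
  and dg: "(g has_derivative (\<lambda>h. (\<Sum>\<^sub>\<infinity>k. a k z) * h + (\<Sum>\<^sub>\<infinity>k. b k z) * cnj h)) (at z within S)" using z by auto
 have "has_wirtinger g (\<Sum>\<^sub>\<infinity>k. a k z) (\<Sum>\<^sub>\<infinity>k. b k z) z"
  using dg at_within_open[OF _ S(2), of z] z by (simp add: has_wirtinger_def)
 moreover have "g x = (\<Sum>\<^sub>\<infinity>k. F k x)" if "x \<in> S" for x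
  using sums_unique2[OF g[OF that] infsum_int_eq_suminf[OF bF B]] that by simp
 ultimately show ?thesis using has_wirtinger_cong[OF _ S(2)] z by fastforce
qed

lemma has_wirtinger_infsum:
 fixes F :: "int \<Rightarrow> complex \<Rightarrow> complex"
 assumes "\<And>x z. Im z > v0 \<Longrightarrow> has_wirtinger (F x) (a x z) (b x z) z"
  and "\<And>x z. Im z > v0 \<Longrightarrow> cmod (F x z) \<le> B x"
  and "\<And>x z. Im z > v0 \<Longrightarrow> cmod (a x z) \<le> B x"
  and "\<And>x z. Im z > v0 \<Longrightarrow> cmod (b x z) \<le> B x"
  and "B summable_on UNIV" and "Im z > v0"
 shows "has_wirtinger (\<lambda>z. \<Sum>\<^sub>\<infinity>x. F x z) (\<Sum>\<^sub>\<infinity>x. a x z) (\<Sum>\<^sub>\<infinity>x. b x z) z"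
 by (rule has_wirtinger_infsum_on[where S = "{z. Im z > v0}" and B = B])
   (use assms in \<open>auto simp: convex_halfspace_Im_gt open_halfspace_Im_gt\<close>)

section \<open>The incomplete Gamma function and the shadow coefficients\<close>

lemma integrable_upper_Gamma:
 fixes a c :: real
 assumes "c > 0" "a \<le> 1"
 shows "(\<lambda>t. t powr (a - 1) * exp (- t)) integrable_on {c..}"
  and "integral {c..} (\<lambda>t. t powr (a - 1) * exp (- t)) \<le> c powr (a - 1) * exp (- c)"
proof -
 have hi: "((\<lambda>t. c powr (a - 1) * exp (- 1 * t)) has_integral c powr (a - 1) * (exp (- 1 * c) / 1)) {c..}"
  by (intro has_integral_mult_right has_integral_exp_minus_to_infinity) auto
 \<comment> \<open>Since a is at most 1, the power is decreasing and is bounded by its value at c;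
   this leaves a plain exponential integral.\<close>
 have le: "t powr (a - 1) * exp (- t) \<le> c powr (a - 1) * exp (- 1 * t)" if "t \<in> {c..}" for t
  using that assms by (auto intro!: mult_right_mono powr_mono2')
 have nn: "norm (t powr (a - 1) * exp (- t)) \<le> c powr (a - 1) * exp (- 1 * t)" if "t \<in> {c..}" for t
  using le[OF that] by simp
 have m: "(\<lambda>t. t powr (a - 1) * exp (- t)) \<in> borel_measurable (lebesgue_on {c..})"
  by (rule continuous_imp_measurable_on_sets_lebesgue) (use assms in \<open>auto intro!: continuous_intros\<close>)
 show i: "(\<lambda>t. t powr (a - 1) * exp (- t)) integrable_on {c..}"
  by (rule measurable_bounded_by_integrable_imp_integrable[OF m _ nn]) (use hi in auto)
 show "integral {c..} (\<lambda>t. t powr (a - 1) * exp (- t)) \<le> c powr (a - 1) * exp (- c)"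
  using integral_le[OF i has_integral_integrable[OF hi] le] unfolding integral_unique[OF hi] by simp
qed

lemma upper_Gamma_bounds:
 assumes "x > 0" "a \<le> 1"
 shows "0 \<le> upper_Gamma a x" "upper_Gamma a x \<le> x powr (a - 1) * exp (- x)"
proof -
 show "upper_Gamma a x \<le> x powr (a - 1) * exp (- x)"
  unfolding upper_Gamma_def using integrable_upper_Gamma(2)[OF assms] .
 show "0 \<le> upper_Gamma a x" unfolding upper_Gamma_def
  by (rule integral_nonneg[OF integrable_upper_Gamma(1)[OF assms]]) auto
qed

lemma upper_Gamma_derivative:
 assumes x: "x > 0" and a: "a \<le> 1"
 shows "(upper_Gamma a has_real_derivative - (x powr (a - 1) * exp (- x))) (at x)"
proof -
 \<comment> \<open>A fixed lower end c below x writes \<open>upper_Gamma\<close> near x as a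
   constant minus an integral over a compact interval.\<close>
 define c where "c = x / 2"
 have c: "0 < c" "c < x" using x by (auto simp: c_def)
 let ?f = "\<lambda>t::real. t powr (a - 1) * exp (- t)"
 have cont: "continuous_on {c..x + 1} ?f" using c by (auto intro!: continuous_intros)
 have "((\<lambda>y. integral {c..y} ?f) has_real_derivative ?f x) (at x within {c..x + 1})"
  by (rule integral_has_real_derivative[OF cont]) (use c in auto)
 then have "((\<lambda>y. integral {c..y} ?f) has_real_derivative ?f x) (at x)"
  using c by (subst (asm) at_within_interior) (auto simp: interior_atLeastAtMost_real)
 then have D: "((\<lambda>y. integral {c..} ?f - integral {c..y} ?f) has_real_derivative - ?f x) (at x)"
  by (auto intro!: derivative_eq_intros)
 have "integral {c..} ?f - integral {c..y} ?f = upper_Gamma a y" if y: "y \<in> {c<..}" for y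
 proof -
  have "negligible ({c..y} \<inter> {y..})"
   by (rule negligible_subset[of "{y}"]) auto
  then have "integral ({c..y} \<union> {y..}) ?f = integral {c..y} ?f + integral {y..} ?f"
   using c y by (intro Henstock_Kurzweil_Integration.integral_Un integrable_upper_Gamma(1) a integrable_continuous_interval)
    (auto intro!: continuous_intros)
  moreover have "{c..y} \<union> {y..} = {c..}" using y by auto
  ultimately show ?thesis by (simp add: upper_Gamma_def)
 qed
 then show ?thesis
  by (intro has_field_derivative_transform_within_open[OF D, of "{c<..}"]) (use c in auto)
qed

text \<open>\<open>shadow_series\<close> below is the non-holomorphic part of a preimage of \<open>theta_series\<close> under \<open>\<xi>\<^sub>\<kappa>\<close>; the index \<open>j\<close>
  counts its \<open>\<tau>\<close>-derivatives, and these satisfy the recursion used here.  The term \<open>x = 0\<close> is the multiple of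
  \<open>v\<^bsup>1-\<kappa>\<^esup>\<close> in the expansion of a preimage of a form with nonzero constant term.\<close>

fun shadow_coeff :: "real \<Rightarrow> real \<Rightarrow> nat \<Rightarrow> int \<Rightarrow> real \<Rightarrow> real" where
 "shadow_coeff wt d 0 x v = (if x = 0 then v powr (1 - wt) / (1 - wt)
   else - ((4 * pi * (gq d x)) powr (wt - 1)
    * upper_Gamma (1 - wt) (4 * pi * (gq d x) * v) * exp (4 * pi * (gq d x) * v)))"
| "shadow_coeff wt d (Suc j) x v = 4 * pi * (gq d x) * shadow_coeff wt d j x v
   + (- 1) ^ j * pochhammer wt j * v powr (- wt - real j)"

lemma shadow_coeff_derivative:
 assumes d: "d > 0" and wt: "wt > 0" "wt \<noteq> 1" and v: "v > 0"
 shows "(shadow_coeff wt d j x has_real_derivative shadow_coeff wt d (Suc j) x v) (at v)"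
proof (induction j)
 case 0
 show ?case
 proof (cases "x = 0")
  case True
  have "((\<lambda>v. v powr (1 - wt) / (1 - wt)) has_real_derivative v powr (- wt)) (at v)"
   using v wt by (auto intro!: derivative_eq_intros)
  then show ?thesis using True by simp
 next
  case False
  define c where "c = 4 * pi * (gq d x)"
  have c: "c > 0" using False d by (simp add: c_def)
  have UG: "(upper_Gamma (1 - wt) has_real_derivative - ((c * v) powr (1 - wt - 1) * exp (- (c * v)))) (at (c * v))"
   by (rule upper_Gamma_derivative) (use c v wt in auto)
  have cv: "((\<lambda>v. c * v) has_real_derivative c) (at v)" by (auto intro!: derivative_eq_intros)
  have "((\<lambda>v. - (c powr (wt - 1) * upper_Gamma (1 - wt) (c * v) * exp (c * v))) has_real_derivative
    c * (- (c powr (wt - 1) * upper_Gamma (1 - wt) (c * v) * exp (c * v)))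
     + c * c powr (wt - 1) * (c * v) powr (- wt) * (exp (- (c * v)) * exp (c * v))) (at v)"
   by (rule derivative_eq_intros DERIV_chain2[OF UG cv] refl)+ (simp add: algebra_simps)
  moreover have "c * c powr (wt - 1) * (c * v) powr (- wt) * (exp (- (c * v)) * exp (c * v)) = v powr (- wt)"
   using c v by (simp add: powr_mult powr_diff powr_minus field_simps exp_minus)
  ultimately show ?thesis using False unfolding shadow_coeff.simps c_def[symmetric] by simp
 qed
next
 case (Suc j)
 have "((\<lambda>v. (- 1) ^ j * pochhammer wt j * v powr (- wt - real j)) has_real_derivative
   (- 1) ^ j * pochhammer wt j * ((- wt - real j) * v powr (- wt - real j - 1))) (at v)"
  using v by (intro DERIV_cmult) (auto intro!: derivative_eq_intros)
 moreover have "(- 1) ^ j * pochhammer wt j * ((- wt - real j) * v powr (- wt - real j - 1)) =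
   (- 1) ^ Suc j * pochhammer wt (Suc j) * v powr (- wt - real (Suc j))"
  by (simp add: pochhammer_Suc algebra_simps)
 ultimately have "((\<lambda>v. 4 * pi * (gq d x) * shadow_coeff wt d j x v
   + (- 1) ^ j * pochhammer wt j * v powr (- wt - real j)) has_real_derivative
   4 * pi * (gq d x) * shadow_coeff wt d (Suc j) x v + (- 1) ^ Suc j * pochhammer wt (Suc j) * v powr (- wt - real (Suc j))) (at v)"
  by (intro DERIV_add DERIV_cmult Suc.IH) simp
 then show ?case by simp
qed

text \<open>The rate v^(-1/2) is common to both weights. For x = 0 and \<open>wt\<close> = 3/2 it is
  the term v^(1-\<open>wt\<close>) itself, while \<open>wt\<close> = 1/2 comes with w 0 = 0. For x
  nonzero the exponential cancels against the incomplete Gamma function, and v^(-\<open>wt\<close>)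
  remains. Each further derivative costs two powers of |x|, hence the exponent 2j + 1.\<close>

lemma shadow_coeff_bound:
 assumes d: "d > 0" and wt: "wt = 3 / 2 \<or> wt = 1 / 2 \<and> w 0 = 0"
  and w: "\<And>x. \<bar>w x\<bar> \<le> C * ab x" and v0: "0 < v0"
 shows "\<exists>K\<ge>0. \<forall>x v. v \<ge> v0 \<longrightarrow> \<bar>w x * shadow_coeff wt d j x v\<bar> \<le> K * ab x ^ (2 * j + 1) * v powr (- 1 / 2)"
proof -
 have C: "C \<ge> 0" using w[of 0] by (simp add: order_trans[OF abs_ge_zero])
 have pw: "v powr (- wt - real j) \<le> v0 powr (1 / 2 - wt - real j) * v powr (- 1 / 2)" if "v \<ge> v0" for j v
 proof -
  have "v powr (- wt - real j) = v powr (1 / 2 - wt - real j) * v powr (- 1 / 2)"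
   by (simp add: powr_add[symmetric])
  also have "\<dots> \<le> v0 powr (1 / 2 - wt - real j) * v powr (- 1 / 2)"
   using that v0 wt by (intro mult_right_mono powr_mono2') auto
  finally show ?thesis .
 qed
 show ?thesis
 proof (induction j)
  case 0
  define K where "K = C * (2 + d / (2 * pi) * v0 powr (1 / 2 - wt - real 0))"
  have "\<bar>w x * shadow_coeff wt d 0 x v\<bar> \<le> K * ab x ^ (2 * 0 + 1) * v powr (- 1 / 2)" if v: "v \<ge> v0" for x v
  proof -
   have vp: "v > 0" using v v0 by simp
   have "\<bar>w x * shadow_coeff wt d 0 x v\<bar> \<le> C * ab x * ((2 + d / (2 * pi) * v0 powr (1 / 2 - wt - real 0)) * v powr (- 1 / 2))"
   proof (cases "x = 0")
    case True
    show ?thesis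
    proof (cases "w 0 = 0")
     case True
     then show ?thesis using \<open>x = 0\<close> C d by simp
    next
     case False
     then have "wt = 3 / 2" using wt by simp
     then have "1 - wt = - 1 / 2" by simp
     then have "shadow_coeff wt d 0 x v = - 2 * v powr (- 1 / 2)" using True by (simp only: shadow_coeff.simps if_True) simp
     then have "\<bar>shadow_coeff wt d 0 x v\<bar> \<le> (2 + d / (2 * pi) * v0 powr (1 / 2 - wt - real 0)) * v powr (- 1 / 2)"
      using d by (simp add: ring_distribs)
     then show ?thesis unfolding abs_mult using w[of x] C by (intro mult_mono) auto
    qed
   next
    case False
    define c where "c = 4 * pi * (gq d x)"
    have c: "c > 0" using False d by (simp add: c_def)
    have "0 < x\<^sup>2" by (rule zero_less_power2[THEN iffD2, OF False])
    then have "1 \<le> x\<^sup>2" by (simp only: int_one_le_iff_zero_less)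
    then have "1 \<le> ri (x\<^sup>2)" by (simp only: of_int_1_le_iff)
    then have "1 \<le> (ri x)\<^sup>2" by (simp only: of_int_power)
    then have "4 * pi * (1 / (2 * d)) \<le> c" unfolding c_def using d by (intro mult_left_mono divide_right_mono) auto
    then have cd: "1 / c \<le> d / (2 * pi)" using d c by (simp add: field_simps)
    have "\<bar>shadow_coeff wt d 0 x v\<bar> = c powr (wt - 1) * upper_Gamma (1 - wt) (c * v) * exp (c * v)"
    proof -
     have "shadow_coeff wt d 0 x v = - (c powr (wt - 1) * upper_Gamma (1 - wt) (c * v) * exp (c * v))"
      using False by (simp only: shadow_coeff.simps c_def if_False)
     moreover have "0 \<le> upper_Gamma (1 - wt) (c * v)"
      by (rule upper_Gamma_bounds(1)) (use c vp wt in auto)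
     ultimately show ?thesis by (simp add: abs_mult)
    qed
    also have "\<dots> \<le> c powr (wt - 1) * ((c * v) powr (1 - wt - 1) * exp (- (c * v))) * exp (c * v)"
     using upper_Gamma_bounds(2)[of "c * v" "1 - wt"] c vp wt by (intro mult_right_mono mult_left_mono) auto
    also have "\<dots> = 1 / c * v powr (- wt)"
     using c vp by (simp add: powr_mult powr_diff powr_minus exp_minus field_simps)
    also have "\<dots> \<le> d / (2 * pi) * (v0 powr (1 / 2 - wt - real 0) * v powr (- 1 / 2))"
     using pw[OF v, of 0] cd c d by (intro mult_mono) auto
    also have "\<dots> \<le> (2 + d / (2 * pi) * v0 powr (1 / 2 - wt - real 0)) * v powr (- 1 / 2)"
    proof -
     have gen: "A * (B * p) \<le> (2 + A * B) * p" if "p \<ge> 0" for A B p :: real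
      using that by (simp add: ring_distribs)
     show ?thesis by (rule gen) simp
    qed
    finally show ?thesis unfolding abs_mult using w[of x] C by (intro mult_mono) auto
   qed
   also have "\<dots> = K * ab x ^ (2 * 0 + 1) * v powr (- 1 / 2)" by (simp add: K_def)
   finally show ?thesis .
  qed
  moreover have "K \<ge> 0" using C d by (auto simp: K_def)
  ultimately show ?case by blast
 next
  case (Suc j)
  then obtain K where K: "K \<ge> 0" "\<And>x v. v \<ge> v0 \<Longrightarrow> \<bar>w x * shadow_coeff wt d j x v\<bar> \<le> K * ab x ^ (2 * j + 1) * v powr (- 1 / 2)"
   by blast
  define K' where "K' = 4 * pi / (2 * d) * K + C * (pochhammer wt j * v0 powr (1 / 2 - wt - real j))"
  have p: "pochhammer wt j > 0" using wt by (intro pochhammer_pos) auto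
  have "\<bar>w x * shadow_coeff wt d (Suc j) x v\<bar> \<le> K' * ab x ^ (2 * Suc j + 1) * v powr (- 1 / 2)" if v: "v \<ge> v0" for x v
  proof -
   let ?y = "1 + ri \<bar>x\<bar>"
   have x2: "(ri x)\<^sup>2 \<le> ?y ^ 2" by (subst power2_abs[symmetric], intro power_mono) auto
   have y1: "?y \<le> ?y ^ (2 * Suc j + 1)" by (rule self_le_power) auto
   have "w x * shadow_coeff wt d (Suc j) x v = 4 * pi / (2 * d) * (ri x)\<^sup>2 * (w x * shadow_coeff wt d j x v)
     + w x * ((- 1) ^ j * pochhammer wt j * v powr (- wt - real j))" by (simp add: algebra_simps)
   also have "\<bar>\<dots>\<bar> \<le> \<bar>4 * pi / (2 * d) * (ri x)\<^sup>2 * (w x * shadow_coeff wt d j x v)\<bar>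
     + \<bar>w x * ((- 1) ^ j * pochhammer wt j * v powr (- wt - real j))\<bar>" by (rule abs_triangle_ineq)
   also have "\<dots> = 4 * pi / (2 * d) * (ri x)\<^sup>2 * \<bar>w x * shadow_coeff wt d j x v\<bar>
     + \<bar>w x\<bar> * (pochhammer wt j * v powr (- wt - real j))"
    using d p by (simp add: abs_mult power_abs)
   also have "\<dots> \<le> 4 * pi / (2 * d) * ?y ^ 2 * (K * ?y ^ (2 * j + 1) * v powr (- 1 / 2))
     + C * ?y ^ (2 * Suc j + 1) * (pochhammer wt j * (v0 powr (1 / 2 - wt - real j) * v powr (- 1 / 2)))"
   proof (intro add_mono mult_mono x2 K(2)[OF v] pw[OF v] order_refl)
    show "\<bar>w x\<bar> \<le> C * ?y ^ (2 * Suc j + 1)" using w[of x] mult_left_mono[OF y1 C] by linarith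
   qed (use d C p K(1) in auto)
   also have "\<dots> = K' * ?y ^ (2 * Suc j + 1) * v powr (- 1 / 2)"
   proof -
    have gen: "a * y ^ 2 * (K * y ^ (2 * j + 1) * t) + C * y ^ (2 * Suc j + 1) * (P * (b * t)) = (a * K + C * (P * b)) * y ^ (2 * Suc j + 1) * t"
     for a y t P b :: real by (simp add: algebra_simps power2_eq_square)
    show ?thesis unfolding K'_def by (rule gen)
   qed
   finally show ?thesis .
  qed
  moreover have "K' \<ge> 0" using C d K(1) p by (auto simp: K'_def)
  ultimately show ?case by blast
 qed
qed

declare shadow_coeff.simps [simp del]

section \<open>Theta series and shadow series on the upper half-plane\<close>

definition theta_series :: "(int \<Rightarrow> real) \<Rightarrow> real \<Rightarrow> complex \<Rightarrow> complex" where
 "theta_series w d z = (\<Sum>\<^sub>\<infinity>x. of_real (w x) * e (of_real (gq d x) * z))"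

definition shadow_series :: "(int \<Rightarrow> real) \<Rightarrow> real \<Rightarrow> real \<Rightarrow> nat \<Rightarrow> complex \<Rightarrow> complex" where
 "shadow_series w wt d j z = (\<Sum>\<^sub>\<infinity>x. of_real (w x * shadow_coeff wt d j x (Im z)) *
   cnj (e (of_real (gq d x) * z))) / (2 * \<i>) ^ j"

lemma norm_e_theta: "cmod (e (of_real (gq d x) * z)) = exp (- (2 * pi * Im z / (2 * d)) * (ri x)\<^sup>2)"
 by (simp add: norm_e)

lemma theta_term_mono:
 assumes "d > 0" "v0 \<le> Im z"
 shows "cmod (e (of_real (gq d x) * z)) \<le> exp (- (2 * pi * v0 / (2 * d)) * (ri x)\<^sup>2)"
 unfolding norm_e_theta using assms by (auto intro!: mult_right_mono divide_right_mono)

lemma theta_series_derivative: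
 assumes d: "d > 0" and w: "\<And>x. \<bar>w x\<bar> \<le> C * ab x" and y: "y \<in> uhp"
 shows "\<exists>D. has_wirtinger (theta_series w d) D 0 y"
proof -
 have C: "C \<ge> 0" using w[of 0] by (simp add: order_trans[OF abs_ge_zero])
 define v0 where "v0 = Im y / 2"
 have v0: "0 < v0" "v0 < Im y" using y by (auto simp: v0_def uhp_def)
 let ?q = "\<lambda>x. gq d x"
 define B where "B x = (C * (1 + 2 * pi / (2 * d))) * (ab x ^ 3 * exp (- (2 * pi * v0 / (2 * d)) * (ri x)\<^sup>2))" for x
 have B: "B summable_on UNIV" unfolding B_def
  by (intro summable_on_cmult_right summable_on_gauss) (use v0 d in auto)
 have b: "C * ab x * t * exp (- (2 * pi * v0 / (2 * d)) * (ri x)\<^sup>2) \<le> B x"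
  if "t \<le> (1 + 2 * pi / (2 * d)) * ab x ^ 2" for t x
 proof -
  have "C * ab x * t \<le> C * ab x * ((1 + 2 * pi / (2 * d)) * ab x ^ 2)"
   using C that by (intro mult_left_mono) auto
  also have "\<dots> = C * (1 + 2 * pi / (2 * d)) * ab x ^ 3" by (simp add: power3_eq_cube power2_eq_square)
  finally show ?thesis unfolding B_def by (simp add: mult.assoc[symmetric] mult_right_mono)
 qed
 have x2: "(ri x)\<^sup>2 \<le> (1 + ri \<bar>x\<bar>) ^ 2" for x
  by (subst power2_abs[symmetric], intro power_mono) auto
 have "has_wirtinger (\<lambda>y. \<Sum>\<^sub>\<infinity>x. of_real (w x) * e (of_real (?q x) * y))
   (\<Sum>\<^sub>\<infinity>x. of_real (w x) * (2 * of_real pi * \<i> * e (of_real (?q x) * y) * of_real (?q x))) (\<Sum>\<^sub>\<infinity>x::int. 0) y"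
 proof (rule has_wirtinger_infsum[where ?v0.0 = v0 and B = B])
  fix x h assume s: "Im h > v0"
  show "has_wirtinger (\<lambda>h. of_real (w x) * e (of_real (?q x) * h)) (of_real (w x) * (2 * of_real pi * \<i> * e (of_real (?q x) * h) * of_real (?q x))) 0 h"
   by (rule has_wirtinger_holomorphic) (use d in \<open>auto intro!: derivative_eq_intros\<close>)
  note m = theta_term_mono[OF d less_imp_le[OF s], of x]
  have "cmod (of_real (w x) * e (of_real (?q x) * h)) \<le> C * ab x * 1 * exp (- (2 * pi * v0 / (2 * d)) * (ri x)\<^sup>2)"
   unfolding norm_mult using w[of x] m C by (intro mult_mono) auto
  also have "\<dots> \<le> B x"
  proof (rule b)
   have "1 \<le> (1 + 2 * pi / (2 * d))" "1 \<le> (1 + ri \<bar>x\<bar>) ^ 2" using d by (auto intro: one_le_power)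
   from mult_mono[OF this] show "1 \<le> (1 + 2 * pi / (2 * d)) * ab x ^ 2" using d by simp
  qed
  finally show "cmod (of_real (w x) * e (of_real (?q x) * h)) \<le> B x" .
  then show "cmod 0 \<le> B x" using norm_ge_zero order_trans by (metis norm_zero)
  have "cmod (of_real (w x) * (2 * of_real pi * \<i> * e (of_real (?q x) * h) * of_real (?q x)))
    = \<bar>w x\<bar> * (2 * pi * ?q x) * cmod (e (of_real (?q x) * h))"
  proof -
   have gen: "cmod (of_real W * (2 * of_real pi * \<i> * z * of_real Q)) = \<bar>W\<bar> * (2 * pi * Q) * cmod z" if "Q \<ge> 0" for W Q z
    using that by (simp add: norm_mult)
   show ?thesis by (rule gen) (use d in simp)
  qed
  also have "\<dots> \<le> C * ab x * (2 * pi * ?q x) * exp (- (2 * pi * v0 / (2 * d)) * (ri x)\<^sup>2)"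
   using w[of x] m C d by (intro mult_mono) auto
  also have "\<dots> \<le> B x"
  proof (rule b)
   have "2 * pi * ?q x \<le> 2 * pi / (2 * d) * ab x ^ 2"
    using x2[of x] d mult_left_mono[OF x2[of x], of "2 * pi / (2 * d)"] by simp
   then show "2 * pi * ?q x \<le> (1 + 2 * pi / (2 * d)) * ab x ^ 2"
    by (simp add: ring_distribs add_increasing)
  qed
  finally show "cmod (of_real (w x) * (2 * of_real pi * \<i> * e (of_real (?q x) * h) * of_real (?q x))) \<le> B x" .
 qed (use B v0 in auto)
 then show ?thesis unfolding theta_series_def[abs_def] by auto
qed

lemma holomorphic_theta_series:
 assumes d: "d > 0" and w: "\<And>x. \<bar>w x\<bar> \<le> C * ab x"
 shows "theta_series w d holomorphic_on uhp"
 unfolding holomorphic_on_open[OF open_uhp]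
proof
 fix z assume "z \<in> uhp"
 from theta_series_derivative[OF d w this] obtain D where "has_wirtinger (theta_series w d) D 0 z" by auto
 then show "\<exists>f'. (theta_series w d has_field_derivative f') (at z)"
  by (auto simp: has_wirtinger_def has_field_derivative_def)
qed

lemma theta_series_summable:
 assumes d: "d > 0" and w: "\<And>x. \<bar>w x\<bar> \<le> C * ab x" and z: "z \<in> uhp"
 shows "(\<lambda>x. cmod (of_real (w x) * e (of_real (gq d x) * z))) summable_on UNIV"
proof (rule summable_on_comparison_test)
 show "(\<lambda>x::int. C * (ab x ^ 1 * exp (- (2 * pi * Im z / (2 * d)) * (ri x)\<^sup>2))) summable_on UNIV"
  by (intro summable_on_cmult_right summable_on_gauss) (use z d in \<open>auto simp: uhp_def\<close>)
 show "cmod (of_real (w x) * e (of_real (gq d x) * z)) \<le> C * (ab x ^ 1 * exp (- (2 * pi * Im z / (2 * d)) * (ri x)\<^sup>2))" for x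
  unfolding norm_mult norm_e_theta mult.assoc[symmetric] using w[of x] by (intro mult_mono) auto
qed auto

lemma moderate_growth_theta_series:
 assumes d: "d > 0" and w: "\<And>x. \<bar>w x\<bar> \<le> C * ab x"
 shows "moderate_growth (theta_series w d)"
proof -
 have C: "C \<ge> 0" using w[of 0] by (simp add: order_trans[OF abs_ge_zero])
 define B where "B x = C * (ab x ^ 1 * exp (- (2 * pi * 1 / (2 * d)) * (ri x)\<^sup>2))" for x
 have B: "B summable_on UNIV" unfolding B_def
  by (intro summable_on_cmult_right summable_on_gauss) (use d in auto)
 show ?thesis
 proof (rule moderate_growthI[where B = 1 and D = "\<Sum>\<^sub>\<infinity>x. B x" and C = 0])
  fix z assume t: "1 \<le> Im z"
  have le: "cmod (of_real (w x) * e (of_real (gq d x) * z)) \<le> B x" for x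
   unfolding norm_mult B_def mult.assoc[symmetric] using w[of x] theta_term_mono[OF d t, of x] C by (intro mult_mono) auto
  have s: "(\<lambda>x. of_real (w x) * e (of_real (gq d x) * z)) summable_on UNIV"
   by (rule abs_summable_summable, rule theta_series_summable[OF d w]) (use t in \<open>auto simp: uhp_def\<close>)
  have "cmod (theta_series w d z) \<le> (\<Sum>\<^sub>\<infinity>x. B x)"
   unfolding theta_series_def by (rule norm_infsum_le[OF has_sum_infsum[OF s] has_sum_infsum[OF B] le])
  then show "cmod (theta_series w d z) \<le> (\<Sum>\<^sub>\<infinity>x. B x) * exp (0 * Im z)" by simp
 qed
qed

text \<open>Differentiating the conjugated exponential in the antiholomorphic direction cancels the
  multiple 4 pi q of the preceding coefficient in the recursion for \<open>shadow_coeff\<close>, so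
  that a pure power of v remains and the series collapses to the conjugate of the theta series. In
  the holomorphic direction only the coefficient is differentiated, which moves j to j + 1.\<close>

lemma shadow_series_wirtinger:
 assumes d: "d > 0" and wt: "wt = 3 / 2 \<or> wt = 1 / 2 \<and> w 0 = 0"
  and w: "\<And>x. \<bar>w x\<bar> \<le> C * ab x" and t: "t \<in> uhp"
 shows "has_wirtinger (shadow_series w wt d j) (shadow_series w wt d (Suc j) t) (shadow_deriv wt (theta_series w d) j t) t"
proof -
 have wt': "wt > 0" "wt \<noteq> 1" using wt by auto
 have C: "C \<ge> 0" using w[of 0] by (simp add: order_trans[OF abs_ge_zero])
 define v0 where "v0 = Im t / 2"
 have v0: "0 < v0" "v0 < Im t" using t by (auto simp: v0_def uhp_def)
 define q where "q x = gq d x" for x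
 obtain K0 where K0: "K0 \<ge> 0" "\<And>x v. v \<ge> v0 \<Longrightarrow> \<bar>w x * shadow_coeff wt d j x v\<bar> \<le> K0 * ab x ^ (2 * j + 1) * v powr (- 1 / 2)"
  using shadow_coeff_bound[OF d wt w v0(1), of j] by blast
 obtain K1 where K1: "K1 \<ge> 0" "\<And>x v. v \<ge> v0 \<Longrightarrow> \<bar>w x * shadow_coeff wt d (Suc j) x v\<bar> \<le> K1 * ab x ^ (2 * Suc j + 1) * v powr (- 1 / 2)"
  using shadow_coeff_bound[OF d wt w v0(1), of "Suc j"] by blast
 define p where "p = v0 powr (- 1 / 2)"
 have p0: "p > 0" using v0 by (simp add: p_def)
 have pv: "v powr (- 1 / 2) \<le> p" if "v \<ge> v0" for v unfolding p_def using that v0 by (intro powr_mono2') auto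
 define pc where "pc v = (- 1) ^ j * pochhammer wt j * v powr (- wt - real j)" for v :: real
 define L where "L = pochhammer wt j * v0 powr (- wt - real j)"
 have pc: "\<bar>pc v\<bar> \<le> L" if "v \<ge> v0" for v
 proof -
  have "v powr (- wt - real j) \<le> v0 powr (- wt - real j)" using that v0 wt' by (intro powr_mono2') auto
  then show ?thesis unfolding pc_def L_def using pochhammer_pos[OF wt'(1), of j] by (simp add: abs_mult)
 qed
 have L0: "L \<ge> 0" using pc[of v0] by (meson abs_ge_zero order_refl order_trans)
 define B where "B x = (K0 * p + K1 * p + C * L) * (ab x ^ (2 * Suc j + 1) * exp (- (2 * pi * v0 / (2 * d)) * (ri x)\<^sup>2))" for x
 have B: "B summable_on UNIV" unfolding B_def
  by (intro summable_on_cmult_right summable_on_gauss) (use v0 d in auto)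
 have b: "cmod (of_real g * cnj (e (of_real (q x) * h))) \<le> B x"
  if "\<bar>g\<bar> \<le> (K0 * p + K1 * p + C * L) * ab x ^ (2 * Suc j + 1)" "Im h > v0" for g x h
 proof -
  have "cmod (of_real g * cnj (e (of_real (q x) * h))) = \<bar>g\<bar> * cmod (e (of_real (q x) * h))" by (simp add: norm_mult)
  also have "\<dots> \<le> (K0 * p + K1 * p + C * L) * ab x ^ (2 * Suc j + 1) * exp (- (2 * pi * v0 / (2 * d)) * (ri x)\<^sup>2)"
   unfolding q_def using that(1) theta_term_mono[OF d less_imp_le[OF that(2)], of x] order_trans[OF abs_ge_zero that(1)]
   by (intro mult_mono) auto
  finally show ?thesis by (simp add: B_def)
 qed
 have y: "1 \<le> 1 + ri \<bar>x\<bar>" for x by simp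
 have b0: "\<bar>w x * shadow_coeff wt d j x v\<bar> \<le> (K0 * p + K1 * p + C * L) * ab x ^ (2 * Suc j + 1)" if v: "v > v0" for x v
 proof -
  have "\<bar>w x * shadow_coeff wt d j x v\<bar> \<le> K0 * ab x ^ (2 * j + 1) * v powr (- 1 / 2)" by (rule K0(2)[OF less_imp_le[OF v]])
  also have "\<dots> \<le> K0 * ab x ^ (2 * Suc j + 1) * p"
   using pv[of v] v K0(1) y[of x] by (intro mult_mono power_increasing) auto
  also have "\<dots> = K0 * p * ab x ^ (2 * Suc j + 1)" by simp
  also have "\<dots> \<le> (K0 * p + K1 * p + C * L) * ab x ^ (2 * Suc j + 1)"
   using K1(1) C L0 p0 by (intro mult_right_mono) auto
  finally show ?thesis .
 qed
 have b1: "\<bar>w x * shadow_coeff wt d (Suc j) x v\<bar> \<le> (K0 * p + K1 * p + C * L) * ab x ^ (2 * Suc j + 1)" if v: "v > v0" for x v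
 proof -
  have "\<bar>w x * shadow_coeff wt d (Suc j) x v\<bar> \<le> K1 * ab x ^ (2 * Suc j + 1) * v powr (- 1 / 2)" by (rule K1(2)[OF less_imp_le[OF v]])
  also have "\<dots> \<le> K1 * ab x ^ (2 * Suc j + 1) * p"
   using pv[of v] v K1(1) by (intro mult_mono) auto
  also have "\<dots> = K1 * p * ab x ^ (2 * Suc j + 1)" by simp
  also have "\<dots> \<le> (K0 * p + K1 * p + C * L) * ab x ^ (2 * Suc j + 1)"
   using K0(1) C L0 p0 by (intro mult_right_mono) auto
  finally show ?thesis .
 qed
 have b2: "\<bar>w x * pc v\<bar> \<le> (K0 * p + K1 * p + C * L) * ab x ^ (2 * Suc j + 1)" if v: "v > v0" for x v
 proof -
  have "\<bar>w x * pc v\<bar> \<le> C * ab x * L" unfolding abs_mult using w[of x] pc[of v] v C by (intro mult_mono) auto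
  also have "\<dots> = C * L * ab x" by simp
  also have "\<dots> \<le> (K0 * p + K1 * p + C * L) * ab x ^ (2 * Suc j + 1)"
   using K0(1) K1(1) C L0 p0 y[of x] by (intro mult_mono self_le_power) auto
  finally show ?thesis .
 qed
 have "has_wirtinger (\<lambda>t. \<Sum>\<^sub>\<infinity>x. of_real (w x * shadow_coeff wt d j x (Im t)) * cnj (e (of_real (q x) * t)))
   (\<Sum>\<^sub>\<infinity>x. of_real (w x * shadow_coeff wt d (Suc j) x (Im t)) / (2 * \<i>) * cnj (e (of_real (q x) * t)))
   (\<Sum>\<^sub>\<infinity>x. - of_real (w x * pc (Im t)) / (2 * \<i>) * cnj (e (of_real (q x) * t))) t"
 proof (rule has_wirtinger_infsum[where ?v0.0 = v0 and B = B])
  fix x h assume s: "Im h > v0"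
  have 1: "has_wirtinger (\<lambda>h. of_real (w x * shadow_coeff wt d j x (Im h))) (of_real (w x * shadow_coeff wt d (Suc j) x (Im h)) / (2 * \<i>))
    (- of_real (w x * shadow_coeff wt d (Suc j) x (Im h)) / (2 * \<i>)) h"
   by (rule has_wirtinger_Im[of "\<lambda>v. w x * shadow_coeff wt d j x v"])
     (intro DERIV_cmult shadow_coeff_derivative d wt', use s v0 in auto)
  have 2: "has_wirtinger (\<lambda>h. cnj (e (of_real (q x) * h))) 0 (cnj (2 * of_real pi * \<i> * e (of_real (q x) * h) * of_real (q x))) h"
   by (rule has_wirtinger_cnj) (auto intro!: derivative_eq_intros)
  have sc: "shadow_coeff wt d (Suc j) x (Im h) = 4 * pi * q x * shadow_coeff wt d j x (Im h) + pc (Im h)"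
   by (simp add: q_def pc_def shadow_coeff.simps)
  show "has_wirtinger (\<lambda>h. of_real (w x * shadow_coeff wt d j x (Im h)) * cnj (e (of_real (q x) * h)))
    (of_real (w x * shadow_coeff wt d (Suc j) x (Im h)) / (2 * \<i>) * cnj (e (of_real (q x) * h)))
    (- of_real (w x * pc (Im h)) / (2 * \<i>) * cnj (e (of_real (q x) * h))) h"
  proof -
   have "- of_real (w x * shadow_coeff wt d (Suc j) x (Im h)) / (2 * \<i>) * cnj (e (of_real (q x) * h)) +
    of_real (w x * shadow_coeff wt d j x (Im h)) * cnj (2 * of_real pi * \<i> * e (of_real (q x) * h) * of_real (q x)) =
    - of_real (w x * pc (Im h)) / (2 * \<i>) * cnj (e (of_real (q x) * h))"
    unfolding sc by (simp add: field_simps)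
   then show ?thesis using has_wirtinger_mult[OF 1 2] by (simp only: mult_zero_right add_0_right)
  qed
  show "cmod (of_real (w x * shadow_coeff wt d j x (Im h)) * cnj (e (of_real (q x) * h))) \<le> B x"
   by (intro b b0 s)
  have half: "cmod (c / (2 * \<i>) * z) \<le> cmod (c * z)" "cmod (- c / (2 * \<i>) * z) \<le> cmod (c * z)" for c z
   using mult_nonneg_nonneg[of "cmod c" "cmod z"] by (simp_all add: norm_mult norm_divide)
  show "cmod (of_real (w x * shadow_coeff wt d (Suc j) x (Im h)) / (2 * \<i>) * cnj (e (of_real (q x) * h))) \<le> B x"
   by (rule order_trans[OF half(1)]) (intro b b1 s)
  show "cmod (- of_real (w x * pc (Im h)) / (2 * \<i>) * cnj (e (of_real (q x) * h))) \<le> B x"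
   by (rule order_trans[OF half(2)]) (intro b b2 s)
 qed (use B v0 in auto)
 from has_wirtinger_cmult[OF this, of "1 / (2 * \<i>) ^ j"]
 have W: "has_wirtinger (shadow_series w wt d j)
   (1 / (2 * \<i>) ^ j * (\<Sum>\<^sub>\<infinity>x. of_real (w x * shadow_coeff wt d (Suc j) x (Im t)) / (2 * \<i>) * cnj (e (of_real (q x) * t))))
   (1 / (2 * \<i>) ^ j * (\<Sum>\<^sub>\<infinity>x. - of_real (w x * pc (Im t)) / (2 * \<i>) * cnj (e (of_real (q x) * t)))) t"
  by (simp add: shadow_series_def[abs_def] q_def)
 have a: "(\<Sum>\<^sub>\<infinity>x. of_real (w x * shadow_coeff wt d (Suc j) x (Im t)) / (2 * \<i>) * cnj (e (of_real (q x) * t))) =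
   (\<Sum>\<^sub>\<infinity>x. of_real (w x * shadow_coeff wt d (Suc j) x (Im t)) * cnj (e (of_real (q x) * t))) / (2 * \<i>)"
  using infsum_cmult_right'[of "1 / (2 * \<i>)" "\<lambda>x. of_real (w x * shadow_coeff wt d (Suc j) x (Im t)) * cnj (e (of_real (q x) * t))" UNIV]
  by (simp add: mult_ac)
 have "(\<Sum>\<^sub>\<infinity>x. - of_real (w x * pc (Im t)) / (2 * \<i>) * cnj (e (of_real (q x) * t))) =
   (\<Sum>\<^sub>\<infinity>x. (- of_real (pc (Im t)) / (2 * \<i>)) * cnj (of_real (w x) * e (of_real (q x) * t)))"
  by (rule infsum_cong) simp
 also have "\<dots> = - of_real (pc (Im t)) / (2 * \<i>) * (\<Sum>\<^sub>\<infinity>x. cnj (of_real (w x) * e (of_real (q x) * t)))"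
  by (rule infsum_cmult_right')
 also have "(\<Sum>\<^sub>\<infinity>x. cnj (of_real (w x) * e (of_real (q x) * t))) = cnj (theta_series w d t)"
  unfolding theta_series_def q_def by (rule infsum_cnj)
 finally have b': "(\<Sum>\<^sub>\<infinity>x. - of_real (w x * pc (Im t)) / (2 * \<i>) * cnj (e (of_real (q x) * t))) =
   - of_real (pc (Im t)) / (2 * \<i>) * cnj (theta_series w d t)" .
 have "- 1 / (2 * \<i>) = \<i> / 2" by (simp add: complex_eq_iff)
 then have "- of_real (pc (Im t)) / (2 * \<i>) * cnj (theta_series w d t) = \<i> / 2 * cnj (theta_series w d t) * of_real (pc (Im t))"
  by (metis (no_types, lifting) minus_divide_left mult.assoc mult.commute mult_minus1 times_divide_eq_left)
 then have "1 / (2 * \<i>) ^ j * (- of_real (pc (Im t)) / (2 * \<i>) * cnj (theta_series w d t)) = shadow_deriv wt (theta_series w d) j t"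
  by (simp only: shadow_deriv_def pc_def times_divide_times_eq times_divide_eq_left mult_1_left)
 moreover have "1 / (2 * \<i>) ^ j * ((\<Sum>\<^sub>\<infinity>x. of_real (w x * shadow_coeff wt d (Suc j) x (Im t)) * cnj (e (of_real (q x) * t))) / (2 * \<i>))
   = shadow_series w wt d (Suc j) t"
  by (simp only: shadow_series_def q_def times_divide_times_eq mult_1_left power_Suc2)
 ultimately show ?thesis using W unfolding a b' by (simp only:)
qed

section \<open>Existence and uniqueness of the decomposition of one component\<close>

definition fourier_half :: "real \<Rightarrow> real \<Rightarrow> real \<Rightarrow> (real \<Rightarrow> complex) \<Rightarrow> (real \<Rightarrow> complex) \<Rightarrow> complex \<Rightarrow> (complex \<Rightarrow> complex) \<Rightarrow> (complex \<Rightarrow> complex) \<Rightarrow> bool" where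
 "fourier_half wt \<alpha> n0 cp cm d fp fm \<longleftrightarrow> (\<forall>z\<in>uhp.
   ((\<lambda>n. cp n * e (of_real n * z)) has_sum fp z) {n. n - \<alpha> \<in> \<int> \<and> n \<ge> n0} \<and>
   ((\<lambda>n. cm n * of_real (upper_Gamma (1 - wt) (4 * pi * \<bar>n\<bar> * Im z)) * e (of_real n * z))
    has_sum (fm z - d * of_real (Im z powr (1 - wt)))) {n. n - \<alpha> \<in> \<int> \<and> n < 0})"

lemma has_sum_diff:
 fixes f g :: "'a \<Rightarrow> complex"
 assumes "(f has_sum a) A" "(g has_sum b) A"
 shows "((\<lambda>x. f x - g x) has_sum (a - b)) A"
 using has_sum_add[OF assms(1) has_sum_cmult_right[OF assms(2), of "- 1"]] by simp

lemma has_sum_lower_bound_extend: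
 assumes "((\<lambda>n. c n * z n) has_sum s) {n. n - \<alpha> \<in> \<int> \<and> n \<ge> n0}" "m0 \<le> n0"
 shows "((\<lambda>n::real. (if n \<ge> n0 then c n else 0) * z n) has_sum (s :: complex)) {n. n - \<alpha> \<in> \<int> \<and> n \<ge> m0}"
 using assms(1) by (rule has_sum_cong_neutral[THEN iffD1, rotated -1]) (use assms(2) in auto)

lemma e_Complex: "e (of_real n * Complex u v) = e (of_real n * (\<i> * of_real v)) * er (n * u)"
 by (simp add: Complex_eq algebra_simps flip: e_add)

lemma upper_Gamma_tendsto_0:
 assumes "a \<le> 1" "c > 0"
 shows "((\<lambda>v. upper_Gamma a (c * v)) \<longlongrightarrow> 0) at_top"
proof (rule tendsto_sandwich[of "\<lambda>_. 0" _ _ "\<lambda>v. exp (- (c * v))"])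
 have ev: "eventually (\<lambda>v::real. v \<ge> 1 / c \<and> v > 0) at_top"
  using eventually_ge_at_top eventually_gt_at_top by (rule eventually_conj)
 show "eventually (\<lambda>v. 0 \<le> upper_Gamma a (c * v)) at_top"
  using ev by eventually_elim (use assms in \<open>auto intro!: upper_Gamma_bounds(1)\<close>)
 show "eventually (\<lambda>v. upper_Gamma a (c * v) \<le> exp (- (c * v))) at_top"
  using ev
 proof eventually_elim
  case (elim v)
  then have cv: "c * v \<ge> 1" using assms by (simp add: field_simps)
  have "upper_Gamma a (c * v) \<le> (c * v) powr (a - 1) * exp (- (c * v))"
   by (rule upper_Gamma_bounds(2)) (use assms elim in auto)
  also have "\<dots> \<le> 1 * exp (- (c * v))"
   using cv assms powr_mono2'[of "a - 1" 1 "c * v"] by (intro mult_right_mono) auto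
  finally show ?case by simp
 qed
 have "filterlim (\<lambda>v. c * v) at_top at_top"
  using assms by (intro filterlim_tendsto_pos_mult_at_top[OF tendsto_const _ filterlim_ident])
 then have "filterlim (\<lambda>v. - (c * v)) at_bot at_top" by (simp add: filterlim_uminus_at_top)
 then show "((\<lambda>v. exp (- (c * v))) \<longlongrightarrow> 0) at_top"
  by (rule filterlim_compose[OF exp_at_bot])
qed auto

text \<open>Take the m-th Fourier coefficient of the difference of the two expansions at height v
  and multiply by exp(2 pi m v): a constant equals a multiple of an incomplete Gamma value, present
  only for m < 0, plus a multiple of v^(1-\<open>wt\<close>) exp(2 pi m v). For m < 0 both terms
  tend to 0. For other m the last function would have to be constant, which is impossible as
  \<open>wt\<close> differs from 1.\<close>

lemma fourier_half_unique:
 assumes 1: "fourier_half wt \<alpha> n1 cp1 cm1 d1 fp1 fm1" and 2: "fourier_half wt \<alpha> n2 cp2 cm2 d2 fp2 fm2"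
  and eq: "\<And>t. t \<in> uhp \<Longrightarrow> fp1 t + fm1 t = fp2 t + fm2 t"
  and wt: "wt > 0" "wt \<noteq> 1" and t: "t \<in> uhp"
 shows "fp1 t = fp2 t"
proof -
 define m0 where "m0 = min n1 n2"
 define X where "X = {n. n - \<alpha> \<in> \<int>}"
 define p where "p n = (if n \<ge> n1 then cp1 n else 0) - (if n \<ge> n2 then cp2 n else 0)" for n
 define M where "M n = cm2 n - cm1 n" for n
 define D where "D = d2 - d1"
 define h where "h t = fp1 t - fp2 t" for t
 have hp: "((\<lambda>n. p n * e (of_real n * t)) has_sum h t) {n. n - \<alpha> \<in> \<int> \<and> n \<ge> m0}" if "t \<in> uhp" for t
 proof -
  have a: "((\<lambda>n. (if n \<ge> n1 then cp1 n else 0) * e (of_real n * t)) has_sum fp1 t) {n. n - \<alpha> \<in> \<int> \<and> n \<ge> m0}"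
   by (rule has_sum_lower_bound_extend) (use 1 that in \<open>auto simp: fourier_half_def m0_def\<close>)
  have b: "((\<lambda>n. (if n \<ge> n2 then cp2 n else 0) * e (of_real n * t)) has_sum fp2 t) {n. n - \<alpha> \<in> \<int> \<and> n \<ge> m0}"
   by (rule has_sum_lower_bound_extend) (use 2 that in \<open>auto simp: fourier_half_def m0_def\<close>)
  show ?thesis using has_sum_diff[OF a b] by (simp only: p_def h_def left_diff_distrib)
 qed
 have hm: "((\<lambda>n. M n * of_real (upper_Gamma (1 - wt) (4 * pi * \<bar>n\<bar> * Im t)) * e (of_real n * t))
   has_sum (h t - D * of_real (Im t powr (1 - wt)))) {n. n - \<alpha> \<in> \<int> \<and> n < 0}" if "t \<in> uhp" for t
 proof -
  have a: "((\<lambda>n. cm1 n * of_real (upper_Gamma (1 - wt) (4 * pi * \<bar>n\<bar> * Im t)) * e (of_real n * t))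
    has_sum (fm1 t - d1 * of_real (Im t powr (1 - wt)))) {n. n - \<alpha> \<in> \<int> \<and> n < 0}"
   using 1 that unfolding fourier_half_def by blast
  have b: "((\<lambda>n. cm2 n * of_real (upper_Gamma (1 - wt) (4 * pi * \<bar>n\<bar> * Im t)) * e (of_real n * t))
    has_sum (fm2 t - d2 * of_real (Im t powr (1 - wt)))) {n. n - \<alpha> \<in> \<int> \<and> n < 0}"
   using 2 that unfolding fourier_half_def by blast
  have "h t = fm2 t - fm1 t" using eq[OF that] by (simp add: h_def algebra_simps)
  then have "fm2 t - d2 * of_real (Im t powr (1 - wt)) - (fm1 t - d1 * of_real (Im t powr (1 - wt))) = h t - D * of_real (Im t powr (1 - wt))"
   by (simp add: D_def algebra_simps)
  then show ?thesis using has_sum_diff[OF b a] by (simp only: M_def left_diff_distrib)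
 qed
 have p0: "p m = 0" if m: "m - \<alpha> \<in> \<int>" "m \<ge> m0" for m
 proof -
  have X: "n - m \<in> \<int>" if "n - \<alpha> \<in> \<int>" for n
   using Ints_diff[OF that m(1)] by simp
  \<comment> \<open>The power of v is constant in u, but m lies in \<alpha> + \<int> and need not be
    an integer; so the coefficient z of this constant may be nonzero for m different from 0.\<close>
  define z where "z = integral {-1/2..1/2} (\<lambda>u::real. er (- m * u))"
  have main: "p m = (if m < 0 then M m * of_real (upper_Gamma (1 - wt) (4 * pi * \<bar>m\<bar> * v)) else 0)
    + D * z * of_real (v powr (1 - wt)) * of_real (exp (2 * pi * m * v))" if v: "v > 0" for v
  proof -
   let ?I = "integral {-1/2..1/2} (\<lambda>u. h (Complex u v) * er (- m * u))"
   have "((\<lambda>n. (p n * e (of_real n * (\<i> * of_real v))) * er (n * u)) has_sum h (Complex u v)) {n. n - \<alpha> \<in> \<int> \<and> n \<ge> m0}" for u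
    using hp[of "Complex u v"] v by (simp add: e_Complex mult.assoc)
   from fourier_coeff_has_sum[OF this, of m] have I1: "?I = p m * e (of_real m * (\<i> * of_real v))"
    using X m by simp
   have "((\<lambda>n. (M n * of_real (upper_Gamma (1 - wt) (4 * pi * \<bar>n\<bar> * v)) * e (of_real n * (\<i> * of_real v))) * er (n * u))
    has_sum (h (Complex u v) - D * of_real (v powr (1 - wt)))) {n. n - \<alpha> \<in> \<int> \<and> n < 0}" for u
    using hm[of "Complex u v"] v by (simp add: e_Complex mult.assoc)
   from fourier_coeff_has_sum[OF this, of m]
   have I2: "integral {-1/2..1/2} (\<lambda>u. (h (Complex u v) - D * of_real (v powr (1 - wt))) * er (- m * u)) =
     (if m < 0 then M m * of_real (upper_Gamma (1 - wt) (4 * pi * \<bar>m\<bar> * v)) * e (of_real m * (\<i> * of_real v)) else 0)"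
    using X m by simp
   have holh: "continuous_on {-1/2..1/2} (\<lambda>u. h (Complex u v))"
   proof -
    have "((\<lambda>n. (p n * e (of_real n * (\<i> * of_real v))) * er (n * u)) has_sum h (Complex u v)) {n. n - \<alpha> \<in> \<int> \<and> n \<ge> m0}" for u
     using hp[of "Complex u v"] v by (simp add: e_Complex mult.assoc)
    note hs = this
    have "(\<lambda>n. p n * e (of_real n * (\<i> * of_real v))) summable_on {n. n - \<alpha> \<in> \<int> \<and> n \<ge> m0}"
     using has_sum_imp_summable[OF hs[of 0]] by simp
    then have "(\<lambda>n. norm (p n * e (of_real n * (\<i> * of_real v)))) summable_on {n. n - \<alpha> \<in> \<int> \<and> n \<ge> m0}"
     by (simp add: summable_on_iff_abs_summable_on_complex)
    then have "uniform_limit {-1/2..1/2} (\<lambda>X u. \<Sum>n\<in>X. (p n * e (of_real n * (\<i> * of_real v))) * er (n * u)) (\<lambda>u. h (Complex u v)) (finite_subsets_at_top {n. n - \<alpha> \<in> \<int> \<and> n \<ge> m0})"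
     by (rule Weierstrass_m_test_general'[OF _ hs, rotated]) (simp add: norm_mult norm_e)
    then show ?thesis
     by (rule uniform_limit_theorem[rotated]) (auto intro!: always_eventually continuous_intros)
   qed
   have "integral {-1/2..1/2} (\<lambda>u. (h (Complex u v) - D * of_real (v powr (1 - wt))) * er (- m * u)) =
    integral {-1/2..1/2} (\<lambda>u. h (Complex u v) * er (- m * u) - D * of_real (v powr (1 - wt)) * er (- m * u))"
    by (simp add: left_diff_distrib)
   also have "\<dots> = ?I - integral {-1/2..1/2} (\<lambda>u. D * of_real (v powr (1 - wt)) * er (- m * u))"
    by (rule Henstock_Kurzweil_Integration.integral_diff) (intro integrable_continuous_interval continuous_intros holh)+
   also have "integral {-1/2..1/2} (\<lambda>u. D * of_real (v powr (1 - wt)) * er (- m * u)) = D * of_real (v powr (1 - wt)) * z"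
    unfolding z_def by simp
   finally have eq: "integral {-1/2..1/2} (\<lambda>u. (h (Complex u v) - D * of_real (v powr (1 - wt))) * er (- m * u)) = ?I - D * of_real (v powr (1 - wt)) * z" .
   then have "?I = integral {-1/2..1/2} (\<lambda>u. (h (Complex u v) - D * of_real (v powr (1 - wt))) * er (- m * u)) + D * of_real (v powr (1 - wt)) * z"
    by simp
   then have J: "p m * e (of_real m * (\<i> * of_real v)) = (if m < 0 then M m * of_real (upper_Gamma (1 - wt) (4 * pi * \<bar>m\<bar> * v)) * e (of_real m * (\<i> * of_real v)) else 0)
     + D * of_real (v powr (1 - wt)) * z" unfolding I1 I2 .
   have ev: "e (of_real m * (\<i> * of_real v)) = of_real (exp (- 2 * pi * m * v))"
   proof -
    have "2 * of_real pi * \<i> * (of_real m * (\<i> * of_real v)) = of_real (- 2 * pi * m * v)" by (simp add: complex_eq_iff)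
    then show ?thesis by (simp only: e_def exp_of_real)
   qed
   have inv: "complex_of_real (exp (- 2 * pi * m * v)) * of_real (exp (2 * pi * m * v)) = 1"
    by (simp flip: of_real_mult exp_add)
   have gen: "P = (if b then Y else 0) + D * z * w * E2"
    if "P * E1 = (if b then Y * E1 else 0) + D * w * z" "E1 * E2 = 1" for P Y w E1 E2 :: complex and b
    using that by (cases b) (simp_all only: if_True if_False, algebra+)
   show ?thesis by (rule gen[OF _ inv]) (use J in \<open>simp only: ev\<close>)
  qed
  show ?thesis
  proof (cases "m < 0")
   case True
   have "((\<lambda>v. upper_Gamma (1 - wt) (4 * pi * \<bar>m\<bar> * v)) \<longlongrightarrow> 0) at_top"
    by (rule upper_Gamma_tendsto_0) (use True wt in \<open>simp_all add: mult_pos_neg\<close>)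
   moreover have "((\<lambda>v. v powr (1 - wt) * exp (2 * pi * m * v)) \<longlongrightarrow> 0) at_top"
   proof -
    define c where "c = - (2 * pi * m)"
    have c: "c > 0" using True by (simp add: c_def mult_pos_neg)
    have "((\<lambda>v::real. v powr (1 - wt) * exp (- c * v)) \<longlongrightarrow> 0) at_top" using c by real_asymp
    then show ?thesis by (simp add: c_def)
   qed
   ultimately have "((\<lambda>v. M m * of_real (upper_Gamma (1 - wt) (4 * pi * \<bar>m\<bar> * v)) + D * z * of_real (v powr (1 - wt) * exp (2 * pi * m * v))) \<longlongrightarrow> M m * of_real 0 + D * z * of_real 0) at_top"
    by (intro tendsto_intros)
   moreover have "eventually (\<lambda>v. M m * of_real (upper_Gamma (1 - wt) (4 * pi * \<bar>m\<bar> * v)) + D * z * of_real (v powr (1 - wt) * exp (2 * pi * m * v)) = p m) at_top"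
    using eventually_gt_at_top[of 0] by eventually_elim (use main True in simp)
   ultimately have "((\<lambda>v::real. p m) \<longlongrightarrow> M m * of_real 0 + D * z * of_real 0) at_top"
    by (rule Lim_transform_eventually)
   then show ?thesis by (simp add: tendsto_const_iff)
  next
   case False
   have pm: "p m = D * z * of_real (v powr (1 - wt) * exp (2 * pi * m * v))" if "v > 0" for v
    using main[OF that] False by simp
   have "D * z = 0"
   proof (rule ccontr)
    assume nz: "D * z \<noteq> 0"
    \<comment> \<open>The values at v = 1, 2, 4 suffice: they give A B^2 = B and A^2 B^4 = B, hence
      A = B = 1.\<close>
    define A B where "A = (2::real) powr (1 - wt)" and "B = exp (2 * pi * m)"
    have AB: "A > 0" "B > 0" by (auto simp: A_def B_def)
    have r: "v powr (1 - wt) * exp (2 * pi * m * v) = exp (2 * pi * m)" if "v > 0" for v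
    proof -
     have "D * z * of_real (v powr (1 - wt) * exp (2 * pi * m * v)) = D * z * of_real (1 powr (1 - wt) * exp (2 * pi * m * 1))"
      by (rule trans[OF pm[OF that, symmetric] pm[OF zero_less_one]])
     then have "complex_of_real (v powr (1 - wt) * exp (2 * pi * m * v)) = of_real (1 powr (1 - wt) * exp (2 * pi * m * 1))"
      using nz by (metis mult_cancel_left)
     then show ?thesis by (simp only: of_real_eq_iff) simp
    qed
    have "exp (2 * pi * m * 2) = B ^ 2" by (simp add: B_def flip: exp_of_nat_mult)
    then have "A * B ^ 2 = B" using r[of 2] by (simp add: A_def B_def)
    then have 2: "A * B = 1" using AB by (simp add: power2_eq_square)
    have e4: "exp (2 * pi * m * 4) = B ^ 4" by (simp add: B_def flip: exp_of_nat_mult)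
    have "(4::real) = 2 * 2" by simp
    then have "(4::real) powr (1 - wt) = A * A" by (simp only: powr_mult A_def)
    then have "A * A * B ^ 4 = B" using r[of 4] e4 by (simp add: B_def)
    moreover have "A * A * B ^ 4 = (A * B) * (A * B) * B * B" by (simp add: power4_eq_xxxx)
    ultimately have "B = 1" using 2 AB by simp
    then have "A = 1" using 2 by simp
    then have "(1 - wt) * ln 2 = 0" unfolding A_def by (simp add: powr_def)
    then show False using wt by simp
   qed
   then show ?thesis using pm[of 1] by simp
  qed
 qed
 have "((\<lambda>n. 0) has_sum h t) {n. n - \<alpha> \<in> \<int> \<and> n \<ge> m0}"
  using hp[OF t] by (rule has_sum_cong[THEN iffD1, rotated]) (simp add: p0)
 then have "h t = 0" by (rule has_sum_unique) (rule has_sum_0, rule refl)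
 then show ?thesis by (simp add: h_def)
qed

text \<open>Several x may contribute to the same exponent n = -x^2/(2d); the fibres are finite and
  are summed to form \<open>cm\<close>. The term x = 0 is the separate multiple of
  v^(1-\<open>wt\<close>), and the holomorphic half is the q-expansion of \<open>fp\<close>.\<close>

lemma fourier_half_shadow:
 assumes d: "d > 0" and wt: "wt = 3 / 2 \<or> wt = 1 / 2 \<and> w 0 = 0"
  and w: "\<And>x. \<bar>w x\<bar> \<le> C * ab x"
  and wq: "\<And>x. w x \<noteq> 0 \<Longrightarrow> - (gq d x) - \<alpha> \<in> \<int>"
  and fp: "fp holomorphic_on uhp" "quasi_periodic (e (of_real \<alpha>)) fp" "moderate_growth fp"
 shows "\<exists>n0 cp cm D. fourier_half wt \<alpha> n0 cp cm D fp (shadow_series w wt d 0)"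
proof -
 obtain n0 cp where cp: "\<And>z. z \<in> uhp \<Longrightarrow> ((\<lambda>n. cp n * e (of_real n * z)) has_sum fp z) {n. n - \<alpha> \<in> \<int> \<and> n \<ge> n0}"
  using q_expansion[OF fp(1) _ fp(3), of \<alpha>] quasi_periodicD[OF fp(2)] by blast
 define q where "q x = gq d x" for x
 define N where "N = {n. n - \<alpha> \<in> \<int> \<and> n < 0}"
 define A where "A = {x::int. x \<noteq> 0 \<and> w x \<noteq> 0}"
 define fib where "fib n = {x \<in> A. - q x = n}" for n
 define cm where "cm n = (\<Sum>x\<in>fib n. - complex_of_real (w x * (4 * pi * \<bar>n\<bar>) powr (wt - 1)))" for n
 define D where "D = complex_of_real (w 0 / (1 - wt))"
 have fin: "finite (fib n)" for n
 proof -
  have "fib n \<subseteq> {- \<lceil>sqrt (2 * d * \<bar>n\<bar>)\<rceil>..\<lceil>sqrt (2 * d * \<bar>n\<bar>)\<rceil>}"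
  proof
   fix x assume "x \<in> fib n"
   then have "(ri x)\<^sup>2 = 2 * d * \<bar>n\<bar>" using d by (auto simp: fib_def q_def)
   then have "\<bar>ri x\<bar> = sqrt (2 * d * \<bar>n\<bar>)" by (metis real_sqrt_abs)
   then have "ri x \<le> sqrt (2 * d * \<bar>n\<bar>)" "- ri x \<le> sqrt (2 * d * \<bar>n\<bar>)" by linarith+
   then show "x \<in> {- \<lceil>sqrt (2 * d * \<bar>n\<bar>)\<rceil>..\<lceil>sqrt (2 * d * \<bar>n\<bar>)\<rceil>}" by (simp, linarith)
  qed
  then show ?thesis using finite_subset by blast
 qed
 have AN: "- q x \<in> N" if "x \<in> A" for x
  using that wq[of x] d by (auto simp: A_def N_def q_def)
 have sum: "((\<lambda>n. cm n * of_real (upper_Gamma (1 - wt) (4 * pi * \<bar>n\<bar> * Im z)) * e (of_real n * z))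
    has_sum (shadow_series w wt d 0 z - D * of_real (Im z powr (1 - wt)))) N" if z: "z \<in> uhp" for z
 proof -
  have v: "Im z > 0" using z by (simp add: uhp_def)
  define T where "T x = of_real (w x * shadow_coeff wt d 0 x (Im z)) * cnj (e (of_real (q x) * z))" for x
  obtain K where K: "K \<ge> 0" "\<And>x v. v \<ge> Im z \<Longrightarrow> \<bar>w x * shadow_coeff wt d 0 x v\<bar> \<le> K * ab x ^ (2 * 0 + 1) * v powr (- 1 / 2)"
   using shadow_coeff_bound[OF d wt w v, of 0] by blast
  have "T summable_on UNIV"
  proof (rule abs_summable_summable, rule summable_on_comparison_test)
   show "(\<lambda>x::int. (K * Im z powr (- 1 / 2)) * (ab x ^ (2 * 0 + 1) * exp (- (2 * pi * Im z / (2 * d)) * (ri x)\<^sup>2))) summable_on UNIV"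
    by (intro summable_on_cmult_right summable_on_gauss) (use v d in auto)
   fix x
   have "cmod (T x) = \<bar>w x * shadow_coeff wt d 0 x (Im z)\<bar> * exp (- (2 * pi * Im z / (2 * d)) * (ri x)\<^sup>2)"
    unfolding T_def norm_mult complex_mod_cnj q_def norm_e_theta by (simp add: norm_mult abs_mult)
   also have "\<dots> \<le> (K * ab x ^ (2 * 0 + 1) * Im z powr (- 1 / 2)) * exp (- (2 * pi * Im z / (2 * d)) * (ri x)\<^sup>2)"
    by (intro mult_right_mono K(2)) auto
   finally show "cmod (T x) \<le> (K * Im z powr (- 1 / 2)) * (ab x ^ (2 * 0 + 1) * exp (- (2 * pi * Im z / (2 * d)) * (ri x)\<^sup>2))"
    by (simp add: mult_ac)
  qed auto
  then have "(T has_sum shadow_series w wt d 0 z) UNIV"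
   using has_sum_infsum[of T UNIV] by (simp add: shadow_series_def T_def[abs_def] q_def)
  moreover have "((\<lambda>x. if x = 0 then T 0 else 0) has_sum T 0) UNIV"
   by (rule has_sum_finite_neutralI[of "{0}"]) auto
  ultimately have "((\<lambda>x. T x - (if x = 0 then T 0 else 0)) has_sum (shadow_series w wt d 0 z - T 0)) UNIV"
   by (rule has_sum_diff)
  moreover have "T 0 = D * of_real (Im z powr (1 - wt))"
   by (simp add: T_def D_def q_def shadow_coeff.simps)
  ultimately have "((\<lambda>x. T x - (if x = 0 then T 0 else 0)) has_sum (shadow_series w wt d 0 z - D * of_real (Im z powr (1 - wt)))) UNIV"
   by (simp only:)
  then have "(T has_sum (shadow_series w wt d 0 z - D * of_real (Im z powr (1 - wt)))) A"
   by (rule has_sum_cong_neutral[THEN iffD1, rotated -1]) (auto simp: A_def T_def)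
  moreover have "bij_betw (\<lambda>x. (- q x, x)) A (Sigma N fib)"
   by (rule bij_betwI[where g = snd]) (use AN in \<open>auto simp: fib_def\<close>)
  ultimately have S: "((\<lambda>(n, x). T x) has_sum (shadow_series w wt d 0 z - D * of_real (Im z powr (1 - wt)))) (Sigma N fib)"
   using has_sum_reindex_bij_betw[of "\<lambda>x. (- q x, x)" A "Sigma N fib" "\<lambda>(n, x). T x"] by simp
  show ?thesis
  proof (rule has_sum_SigmaD[OF S])
   fix n assume n: "n \<in> N"
   have "T x = - complex_of_real (w x * (4 * pi * \<bar>n\<bar>) powr (wt - 1)) * of_real (upper_Gamma (1 - wt) (4 * pi * \<bar>n\<bar> * Im z)) * e (of_real n * z)"
    if x: "x \<in> fib n" for x
   proof -
    have qn: "q x = \<bar>n\<bar>" "n = - q x" "x \<noteq> 0" using x n by (auto simp: fib_def N_def A_def)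
    have "shadow_coeff wt d 0 x (Im z) = - ((4 * pi * q x) powr (wt - 1) * upper_Gamma (1 - wt) (4 * pi * q x * Im z) * exp (4 * pi * q x * Im z))"
     using qn by (simp only: shadow_coeff.simps q_def if_False)
    moreover have "cnj (e (of_real (q x) * z)) * of_real (exp (4 * pi * q x * Im z)) = e (of_real n * z)"
    proof -
     have "of_real (exp (4 * pi * q x * Im z)) = e (- 2 * \<i> * of_real (q x * Im z))"
     proof -
      have "2 * of_real pi * \<i> * (- 2 * \<i> * of_real (q x * Im z)) = of_real (4 * pi * q x * Im z)" by (simp add: complex_eq_iff)
      then show ?thesis by (simp only: e_def exp_of_real)
     qed
     moreover have "- cnj (of_real (q x) * z) + - 2 * \<i> * of_real (q x * Im z) = of_real n * z"
      unfolding qn(2) by (simp add: complex_eq_iff)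
     ultimately show ?thesis by (simp only: cnj_e e_add[symmetric])
    qed
    ultimately show ?thesis unfolding T_def qn(1)[symmetric]
     by (simp add: mult_ac) (metis mult.left_commute mult.commute)?
   qed
   then have "(\<Sum>x\<in>fib n. T x) = cm n * of_real (upper_Gamma (1 - wt) (4 * pi * \<bar>n\<bar> * Im z)) * e (of_real n * z)"
    by (simp add: cm_def sum_distrib_right)
   then show "((\<lambda>x. case (n, x) of (n, x) \<Rightarrow> T x) has_sum cm n * of_real (upper_Gamma (1 - wt) (4 * pi * \<bar>n\<bar> * Im z)) * e (of_real n * z)) (fib n)"
    using has_sum_finite[OF fin[of n], of T] by simp
  qed
 qed
 show ?thesis unfolding fourier_half_def using cp sum[unfolded N_def] by blast
qed

section \<open>Poisson summation and the inversion formula\<close>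

lemma periodic_integral_shift:
 fixes k :: "real \<Rightarrow> complex"
 assumes cont: "continuous_on UNIV k" and per: "\<And>x. k (x + 1) = k x"
 shows "integral {-1/2..1/2} (\<lambda>x. k (x + t)) = integral {-1/2..1/2} k"
proof -
 define m where "m = \<lfloor>t\<rfloor>"
 have perZ: "k (x + of_int i) = k x" for x i
 proof (induction i rule: int_induct[where k = 0])
  case (step1 i)
  then show ?case using per[of "x + of_int i"] by (simp add: add.assoc)
 next
  case (step2 i)
  then show ?case using per[of "x + of_int (i - 1)"] by (simp add: add.assoc)
 qed simp
 define f where "f = t - of_int m"
 have f: "0 \<le> f" "f < 1" unfolding f_def m_def by linarith+
 have int: "k integrable_on {a..b}" for a b
  by (intro integrable_continuous_interval continuous_on_subset[OF cont]) auto
 have sh: "integral {a..b} (\<lambda>x. k (x + c)) = integral {a + c..b + c} k" for a b c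
  using integral_shift_real_ivl[of "a + c" c "b + c" k] by simp
 have "integral {-1/2..1/2} (\<lambda>x. k (x + t)) = integral {-1/2..1/2} (\<lambda>x. k (x + f))"
  using perZ[of "x + f" m for x] by (simp add: f_def)
 also have "\<dots> = integral {-1/2 + f..1/2 + f} k" by (rule sh)
 also have "\<dots> = integral {-1/2 + f..1/2} k + integral {1/2..1/2 + f} k"
  using f by (intro Henstock_Kurzweil_Integration.integral_combine[symmetric] int) auto
 also have "integral {1/2..1/2 + f} k = integral {-1/2..-1/2 + f} k"
  using sh[of "-1/2" "-1/2 + f" 1] per by simp
 also have "integral {-1/2 + f..1/2} k + integral {-1/2..-1/2 + f} k = integral {-1/2..1/2} k"
  using f by (subst add.commute, intro Henstock_Kurzweil_Integration.integral_combine int) auto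
 finally show ?thesis .
qed

text \<open>A shift by t = 1/(2n) reverses the sign of e(n x), so twice the integral is the integral
  of (g(x) - g(x + t)) e(n x), which is small by uniform continuity.\<close>

lemma riemann_lebesgue_periodic:
 fixes g :: "real \<Rightarrow> complex"
 assumes cont: "continuous_on UNIV g" and per: "\<And>x. g (x + 1) = g x" and eps: "\<epsilon> > 0"
 shows "\<exists>N0. \<forall>n::int. \<bar>n\<bar> \<ge> N0 \<longrightarrow> cmod (integral {-1/2..1/2} (\<lambda>x. g x * er (of_int n * x))) < \<epsilon>"
proof -
 have "uniformly_continuous_on {-2..2} g"
  by (intro compact_uniformly_continuous continuous_on_subset[OF cont]) auto
 then obtain \<delta> where \<delta>: "\<delta> > 0" "\<And>x y. x \<in> {-2..2} \<Longrightarrow> y \<in> {-2..2} \<Longrightarrow> dist y x < \<delta> \<Longrightarrow> dist (g y) (g x) < \<epsilon>"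
 proof -
  have "\<exists>\<delta>>0. \<forall>x\<in>{-2..2}. \<forall>y\<in>{-2..2}. dist y x < \<delta> \<longrightarrow> dist (g y) (g x) < \<epsilon>"
   using \<open>uniformly_continuous_on {-2..2} g\<close> eps by (simp add: uniformly_continuous_on_def)
  then show ?thesis using that by auto
 qed
 define N0 where "N0 = \<lceil>1 / \<delta>\<rceil> + 1"
 have "cmod (integral {-1/2..1/2} (\<lambda>x. g x * er (of_int n * x))) < \<epsilon>" if n: "\<bar>n\<bar> \<ge> N0" for n
 proof -
  let ?I = "integral {-1/2..1/2} (\<lambda>x. g x * er (of_int n * x))"
  have nb: "ri \<bar>n\<bar> > 1 / \<delta>" "1 / \<delta> > 0" using n \<delta>(1) unfolding N0_def by (linarith, simp)
  then have n0: "n \<noteq> 0" by auto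
  define t where "t = 1 / (2 * ri n)"
  have n1: "ri \<bar>n\<bar> \<ge> 1" using n0 by linarith
  have tl: "\<bar>t\<bar> < \<delta>" "\<bar>t\<bar> \<le> 1 / 2"
  proof -
   have "1 < \<delta> * ri \<bar>n\<bar>" using nb \<delta>(1) by (simp add: field_simps)
   then show "\<bar>t\<bar> < \<delta>" using n1 \<delta>(1) by (simp add: t_def abs_mult field_simps)
   show "\<bar>t\<bar> \<le> 1 / 2" using n1 by (simp add: t_def abs_mult field_simps)
  qed
  have et: "er (of_int n * (x + t)) = - er (of_int n * x)" for x
  proof -
   have "ri n * (x + t) = ri n * x + 1 / 2" using n0 by (simp add: t_def field_simps)
   moreover have "e (1 / 2) = - 1" by (simp add: e_def)
   ultimately show ?thesis by (simp add: e_add)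
  qed
  have c: "continuous_on UNIV (\<lambda>x. g x * er (of_int n * x))"
   by (intro continuous_intros cont)
  have p: "g (x + 1) * er (of_int n * (x + 1)) = g x * er (of_int n * x)" for x
   by (simp add: per distrib_left e_add)
  have "?I = integral {-1/2..1/2} (\<lambda>x. g (x + t) * er (of_int n * (x + t)))"
   by (rule periodic_integral_shift[OF c p, symmetric])
  also have "\<dots> = - integral {-1/2..1/2} (\<lambda>x. g (x + t) * er (of_int n * x))"
   unfolding et by simp
  finally have I2: "?I = - integral {-1/2..1/2} (\<lambda>x. g (x + t) * er (of_int n * x))" .
  have cg: "continuous_on S g" "continuous_on S (\<lambda>x. g (x + t))" for S
   by (rule continuous_on_subset[OF cont], simp, rule continuous_on_compose2[OF cont]) (auto intro!: continuous_intros)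
  have "2 * ?I = integral {-1/2..1/2} (\<lambda>x. g x * er (of_int n * x) - g (x + t) * er (of_int n * x))"
   by (subst Henstock_Kurzweil_Integration.integral_diff)
     (use I2 in \<open>auto intro!: integrable_continuous_interval continuous_intros cg\<close>)
  also have "cmod \<dots> \<le> \<epsilon> * (1/2 - (-1/2))"
  proof (rule integral_bound)
   show "continuous_on {-1/2..1/2} (\<lambda>x. g x * er (of_int n * x) - g (x + t) * er (of_int n * x))"
    by (intro continuous_intros cg)
   fix x :: real assume x: "x \<in> {-1/2..1/2}"
   have "cmod (g x * er (of_int n * x) - g (x + t) * er (of_int n * x)) = dist (g x) (g (x + t))"
    by (simp add: norm_mult norm_e dist_norm flip: left_diff_distrib)
   also have "\<dots> < \<epsilon>" by (rule \<delta>(2)) (use x tl in \<open>auto simp: dist_norm abs_le_iff\<close>)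
   finally show "cmod (g x * er (of_int n * x) - g (x + t) * er (of_int n * x)) \<le> \<epsilon>" by simp
  qed auto
  finally have "2 * cmod ?I \<le> \<epsilon>" by (simp add: norm_mult)
  then show ?thesis using eps by linarith
 qed
 then show ?thesis by blast
qed

text \<open>Chernoff's proof of pointwise convergence: if \<open>F(0) = 0\<close>, then \<open>F(x) = (e(x) - 1) g(x)\<close> with \<open>g\<close>
  continuous, so the Fourier coefficients of \<open>F\<close> telescope.\<close>

lemma fourier_series_at_0:
 fixes F :: "real \<Rightarrow> complex"
 assumes cont: "continuous_on UNIV F" and per: "\<And>x. F (x + 1) = F x"
  and diff: "((\<lambda>x. (F x - F 0) / of_real x) \<longlongrightarrow> F') (at 0)"
 shows "(\<lambda>N. \<Sum>n\<in>{- int N..int N}. integral {-1/2..1/2} (\<lambda>x. F x * er (- of_int n * x))) \<longlonglongrightarrow> F 0"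
proof -
 have eI: "er x = 1 \<longleftrightarrow> x \<in> \<int>" for x by (rule e_of_real_eq_1_iff)
 have perZ: "F (x + of_int i) = F x" for x i
 proof (induction i rule: int_induct[where k = 0])
  case (step1 i)
  then show ?case using per[of "x + of_int i"] by (simp add: add.assoc)
 next
  case (step2 i)
  then show ?case using per[of "x + of_int (i - 1)"] by (simp add: add.assoc)
 qed simp
 define g where "g x = (if x \<in> \<int> then F' / (2 * of_real pi * \<i>) else (F x - F 0) / (er x - 1))" for x :: real
 have gper: "g (x + of_int i) = g x" for x i
 proof -
  have "x + of_int i \<in> \<int> \<longleftrightarrow> x \<in> \<int>" using Ints_diff[of "x + of_int i" "of_int i"] by auto
  then show ?thesis by (simp add: g_def perZ e_add)
 qed
 have cFx: "isCont F x" for x using cont by (simp add: continuous_on_eq_continuous_at)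
 have g0: "isCont g 0"
 proof -
  note diff
  moreover have "((\<lambda>x. (er x - 1) / of_real x) \<longlongrightarrow> 2 * of_real pi * \<i>) (at 0)"
  proof -
   have "(e has_field_derivative 2 * of_real pi * \<i> * e 0 * 1) (at 0)"
    using has_field_derivative_e[of "\<lambda>x. x" 1 0 UNIV] by (simp add: DERIV_ident)
   then have "((\<lambda>z. (e z - 1) / z) \<longlongrightarrow> 2 * of_real pi * \<i>) (at 0)"
    by (simp add: has_field_derivative_iff)
   moreover have "filterlim complex_of_real (at 0) (at 0)"
    unfolding filterlim_at by (auto intro!: tendsto_eq_intros simp: eventually_at_filter)
   ultimately show ?thesis using filterlim_compose[of "\<lambda>z. (e z - 1) / z"] by blast
  qed
  ultimately have "((\<lambda>x. ((F x - F 0) / of_real x) / ((er x - 1) / of_real x)) \<longlongrightarrow> F' / (2 * of_real pi * \<i>)) (at 0)"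
   by (intro tendsto_divide) auto
  moreover have "eventually (\<lambda>x. ((F x - F 0) / of_real x) / ((er x - 1) / of_real x) = g x) (at 0)"
  proof -
   have "x \<notin> \<int>" if "x \<noteq> 0" "dist x 0 < 1" for x :: real
    using that by (auto elim!: Ints_cases)
   then show ?thesis unfolding eventually_at by (intro exI[of _ 1]) (auto simp: g_def)
  qed
  ultimately have "(g \<longlongrightarrow> F' / (2 * of_real pi * \<i>)) (at 0)" by (rule Lim_transform_eventually)
  then show ?thesis by (simp add: isCont_def g_def)
 qed
 have gc: "isCont g x" for x
 proof (cases "x \<in> \<int>")
  case True
  then obtain i where i: "x = of_int i" by (auto elim: Ints_cases)
  have "isCont (\<lambda>y. g (y - of_int i)) x"
   by (rule isCont_o2[where g = g]) (auto intro!: continuous_intros simp: i g0)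
  moreover have "(\<lambda>y. g (y - of_int i)) = g" using gper[of _ "- i"] by auto
  ultimately show ?thesis by simp
 next
  case False
  have "isCont (\<lambda>x. (F x - F 0) / (er x - 1)) x"
  proof -
   have "isCont (\<lambda>x. e (complex_of_real x)) x"
    unfolding e_def by (intro continuous_intros)
   then show ?thesis using False eI[of x] by (intro continuous_intros cFx) auto
  qed
  moreover have "eventually (\<lambda>y. y \<in> - \<int>) (nhds x)"
   using False by (intro eventually_nhds_in_open) (auto simp: open_Compl closed_Ints)
  then have "eventually (\<lambda>y. g y = (F y - F 0) / (er y - 1)) (nhds x)"
   by eventually_elim (simp add: g_def)
  ultimately show ?thesis using isCont_cong by fastforce
 qed
 have cg: "continuous_on S g" for S using gc by (simp add: continuous_at_imp_continuous_on)
 have Fg: "F x = F 0 + g x * (er x - 1)" for x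
 proof (cases "x \<in> \<int>")
  case True
  then obtain i where "x = of_int i" by (auto elim: Ints_cases)
  then show ?thesis using perZ[of 0 i] by simp
 next
  case False
  then show ?thesis using eI[of x] by (simp add: g_def)
 qed
 define G where "G n = integral {-1/2..1/2} (\<lambda>x. g x * er (of_int n * x))" for n :: int
 have coeff: "integral {-1/2..1/2} (\<lambda>x. F x * er (- of_int n * x)) = (if n = 0 then F 0 else 0) + (G (1 - n) - G (- n))" for n
 proof -
  have "(\<lambda>x. F x * er (- of_int n * x)) = (\<lambda>x. F 0 * er (- of_int n * x) + (g x * er (of_int (1 - n) * x) - g x * er (of_int (- n) * x)))"
  proof
   fix x
   have "er (of_int (1 - n) * x) = er x * er (- of_int n * x)"
    by (simp add: algebra_simps flip: e_add)
   then show "F x * er (- of_int n * x) = F 0 * er (- of_int n * x) + (g x * er (of_int (1 - n) * x) - g x * er (of_int (- n) * x))"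
    by (subst Fg) (simp add: algebra_simps)
  qed
  then have "integral {-1/2..1/2} (\<lambda>x. F x * er (- of_int n * x)) =
    integral {-1/2..1/2} (\<lambda>x. F 0 * er (- of_int n * x) + (g x * er (of_int (1 - n) * x) - g x * er (of_int (- n) * x)))"
   by (rule arg_cong)
  also have "\<dots> = integral {-1/2..1/2} (\<lambda>x. F 0 * er (- of_int n * x)) + integral {-1/2..1/2} (\<lambda>x. g x * er (of_int (1 - n) * x) - g x * er (of_int (- n) * x))"
   by (rule Henstock_Kurzweil_Integration.integral_add) (intro integrable_continuous_interval continuous_intros cg)+
  also have "integral {-1/2..1/2} (\<lambda>x. g x * er (of_int (1 - n) * x) - g x * er (of_int (- n) * x)) = G (1 - n) - G (- n)"
   unfolding G_def by (rule Henstock_Kurzweil_Integration.integral_diff) (intro integrable_continuous_interval continuous_intros cg)+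
  also have "integral {-1/2..1/2} (\<lambda>x. F 0 * er (- of_int n * x)) = (if n = 0 then F 0 else 0)"
   using integral_e_period[of "- of_int n"] by simp
  finally show ?thesis .
 qed
 define I where "I n = integral {-1/2..1/2} (\<lambda>x. F x * er (- of_int n * x))" for n :: int
 have coeff': "I n = (if n = 0 then F 0 else 0) + (G (1 - n) - G (- n))" for n
  unfolding I_def by (rule coeff)
 have tele: "(\<Sum>n\<in>{- int N..int N}. I n) = F 0 + (G (int N + 1) - G (- int N))" for N
 proof (induction N)
  case 0
  then show ?case using coeff'[of 0] by simp
 next
  case (Suc N)
  have "{- int (Suc N)..int (Suc N)} = insert (- int (Suc N)) (insert (int (Suc N)) {- int N..int N})" by auto
  then have "(\<Sum>n\<in>{- int (Suc N)..int (Suc N)}. I n) = I (- int (Suc N)) + (I (int (Suc N)) + (\<Sum>n\<in>{- int N..int N}. I n))"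
   by simp
  also have "\<dots> = (G (int (Suc N) + 1) - G (int (Suc N))) + ((G (- int N) - G (- int (Suc N))) + (F 0 + (G (int N + 1) - G (- int N))))"
  proof -
   have "I (- int (Suc N)) = G (int (Suc N) + 1) - G (int (Suc N))" using coeff'[of "- int (Suc N)"] by (simp add: add_ac)
   moreover have "I (int (Suc N)) = G (- int N) - G (- int (Suc N))" using coeff'[of "int (Suc N)"] by simp
   ultimately show ?thesis by (simp only: Suc)
  qed
  finally show ?case by (simp add: add_ac)
 qed
 show ?thesis
  unfolding I_def[symmetric]
 proof (rule LIMSEQ_I)
  fix r :: real assume r: "r > 0"
  obtain N0 where N0: "\<And>n. \<bar>n\<bar> \<ge> N0 \<Longrightarrow> cmod (G n) < r / 2"
   using riemann_lebesgue_periodic[OF cg, of "r / 2"] gper[of _ 1] r unfolding G_def by auto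
  show "\<exists>no. \<forall>N\<ge>no. norm ((\<Sum>n\<in>{- int N..int N}. I n) - F 0) < r"
  proof (intro exI[of _ "nat \<bar>N0\<bar>"] allI impI)
   fix N assume "nat \<bar>N0\<bar> \<le> N"
   then have n: "N0 \<le> \<bar>int N + 1\<bar>" "N0 \<le> \<bar>- int N\<bar>" by linarith+
   have "cmod (G (int N + 1)) < r / 2" "cmod (G (- int N)) < r / 2" by (rule N0[OF n(1)], rule N0[OF n(2)])
   then show "norm ((\<Sum>n\<in>{- int N..int N}. I n) - F 0) < r"
    unfolding tele using norm_triangle_ineq4[of "G (int N + 1)" "G (- int N)"] by simp
  qed
 qed
qed

section \<open>Poisson summation for Gaussians\<close>

lemma gauss_fourier_transform:
 assumes s: "s > 0"
 shows "(LINT x|lborel. complex_of_real (exp (- (pi * s * x\<^sup>2))) * er (- y * x)) = of_real (exp (- (pi * y\<^sup>2 / s)) / sqrt s)"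
  and "integrable lborel (\<lambda>x. complex_of_real (exp (- (pi * s * x\<^sup>2))) * er (- y * x))"
proof -
 \<comment> \<open>Scaling by c turns exp(-x^2/2) into exp(-pi s x^2) and the claim into the formula
   for the characteristic function of the standard normal distribution.\<close>
 define c where "c = sqrt (2 * pi * s)"
 have c: "c > 0" using s by (simp add: c_def)
 have c2: "c\<^sup>2 = 2 * pi * s" using s by (simp add: c_def)
 define t where "t = - 2 * pi * y / c"
 have char: "(CLINT x|std_normal_distribution. iexp (t * x)) = of_real (exp (- (t\<^sup>2) / 2))"
  using fun_cong[OF char_std_normal_distribution, of t] by (simp add: char_def)
 have id: "complex_of_real (std_normal_density x) * iexp (t * x) = of_real (1 / sqrt (2 * pi)) * (of_real (exp (- (x\<^sup>2) / 2)) * iexp (t * x))" for x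
  by (simp add: std_normal_density_def)
 have intS: "integrable lborel (\<lambda>x. complex_of_real (exp (- (x\<^sup>2) / 2)) * iexp (t * x))"
 proof (rule Bochner_Integration.integrable_bound)
  show "integrable lborel (\<lambda>x. sqrt (2 * pi) * std_normal_density x)" by (intro integrable_mult_right) (rule integrable_normal_density, simp)
  show "AE x in lborel. cmod (complex_of_real (exp (- (x\<^sup>2) / 2)) * iexp (t * x)) \<le> norm (sqrt (2 * pi) * std_normal_density x)"
   by (auto simp: norm_mult std_normal_density_def)
 qed simp
 have "(CLINT x|std_normal_distribution. iexp (t * x)) = (CLINT x|lborel. std_normal_density x *\<^sub>R iexp (t * x))"
  by (subst integral_density) auto
 also have "\<dots> = of_real (1 / sqrt (2 * pi)) * (CLINT x|lborel. of_real (exp (- (x\<^sup>2) / 2)) * iexp (t * x))"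
  unfolding scaleR_conv_of_real id by simp
 finally have I: "(CLINT x|lborel. of_real (exp (- (x\<^sup>2) / 2)) * iexp (t * x)) = of_real (sqrt (2 * pi) * exp (- (t\<^sup>2) / 2))"
  unfolding char by (simp add: field_simps)
 have eq: "complex_of_real (exp (- ((0 + c * x)\<^sup>2) / 2)) * iexp (t * (0 + c * x)) = complex_of_real (exp (- (pi * s * x\<^sup>2))) * er (- y * x)" for x
 proof -
  have "(c * x)\<^sup>2 / 2 = pi * s * x\<^sup>2" by (simp add: power_mult_distrib c2)
  moreover have "t * (c * x) = - 2 * pi * y * x" using c by (simp add: t_def)
  ultimately show ?thesis by (simp add: e_def mult_ac)
 qed
 show "integrable lborel (\<lambda>x. complex_of_real (exp (- (pi * s * x\<^sup>2))) * er (- y * x))"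
  using lborel_integrable_real_affine[OF intS, of c 0] c unfolding eq by simp
 have "(CLINT x|lborel. of_real (exp (- (x\<^sup>2) / 2)) * iexp (t * x)) = \<bar>c\<bar> *\<^sub>R (LINT x|lborel. complex_of_real (exp (- (pi * s * x\<^sup>2))) * er (- y * x))"
  using lborel_integral_real_affine[of c "\<lambda>x. of_real (exp (- (x\<^sup>2) / 2)) * iexp (t * x)" 0] c unfolding eq by simp
 then have "(LINT x|lborel. complex_of_real (exp (- (pi * s * x\<^sup>2))) * er (- y * x)) = of_real (sqrt (2 * pi) * exp (- (t\<^sup>2) / 2) / c)"
  unfolding I using c by (simp add: scaleR_conv_of_real field_simps)
 moreover have "t\<^sup>2 / 2 = pi * y\<^sup>2 / s"
 proof -
  have "t\<^sup>2 = (2 * pi * y)\<^sup>2 / c\<^sup>2" by (simp add: t_def power_divide)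
  then show ?thesis unfolding c2 using s by (simp add: power2_eq_square field_simps)
 qed
 moreover have "sqrt (2 * pi) / c = 1 / sqrt s" using s by (simp add: c_def real_sqrt_mult)
 moreover have "sqrt (2 * pi) * exp (- (t\<^sup>2) / 2) / c = (sqrt (2 * pi) / c) * exp (- (t\<^sup>2 / 2))" by simp
 ultimately show "(LINT x|lborel. complex_of_real (exp (- (pi * s * x\<^sup>2))) * er (- y * x)) = of_real (exp (- (pi * y\<^sup>2 / s)) / sqrt s)"
  by (simp only: times_divide_eq_left mult_1_left)
qed

text \<open>Fourier partial sums are symmetric, whereas \<open>has_sum\<close> runs through all
  finite sets; symmetric intervals are cofinal among these.\<close>

lemma has_sum_symmetric_tendsto:
 fixes c :: "int \<Rightarrow> complex"
 assumes "(c has_sum s) UNIV"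
 shows "(\<lambda>N. \<Sum>n\<in>{- int N..int N}. c n) \<longlonglongrightarrow> s"
proof -
 have "filterlim (\<lambda>N. {- int N..int N}) (finite_subsets_at_top UNIV) sequentially"
  unfolding filterlim_iff eventually_finite_subsets_at_top
 proof safe
  fix P :: "int set \<Rightarrow> bool" and X :: "int set"
  assume X: "finite X" "\<forall>Y. finite Y \<and> X \<subseteq> Y \<and> Y \<subseteq> UNIV \<longrightarrow> P Y"
  obtain N0 where N0: "\<And>x. x \<in> X \<Longrightarrow> \<bar>x\<bar> \<le> int N0"
  proof -
   have "finite (nat ` abs ` X)" using X by simp
   then have m: "y \<le> Max (nat ` abs ` X)" if "y \<in> nat ` abs ` X" for y using that by (rule Max_ge)
   define m where "m = Max (nat ` abs ` X)"
   note m = m[folded m_def]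
   have "\<bar>x\<bar> \<le> int m" if "x \<in> X" for x 
   proof -
    have "nat \<bar>x\<bar> \<le> m" by (rule m) (use that in blast)
    then show ?thesis by linarith
   qed
   then show ?thesis by (rule that)
  qed
  show "eventually (\<lambda>N. P {- int N..int N}) sequentially"
   unfolding eventually_sequentially
  proof (intro exI[of _ N0] allI impI)
   fix N assume "N0 \<le> N"
   then have "X \<subseteq> {- int N..int N}" using N0 by (force simp: abs_le_iff)
   then show "P {- int N..int N}" using X(2) by simp
  qed
 qed
 then show ?thesis using assms unfolding has_sum_def by (rule filterlim_compose[rotated])
qed

text \<open>The argument is complex, although Poisson summation concerns real points: termwise
  complex differentiation then yields the continuity and the differentiability that
  \<open>fourier_series_at_0\<close> asks for.\<close>

definition gauss_sum :: "real \<Rightarrow> complex \<Rightarrow> complex" where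
 "gauss_sum s z = (\<Sum>\<^sub>\<infinity>n::int. exp (- (of_real (pi * s) * (of_int n + z)\<^sup>2)))"

lemma gauss_term_bound:
 assumes "s > 0" "cmod w \<le> R"
 shows "cmod (exp (- (of_real (pi * s) * (of_int n + w)\<^sup>2))) \<le> exp (pi * s * R\<^sup>2) * exp (- (pi * s / 2) * (ri n)\<^sup>2)"
proof -
 have "Re (of_real (pi * s) * (of_int n + w)\<^sup>2) = pi * s * ((ri n + Re w)\<^sup>2 - (Im w)\<^sup>2)"
  by (simp add: power2_eq_square algebra_simps)
 moreover have "(ri n)\<^sup>2 / 2 - R\<^sup>2 \<le> (ri n + Re w)\<^sup>2 - (Im w)\<^sup>2"
 proof -
  have "(cmod w)\<^sup>2 \<le> R\<^sup>2" using assms(2) by (intro power_mono) auto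
  then have "(Re w)\<^sup>2 + (Im w)\<^sup>2 \<le> R\<^sup>2" by (simp add: cmod_power2)
  moreover have "0 \<le> (ri n + 2 * Re w)\<^sup>2" by simp
  ultimately show ?thesis by (simp add: power2_eq_square algebra_simps)
 qed
 then have "pi * s * ((ri n)\<^sup>2 / 2 - R\<^sup>2) \<le> pi * s * ((ri n + Re w)\<^sup>2 - (Im w)\<^sup>2)"
  using assms(1) by (intro mult_left_mono) auto
 ultimately have "- Re (of_real (pi * s) * (of_int n + w)\<^sup>2) \<le> pi * s * R\<^sup>2 + - (pi * s / 2) * (ri n)\<^sup>2"
  by (simp add: algebra_simps)
 then show ?thesis unfolding norm_exp_eq_Re exp_add[symmetric] by simp
qed

lemma gauss_sum_facts:
 assumes s: "s > 0"
 shows "\<exists>D. (gauss_sum s has_field_derivative D) (at z)"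
  and "((\<lambda>n. exp (- (of_real (pi * s) * (of_int n + z)\<^sup>2))) has_sum gauss_sum s z) UNIV"
proof -
 define R where "R = cmod z + 1"
 have R: "R > 0" "R \<ge> 1" by (auto simp: R_def add_nonneg_pos)
 define K where "K = exp (pi * s * R\<^sup>2) * (1 + 2 * (pi * s) * (1 + R))"
 define B where "B n = K * (ab n ^ 1 * exp (- (pi * s / 2) * (ri n)\<^sup>2))" for n
 have B: "B summable_on UNIV" unfolding B_def
  by (intro summable_on_cmult_right summable_on_gauss) (use s in simp)
 let ?E = "\<lambda>(n::int) (w::complex). exp (- (of_real (pi * s) * (of_int n + w)\<^sup>2))"
 have b: "cmod (?E n w) * t \<le> B n" if w: "w \<in> ball 0 R" and t: "0 \<le> t" "t \<le> (1 + 2 * (pi * s) * (1 + R)) * ab n" for w :: complex and n t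
 proof -
  have "cmod (?E n w) * t \<le> (exp (pi * s * R\<^sup>2) * exp (- (pi * s / 2) * (ri n)\<^sup>2)) * ((1 + 2 * (pi * s) * (1 + R)) * ab n)"
   by (intro mult_mono gauss_term_bound) (use w t s in auto)
  also have "\<dots> = B n" by (simp add: B_def K_def)
  finally show ?thesis .
 qed
 have b1: "cmod (?E n w) \<le> B n" if "w \<in> ball 0 R" for w :: complex and n
 proof -
  have "1 * 1 \<le> (1 + 2 * (pi * s) * (1 + R)) * ab n" using s R by (intro mult_mono) auto
  from b[OF that zero_le_one] this show ?thesis by simp
 qed
 have "has_wirtinger (\<lambda>w. \<Sum>\<^sub>\<infinity>n. ?E n w) (\<Sum>\<^sub>\<infinity>n. ?E n z * - (of_real (2 * (pi * s)) * (of_int n + z))) (\<Sum>\<^sub>\<infinity>n::int. 0) z"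
 proof (rule has_wirtinger_infsum_on[where S = "ball 0 R" and B = B])
  fix n :: int and w :: complex assume w: "w \<in> ball 0 R"
  show "has_wirtinger (?E n) (?E n w * - (of_real (2 * (pi * s)) * (of_int n + w))) 0 w"
   by (rule has_wirtinger_holomorphic) (auto intro!: derivative_eq_intros simp: algebra_simps)
  show "cmod (?E n w) \<le> B n" by (rule b1[OF w])
  then show "cmod 0 \<le> B n" by (metis norm_ge_zero norm_zero order_trans)
  have "cmod (of_int n + w) \<le> ri \<bar>n\<bar> + R"
   using norm_triangle_ineq[of "of_int n" w] w by (simp add: norm_of_int)
  also have "\<dots> \<le> (1 + R) * ab n" using R by (simp add: algebra_simps)
  finally have "2 * (pi * s) * cmod (of_int n + w) \<le> 2 * (pi * s) * ((1 + R) * ab n)"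
   using s by (intro mult_left_mono) auto
  also have "\<dots> \<le> (1 + 2 * (pi * s) * (1 + R)) * ab n" by (simp add: algebra_simps)
  finally have "cmod (?E n w) * (2 * (pi * s) * cmod (of_int n + w)) \<le> B n" using w s by (intro b) auto
  moreover have "cmod (?E n w * - (of_real (2 * (pi * s)) * (of_int n + w))) = cmod (?E n w) * (2 * (pi * s) * cmod (of_int n + w))"
  proof -
   have gen: "cmod (E * - (of_real q * y)) = cmod E * (q * cmod y)" if "q \<ge> 0" for E y q using that by (simp add: norm_mult)
   show ?thesis by (rule gen) (use s in simp)
  qed
  ultimately show "cmod (?E n w * - (of_real (2 * (pi * s)) * (of_int n + w))) \<le> B n" by simp
 qed (use B R in \<open>auto simp: R_def\<close>)
 then show "\<exists>D. (gauss_sum s has_field_derivative D) (at z)"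
  by (auto simp: has_wirtinger_def has_field_derivative_def gauss_sum_def[abs_def])
 have "(\<lambda>n. ?E n z) summable_on UNIV"
  by (rule abs_summable_summable, rule summable_on_comparison_test[OF B]) (use b1[of z] in \<open>auto simp: R_def\<close>)
 then show "((\<lambda>n. ?E n z) has_sum gauss_sum s z) UNIV" unfolding gauss_sum_def by (rule has_sum_infsum)
qed

lemma gauss_sum_periodic: "gauss_sum s (z + 1) = gauss_sum s z"
proof -
 have bij: "bij_betw (\<lambda>n::int. n + 1) UNIV UNIV" by (intro bij_betwI[where g = "\<lambda>n. n - 1"]) auto
 have "gauss_sum s (z + 1) = (\<Sum>\<^sub>\<infinity>n::int. exp (- (of_real (pi * s) * (of_int (n + 1) + z)\<^sup>2)))"
  by (simp add: gauss_sum_def add_ac)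
 also have "\<dots> = gauss_sum s z"
  using infsum_reindex_bij_betw[OF bij, of "\<lambda>n. exp (- (of_real (pi * s) * (of_int n + z)\<^sup>2))"] by (simp add: gauss_sum_def)
 finally show ?thesis .
qed

text \<open>Unfolding: integrating the sum of all translates over one period is integrating a single
  Gaussian over the line. The factor e(n a) comes from the substitution that centres it at
  0.\<close>

lemma gauss_sum_fourier_coeff:
 assumes s: "s > 0"
 shows "integral {-1/2..1/2} (\<lambda>x. gauss_sum s (of_real (x + a)) * er (- of_int n * x))
   = er (of_int n * a) * of_real (exp (- (pi * (of_int n)\<^sup>2 / s)) / sqrt s)"
proof -
 define h where "h x = complex_of_real (exp (- (pi * s * (x + a)\<^sup>2))) * er (- of_int n * x)" for x
 have cphi: "continuous_on S h" for S unfolding h_def by (intro continuous_intros)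
 have shift: "h (x + of_int m) = exp (- (of_real (pi * s) * (of_int m + of_real (x + a))\<^sup>2)) * er (- of_int n * x)" for x m
 proof -
  have "complex_of_real (- of_int n * (x + of_int m)) = of_real (- of_int n * x) + of_int (- n * m)"
   by (simp add: algebra_simps)
  then have "er (- of_int n * (x + of_int m)) = er (- of_int n * x)" by (simp only: e_add e_of_int mult_1_right)
  moreover have "complex_of_real (exp (- (pi * s * (x + of_int m + a)\<^sup>2))) = exp (- (of_real (pi * s) * (of_int m + of_real (x + a))\<^sup>2))"
   by (simp add: add_ac flip: exp_of_real)
  ultimately show ?thesis unfolding h_def by simp
 qed
 define R where "R = \<bar>a\<bar> + 1"
 have "((\<lambda>m. integral {-1/2..1/2} (\<lambda>x. h (x + of_int m))) has_sum integral {-1/2..1/2} (\<lambda>x. gauss_sum s (of_real (x + a)) * er (- of_int n * x))) UNIV"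
 proof (rule integral_infsum)
  show "continuous_on {-1/2..1/2} (\<lambda>x. h (x + of_int m))" for m :: int unfolding h_def by (intro continuous_intros)
  show "cmod (h (x + of_int m)) \<le> exp (pi * s * R\<^sup>2) * exp (- (pi * s / 2) * (ri m)\<^sup>2)" if "x \<in> {-1/2..1/2}" for x and m :: int
  proof -
   have "cmod (of_real (x + a)) \<le> R" using that unfolding norm_of_real R_def by (auto simp: abs_le_iff)
   from gauss_term_bound[OF s this, of m] show ?thesis unfolding shift norm_mult by (simp add: norm_e)
  qed
  show "(\<lambda>m::int. exp (pi * s * R\<^sup>2) * exp (- (pi * s / 2) * (ri m)\<^sup>2)) summable_on UNIV"
   using summable_on_gauss[of "pi * s / 2" 0] s by (intro summable_on_cmult_right) simp
  show "((\<lambda>m. h (x + of_int m)) has_sum gauss_sum s (of_real (x + a)) * er (- of_int n * x)) UNIV" for x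
   unfolding shift by (intro has_sum_cmult_left gauss_sum_facts(2) s)
 qed
 from has_sum_symmetric_tendsto[OF this]
 have L1: "(\<lambda>N. \<Sum>m\<in>{- int N..int N}. integral {-1/2..1/2} (\<lambda>x. h (x + of_int m))) \<longlonglongrightarrow> integral {-1/2..1/2} (\<lambda>x. gauss_sum s (of_real (x + a)) * er (- of_int n * x))" .
 have int: "h integrable_on {c..d}" for c d by (intro integrable_continuous_interval cphi)
 have sh: "integral {-1/2..1/2} (\<lambda>x. h (x + t)) = integral {t - 1/2..t + 1/2} h" for t
  using integral_shift_real_ivl[of "t - 1/2" t "t + 1/2" h] by simp
 have partial: "(\<Sum>m\<in>{- int N..int N}. integral {-1/2..1/2} (\<lambda>x. h (x + of_int m))) = integral {- real N - 1/2..real N + 1/2} h" for N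
 proof (induction N)
  case 0
  then show ?case by simp
 next
  case (Suc N)
  have set: "{- int (Suc N)..int (Suc N)} = insert (- int (Suc N)) (insert (int (Suc N)) {- int N..int N})" by auto
  have a1: "integral {- real N - 3/2..real N + 3/2} h = integral {- real N - 3/2..- real N - 1/2} h + integral {- real N - 1/2..real N + 3/2} h"
   by (intro Henstock_Kurzweil_Integration.integral_combine[symmetric] int) auto
  have a2: "integral {- real N - 1/2..real N + 3/2} h = integral {- real N - 1/2..real N + 1/2} h + integral {real N + 1/2..real N + 3/2} h"
   by (intro Henstock_Kurzweil_Integration.integral_combine[symmetric] int) auto
  have b1: "integral {-1/2..1/2} (\<lambda>x. h (x + of_int (- int (Suc N)))) = integral {- real N - 3/2..- real N - 1/2} h"
  proof -
   have "ri (- int (Suc N)) - 1/2 = - real N - 3/2" "ri (- int (Suc N)) + 1/2 = - real N - 1/2" by simp_all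
   then show ?thesis unfolding sh by (simp only:)
  qed
  have b2: "integral {-1/2..1/2} (\<lambda>x. h (x + of_int (int (Suc N)))) = integral {real N + 1/2..real N + 3/2} h"
  proof -
   have "ri (int (Suc N)) - 1/2 = real N + 1/2" "ri (int (Suc N)) + 1/2 = real N + 3/2" by simp_all
   then show ?thesis unfolding sh by (simp only:)
  qed
  have e1: "- real (Suc N) - 1/2 = - real N - 3/2" "real (Suc N) + 1/2 = real N + 3/2" by simp_all
  show ?case unfolding set e1 a1 a2 using Suc b1 b2 by simp
 qed
 have psi: "h x = er (of_int n * a) * (complex_of_real (exp (- (pi * s * (a + 1 * x)\<^sup>2))) * er (- of_int n * (a + 1 * x)))" for x
  unfolding h_def by (simp add: algebra_simps flip: e_add)
 have intL: "integrable lborel h"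
  unfolding psi[abs_def] by (intro integrable_mult_right lborel_integrable_real_affine[OF gauss_fourier_transform(2)[OF s]]) simp
 have L: "(LINT x|lborel. h x) = er (of_int n * a) * of_real (exp (- (pi * (of_int n)\<^sup>2 / s)) / sqrt s)"
 proof -
  have "(LINT x|lborel. h x) = er (of_int n * a) * (LINT x|lborel. complex_of_real (exp (- (pi * s * (a + 1 * x)\<^sup>2))) * er (- of_int n * (a + 1 * x)))"
   unfolding psi by (rule integral_mult_right_zero)
  also have "(LINT x|lborel. complex_of_real (exp (- (pi * s * (a + 1 * x)\<^sup>2))) * er (- of_int n * (a + 1 * x))) =
    (LINT x|lborel. complex_of_real (exp (- (pi * s * x\<^sup>2))) * er (- of_int n * x))"
   using lborel_integral_real_affine[of 1 "\<lambda>x. complex_of_real (exp (- (pi * s * x\<^sup>2))) * er (- of_int n * x)" a] by simp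
  finally show ?thesis unfolding gauss_fourier_transform(1)[OF s] .
 qed
 have "(\<lambda>N. LINT x|lborel. indicator {- real N - 1/2..real N + 1/2} x *\<^sub>R h x) \<longlonglongrightarrow> (LINT x|lborel. h x)"
 proof (rule integral_dominated_convergence[where w = "\<lambda>x. cmod (h x)"])
  show "AE x in lborel. (\<lambda>N. indicator {- real N - 1/2..real N + 1/2} x *\<^sub>R h x) \<longlonglongrightarrow> h x"
  proof (rule AE_I2)
   fix x :: real
   have "eventually (\<lambda>N. h x = indicator {- real N - 1/2..real N + 1/2} x *\<^sub>R h x) sequentially"
    using eventually_ge_at_top[of "nat \<lceil>\<bar>x\<bar>\<rceil>"]
   proof eventually_elim
    case (elim N)
    then have "\<bar>x\<bar> \<le> real N" by linarith
    then have "x \<in> {- real N - 1/2..real N + 1/2}" by auto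
    then show ?case by simp
   qed
   then show "(\<lambda>N. indicator {- real N - 1/2..real N + 1/2} x *\<^sub>R h x) \<longlonglongrightarrow> h x"
    by (rule Lim_transform_eventually[OF tendsto_const])
  qed
  show "AE x in lborel. norm (indicator {- real N - 1/2..real N + 1/2} x *\<^sub>R h x) \<le> cmod (h x)" for N
   by (auto simp: indicator_def)
 qed (use intL in \<open>auto intro: borel_measurable_integrable\<close>)
 moreover have "(LINT x|lborel. indicator {- real N - 1/2..real N + 1/2} x *\<^sub>R h x) = integral {- real N - 1/2..real N + 1/2} h" for N
  using set_borel_integral_eq_integral(2)[of "{- real N - 1/2..real N + 1/2}" h] borel_integrable_compact[of "{- real N - 1/2..real N + 1/2}" h] cphi
  by (simp add: set_lebesgue_integral_def set_integrable_def)
 ultimately show ?thesis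
  using LIMSEQ_unique[OF L1] unfolding partial L by simp
qed

text \<open>\<open>fourier_series_at_0\<close> yields convergence of symmetric partial sums only;
  absolute summability of the Gaussian coefficients upgrades this to an unconditional sum.\<close>

lemma poisson_gauss:
 assumes s: "s > 0"
 shows "((\<lambda>n::int. er (of_int n * a) * of_real (exp (- (pi * (of_int n)\<^sup>2 / s)) / sqrt s)) has_sum gauss_sum s (of_real a)) UNIV"
proof -
 define F where "F x = gauss_sum s (of_real (x + a))" for x
 have cg: "isCont (gauss_sum s) z" for z using gauss_sum_facts(1)[OF s, of z] DERIV_isCont by blast
 have "continuous_on UNIV (gauss_sum s)" using cg by (simp add: continuous_at_imp_continuous_on)
 then have cF: "continuous_on UNIV F" unfolding F_def by (rule continuous_on_compose2) (auto intro!: continuous_intros)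
 have pF: "F (x + 1) = F x" for x
  using gauss_sum_periodic[of s "of_real (x + a)"] by (simp add: F_def add_ac)
 obtain D where D: "(gauss_sum s has_field_derivative D) (at (of_real a))" using gauss_sum_facts(1)[OF s] by blast
 have dF: "((\<lambda>x. (F x - F 0) / of_real x) \<longlongrightarrow> D) (at 0)"
 proof -
  have "((\<lambda>h. (gauss_sum s (of_real a + h) - gauss_sum s (of_real a)) / h) \<longlongrightarrow> D) (at 0)" using D by (simp add: DERIV_def)
  moreover have "filterlim complex_of_real (at 0) (at 0)"
   unfolding filterlim_at by (auto intro!: tendsto_eq_intros simp: eventually_at_filter)
  ultimately have "((\<lambda>x. (gauss_sum s (of_real a + of_real x) - gauss_sum s (of_real a)) / of_real x) \<longlongrightarrow> D) (at 0)"
   by (rule filterlim_compose)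
  then show ?thesis by (simp add: F_def add.commute)
 qed
 let ?c = "\<lambda>n::int. er (of_int n * a) * of_real (exp (- (pi * (of_int n)\<^sup>2 / s)) / sqrt s)"
 have L: "(\<lambda>N. \<Sum>n\<in>{- int N..int N}. ?c n) \<longlonglongrightarrow> F 0"
  using fourier_series_at_0[OF cF pF dF] unfolding F_def gauss_sum_fourier_coeff[OF s] by simp
 have "?c summable_on UNIV"
 proof (rule abs_summable_summable, rule summable_on_comparison_test)
  show "(\<lambda>n::int. 1 / sqrt s * (ab n ^ 0 * exp (- (pi / s) * (ri n)\<^sup>2))) summable_on UNIV"
   by (intro summable_on_cmult_right summable_on_gauss) (use s in simp)
  show "cmod (?c n) \<le> 1 / sqrt s * (ab n ^ 0 * exp (- (pi / s) * (ri n)\<^sup>2))" for n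
   using s by (simp add: norm_mult norm_e norm_divide)
 qed auto
 then have H: "(?c has_sum infsum ?c UNIV) UNIV" by (rule has_sum_infsum)
 have "infsum ?c UNIV = F 0" by (rule LIMSEQ_unique[OF has_sum_symmetric_tendsto[OF H] L])
 with H show ?thesis by (simp add: F_def)
qed

section \<open>Unary theta series of residue classes and their inversion\<close>

definition theta1 :: "int \<Rightarrow> int \<Rightarrow> complex \<Rightarrow> complex" where
 "theta1 D r = theta_series (\<lambda>x. if x mod D = r mod D then 1 else 0) (ri D)"

lemma theta1_weight_bound: "\<bar>if x mod D = r mod D then 1 else (0::real)\<bar> \<le> 1 * ab x"
 by simp

lemma theta1_has_sum:
 assumes D: "D > 0" and z: "z \<in> uhp"
 shows "((\<lambda>x. of_real (if x mod D = r mod D then 1 else 0) * e (of_real (gq (ri D) x) * z)) has_sum theta1 D r z) UNIV"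
 unfolding theta1_def theta_series_def
 by (rule has_sum_infsum, rule abs_summable_summable, rule theta_series_summable[OF _ theta1_weight_bound z])
   (use D in simp)

lemma has_sum_sum:
 fixes f :: "'i \<Rightarrow> 'a \<Rightarrow> complex"
 assumes "\<And>i. i \<in> I \<Longrightarrow> (f i has_sum s i) A"
 shows "((\<lambda>x. \<Sum>i\<in>I. f i x) has_sum (\<Sum>i\<in>I. s i)) A"
 using assms by (induction I rule: infinite_finite_induct) (auto intro: has_sum_add has_sum_0)

lemma holomorphic_theta1: "D > 0 \<Longrightarrow> theta1 D r holomorphic_on uhp"
 unfolding theta1_def by (rule holomorphic_theta_series[OF _ theta1_weight_bound]) simp

lemma moderate_growth_theta1: "D > 0 \<Longrightarrow> moderate_growth (theta1 D r)"
 unfolding theta1_def by (rule moderate_growth_theta_series[OF _ theta1_weight_bound]) simp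

lemma minus_inverse_uhp: "z \<in> uhp \<Longrightarrow> - 1 / z \<in> uhp"
proof -
 assume z: "z \<in> uhp"
 then have "(Re z)\<^sup>2 + (Im z)\<^sup>2 > 0" by (auto simp: uhp_def intro: add_nonneg_pos)
 then show ?thesis using z by (simp add: uhp_def Im_divide)
qed

lemma uhp_not_nonpos: "z \<in> uhp \<Longrightarrow> z \<notin> \<real>\<^sub>\<le>\<^sub>0" "z \<in> uhp \<Longrightarrow> z \<noteq> 0"
 by (auto simp: uhp_def complex_nonpos_Reals_iff)

text \<open>With x = D n + r the left side is \<open>gauss_sum\<close> at s = D/y and shift r/D. Its
  Poisson dual runs over all integers with phase e(x r/D), which depends only on x modulo D, and
  sorting by residues gives the theta series on the right.\<close>

lemma theta1_inversion_imaginary: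
 assumes D: "D > 0" and y: "y > 0"
 shows "theta1 D r (- 1 / (\<i> * of_real y)) = of_real (sqrt (y / ri D)) *
   (\<Sum>s\<in>{0..<D}. er (ri (r * s) / ri D) * theta1 D s (\<i> * of_real y))"
proof -
 define d where "d = ri D"
 have d: "d > 0" using D by (simp add: d_def)
 define a where "a = ri r / d"
 define s where "s = d / y"
 have s: "s > 0" using d y by (simp add: s_def)
 have inv: "- 1 / (\<i> * of_real y) = \<i> * of_real (1 / y)" using y by (simp add: field_simps)
 have expo: "e (of_real (gq d x) * (\<i> * of_real t)) = exp (of_real (- (pi * (ri x)\<^sup>2 * t / d)))" for x t
 proof -
  have "2 * of_real pi * \<i> * (of_real (gq d x) * (\<i> * of_real t)) = of_real (- (pi * (ri x)\<^sup>2 * t / d))"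
   using d by (simp add: complex_eq_iff)
  then show ?thesis by (simp only: e_def)
 qed
 have L: "theta1 D r (- 1 / (\<i> * of_real y)) = gauss_sum s (of_real a)"
 proof -
  have bij: "bij_betw (\<lambda>n. D * n + r) UNIV {x. x mod D = r mod D}"
  proof (rule bij_betwI[where g = "\<lambda>x. (x - r) div D"])
   fix x assume "x \<in> {x. x mod D = r mod D}"
   then have "D dvd x - r" by (simp add: mod_eq_dvd_iff)
   then show "D * ((x - r) div D) + r = x" by simp
  qed (use D in auto)
  have "((\<lambda>n. exp (- (of_real (pi * s) * (of_int n + of_real a)\<^sup>2))) has_sum gauss_sum s (of_real a)) UNIV"
   by (rule gauss_sum_facts(2)[OF s])
  moreover have "exp (- (of_real (pi * s) * (of_int n + of_real a)\<^sup>2)) = e (of_real ((ri (D * n + r))\<^sup>2 / (2 * d)) * (\<i> * of_real (1 / y)))" for n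
  proof -
   have "pi * s * (ri n + a)\<^sup>2 = pi * (ri (D * n + r))\<^sup>2 * (1 / y) / d"
    using d y by (simp add: s_def a_def d_def[symmetric] power2_eq_square field_simps)
   moreover have "- (of_real (pi * s) * (of_int n + of_real a)\<^sup>2) = complex_of_real (- (pi * s * (ri n + a)\<^sup>2))" by simp
   ultimately show ?thesis unfolding expo by (simp only:)
  qed
  ultimately have "((\<lambda>x. e (of_real (gq d x) * (\<i> * of_real (1 / y)))) has_sum gauss_sum s (of_real a)) {x. x mod D = r mod D}"
   using has_sum_reindex_bij_betw[OF bij, of "\<lambda>x. e (of_real (gq d x) * (\<i> * of_real (1 / y)))"] by simp
  then have "((\<lambda>x. of_real (if x mod D = r mod D then 1 else 0) * e (of_real (gq d x) * (\<i> * of_real (1 / y)))) has_sum gauss_sum s (of_real a)) UNIV"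
   by (rule has_sum_cong_neutral[THEN iffD1, rotated -1]) auto
  moreover have "((\<lambda>x. of_real (if x mod D = r mod D then 1 else 0) * e (of_real (gq d x) * (\<i> * of_real (1 / y)))) has_sum theta1 D r (\<i> * of_real (1 / y))) UNIV"
   unfolding d_def by (rule theta1_has_sum[OF D]) (use y in \<open>simp add: uhp_def\<close>)
  ultimately show ?thesis unfolding inv by (rule has_sum_unique[symmetric])
 qed
 have "((\<lambda>x. \<Sum>k\<in>{0..<D}. er (ri (r * k) / d) * (of_real (if x mod D = k mod D then 1 else 0) * e (of_real (gq d x) * (\<i> * of_real y))))
   has_sum (\<Sum>k\<in>{0..<D}. er (ri (r * k) / d) * theta1 D k (\<i> * of_real y))) UNIV"
  unfolding d_def by (intro has_sum_sum has_sum_cmult_right theta1_has_sum D) (use y in \<open>simp add: uhp_def\<close>)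
 moreover have "(\<Sum>k\<in>{0..<D}. er (ri (r * k) / d) * (of_real (if x mod D = k mod D then 1 else 0) * e (of_real (gq d x) * (\<i> * of_real y))))
   = er (of_int x * a) * of_real (exp (- (pi * (of_int x)\<^sup>2 / s)))" for x
 proof -
  have "(\<Sum>k\<in>{0..<D}. er (ri (r * k) / d) * (of_real (if x mod D = k mod D then 1 else 0) * e (of_real (gq d x) * (\<i> * of_real y))))
   = (\<Sum>k\<in>{0..<D}. if k = x mod D then er (ri (r * k) / d) * e (of_real (gq d x) * (\<i> * of_real y)) else 0)"
   by (intro sum.cong refl) auto
  also have "\<dots> = er (ri (r * (x mod D)) / d) * e (of_real (gq d x) * (\<i> * of_real y))"
   using D by (simp add: sum.delta)
  also have "\<dots> = er (of_int x * a) * of_real (exp (- (pi * (of_int x)\<^sup>2 / s)))"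
  proof -
  have e1: "er (ri (r * (x mod D)) / d) = er (of_int x * a)"
  proof (rule e_of_real_cong)
   have "ri x = ri D * ri (x div D) + ri (x mod D)" by (metis mult_div_mod_eq of_int_add of_int_mult)
   then have "ri (r * (x mod D)) / d - ri x * a = of_int (- r * (x div D))"
    using d by (simp add: a_def d_def field_simps)
   then show "ri (r * (x mod D)) / d - ri x * a \<in> \<int>" by (metis Ints_of_int)
  qed
  have e2: "e (of_real (gq d x) * (\<i> * of_real y)) = of_real (exp (- (pi * (of_int x)\<^sup>2 / s)))"
   unfolding expo using d y by (simp add: s_def flip: exp_of_real)
  show ?thesis by (simp only: e1 e2)
  qed
  finally show ?thesis .
 qed
 ultimately have H: "((\<lambda>x. er (of_int x * a) * of_real (exp (- (pi * (of_int x)\<^sup>2 / s)))) has_sum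
   (\<Sum>k\<in>{0..<D}. er (ri (r * k) / d) * theta1 D k (\<i> * of_real y))) UNIV" by simp
 have "gauss_sum s (of_real a) = of_real (1 / sqrt s) * (\<Sum>k\<in>{0..<D}. er (ri (r * k) / d) * theta1 D k (\<i> * of_real y))"
 proof (rule has_sum_unique[OF poisson_gauss[OF s]])
  show "((\<lambda>n. er (of_int n * a) * of_real (exp (- (pi * (of_int n)\<^sup>2 / s)) / sqrt s)) has_sum
    of_real (1 / sqrt s) * (\<Sum>k\<in>{0..<D}. er (ri (r * k) / d) * theta1 D k (\<i> * of_real y))) UNIV"
   using has_sum_cmult_right[OF H, of "of_real (1 / sqrt s)"] by (simp add: mult_ac)
 qed
 moreover have "1 / sqrt s = sqrt (y / d)" using d y by (simp add: s_def real_sqrt_divide)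
 ultimately show ?thesis unfolding L d_def by simp
qed

text \<open>Both sides are holomorphic in t, so they agree on the half-plane once they agree on the
  imaginary axis. The root of unity e(-1/8) compensates csqrt(\<i> y) = e(1/8) sqrt y.\<close>

lemma theta1_inversion:
 assumes D: "D > 0" and t: "t \<in> uhp"
 shows "theta1 D r (- 1 / t) = csqrt t * (e (- 1 / 8) / of_real (sqrt (ri D))) *
   (\<Sum>s\<in>{0..<D}. er (ri (r * s) / ri D) * theta1 D s t)"
proof -
 let ?f = "\<lambda>t. theta1 D r (- 1 / t)"
 let ?g = "\<lambda>t. csqrt t * (e (- 1 / 8) / of_real (sqrt (ri D))) *
   (\<Sum>s\<in>{0..<D}. er (ri (r * s) / ri D) * theta1 D s t)"
 have hf: "?f holomorphic_on uhp"
 proof (rule holomorphic_on_compose_gen[OF _ holomorphic_theta1[OF D], unfolded o_def])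
  show "(\<lambda>t. - 1 / t) holomorphic_on uhp" by (intro holomorphic_intros) (use uhp_not_nonpos in auto)
 qed (use minus_inverse_uhp in auto)
 have hg: "?g holomorphic_on uhp"
  by (intro holomorphic_intros holomorphic_theta1 D) (use uhp_not_nonpos in auto)
 have "(\<lambda>t. ?f t - ?g t) t = 0"
 proof (rule analytic_continuation[of "\<lambda>t. ?f t - ?g t" uhp "(\<lambda>y. \<i> * of_real y) ` {0<..}" \<i>])
  show "(\<lambda>t. ?f t - ?g t) holomorphic_on uhp" by (intro holomorphic_on_diff hf hg)
  show "connected uhp" using convex_uhp by (rule convex_connected)
  show "\<i> islimpt (\<lambda>y. \<i> * of_real y) ` {0<..}"
   unfolding islimpt_approachable
  proof (intro allI impI)
   fix \<epsilon> :: real assume "\<epsilon> > 0"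
   then have "\<i> * of_real (1 + \<epsilon> / 2) \<noteq> \<i>" "dist (\<i> * of_real (1 + \<epsilon> / 2)) \<i> < \<epsilon>"
    by (auto simp: complex_eq_iff dist_norm algebra_simps norm_mult)
   then show "\<exists>x'\<in>(\<lambda>y. \<i> * of_real y) ` {0<..}. x' \<noteq> \<i> \<and> dist x' \<i> < \<epsilon>" using \<open>\<epsilon> > 0\<close>
    by (intro bexI[of _ "\<i> * of_real (1 + \<epsilon> / 2)"] conjI imageI) auto
  qed
  fix z assume "z \<in> (\<lambda>y. \<i> * complex_of_real y) ` {0<..}"
  then obtain y where y: "z = \<i> * of_real y" "y > 0" by auto
  have "csqrt z = of_real (sqrt y) * e (1 / 8)"
  proof (rule csqrt_unique)
   have "e (1 / 8) ^ 2 = e (1 / 4)" by (simp add: power2_eq_square flip: e_add)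
   moreover have "e (1 / 4) = \<i>"
   proof -
    have "2 * of_real pi * \<i> * (1 / 4) = \<i> * of_real (pi / 2)" by simp
    then show ?thesis by (simp only: e_def cis_conv_exp[symmetric] cis_pi_half)
   qed
   ultimately show "(of_real (sqrt y) * e (1 / 8))\<^sup>2 = z"
    using y by (simp add: power_mult_distrib flip: of_real_power)
   have "e (1 / 8) = cis (pi / 4)" by (simp add: e_def cis_conv_exp mult_ac)
   then have "Re (of_real (sqrt y) * e (1 / 8)) = sqrt y * cos (pi / 4)" by simp
   then show "0 < Re (of_real (sqrt y) * e (1 / 8)) \<or> Re (of_real (sqrt y) * e (1 / 8)) = 0 \<and> 0 \<le> Im (of_real (sqrt y) * e (1 / 8))"
   proof -
    assume eq: "Re (of_real (sqrt y) * e (1 / 8)) = sqrt y * cos (pi / 4)"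
    have "0 < Re (of_real (sqrt y) * e (1 / 8))" unfolding eq using y by (simp add: cos_45)
    then show ?thesis by blast
   qed
  qed
  moreover have "e (1 / 8) * e (- 1 / 8) = 1" by (simp flip: e_add)
  ultimately have "csqrt z * (e (- 1 / 8) / of_real (sqrt (ri D))) = of_real (sqrt (y / ri D))"
   by (simp add: real_sqrt_divide)
  then show "?f z - ?g z = 0" using theta1_inversion_imaginary[OF D y(2), of r] y by simp
 qed (use t open_uhp in \<open>auto simp: uhp_def\<close>)
 then show ?thesis by simp
qed

no_notation fps_nth (infixl \<open>$\<close> 75)

section \<open>Compatibility of the raising operators with inversion\<close>

lemma csqrt_powi_derivative:
 assumes "z \<in> uhp"
 shows "((\<lambda>w. csqrt w powi N) has_field_derivative (of_int N / (2 * z) * csqrt z powi N)) (at z)"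
proof -
 have nz: "csqrt z \<noteq> 0" "z \<noteq> 0" using uhp_not_nonpos[OF assms] by auto
 have D: "(csqrt has_field_derivative inverse (2 * csqrt z)) (at z)"
  by (rule has_field_derivative_csqrt) (use uhp_not_nonpos[OF assms] in auto)
 have "((\<lambda>w. csqrt w powi N) has_field_derivative of_int N * csqrt z powi (N - 1) * inverse (2 * csqrt z)) (at z)"
  by (rule DERIV_power_int[OF D disjI2[OF nz(1)]])
 moreover have "of_int N * csqrt z powi (N - 1) * inverse (2 * csqrt z) = of_int N / (2 * z) * csqrt z powi N"
 proof -
  have "csqrt z powi N = csqrt z powi (N - 1) * csqrt z" using nz power_int_add[of "csqrt z" "N - 1" 1] by simp
  moreover have "csqrt z * csqrt z = z" using power2_csqrt[of z] by (simp add: power2_eq_square)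
  ultimately show ?thesis using nz by (simp add: field_simps) (metis mult.assoc mult.commute)?
 qed
 ultimately show ?thesis by (simp only:)
qed

text \<open>The transformation law is differentiated: the derivative of -1/w is 1/w^2, and the
  logarithmic derivative of the automorphy factor is N/(2z).\<close>

lemma wirtinger_inversion:
 assumes F: "has_wirtinger F a b (- 1 / z)" and g: "has_wirtinger g a' b' z"
  and eq: "\<And>w. w \<in> uhp \<Longrightarrow> F (- 1 / w) = csqrt w powi N * g w" and z: "z \<in> uhp"
 shows "a = z\<^sup>2 * csqrt z powi N * (a' + of_int N / (2 * z) * g z)"
proof -
 have nz: "z \<noteq> 0" using uhp_not_nonpos[OF z] by simp
 have "((\<lambda>w. - 1 / w) has_field_derivative 1 / z\<^sup>2) (at z)"
  using nz by (auto intro!: derivative_eq_intros simp: power2_eq_square)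
 from has_derivative_compose[OF this[unfolded has_field_derivative_def] F[unfolded has_wirtinger_def]]
 have 1: "has_wirtinger (\<lambda>w. F (- 1 / w)) (a / z\<^sup>2) (b * cnj (1 / z\<^sup>2)) z"
  by (simp add: has_wirtinger_def mult.assoc)
 have "has_wirtinger (\<lambda>w. csqrt w powi N * g w) (of_int N / (2 * z) * csqrt z powi N * g z + csqrt z powi N * a')
   (0 * g z + csqrt z powi N * b') z"
  by (rule has_wirtinger_mult[OF has_wirtinger_holomorphic[OF csqrt_powi_derivative[OF z]] g])
 then have 2: "has_wirtinger (\<lambda>w. F (- 1 / w)) (of_int N / (2 * z) * csqrt z powi N * g z + csqrt z powi N * a')
   (0 * g z + csqrt z powi N * b') z"
  by (rule has_wirtinger_cong[OF _ open_uhp z]) (simp only: eq)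
 have "a / z\<^sup>2 = of_int N / (2 * z) * csqrt z powi N * g z + csqrt z powi N * a'"
  using has_wirtinger_d(3)[OF 1] has_wirtinger_d(3)[OF 2] by simp
 then show ?thesis using nz by (simp add: field_simps)
qed

lemma Im_minus_inverse: "z \<in> uhp \<Longrightarrow> Im (- 1 / z) = Im z / (cmod z)\<^sup>2"
 by (simp add: Im_divide cmod_power2)

text \<open>Raising is compatible with the action of S and increases the weight by 2; N is twice the
  weight, because the automorphy factor is a power of \<open>csqrt\<close>, so the exponent grows by
  4. A sum over J is carried along since the Weil representation mixes the components of a
  vector-valued form.\<close>

lemma Rpow_inversion:
 assumes DF: "\<And>i z. z \<in> uhp \<Longrightarrow> has_wirtinger (DF i) (DF (Suc i) z) (EF i z) z"
  and DG: "\<And>j i z. j \<in> J \<Longrightarrow> z \<in> uhp \<Longrightarrow> has_wirtinger (DG j i) (DG j (Suc i) z) (EG j i z) z"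
  and eq: "\<And>z. z \<in> uhp \<Longrightarrow> DF 0 (- 1 / z) = csqrt z powi N * (\<Sum>j\<in>J. c j * DG j 0 z)"
  and wt: "wt = ri N / 2" and z: "z \<in> uhp"
 shows "Rpow wt DF m (- 1 / z) = csqrt z powi (N + 4 * int m) * (\<Sum>j\<in>J. c j * Rpow wt (DG j) m z)"
 using z
proof (induction m arbitrary: z)
 case 0
 then show ?case using eq[OF 0] minus_inverse_uhp[OF 0] by (simp add: uhp_def)
next
 case (Suc m)
 define s where "s = - 1 / z"
 define k where "k = wt + 2 * real m"
 define h where "h = csqrt z powi (N + 4 * int m)"
 define g where "g = (\<lambda>z. \<Sum>j\<in>J. c j * Rpow wt (DG j) m z)"
 define S where "S = (\<Sum>j\<in>J. c j * Rpow wt (DG j) (Suc m) z)"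
 have v: "Im z > 0" "Im s > 0" and s: "s \<in> uhp"
  using Suc.prems minus_inverse_uhp[OF Suc.prems] by (auto simp: uhp_def s_def)
 have nz: "z \<noteq> 0" "csqrt z \<noteq> 0" using uhp_not_nonpos[OF Suc.prems] by auto
 have F: "has_wirtinger (Rpow wt DF m) ((Rpow wt DF (Suc m) s - of_real (k / Im s) * Rpow wt DF m s) / (2 * \<i>)) 
   (of_real (real m * (wt + real m - 1) / (Im s)\<^sup>2) / (2 * \<i>) * Rpow wt DF (m - 1) s
    + (\<Sum>i\<le>m. of_real (Rcoeff wt m i * Im s powr (real i - real m)) * (2 * \<i>) ^ i * EF i s)) s"
  unfolding k_def by (rule has_wirtinger_Rpow[where E = "\<lambda>i. EF i s", OF v(2) DF[OF s]])
 have G: "has_wirtinger g (\<Sum>j\<in>J. c j * ((Rpow wt (DG j) (Suc m) z - of_real (k / Im z) * Rpow wt (DG j) m z) / (2 * \<i>)))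
   (\<Sum>j\<in>J. c j * (of_real (real m * (wt + real m - 1) / (Im z)\<^sup>2) / (2 * \<i>) * Rpow wt (DG j) (m - 1) z
    + (\<Sum>i\<le>m. of_real (Rcoeff wt m i * Im z powr (real i - real m)) * (2 * \<i>) ^ i * EG j i z))) z"
  unfolding k_def g_def
  by (intro has_wirtinger_sum has_wirtinger_cmult has_wirtinger_Rpow[where E = "\<lambda>i. EG _ i z"] v(1) DG Suc.prems)
 have a': "(\<Sum>j\<in>J. c j * ((Rpow wt (DG j) (Suc m) z - of_real (k / Im z) * Rpow wt (DG j) m z) / (2 * \<i>))) = (S - of_real (k / Im z) * g z) / (2 * \<i>)"
  unfolding S_def g_def sum_distrib_left sum_subtractf[symmetric] sum_divide_distrib by (rule sum.cong) (auto simp: algebra_simps)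
 have IH: "Rpow wt DF m (- 1 / w) = csqrt w powi (N + 4 * int m) * g w" if "w \<in> uhp" for w
  using Suc.IH[OF that] by (simp add: g_def)
 have "(Rpow wt DF (Suc m) s - of_real (k / Im s) * Rpow wt DF m s) / (2 * \<i>) =
   z\<^sup>2 * h * ((S - of_real (k / Im z) * g z) / (2 * \<i>) + of_int (N + 4 * int m) / (2 * z) * g z)"
  using wirtinger_inversion[OF F[unfolded s_def] G IH Suc.prems] unfolding a' h_def s_def[symmetric] .
 moreover have "Rpow wt DF (Suc m) s = of_real (k / Im s) * Rpow wt DF m s +
   2 * \<i> * ((Rpow wt DF (Suc m) s - of_real (k / Im s) * Rpow wt DF m s) / (2 * \<i>))" by simp
 moreover have "Rpow wt DF m s = h * g z" using IH[OF Suc.prems] by (simp add: s_def h_def)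
 moreover have "of_int (N + 4 * int m) = complex_of_real (2 * k)" by (simp add: k_def wt)
 moreover have "k / Im s = k * (cmod z)\<^sup>2 / Im z" using Im_minus_inverse[OF Suc.prems] by (simp add: s_def)
 ultimately have "Rpow wt DF (Suc m) s = of_real (k * (cmod z)\<^sup>2 / Im z) * (h * g z) +
   2 * \<i> * (z\<^sup>2 * h * ((S - of_real (k / Im z) * g z) / (2 * \<i>) + of_real (2 * k) / (2 * z) * g z))"
  by (simp only:)
 also have "\<dots> = z\<^sup>2 * h * S + h * of_real k * g z * (of_real ((cmod z)\<^sup>2) / of_real (Im z) - z\<^sup>2 / of_real (Im z) + 2 * \<i> * z)"
  using nz v by (simp add: field_simps power2_eq_square)
 \<comment> \<open>This is z (cnj z - z + 2\<i>v) / v. Its vanishing says that the summand weight /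
   v of the raising operator absorbs the derivative of the automorphy factor.\<close>
 also have "of_real ((cmod z)\<^sup>2) / of_real (Im z) - z\<^sup>2 / of_real (Im z) + 2 * \<i> * z = 0"
 proof -
  have "of_real ((cmod z)\<^sup>2) - z\<^sup>2 + 2 * \<i> * z * of_real (Im z) = 0"
   unfolding complex_norm_square by (simp add: complex_eq_iff power2_eq_square algebra_simps)
  then have "(of_real ((cmod z)\<^sup>2) - z\<^sup>2 + 2 * \<i> * z * of_real (Im z)) / of_real (Im z) = 0" by simp
  then show ?thesis using v by (simp add: add_divide_distrib diff_divide_distrib)
 qed
 also have "z\<^sup>2 * h * S + h * of_real k * g z * 0 = csqrt z powi (N + 4 * int (Suc m)) * S"
 proof -
  have "csqrt z powi (N + 4 * int (Suc m)) = h * csqrt z ^ 4"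
   using nz power_int_add[of "csqrt z" "N + 4 * int m" 4] by (simp add: h_def algebra_simps)
  moreover have "csqrt z ^ 4 = z\<^sup>2"
   using power2_csqrt[of z] power_mult[of "csqrt z" 2 2] by simp
  ultimately show ?thesis by simp
 qed
 finally show ?case unfolding s_def S_def .
qed

section \<open>Bilinearity of the form\<close>

lemma bV_expand: "bV M X Y = - real M * (X$1$1 * Y$1$1 + X$1$2 * Y$2$1 + X$2$1 * Y$1$2 + X$2$2 * Y$2$2)"
 by (simp add: bV_def trace_def matrix_matrix_mult_def UNIV_2 algebra_simps)

lemma bV_commute: "bV M X Y = bV M Y X"
 by (simp add: bV_expand algebra_simps)

lemma bV_add_left: "bV M (X + Y) Z = bV M X Z + bV M Y Z"
 by (simp add: bV_expand algebra_simps)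

lemma bV_scale_left: "bV M (c *\<^sub>R X) Z = c * bV M X Z"
 by (simp add: bV_expand algebra_simps)

lemma bV_diff_left: "bV M (X - Y) Z = bV M X Z - bV M Y Z"
 by (simp add: bV_expand algebra_simps)

lemma bV_add_right: "bV M Z (X + Y) = bV M Z X + bV M Z Y"
 by (simp add: bV_expand algebra_simps)

lemma bV_scale_right: "bV M Z (c *\<^sub>R X) = c * bV M Z X"
 by (simp add: bV_expand algebra_simps)

lemma bV_diff_right: "bV M Z (X - Y) = bV M Z X - bV M Z Y"
 by (simp add: bV_expand algebra_simps)

lemmas bV_simps = bV_add_left bV_scale_left bV_diff_left bV_add_right bV_scale_right bV_diff_right

section \<open>The lattices\<close>

definition tr0 :: "(real^2^2) set" where "tr0 = {X. X$2$2 = - X$1$1}"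

lemma subspace_tr0: "subspace tr0"
 by (auto simp: subspace_def tr0_def)

lemma tr0_closed: "X \<in> tr0 \<Longrightarrow> Y \<in> tr0 \<Longrightarrow> X + Y \<in> tr0" "X \<in> tr0 \<Longrightarrow> c *\<^sub>R X \<in> tr0" "X \<in> tr0 \<Longrightarrow> Y \<in> tr0 \<Longrightarrow> X - Y \<in> tr0"
 by (auto simp: tr0_def)

lemma V_subset_tr0: "V M \<subseteq> tr0"
 by (auto simp: V_def tr0_def)

lemma polar_tr0: "X \<in> tr0 \<Longrightarrow> Y \<in> tr0 \<Longrightarrow> polar (qV M) X Y = bV M X Y"
 by (rule polar_qV) (auto simp: tr0_def trace_def UNIV_2)

lemma qV_tr0: "X \<in> tr0 \<Longrightarrow> qV M X = bV M X X / 2"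
 by (simp add: qV_def bV_expand tr0_def det_2 algebra_simps)

lemma span_V:
 assumes "M > 0" shows "span (V M) = tr0"
proof
 show "span (V M) \<subseteq> tr0" using V_subset_tr0 subspace_tr0 by (rule span_minimal)
 show "tr0 \<subseteq> span (V M)"
 proof
  fix X assume X: "X \<in> tr0"
  define E where "E a b c = (vector [vector [- b / (2 * real M), - c / real M], vector [a, b / (2 * real M)]] :: real^2^2)" for a b c :: real
  have E: "E a b c \<in> V M" if "a \<in> \<rat>" "b \<in> \<rat>" "c \<in> \<rat>" for a b c
   unfolding V_def E_def by (rule CollectI, rule exI[of _ a], rule exI[of _ b], rule exI[of _ c]) (simp only: that simp_thms)
  have "X = X$2$1 *\<^sub>R E 1 0 0 + (- 2 * real M * X$1$1) *\<^sub>R E 0 1 0 + (- real M * X$1$2) *\<^sub>R E 0 0 1"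
   using X assms by (simp add: vec_eq_iff forall_2 E_def tr0_def)
  also have "\<dots> \<in> span (V M)" by (intro span_add span_scale span_base E) auto
  finally show "X \<in> span (V M)" .
 qed
qed

lemma int_spanI: "(\<Sum>b\<in>B. of_int (c b) *\<^sub>R b) \<in> int_span B"
 unfolding int_span_def by blast

lemma int_span_closed:
 assumes "X \<in> int_span B" "Y \<in> int_span B"
 shows "X + Y \<in> int_span B" "of_int n *\<^sub>R X \<in> int_span B" "X - Y \<in> int_span B" "0 \<in> int_span B"
proof -
 obtain a where a: "X = (\<Sum>b\<in>B. of_int (a b) *\<^sub>R b)" using assms unfolding int_span_def by auto
 obtain c where c: "Y = (\<Sum>b\<in>B. of_int (c b) *\<^sub>R b)" using assms unfolding int_span_def by auto
 have "X + Y = (\<Sum>b\<in>B. of_int (a b + c b) *\<^sub>R b)" by (simp add: a c sum.distrib scaleR_add_left)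
 then show "X + Y \<in> int_span B" by (simp only: int_spanI)
 have "of_int n *\<^sub>R X = (\<Sum>b\<in>B. of_int (n * a b) *\<^sub>R b)" by (simp add: a scaleR_sum_right)
 then show "of_int n *\<^sub>R X \<in> int_span B" by (simp only: int_spanI)
 have "X - Y = (\<Sum>b\<in>B. of_int (a b - c b) *\<^sub>R b)" by (simp add: a c sum_subtractf scaleR_diff_left)
 then show "X - Y \<in> int_span B" by (simp only: int_spanI)
 show "0 \<in> int_span B" using int_spanI[of "\<lambda>_. 0" B] by simp
qed

locale special_lattice =
 fixes M :: nat and L :: "(real^2^2) set" and X0 :: "real^2^2" and zA :: complex
 assumes M: "M > 0" and evL: "even_lattice (qV M) L" and LV: "L \<subseteq> V M" and spanL: "span L = span (V M)"
  and X0: "X0 \<in> dual_lattice (qV M) L" and qX0: "qV M X0 > 0"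
  and zA: "zA \<in> uhp" and X1X0: "span {X1 M zA} = span {X0}"
begin

abbreviation "ip \<equiv> bV M"

definition "P = L \<inter> span {X0}"
definition "N = L \<inter> {X. bV M X X0 = 0}"

lemma span_L: "span L = tr0"
 using spanL span_V[OF M] by simp

lemma L_tr0: "X \<in> L \<Longrightarrow> X \<in> tr0"
 using span_L span_base by blast

lemma L_closed: "X \<in> L \<Longrightarrow> Y \<in> L \<Longrightarrow> X + Y \<in> L" "X \<in> L \<Longrightarrow> of_int n *\<^sub>R X \<in> L" "X \<in> L \<Longrightarrow> Y \<in> L \<Longrightarrow> X - Y \<in> L" "0 \<in> L"
proof -
 obtain B where "L = int_span B" using evL by (auto simp: even_lattice_def)
 then show "X \<in> L \<Longrightarrow> Y \<in> L \<Longrightarrow> X + Y \<in> L" "X \<in> L \<Longrightarrow> of_int n *\<^sub>R X \<in> L" "X \<in> L \<Longrightarrow> Y \<in> L \<Longrightarrow> X - Y \<in> L" "0 \<in> L"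
  by (simp_all add: int_span_closed int_span_closed(4)[OF int_spanI int_spanI])
qed

lemma qV_L: "X \<in> L \<Longrightarrow> qV M X \<in> \<int>"
 using evL unfolding even_lattice_def by blast

lemma ip_L: "X \<in> L \<Longrightarrow> Y \<in> L \<Longrightarrow> ip X Y \<in> \<int>"
 using qV_L L_closed polar_tr0[OF L_tr0 L_tr0, of X Y] unfolding polar_def by (metis Ints_diff)

lemma mem_dual_L: "X \<in> dual_lattice (qV M) L \<longleftrightarrow> X \<in> tr0 \<and> (\<forall>Y\<in>L. ip X Y \<in> \<int>)"
 unfolding dual_lattice_def span_L using polar_tr0 L_tr0 by auto

lemma L_subset_dual: "L \<subseteq> dual_lattice (qV M) L"
 using L_tr0 ip_L by (auto simp: mem_dual_L)

lemma X0_tr0: "X0 \<in> tr0" and ip_X0_L: "Y \<in> L \<Longrightarrow> ip X0 Y \<in> \<int>"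
 using X0 by (auto simp: mem_dual_L)

lemma ip_X0_pos: "ip X0 X0 > 0"
 using qX0 qV_tr0[OF X0_tr0] by simp

lemma X0_nonzero: "X0 \<noteq> 0"
 using ip_X0_pos bV_expand[of M 0 0] by auto

text \<open>Removing the normalizing scalar from \<open>X1 M zA\<close> keeps the computations in
  matrix entries polynomial.\<close>

definition mA :: "real^2^2" where "mA = vector [vector [- Re zA, (Re zA)\<^sup>2 + (Im zA)\<^sup>2], vector [- 1, Re zA]]"

lemma yA: "Im zA > 0"
 using zA by (simp add: uhp_def)

lemma X0_mA: "\<exists>c. c \<noteq> 0 \<and> X0 = c *\<^sub>R mA" and X1_X0: "\<exists>c. c \<noteq> 0 \<and> X1 M zA = c *\<^sub>R X0"
proof -
 note nz = X0_nonzero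
 have "X0 \<in> span {X1 M zA}" unfolding X1X0 by (simp add: span_base)
 then obtain c where c: "X0 = c *\<^sub>R X1 M zA" by (auto simp: span_singleton)
 then have c0: "c \<noteq> 0" using nz by auto
 have e: "X1 M zA = (1 / (sqrt (2 * real M) * Im zA)) *\<^sub>R mA" by (simp add: X1_def mA_def)
 show "\<exists>c. c \<noteq> 0 \<and> X0 = c *\<^sub>R mA"
  by (rule exI[of _ "c * (1 / (sqrt (2 * real M) * Im zA))"]) (use c c0 M yA in \<open>simp add: e\<close>)
 show "\<exists>c. c \<noteq> 0 \<and> X1 M zA = c *\<^sub>R X0"
  by (rule exI[of _ "1 / c"]) (use c c0 in simp)
qed

definition perp :: "(real^2^2) set" where "perp = {X \<in> tr0. ip X X0 = 0}"

text \<open>\<open>cs\<close> and \<open>ct\<close> are coordinates on the complement of X0 in which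
  the form becomes -2M times the Euclidean inner product, as \<open>ip_perp\<close> shows. They make
  its negative definiteness and all questions about orthogonality there elementary.\<close>

definition cs :: "real^2^2 \<Rightarrow> real" where "cs X = X$1$1 - X$2$1 * Re zA"
definition ct :: "real^2^2 \<Rightarrow> real" where "ct X = X$2$1 * Im zA"

lemma perp_12:
 assumes "X \<in> perp"
 shows "X$1$2 = X$2$1 * ((Re zA)\<^sup>2 + (Im zA)\<^sup>2) - 2 * X$1$1 * Re zA" "X$2$2 = - X$1$1"
proof -
 show t: "X$2$2 = - X$1$1" using assms by (simp add: perp_def tr0_def)
 obtain c where c: "c \<noteq> 0" "X0 = c *\<^sub>R mA" using X0_mA by blast
 have "ip X X0 = 0" using assms by (simp add: perp_def)
 then have "ip X mA = 0" unfolding c(2) bV_scale_right using c(1) by simp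
 then show "X$1$2 = X$2$1 * ((Re zA)\<^sup>2 + (Im zA)\<^sup>2) - 2 * X$1$1 * Re zA"
 proof -
  have "ip X mA = real M * (X$1$2 - (X$2$1 * ((Re zA)\<^sup>2 + (Im zA)\<^sup>2) - 2 * X$1$1 * Re zA))"
   by (simp add: bV_expand mA_def t algebra_simps)
  then show ?thesis using M \<open>ip X mA = 0\<close> by simp
 qed
qed

lemma ip_perp:
 assumes "X \<in> perp" "Y \<in> perp"
 shows "ip X Y = - 2 * real M * (cs X * cs Y + ct X * ct Y)"
 unfolding bV_expand perp_12[OF assms(1)] perp_12[OF assms(2)] cs_def ct_def by (simp add: power2_eq_square algebra_simps)

lemma perp_eq_0: "X \<in> perp \<Longrightarrow> cs X = 0 \<Longrightarrow> ct X = 0 \<Longrightarrow> X = 0"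
 using perp_12[of X] yA by (simp add: cs_def ct_def vec_eq_iff forall_2)

lemma ip_perp_neg: "X \<in> perp \<Longrightarrow> X \<noteq> 0 \<Longrightarrow> ip X X < 0"
proof -
 assume X: "X \<in> perp" "X \<noteq> 0"
 then have "cs X \<noteq> 0 \<or> ct X \<noteq> 0" using perp_eq_0 by blast
 then have "cs X * cs X + ct X * ct X > 0" by (auto simp: zero_less_mult_iff add_pos_nonneg add_nonneg_pos not_square_less_zero linorder_neq_iff)
 then show ?thesis using M unfolding ip_perp[OF X(1) X(1)] by (simp add: mult_neg_pos)
qed

text \<open>The complement of X0 is a plane. By the Lagrange identity two nonzero orthogonal vectors
  in it have nonvanishing determinant, so a vector orthogonal to both is 0.\<close>

lemma perp_orthogonal_eq_0:
 assumes X: "X \<in> perp" "X \<noteq> 0" and Y: "Y \<in> perp" "Y \<noteq> 0" and D: "D \<in> perp"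
  and o: "ip X Y = 0" "ip D X = 0" "ip D Y = 0"
 shows "D = 0"
proof -
 have 1: "cs X * cs Y + ct X * ct Y = 0" "cs D * cs X + ct D * ct X = 0" "cs D * cs Y + ct D * ct Y = 0"
  using o M ip_perp[OF X(1) Y(1)] ip_perp[OF D X(1)] ip_perp[OF D Y(1)] by simp_all
 have nX: "cs X * cs X + ct X * ct X \<noteq> 0" "cs Y * cs Y + ct Y * ct Y \<noteq> 0"
  using ip_perp_neg[OF X] ip_perp_neg[OF Y] ip_perp[OF X(1) X(1)] ip_perp[OF Y(1) Y(1)] by auto
 have "(cs X * ct Y - cs Y * ct X) * (cs X * ct Y - cs Y * ct X) = (cs X * cs X + ct X * ct X) * (cs Y * cs Y + ct Y * ct Y) - (cs X * cs Y + ct X * ct Y) * (cs X * cs Y + ct X * ct Y)"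
  by algebra
 then have det: "cs X * ct Y - cs Y * ct X \<noteq> 0" using 1(1) nX by auto
 have "cs D * (cs X * ct Y - cs Y * ct X) = 0" "ct D * (cs X * ct Y - cs Y * ct X) = 0" using 1 by algebra+
 then show ?thesis using det D perp_eq_0 by auto
qed

lemma perp_closed: "X \<in> perp \<Longrightarrow> Y \<in> perp \<Longrightarrow> X + Y \<in> perp" "X \<in> perp \<Longrightarrow> c *\<^sub>R X \<in> perp" "X \<in> perp \<Longrightarrow> Y \<in> perp \<Longrightarrow> X - Y \<in> perp"
 using tr0_closed by (auto simp: perp_def bV_simps)

lemma N_perp: "X \<in> N \<Longrightarrow> X \<in> perp"
 by (auto simp: N_def perp_def L_tr0)

text \<open>A linear map that vanishes on L vanishes on its span, which consists of all traceless
  matrices. This provides lattice vectors with nonzero image under a projection without handling a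
  basis of L.\<close>

lemma linear_nonzero_on_L:
 assumes "linear f" "x \<in> tr0" "f x \<noteq> (0 :: real^2^2)"
 shows "\<exists>Y\<in>L. f Y \<noteq> 0"
proof (rule ccontr)
 assume "\<not> (\<exists>Y\<in>L. f Y \<noteq> 0)"
 then have "f y = 0" if "y \<in> span L" for y
  using linear_eq_0_on_span[OF assms(1)] that by blast
 then show False using assms span_L by auto
qed

text \<open>Gram-Schmidt without division: every projection is multiplied by integral denominators,
  hence maps L to L, and \<open>linear_nonzero_on_L\<close> produces a vector on which it does not
  vanish.\<close>

lemma exists_frame: "\<exists>p b1 b2. p \<in> P \<and> p \<noteq> 0 \<and> b1 \<in> N \<and> b1 \<noteq> 0 \<and> b2 \<in> N \<and> b2 \<noteq> 0 \<and> ip b1 b2 = 0"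
proof -
 have "\<exists>Y\<in>L. ip X0 Y *\<^sub>R X0 \<noteq> 0"
  by (rule linear_nonzero_on_L[of _ X0]) (use X0_tr0 ip_X0_pos X0_nonzero in \<open>auto intro!: linearI simp: bV_simps scaleR_add_left\<close>)
 then obtain Y where Y: "Y \<in> L" "ip X0 Y \<noteq> 0" by auto
 obtain y where y: "ip X0 Y = of_int y" using ip_X0_L[OF Y(1)] by (auto elim: Ints_cases)
 \<comment> \<open>\<open>X0\<close> is only known to lie in the dual lattice, so a lattice vector Y
   not orthogonal to it takes its place: \<open>\<pi>\<close> is the projection to the complement of
   X0 along Y, cleared of denominators.\<close>
 define \<pi> where "\<pi> Z = ip X0 Y *\<^sub>R Z - ip X0 Z *\<^sub>R Y" for Z
 have lin: "linear \<pi>" unfolding \<pi>_def by (auto intro!: linearI simp: bV_simps algebra_simps)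
 have \<pi>N: "\<pi> Z \<in> N" if ZL: "Z \<in> L" for Z
 proof -
  obtain z where z: "ip X0 Z = of_int z" using ip_X0_L[OF ZL] by (auto elim: Ints_cases)
  have "\<pi> Z \<in> L" unfolding \<pi>_def y z by (intro L_closed ZL Y)
  moreover have "ip (\<pi> Z) X0 = 0" by (simp add: \<pi>_def bV_simps bV_commute[of M _ X0])
  ultimately show ?thesis by (simp add: N_def)
 qed
 have tr: "w \<in> perp \<Longrightarrow> \<pi> w = ip X0 Y *\<^sub>R w" for w by (simp add: \<pi>_def perp_def bV_commute[of M X0])
 \<comment> \<open>The vector of \<open>perp\<close> with prescribed coordinates \<open>cs\<close> =
   s and \<open>ct\<close> = t Im zA.\<close>
 define w where "w s t = (vector [vector [s + t * Re zA, t * ((Re zA)\<^sup>2 + (Im zA)\<^sup>2) - 2 * (s + t * Re zA) * Re zA], vector [t, - (s + t * Re zA)]] :: real^2^2)" for s t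
 have w: "w s t \<in> perp" "cs (w s t) = s" "ct (w s t) = t * Im zA" for s t
 proof -
  obtain c where c: "X0 = c *\<^sub>R mA" using X0_mA by blast
  have "ip (w s t) mA = 0" by (simp add: w_def bV_expand mA_def algebra_simps)
  then have "ip (w s t) X0 = 0" unfolding c bV_scale_right by simp
  moreover have "w s t \<in> tr0" by (simp add: tr0_def w_def)
  ultimately show "w s t \<in> perp" by (simp add: perp_def)
 qed (auto simp: w_def cs_def ct_def)
 have "\<exists>Z\<in>L. \<pi> Z \<noteq> 0"
 proof (rule linear_nonzero_on_L[OF lin, of "w 1 0"])
  show "w 1 0 \<in> tr0" using w(1)[of 1 0] by (simp add: perp_def)
  have "w 1 0 \<noteq> 0" using w(2)[of 1 0] by (auto simp: cs_def)
  then show "\<pi> (w 1 0) \<noteq> 0" using tr[OF w(1)] Y by simp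
 qed
 then obtain Z1 where Z1: "Z1 \<in> L" "\<pi> Z1 \<noteq> 0" by blast
 define b1 where "b1 = \<pi> Z1"
 have b1: "b1 \<in> N" "b1 \<noteq> 0" using Z1 \<pi>N by (auto simp: b1_def)
 note b1p = N_perp[OF b1(1)]
 have b1L: "b1 \<in> L" using b1 by (simp add: N_def)
 have b11: "ip b1 b1 \<noteq> 0" using ip_perp_neg[OF b1p b1(2)] by simp
 obtain n1 where n1: "ip b1 b1 = of_int n1" using ip_L[OF b1L b1L] by (auto elim: Ints_cases)
 define \<pi>2 where "\<pi>2 Z = ip b1 b1 *\<^sub>R Z - ip b1 Z *\<^sub>R b1" for Z
 have lin2: "linear (\<pi>2 \<circ> \<pi>)" by (rule linear_compose[OF lin]) (auto intro!: linearI simp: \<pi>2_def bV_simps algebra_simps)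
 have \<pi>2N: "\<pi>2 Z \<in> N \<and> ip b1 (\<pi>2 Z) = 0" if "Z \<in> N" for Z
 proof -
  have ZL: "Z \<in> L" using that by (simp add: N_def)
  obtain z where z: "ip b1 Z = of_int z" using ip_L[OF b1L ZL] by (auto elim: Ints_cases)
  have "\<pi>2 Z \<in> L" unfolding \<pi>2_def n1 z by (intro L_closed ZL b1L)
  then show ?thesis using that b1 by (auto simp: N_def \<pi>2_def bV_simps)
 qed
 \<comment> \<open>In the coordinates \<open>cs\<close> and \<open>ct\<close> this is
   \<open>b1\<close> rotated by a quarter turn.\<close>
 define w1 where "w1 = w (- ct b1) (cs b1 / Im zA)"
 have w1: "w1 \<in> perp" "w1 \<noteq> 0" "ip b1 w1 = 0"
 proof -
  show w1p: "w1 \<in> perp" by (simp add: w1_def w)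
  have c: "cs w1 = - ct b1" "ct w1 = cs b1" using yA by (auto simp: w1_def w)
  show "ip b1 w1 = 0" unfolding ip_perp[OF b1p w1p] c by simp
  show "w1 \<noteq> 0"
  proof
   assume "w1 = 0"
   then have "ct b1 = 0" "cs b1 = 0" using c by (auto simp: cs_def ct_def)
   then show False using perp_eq_0[OF b1p] b1 by simp
  qed
 qed
 have "\<exists>Z\<in>L. (\<pi>2 \<circ> \<pi>) Z \<noteq> 0"
 proof (rule linear_nonzero_on_L[OF lin2, of w1])
  show "w1 \<in> tr0" using w1 by (simp add: perp_def)
  show "(\<pi>2 \<circ> \<pi>) w1 \<noteq> 0" using tr[OF w1(1)] w1 b11 Y by (simp add: \<pi>2_def bV_simps)
 qed
 then obtain Z2 where Z2: "Z2 \<in> L" "\<pi>2 (\<pi> Z2) \<noteq> 0" by auto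
 define b2 where "b2 = \<pi>2 (\<pi> Z2)"
 have b2: "b2 \<in> N" "b2 \<noteq> 0" "ip b1 b2 = 0" using Z2 \<pi>2N[OF \<pi>N] by (auto simp: b2_def)
 note b2p = N_perp[OF b2(1)]
 have b2L: "b2 \<in> L" using b2 by (simp add: N_def)
 have b22: "ip b2 b2 \<noteq> 0" using ip_perp_neg[OF b2p b2(2)] by simp
 obtain n2 where n2: "ip b2 b2 = of_int n2" using ip_L[OF b2L b2L] by (auto elim: Ints_cases)
 \<comment> \<open>The part orthogonal to \<open>b1\<close> and \<open>b2\<close>, with denominators
   cleared. It is a multiple of X0, because its component \<open>D\<close> in the plane is
   orthogonal to both.\<close>
 define \<pi>3 where "\<pi>3 Z = (ip b1 b1 * ip b2 b2) *\<^sub>R Z - (ip b2 b2 * ip b1 Z) *\<^sub>R b1 - (ip b1 b1 * ip b2 Z) *\<^sub>R b2" for Z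
 have lin3: "linear \<pi>3" unfolding \<pi>3_def by (auto intro!: linearI simp: bV_simps algebra_simps)
 have "\<exists>Z\<in>L. \<pi>3 Z \<noteq> 0"
 proof (rule linear_nonzero_on_L[OF lin3 X0_tr0])
  show "\<pi>3 X0 \<noteq> 0" using b1p b2p b11 b22 X0_nonzero by (simp add: \<pi>3_def perp_def)
 qed
 then obtain Z3 where Z3: "Z3 \<in> L" "\<pi>3 Z3 \<noteq> 0" by blast
 define p where "p = \<pi>3 Z3"
 obtain z1 z2 where z: "ip b1 Z3 = of_int z1" "ip b2 Z3 = of_int z2" using ip_L b1L b2L Z3(1) by (meson Ints_cases)
 have pL: "p \<in> L" unfolding p_def \<pi>3_def z n1 n2 of_int_mult[symmetric] by (intro L_closed Z3 b1L b2L)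
 have "ip p b1 = 0" "ip p b2 = 0" using b2(3) unfolding p_def \<pi>3_def
  by (simp_all add: bV_simps bV_commute[of M Z3] bV_commute[of M b2 b1])
 moreover define D where "D = p - (ip p X0 / ip X0 X0) *\<^sub>R X0"
 have "D \<in> perp" using ip_X0_pos L_tr0[OF pL] X0_tr0 tr0_closed by (simp add: D_def perp_def bV_simps)
 moreover have "ip X0 b1 = 0" "ip X0 b2 = 0" using b1p b2p bV_commute by (auto simp: perp_def)
 ultimately have "D = 0"
  by (intro perp_orthogonal_eq_0[OF b1p b1(2) b2p b2(2)]) (auto simp: D_def bV_simps b2(3))
 then have "p \<in> span {X0}" by (simp add: D_def span_singleton)
 then have "p \<in> P" using pL by (simp add: P_def)
 then show ?thesis using Z3(2) b1 b2 by (auto simp: p_def)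
qed

end

section \<open>Cosets, signatures and the choice of a frame\<close>

lemma coset_eq_iff:
 fixes K :: "'a::ab_group_add set"
 assumes K: "0 \<in> K" "\<And>X Y. X \<in> K \<Longrightarrow> Y \<in> K \<Longrightarrow> X - Y \<in> K"
 shows "X +o K = Y +o K \<longleftrightarrow> X - Y \<in> K"
proof
 assume "X +o K = Y +o K"
 moreover have "X \<in> X +o K" using K(1) by (auto simp: elt_set_plus_def)
 ultimately have "X \<in> Y +o K" by simp
 then show "X - Y \<in> K" by (auto simp: elt_set_plus_def)
next
 have add: "a + b \<in> K" if "a \<in> K" "b \<in> K" for a b
  using K(2)[OF that(1) K(2)[OF K(1) that(2)]] by simp
 assume XY: "X - Y \<in> K"
 have "z \<in> X +o K \<longleftrightarrow> z \<in> Y +o K" for z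
 proof -
  have "z \<in> X +o K \<longleftrightarrow> z - X \<in> K" for X
   by (auto simp: elt_set_plus_def intro!: bexI[of _ "z - X"])
  moreover have "z - X \<in> K \<longleftrightarrow> z - Y \<in> K"
   using add[OF _ XY, of "z - X"] K(2)[OF _ XY, of "z - Y"] by auto
  ultimately show ?thesis by simp
 qed
 then show "X +o K = Y +o K" by blast
qed

lemma mem_coset: fixes K :: "'a::ab_group_add set" shows "z \<in> X +o K \<longleftrightarrow> z - X \<in> K"
 by (auto simp: elt_set_plus_def intro!: bexI[of _ "z - X"])

lemma dual_lattice_neg: "dual_lattice (\<lambda>X. - q X) K = dual_lattice q K"
proof -
 have "polar (\<lambda>X. - q X) X Y = - polar q X Y" for X Y :: 'a by (simp add: polar_def)
 then show ?thesis unfolding dual_lattice_def by (simp add: minus_in_Ints_iff)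
qed

lemma disc_group_neg: "disc_group (\<lambda>X. - q X) K = disc_group q K"
 by (simp add: disc_group_def dual_lattice_neg)

lemma pos_indexI:
 assumes "subspace W" "W \<subseteq> U" "\<And>X. X \<in> W \<Longrightarrow> X \<noteq> 0 \<Longrightarrow> q X > 0" "dim W = n"
  and "\<And>W. subspace W \<Longrightarrow> W \<subseteq> U \<Longrightarrow> (\<And>X. X \<in> W \<Longrightarrow> X \<noteq> 0 \<Longrightarrow> q X > 0) \<Longrightarrow> dim W \<le> n"
 shows "pos_index q U = n"
 unfolding pos_index_def
proof (rule Max_eqI)
 show "finite {dim W |W. subspace W \<and> W \<subseteq> U \<and> (\<forall>X\<in>W. X \<noteq> 0 \<longrightarrow> q X > 0)}"
  by (rule finite_subset[of _ "{..n}"]) (use assms(5) in auto)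
qed (use assms in auto)

text \<open>\<open>p\<close> generates P, whereas \<open>b1\<close> and \<open>b2\<close> merely
  span an orthogonal sublattice of finite index in N. The signs are chosen such that
  \<open>d1\<close> and \<open>d2\<close> are positive, like \<open>d0\<close>.\<close>

locale framed_lattice = special_lattice +
 fixes p b1 b2 :: "real^2^2" and d0 d1 d2 :: int
 assumes P_eq: "P = range (\<lambda>n. of_int n *\<^sub>R p)" and b1: "b1 \<in> N" "b1 \<noteq> 0" and b2: "b2 \<in> N" "b2 \<noteq> 0"
  and b12: "ip b1 b2 = 0"
  and d0: "ip p p = of_int d0" "d0 > 0" and d1: "ip b1 b1 = - of_int d1" and d2: "ip b2 b2 = - of_int d2"

text \<open>A vector of least positive norm generates the lattice P on a line: subtracting the
  integral part of a multiple leaves a shorter vector, which must be 0.\<close>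

lemma (in special_lattice) exists_framed: "\<exists>p b1 b2 d0 d1 d2. framed_lattice M L X0 zA p b1 b2 d0 d1 d2"
proof -
 obtain p' b1 b2 where p': "p' \<in> P" "p' \<noteq> 0" and b: "b1 \<in> N" "b1 \<noteq> 0" "b2 \<in> N" "b2 \<noteq> 0" "ip b1 b2 = 0"
  using exists_frame by blast
 define A where "A = {m::nat. m > 0 \<and> (\<exists>X\<in>P. ip X X = real m)}"
 have pos: "ip X X > 0" if "X \<in> P" "X \<noteq> 0" for X
 proof -
  obtain t where t: "X = t *\<^sub>R X0" using \<open>X \<in> P\<close> by (auto simp: P_def span_singleton)
  then have "t * t > 0" using that(2) by (auto simp: zero_less_mult_iff linorder_neq_iff)
  then show ?thesis using ip_X0_pos by (simp add: t bV_simps mult.assoc[symmetric])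
 qed
 have PL: "X \<in> L" if "X \<in> P" for X using that by (simp add: P_def)
 have inA: "nat \<lfloor>ip X X\<rfloor> \<in> A \<and> ip X X = real (nat \<lfloor>ip X X\<rfloor>)" if X: "X \<in> P" "X \<noteq> 0" for X
 proof -
  obtain m where m: "ip X X = of_int m" using ip_L[OF PL PL, OF X(1) X(1)] by (auto elim: Ints_cases)
  have "m > 0" using pos[OF X] m by simp
  then show ?thesis using m X unfolding A_def by auto
 qed
 define m where "m = (LEAST m. m \<in> A)"
 have mA: "m \<in> A" unfolding m_def using inA[OF p'] by (meson LeastI)
 have m_le: "m \<le> m'" if "m' \<in> A" for m' unfolding m_def using that by (rule Least_le)
 obtain p where p: "p \<in> P" "ip p p = real m" "m > 0" using mA by (auto simp: A_def)
 have p0: "p \<noteq> 0" using p by (auto simp: bV_expand)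
 have "P = range (\<lambda>n. of_int n *\<^sub>R p)"
 proof
  show "range (\<lambda>n. of_int n *\<^sub>R p) \<subseteq> P"
   using L_closed(2)[OF PL[OF p(1)]] p(1) by (auto simp: P_def intro: span_scale)
  show "P \<subseteq> range (\<lambda>n. of_int n *\<^sub>R p)"
  proof
   fix X assume X: "X \<in> P"
   obtain a c where ac: "X = a *\<^sub>R X0" "p = c *\<^sub>R X0" using X p by (auto simp: P_def span_singleton)
   then have c: "c \<noteq> 0" using p0 by auto
   define t where "t = a / c"
   have Xt: "X = t *\<^sub>R p" using c by (simp add: t_def ac)
   define Y where "Y = X - of_int \<lfloor>t\<rfloor> *\<^sub>R p"
   have "Y \<in> L" unfolding Y_def by (intro L_closed PL X p)
   moreover have "Y \<in> span {X0}" unfolding Y_def ac by (intro span_diff span_scale span_base) auto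
   ultimately have YP: "Y \<in> P" by (simp add: P_def)
   have Y: "Y = frac t *\<^sub>R p" by (simp add: Y_def Xt frac_def scaleR_diff_left)
   have "Y = 0"
   proof (rule ccontr)
    assume "Y \<noteq> 0"
    from inA[OF YP this] m_le have "real m \<le> ip Y Y" by (metis of_nat_le_iff)
    also have "ip Y Y = frac t * frac t * real m" by (simp add: Y bV_simps p)
    finally have "1 \<le> frac t * frac t" using p(3) by simp
    moreover have "frac t * frac t < 1 * 1" using frac_lt_1[of t] frac_ge_0[of t]
     by (intro mult_strict_mono') auto
    ultimately show False by simp
   qed
   then show "X \<in> range (\<lambda>n. of_int n *\<^sub>R p)" by (auto simp: Y_def)
  qed
 qed
 moreover have bL: "b1 \<in> L" "b2 \<in> L" using b by (auto simp: N_def)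
 obtain e1 where "ip b1 b1 = of_int e1" using ip_L[OF bL(1) bL(1)] by (auto elim: Ints_cases)
 moreover obtain e2 where "ip b2 b2 = of_int e2" using ip_L[OF bL(2) bL(2)] by (auto elim: Ints_cases)
 ultimately have "framed_lattice M L X0 zA p b1 b2 (int m) (- e1) (- e2)"
  using b p by unfold_locales (auto simp: P_def N_def)
 then show ?thesis by blast
qed

section \<open>Coordinates with respect to the frame and character sums\<close>

context framed_lattice
begin

lemma frame_L: "p \<in> L" "b1 \<in> L" "b2 \<in> L"
proof -
 have "1 *\<^sub>R p \<in> P" unfolding P_eq by (rule range_eqI[of _ _ 1]) simp
 then show "p \<in> L" by (simp add: P_def)
qed (use b1 b2 in \<open>auto simp: N_def\<close>)

lemma frame_tr0: "p \<in> tr0" "b1 \<in> tr0" "b2 \<in> tr0"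
 using frame_L L_tr0 by auto

lemma d12_pos: "d1 > 0" "d2 > 0"
 using ip_perp_neg[OF N_perp[OF b1(1)] b1(2)] ip_perp_neg[OF N_perp[OF b2(1)] b2(2)] d1 d2 by auto

lemma p_in_P: "p \<in> P"
 unfolding P_eq by (rule range_eqI[of _ _ 1]) simp

lemma p_X0: "\<exists>c. c \<noteq> 0 \<and> p = c *\<^sub>R X0"
proof -
 obtain c where c: "p = c *\<^sub>R X0" using p_in_P by (auto simp: P_def span_singleton)
 moreover have "c \<noteq> 0" using d0 c by (auto simp: bV_expand)
 ultimately show ?thesis by blast
qed

lemma ip_p_perp: "X \<in> perp \<Longrightarrow> ip X p = 0" "X \<in> perp \<Longrightarrow> ip p X = 0"
proof -
 obtain c where "p = c *\<^sub>R X0" using p_X0 by blast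
 then show "X \<in> perp \<Longrightarrow> ip X p = 0" "X \<in> perp \<Longrightarrow> ip p X = 0"
  by (auto simp: perp_def bV_simps bV_commute[of M X0])
qed

lemma ip_p_zero: "ip X p = 0 \<Longrightarrow> X \<in> tr0 \<Longrightarrow> X \<in> perp"
proof -
 assume "ip X p = 0" "X \<in> tr0"
 moreover obtain c where "c \<noteq> 0" "p = c *\<^sub>R X0" using p_X0 by blast
 ultimately show "X \<in> perp" unfolding perp_def by (auto simp: bV_simps)
qed

lemmas frame_perp = N_perp[OF b1(1)] N_perp[OF b2(1)]

lemma frame_ip: "ip p b1 = 0" "ip p b2 = 0" "ip b1 p = 0" "ip b2 p = 0" "ip b1 b2 = 0" "ip b2 b1 = 0"
 using ip_p_perp[OF frame_perp(1)] ip_p_perp[OF frame_perp(2)] b12 bV_commute[of M b2 b1] by auto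

text \<open>Integral coordinates on the dual of the lattice spanned by the frame: up to sign, the
  entries are the inner products with \<open>p\<close>, \<open>b1\<close>, \<open>b2\<close>. All of
  L' lies in the image, and q becomes diagonal.\<close>

definition pt :: "int \<times> int \<times> int \<Rightarrow> real^2^2" where
 "pt x = (of_int (fst x) / of_int d0) *\<^sub>R p + (of_int (fst (snd x)) / of_int d1) *\<^sub>R b1 + (of_int (snd (snd x)) / of_int d2) *\<^sub>R b2"

lemma pt_add: "pt (x + y) = pt x + pt y" and pt_diff: "pt (x - y) = pt x - pt y"
 by (auto simp: pt_def add_divide_distrib diff_divide_distrib scaleR_add_left scaleR_diff_left)

lemma pt_tr0: "pt x \<in> tr0"
 unfolding pt_def by (intro tr0_closed frame_tr0)

lemma ip_pt_frame: "ip (pt x) p = of_int (fst x)" "ip (pt x) b1 = - of_int (fst (snd x))" "ip (pt x) b2 = - of_int (snd (snd x))"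
 using d0 d12_pos by (auto simp: pt_def bV_simps frame_ip d1 d2)

lemma ip_pt: "ip (pt x) (pt y) = of_int (fst x * fst y) / of_int d0 - of_int (fst (snd x) * fst (snd y)) / of_int d1 - of_int (snd (snd x) * snd (snd y)) / of_int d2"
 unfolding pt_def[of y] bV_simps ip_pt_frame by (simp add: mult.commute)

lemma qV_pt: "qV M (pt x) = (of_int (fst x))\<^sup>2 / (2 * of_int d0) - (of_int (fst (snd x)))\<^sup>2 / (2 * of_int d1) - (of_int (snd (snd x)))\<^sup>2 / (2 * of_int d2)"
 unfolding qV_tr0[OF pt_tr0] ip_pt by (simp add: power2_eq_square)

lemma frame_expansion:
 assumes X: "X \<in> tr0"
 shows "X = (ip X p / of_int d0) *\<^sub>R p - (ip X b1 / of_int d1) *\<^sub>R b1 - (ip X b2 / of_int d2) *\<^sub>R b2"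
proof -
 define D where "D = X - ((ip X p / of_int d0) *\<^sub>R p - (ip X b1 / of_int d1) *\<^sub>R b1 - (ip X b2 / of_int d2) *\<^sub>R b2)"
 have D: "D \<in> tr0" unfolding D_def by (intro tr0_closed X frame_tr0)
 have "ip D p = 0" using d0 by (simp add: D_def bV_simps frame_ip)
 from ip_p_zero[OF this D] have "D \<in> perp" .
 moreover have "ip D b1 = 0" "ip D b2 = 0" using d12_pos by (simp_all add: D_def bV_simps frame_ip d1 d2)
 ultimately have "D = 0" by (intro perp_orthogonal_eq_0[OF frame_perp(1) b1(2) frame_perp(2) b2(2)]) (auto simp: b12)
 then show ?thesis by (simp add: D_def)
qed

lemma in_range_pt:
 assumes X: "X \<in> tr0" and i: "ip X p \<in> \<int>" "ip X b1 \<in> \<int>" "ip X b2 \<in> \<int>"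
 shows "\<exists>x. X = pt x"
proof -
 obtain x0 x1 x2 where x: "ip X p = of_int x0" "ip X b1 = of_int x1" "ip X b2 = of_int x2" using i by (auto elim!: Ints_cases)
 have "X = pt (x0, - x1, - x2)" unfolding pt_def using frame_expansion[OF X] by (simp add: x)
 then show ?thesis by blast
qed

lemma pt_inject: "pt x = pt y \<longleftrightarrow> x = y"
proof
 assume "pt x = pt y"
 then have "ip (pt x) p = ip (pt y) p" "ip (pt x) b1 = ip (pt y) b1" "ip (pt x) b2 = ip (pt y) b2" by simp_all
 then show "x = y" unfolding ip_pt_frame by (auto simp: prod_eq_iff)
qed simp

abbreviation "LD \<equiv> dual_lattice (qV M) L"

lemma LD_closed: "X \<in> LD \<Longrightarrow> Y \<in> LD \<Longrightarrow> X + Y \<in> LD" "X \<in> LD \<Longrightarrow> Y \<in> LD \<Longrightarrow> X - Y \<in> LD" "0 \<in> LD"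
 using tr0_closed subspace_tr0 by (auto simp: mem_dual_L bV_simps subspace_0 bV_expand[of M 0])

lemma LD_range_pt: "X \<in> LD \<Longrightarrow> \<exists>x. X = pt x"
 using frame_L by (intro in_range_pt) (auto simp: mem_dual_L)

definition md :: "int \<times> int \<times> int \<Rightarrow> int \<times> int \<times> int" where
 "md x = (fst x mod d0, fst (snd x) mod d1, snd (snd x) mod d2)"

definition rbox :: "(int \<times> int \<times> int) set" where "rbox = {0..<d0} \<times> {0..<d1} \<times> {0..<d2}"

lemma finite_rbox: "finite rbox" by (simp add: rbox_def)

lemma md_box: "md x \<in> rbox" using d0 d12_pos by (simp add: md_def rbox_def)

lemma md_id: "x \<in> rbox \<Longrightarrow> md x = x" by (auto simp: md_def rbox_def)

lemma pt_md: "pt x - pt (md x) \<in> L"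
proof -
 have "ri a / ri d - ri (a mod d) / ri d = of_int (a div d)" if "d > 0" for a d :: int
 proof -
  have "ri a = of_int (a div d) * of_int d + of_int (a mod d)"
   by (metis div_mult_mod_eq of_int_add of_int_mult)
  then show ?thesis using that by (simp add: field_simps)
 qed
 note 1 = this[OF d0(2)] this[OF d12_pos(1)] this[OF d12_pos(2)]
 have "pt x - pt (md x) = of_int (fst x div d0) *\<^sub>R p + of_int (fst (snd x) div d1) *\<^sub>R b1 + of_int (snd (snd x) div d2) *\<^sub>R b2"
  unfolding 1[symmetric] by (simp add: pt_def md_def scaleR_diff_left)
 also have "\<dots> \<in> L" by (intro L_closed frame_L)
 finally show ?thesis .
qed

lemma pt_md_LD: "pt (md x) \<in> LD \<longleftrightarrow> pt x \<in> LD"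
proof -
 have D: "pt x - pt (md x) \<in> LD" using pt_md L_subset_dual by blast
 show ?thesis using LD_closed(1)[OF D, of "pt (md x)"] LD_closed(2)[OF _ D, of "pt x"] by auto
qed

text \<open>The residues of L' modulo the lattice spanned by the frame. This group is finer than
  L'/L: several residues may lie in one class.\<close>

definition I0 :: "(int \<times> int \<times> int) set" where "I0 = {r \<in> rbox. pt r \<in> LD}"

lemma finite_I0: "finite I0" and I0_box: "I0 \<subseteq> rbox"
 using finite_rbox by (auto simp: I0_def)

text \<open>The coordinate functional of a basis vector of L is represented by the vector
  \<open>z\<close> built from its values on the frame. This vector lies in L', so y has integral
  coordinates; in short, the dual of the dual is L.\<close>

lemma double_dual: 
 assumes y: "y \<in> tr0" and int: "\<And>z. z \<in> LD \<Longrightarrow> ip z y \<in> \<int>"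
 shows "y \<in> L"
proof -
 obtain B where B: "finite B" "independent B" "L = int_span B" using evL by (auto simp: even_lattice_def)
 have BL: "b \<in> L" if "b \<in> B" for b
 proof -
  have "(\<Sum>c\<in>B. of_int (if c = b then 1 else 0) *\<^sub>R c) \<in> L" unfolding B(3) by (rule int_spanI)
  moreover have "(\<Sum>c\<in>B. of_int (if c = b then 1 else 0) *\<^sub>R c) = (\<Sum>c\<in>B. if c = b then c else 0)"
   by (intro sum.cong) auto
  ultimately show ?thesis using that B(1) by simp
 qed
 have "span B = tr0"
 proof
  show "span B \<subseteq> tr0" using BL L_tr0 by (intro span_minimal subspace_tr0) auto
  have "L \<subseteq> span B" unfolding B(3) int_span_def by (auto intro!: span_sum intro: span_scale span_base)
  then show "tr0 \<subseteq> span B" unfolding span_L[symmetric] by (rule span_minimal) auto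
 qed
 note sB = this
 define h where "h b X = representation B X b" for b X
 have lin: "h b (X + Y) = h b X + h b Y" "h b (c *\<^sub>R X) = c * h b X" "h b (X - Y) = h b X - h b Y"
  if "X \<in> tr0" "Y \<in> tr0" for b X Y c
  using that by (auto simp: h_def representation_add[OF B(2)] representation_scale[OF B(2)] representation_diff[OF B(2)] sB)
 have intL: "h b X \<in> \<int>" if XL: "X \<in> L" for b X
 proof -
  obtain c where c: "X = (\<Sum>b\<in>B. of_int (c b) *\<^sub>R b)" using XL unfolding B(3) int_span_def by auto
  have "h b X = (\<Sum>a\<in>B. representation B (of_int (c a) *\<^sub>R a) b)"
   unfolding h_def c by (subst representation_sum[OF B(2)]) (auto intro: span_scale span_base)
  also have "\<dots> = (\<Sum>a\<in>B. of_int (c a) * (if a = b then 1 else 0))"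
   by (intro sum.cong refl) (auto simp: representation_scale[OF B(2)] span_base representation_basis[OF B(2)])
  also have "\<dots> \<in> \<int>" by (intro Ints_sum Ints_mult) auto
  finally show ?thesis .
 qed
 have inty: "h b y \<in> \<int>" for b
 proof -
  define z where "z = (h b p / of_int d0) *\<^sub>R p - (h b b1 / of_int d1) *\<^sub>R b1 - (h b b2 / of_int d2) *\<^sub>R b2"
  have ipz: "ip z X = h b X" if X: "X \<in> tr0" for X
  proof -
   have "h b X = h b ((ip X p / of_int d0) *\<^sub>R p - (ip X b1 / of_int d1) *\<^sub>R b1 - (ip X b2 / of_int d2) *\<^sub>R b2)"
    using frame_expansion[OF X] by simp
   also have "\<dots> = ip X p / of_int d0 * h b p - ip X b1 / of_int d1 * h b b1 - ip X b2 / of_int d2 * h b b2"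
    using frame_tr0 tr0_closed by (simp add: lin)
   also have "\<dots> = ip z X" by (simp add: z_def bV_simps bV_commute[of M _ X] mult.commute)
   finally show ?thesis by simp
  qed
  have "z \<in> tr0" unfolding z_def by (intro tr0_closed frame_tr0)
  then have "z \<in> LD" using ipz intL L_tr0 by (auto simp: mem_dual_L)
  from int[OF this] ipz[OF y] show ?thesis by simp
 qed
 have "y = (\<Sum>b\<in>B. h b y *\<^sub>R b)"
  unfolding h_def using sum_representation_eq[OF B(2) _ B(1) order_refl, of y] y sB by simp
 also have "\<dots> = (\<Sum>b\<in>B. of_int \<lfloor>h b y\<rfloor> *\<^sub>R b)" using inty by (auto elim!: Ints_cases intro!: sum.cong simp: of_int_floor)
 also have "\<dots> \<in> L" unfolding B(3) by (rule int_spanI)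
 finally show ?thesis .
qed

lemma ip_md_cong: "ip (pt (md x)) (pt y) - ip (pt x) (pt y) \<in> \<int>"
proof -
 have gen: "ri ((a mod d) * c) / ri d - ri (a * c) / ri d \<in> \<int>" if "d > 0" for a c d :: int
 proof -
  have "ri (a mod d) = of_int a - of_int (a div d) * of_int d"
   by (metis minus_div_mult_eq_mod of_int_diff of_int_mult)
  then have "ri ((a mod d) * c) = of_int a * of_int c - of_int (a div d) * of_int d * of_int c"
   by (simp only: of_int_mult left_diff_distrib)
  then have "ri ((a mod d) * c) / ri d - ri (a * c) / ri d = of_int (- (a div d) * c)"
   using that by (simp add: diff_divide_distrib)
  then show ?thesis by (metis Ints_of_int)
 qed
 have "ip (pt (md x)) (pt y) - ip (pt x) (pt y) =
   (ri ((fst x mod d0) * fst y) / ri d0 - ri (fst x * fst y) / ri d0)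
   - (ri ((fst (snd x) mod d1) * fst (snd y)) / ri d1 - ri (fst (snd x) * fst (snd y)) / ri d1)
   - (ri ((snd (snd x) mod d2) * snd (snd y)) / ri d2 - ri (snd (snd x) * snd (snd y)) / ri d2)"
  unfolding ip_pt md_def fst_conv snd_conv by simp
 also have "\<dots> \<in> \<int>" by (intro Ints_diff gen d0 d12_pos)
 finally show ?thesis .
qed

text \<open>Orthogonality for the group of residues: the character given by \<open>pt y\<close> is
  trivial on L' exactly if \<open>pt y\<close> lies in L, by \<open>double_dual\<close>; otherwise a
  translation by some t multiplies the sum by a number different from 1.\<close>

lemma character_sum:
 "(\<Sum>r\<in>I0. er (ip (pt r) (pt y))) = (if pt y \<in> L then of_nat (card I0) else 0)"
proof (cases "pt y \<in> L")
 case True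
 have "er (ip (pt r) (pt y)) = 1" if "r \<in> I0" for r
  using that True unfolding e_of_real_eq_1_iff I0_def mem_dual_L by blast
 then show ?thesis using True by simp
next
 case False
 obtain z where z: "z \<in> LD" "ip z (pt y) \<notin> \<int>" using double_dual[OF pt_tr0] False by blast
 obtain t where t: "z = pt t" using LD_range_pt[OF z(1)] by blast
 let ?g = "\<lambda>r. er (ip (pt r) (pt y))"
 have mdm: "md (md a + b) = md (a + b)" "md (md a - b) = md (a - b)" for a b
  by (simp_all add: md_def mod_add_left_eq mod_diff_left_eq)
 have bij: "bij_betw (\<lambda>r. md (r + t)) I0 I0"
 proof (rule bij_betwI[where g = "\<lambda>r. md (r + (0 - t))"])
  have "md (r + t) \<in> I0" if "r \<in> I0" for r
   using that z LD_closed(1) by (simp add: I0_def md_box pt_md_LD pt_add t)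
  then show "(\<lambda>r. md (r + t)) \<in> I0 \<rightarrow> I0" by blast
  have "md (r + (0 - t)) \<in> I0" if "r \<in> I0" for r
   using that z LD_closed(2) by (simp add: I0_def md_box pt_md_LD pt_diff t)
  then show "(\<lambda>r. md (r + (0 - t))) \<in> I0 \<rightarrow> I0" by blast
  show "md (md (r + t) + (0 - t)) = r" if "r \<in> I0" for r using that by (simp add: mdm I0_def md_id)
  show "md (md (r + (0 - t)) + t) = r" if "r \<in> I0" for r using that by (simp add: mdm I0_def md_id)
 qed
 have "(\<Sum>r\<in>I0. ?g r) = (\<Sum>r\<in>I0. ?g (md (r + t)))"
  by (rule sum.reindex_bij_betw[OF bij, symmetric])
 also have "\<dots> = (\<Sum>r\<in>I0. ?g (r + t))"
  by (intro sum.cong refl e_of_real_cong ip_md_cong)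
 also have "\<dots> = (\<Sum>r\<in>I0. er (ip z (pt y)) * ?g r)"
  by (intro sum.cong refl) (simp add: pt_add bV_simps e_add t mult.commute)
 also have "\<dots> = er (ip z (pt y)) * (\<Sum>r\<in>I0. ?g r)" by (rule sum_distrib_left[symmetric])
 finally have "(1 - er (ip z (pt y))) * (\<Sum>r\<in>I0. ?g r) = 0" by (simp add: algebra_simps)
 then show ?thesis using z(2) False e_of_real_eq_1_iff[of "ip z (pt y)"] by auto
qed

definition lam :: "int \<times> int \<times> int \<Rightarrow> (real^2^2) set" where "lam r = pt r +o L"

abbreviation "DL \<equiv> disc_group (qV M) L"

lemma lam_eq: "pt x +o L = lam (md x)"
 unfolding lam_def by (subst coset_eq_iff) (auto simp: L_closed pt_md)

lemma lam_DL: "r \<in> I0 \<Longrightarrow> lam r \<in> DL"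
 by (auto simp: I0_def lam_def disc_group_def)

lemma DL_eq: "DL = lam ` I0"
proof
 show "DL \<subseteq> lam ` I0"
 proof
  fix \<mu> assume "\<mu> \<in> DL"
  then obtain X where X: "X \<in> LD" "\<mu> = X +o L" by (auto simp: disc_group_def)
  obtain x where x: "X = pt x" using LD_range_pt[OF X(1)] by blast
  have "md x \<in> I0" using X pt_md_LD md_box by (simp add: I0_def x)
  then show "\<mu> \<in> lam ` I0" using X(2) lam_eq x by simp
 qed
qed (use lam_DL in auto)

lemma finite_DL: "finite DL" by (simp add: DL_eq finite_I0)

text \<open>As \<open>lam\<close> need not be injective on \<open>I0\<close>, a class is recognized
  by reducing coordinates, and a sum over a class runs over all residues above it.\<close>

lemma mem_DL: "\<mu> \<in> DL \<Longrightarrow> pt x \<in> \<mu> \<longleftrightarrow> md x \<in> I0 \<and> lam (md x) = \<mu>"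
proof -
 assume "\<mu> \<in> DL"
 then obtain r where r: "r \<in> I0" "\<mu> = lam r" by (auto simp: DL_eq)
 have "pt x \<in> \<mu> \<longleftrightarrow> pt x +o L = \<mu>"
  unfolding r lam_def mem_coset by (subst coset_eq_iff) (auto simp: L_closed)
 moreover have "pt x \<in> LD" if "pt x \<in> \<mu>"
  using that r LD_closed(1)[of "pt r" "pt x - pt r"] L_subset_dual by (auto simp: lam_def mem_coset I0_def)
 ultimately show ?thesis using pt_md_LD md_box by (auto simp: lam_eq I0_def)
qed

lemma coset_subset_LD: "\<mu> \<in> DL \<Longrightarrow> X \<in> \<mu> \<Longrightarrow> X \<in> LD"
 using LD_closed L_subset_dual by (auto simp: disc_group_def elt_set_plus_def)

end

section \<open>The generators T and S acting on components\<close>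

lemma rep_coset: fixes K :: "'a::ab_group_add set" shows "0 \<in> K \<Longrightarrow> rep (X +o K) \<in> X +o K"
 unfolding rep_def by (rule someI[of _ X]) (simp add: mem_coset)

lemma mp_T_Mp2Z: "mp_T \<in> Mp2Z"
 by (auto simp: mp_T_def Mp2Z_def det_2 intro!: holomorphic_intros holomorphic_transform[of "\<lambda>_. 1" _ "restrict (\<lambda>_. 1) uhp"])

lemma mp_S_Mp2Z: "mp_S \<in> Mp2Z"
proof -
 have "csqrt holomorphic_on uhp" using uhp_not_nonpos by (intro holomorphic_intros) auto
 then have "restrict csqrt uhp holomorphic_on uhp" by (rule holomorphic_transform) auto
 then show ?thesis by (simp add: mp_S_def Mp2Z_def det_2)
qed

lemma transforms_T:
 assumes "transforms_with_weight wt q K f" "z \<in> uhp" "\<mu> \<in> disc_group q K"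
 shows "f (z + 1) \<mu> = er (q (rep \<mu>)) * f z \<mu>"
proof -
 have "f (moebius (fst mp_T) z) \<mu> = (snd mp_T z) powi \<lfloor>2 * wt\<rfloor> * weil_T q K (f z) \<mu>"
  using assms mp_T_Mp2Z weil_rep.T[of q K] unfolding transforms_with_weight_def by blast
 then show ?thesis using assms(2) by (simp add: mp_T_def moebius_def weil_T_def)
qed

lemma transforms_S:
 assumes "transforms_with_weight wt q K f" "z \<in> uhp" "\<mu> \<in> disc_group q K"
 shows "f (- 1 / z) \<mu> = csqrt z powi \<lfloor>2 * wt\<rfloor> * weil_S q K (f z) \<mu>"
proof -
 have "f (moebius (fst mp_S) z) \<mu> = (snd mp_S z) powi \<lfloor>2 * wt\<rfloor> * weil_S q K (f z) \<mu>"
  using assms mp_S_Mp2Z weil_rep.S[of q K] unfolding transforms_with_weight_def by blast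
 then show ?thesis using assms(2) by (simp add: mp_S_def moebius_def)
qed

lemma theta1_mod: "theta1 D (r mod D) = theta1 D r"
 by (simp add: theta1_def)

lemma theta1_uminus: "theta1 D (- r) = theta1 D r"
proof -
 have w: "(- x) mod D = (- r) mod D \<longleftrightarrow> x mod D = r mod D" for x :: int
  by (metis minus_equation_iff mod_minus_eq)
 have "(\<Sum>\<^sub>\<infinity>x. of_real (if x mod D = (- r) mod D then 1 else 0) * e (of_real (gq (ri D) x) * z))
   = (\<Sum>\<^sub>\<infinity>x\<in>range uminus. of_real (if x mod D = (- r) mod D then 1 else 0) * e (of_real (gq (ri D) x) * z))" for z
  by simp
 also have "\<dots> z = (\<Sum>\<^sub>\<infinity>x. of_real (if x mod D = r mod D then 1 else 0) * e (of_real (gq (ri D) x) * z))" for z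
  by (subst infsum_reindex) (simp_all add: o_def w)
 finally show ?thesis by (simp add: theta1_def theta_series_def fun_eq_iff)
qed

text \<open>The evenness of the lattice enters here: (D m)^2 / (2D) is an integer because D is
  even.\<close>

lemma square_residue_Ints:
 assumes "even D" "D > 0" "x mod D = r mod D"
 shows "gq (ri D) x - gq (ri D) r \<in> \<int>"
proof -
 obtain m where m: "x = r + D * m" using assms(3) by (metis mod_eqE mult.commute add.commute)
 obtain h where h: "D = 2 * h" using assms(1) by auto
 have "h \<noteq> 0" using assms(2) h by auto
 then have "gq (ri D) x - gq (ri D) r = of_int (r * m + h * m * m)"
  by (simp add: m h field_simps power2_eq_square)
 then show ?thesis by (metis Ints_of_int)
qed

lemma theta1_shift:
 assumes D: "even D" "D > 0"
 shows "quasi_periodic (er (gq (ri D) r)) (theta1 D r)"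
 unfolding quasi_periodic_def
proof (intro ballI)
 fix z assume z: "z \<in> uhp"
 let ?c = "er (gq (ri D) r)"
 have "((\<lambda>x. ?c * (of_real (if x mod D = r mod D then 1 else 0) * e (of_real (gq (ri D) x) * z)))
   has_sum ?c * theta1 D r z) UNIV"
  by (intro has_sum_cmult_right theta1_has_sum D z)
 moreover have "?c * (of_real (if x mod D = r mod D then 1 else 0) * e (of_real (gq (ri D) x) * z))
   = of_real (if x mod D = r mod D then 1 else 0) * e (of_real (gq (ri D) x) * (z + 1))" for x
  using e_of_real_cong[OF square_residue_Ints[OF D, of x r]] by (auto simp: distrib_left e_add)
 ultimately show "theta1 D r (z + 1) = ?c * theta1 D r z"
  using has_sum_unique theta1_has_sum[OF D(2), of "z + 1" r] z by (metis (no_types, lifting) has_sum_cong uhp_add(2))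
qed

section \<open>The lattices P and L under the Weil representation\<close>

context framed_lattice
begin

lemma qV_int_even: "ip X X = of_int d \<Longrightarrow> X \<in> L \<Longrightarrow> even d"
proof -
 assume X: "ip X X = of_int d" "X \<in> L"
 obtain m where "qV M X = of_int m" using qV_L[OF X(2)] by (auto elim: Ints_cases)
 then have "ri d = of_int (2 * m)" using qV_tr0[OF L_tr0[OF X(2)]] X(1) by simp
 then have "d = 2 * m" by (simp only: of_int_eq_iff)
 then show "even d" by simp
qed

lemma d_even: "even d0" "even d1" "even d2"
 using qV_int_even[of p d0] qV_int_even[of b1 "- d1"] qV_int_even[of b2 "- d2"] d0 d1 d2 frame_L by auto

lemma d_pos: "d0 > 0" "d1 > 0" "d2 > 0" "ri d0 > 0"
 using d0 d12_pos by auto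

lemma P_closed: "X \<in> P \<Longrightarrow> Y \<in> P \<Longrightarrow> X - Y \<in> P" "0 \<in> P"
proof -
 show "0 \<in> P" unfolding P_eq by (rule range_eqI[of _ _ 0]) simp
 assume "X \<in> P" "Y \<in> P"
 then obtain m n where "X = of_int m *\<^sub>R p" "Y = of_int n *\<^sub>R p" unfolding P_eq by auto
 then have "X - Y = of_int (m - n) *\<^sub>R p" by (simp add: scaleR_diff_left)
 then show "X - Y \<in> P" unfolding P_eq by blast
qed

lemma span_P: "span P = span {p}"
proof
 show "span P \<subseteq> span {p}" unfolding P_eq by (rule span_minimal) (auto intro: span_scale span_base)
 show "span {p} \<subseteq> span P" using p_in_P by (intro span_mono) auto
qed

definition pp :: "int \<Rightarrow> real^2^2" where "pp x = (of_int x / of_int d0) *\<^sub>R p"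

lemma pp_diff: "pp (x - y) = pp x - pp y" by (simp add: pp_def diff_divide_distrib scaleR_diff_left)

lemma ip_pp: "ip (pp x) p = of_int x" "ip (pp x) (pp y) = of_int (x * y) / of_int d0"
 using d0 by (auto simp: pp_def bV_simps)

lemma pp_tr0: "pp x \<in> tr0" unfolding pp_def by (intro tr0_closed frame_tr0)

lemma qV_pp: "qV M (pp x) = (of_int x)\<^sup>2 / (2 * of_int d0)"
 unfolding qV_tr0[OF pp_tr0] ip_pp by (simp add: power2_eq_square)

lemma pp_mem_P: "pp x \<in> P \<longleftrightarrow> x mod d0 = 0"
proof
 assume "pp x \<in> P"
 then obtain n where "pp x = of_int n *\<^sub>R p" unfolding P_eq by auto
 then have "ip (pp x) p = of_int n * of_int d0" by (simp add: bV_simps d0)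
 then have "ri x = of_int (n * d0)" by (simp add: ip_pp)
 then have "x = n * d0" by (simp only: of_int_eq_iff)
 then show "x mod d0 = 0" by simp
next
 assume "x mod d0 = 0"
 then obtain n where "x = d0 * n" by auto
 then have "pp x = of_int n *\<^sub>R p" using d0 by (simp add: pp_def)
 then show "pp x \<in> P" unfolding P_eq by blast
qed

lemma P_dual_eq: "dual_lattice (qV M) P = range pp"
proof
 show "dual_lattice (qV M) P \<subseteq> range pp"
 proof
  fix X assume X: "X \<in> dual_lattice (qV M) P"
  then obtain t where t: "X = t *\<^sub>R p" by (auto simp: dual_lattice_def span_P span_singleton)
  then have Xt: "X \<in> tr0" using frame_tr0 tr0_closed by simp
  have "ip X p \<in> \<int>" using X p_in_P polar_tr0[OF Xt frame_tr0(1)] by (auto simp: dual_lattice_def)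
  then obtain x where "ip X p = of_int x" by (auto elim: Ints_cases)
  then have "X = pp x" using d0 by (simp add: t pp_def bV_simps field_simps)
  then show "X \<in> range pp" by blast
 qed
 show "range pp \<subseteq> dual_lattice (qV M) P"
 proof clarify
  fix x
  have "pp x \<in> span P" unfolding span_P pp_def by (intro span_scale span_base) simp
  moreover have "polar (qV M) (pp x) Y \<in> \<int>" if YP: "Y \<in> P" for Y
  proof -
   obtain n where n: "Y = of_int n *\<^sub>R p" using YP unfolding P_eq by auto
   have "polar (qV M) (pp x) Y = ip (pp x) Y" by (rule polar_tr0) (use frame_tr0 tr0_closed in \<open>auto simp: pp_def n\<close>)
   then show ?thesis by (simp add: n bV_simps ip_pp)
  qed
  ultimately show "pp x \<in> dual_lattice (qV M) P" by (simp add: dual_lattice_def)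
 qed
qed

definition mu :: "int \<Rightarrow> (real^2^2) set" where "mu r = pp r +o P"

abbreviation "DP \<equiv> disc_group (qV M) P"

lemma mu_eq_iff: "mu x = mu y \<longleftrightarrow> x mod d0 = y mod d0"
proof -
 have "mu x = mu y \<longleftrightarrow> pp (x - y) \<in> P" unfolding mu_def pp_diff by (intro coset_eq_iff P_closed)
 then show ?thesis by (simp add: pp_mem_P mod_eq_dvd_iff dvd_eq_mod_eq_0)
qed

lemma DP_eq: "DP = mu ` {0..<d0}" and inj_mu: "inj_on mu {0..<d0}"
proof -
 have "DP = range mu" unfolding disc_group_def P_dual_eq mu_def by auto
 also have "\<dots> = mu ` {0..<d0}"
 proof
  have "mu x = mu (x mod d0)" "x mod d0 \<in> {0..<d0}" for x using d0 by (auto simp: mu_eq_iff)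
  then show "range mu \<subseteq> mu ` {0..<d0}" by blast
 qed auto
 finally show "DP = mu ` {0..<d0}" .
 show "inj_on mu {0..<d0}" by (rule inj_onI) (auto simp: mu_eq_iff)
qed

lemma mu_DP: "mu x \<in> DP"
 unfolding disc_group_def P_dual_eq mu_def by blast

lemma card_DP: "card DP = nat d0"
 unfolding DP_eq by (simp add: card_image inj_mu)

lemma mem_mu: "pp x \<in> mu r \<longleftrightarrow> x mod d0 = r mod d0"
 unfolding mu_def mem_coset pp_diff[symmetric] pp_mem_P by (simp add: mod_eq_dvd_iff dvd_eq_mod_eq_0)

lemma mu_subset: "X \<in> mu r \<Longrightarrow> \<exists>x. X = pp x \<and> x mod d0 = r mod d0"
proof -
 assume X: "X \<in> mu r"
 then obtain n where "X = pp r + of_int n *\<^sub>R p" unfolding mu_def P_eq elt_set_plus_def by auto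
 then have "X = pp (r + n * d0)" using d0 by (simp add: pp_def add_divide_distrib scaleR_add_left)
 moreover have "(r + n * d0) mod d0 = r mod d0" by simp
 ultimately show ?thesis by blast
qed

lemma rep_mu: "\<exists>x. rep (mu r) = pp x \<and> x mod d0 = r mod d0"
 using mu_subset rep_coset[OF P_closed(2)] unfolding mu_def by blast

lemma qV_rep_mu: "qV M (rep (mu r)) - (of_int r)\<^sup>2 / (2 * of_int d0) \<in> \<int>"
 using rep_mu[of r] square_residue_Ints[OF d_even(1) d_pos(1)] qV_pp by metis

lemma dim_le_1:
 assumes W: "subspace W" "\<And>X Y. X \<in> W \<Longrightarrow> Y \<in> W \<Longrightarrow> X \<noteq> 0 \<Longrightarrow> \<exists>c. Y = c *\<^sub>R X"
 shows "dim (W :: (real^2^2) set) \<le> 1"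
proof (cases "W \<subseteq> {0}")
 case True
 then show ?thesis by (simp add: dim_eq_0[THEN iffD2])
next
 case False
 then obtain X where X: "X \<in> W" "X \<noteq> 0" by auto
 have "W \<subseteq> span {X}" using W(2)[OF X(1) _ X(2)] by (auto simp: span_singleton)
 then have "dim W \<le> card {X}" using dim_le_card[of W "{X}"] by simp
 then show ?thesis by simp
qed

lemma qV_p: "c \<noteq> 0 \<Longrightarrow> qV M (c *\<^sub>R p) > 0"
proof -
 assume "c \<noteq> 0"
 then have "c * c > 0" by (auto simp: zero_less_mult_iff linorder_neq_iff)
 then show "qV M (c *\<^sub>R p) > 0" unfolding qV_tr0[OF tr0_closed(2)[OF frame_tr0(1)]] using d0 by (simp add: bV_simps mult.assoc[symmetric])
qed

lemma qV_perp: "X \<in> perp \<Longrightarrow> X \<noteq> 0 \<Longrightarrow> qV M X < 0"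
 using ip_perp_neg[of X] qV_tr0[of X M] by (simp add: perp_def)

lemma p_nonzero: "p \<noteq> 0" using d0 bV_expand[of M 0 0] by auto

lemma dim_span_p: "dim (span {p}) = 1"
 using p_nonzero by (simp add: dim_singleton)

lemma signature_P: "signature (\<lambda>X. - qV M X) P = (0, 1)"
proof -
 have "pos_index (\<lambda>X. - qV M X) (span P) = 0"
 proof (rule pos_indexI[where W = "{0}"])
  fix W assume W: "subspace W" "W \<subseteq> span P" "\<And>X. X \<in> W \<Longrightarrow> X \<noteq> 0 \<Longrightarrow> - qV M X > 0"
  have "W \<subseteq> {0}"
  proof
   fix X assume X: "X \<in> W"
   then obtain c where c: "X = c *\<^sub>R p" using W(2) by (auto simp: span_P span_singleton)
   have "c = 0" using W(3)[OF X] qV_p[of c] c p_nonzero by (cases "c = 0") auto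
   then show "X \<in> {0}" by (simp add: c)
  qed
  then show "dim W \<le> 0" by simp
 qed (auto simp: span_zero subspace_single_0)
 moreover have "pos_index (\<lambda>X. - (- qV M X)) (span P) = 1"
 proof (rule pos_indexI[where W = "span {p}"])
  fix W assume W: "subspace W" "W \<subseteq> span P"
  show "dim W \<le> 1" using dim_subset[OF W(2)] dim_span_p by (simp add: span_P)
 next
  fix X assume "X \<in> span {p}" "X \<noteq> 0"
  then show "- (- qV M X) > 0" using qV_p by (auto simp: span_singleton)
 qed (auto simp: span_P dim_span_p p_nonzero)
 ultimately show ?thesis by (simp add: signature_def)
qed

text \<open>The dimensions are bounded by comparison with the frame: a positive definite subspace
  meets \<open>perp\<close> trivially, and a negative definite one projects injectively along
  \<open>p\<close> to the plane of \<open>b1\<close> and \<open>b2\<close>.\<close>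

lemma signature_L: "signature (qV M) L = (1, 2)"
proof -
 have "pos_index (qV M) (span L) = 1"
 proof (rule pos_indexI[where W = "span {p}"])
  show "span {p} \<subseteq> span L" using frame_L by (intro span_mono) auto
  fix W assume W: "subspace W" "W \<subseteq> span L" "\<And>X. X \<in> W \<Longrightarrow> X \<noteq> 0 \<Longrightarrow> qV M X > 0"
  show "dim W \<le> 1"
  proof (rule dim_le_1[OF W(1)])
   fix X Y assume X: "X \<in> W" "X \<noteq> 0" and Y: "Y \<in> W"
   have t: "X \<in> tr0" "Y \<in> tr0" using W(2) X Y by (auto simp: span_L)
   have iX: "ip X p \<noteq> 0" using W(3)[OF X] ip_p_zero[OF _ t(1)] qV_perp[of X] X(2) by force
   define Z where "Z = Y - (ip Y p / ip X p) *\<^sub>R X"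
   have "Z \<in> W" unfolding Z_def by (intro subspace_diff[OF W(1)] subspace_scale[OF W(1)] X Y)
   moreover have "ip Z p = 0" using iX by (simp add: Z_def bV_simps)
   then have "Z \<in> perp" by (rule ip_p_zero) (use t tr0_closed in \<open>simp add: Z_def\<close>)
   ultimately have "Z = 0" using W(3)[of Z] qV_perp[of Z] by force
   then show "\<exists>c. Y = c *\<^sub>R X" by (auto simp: Z_def)
  qed
 next
  fix X assume "X \<in> span {p}" "X \<noteq> 0"
  then show "qV M X > 0" using qV_p by (auto simp: span_singleton)
 qed (auto simp: dim_span_p p_nonzero)
 moreover have "pos_index (\<lambda>X. - qV M X) (span L) = 2"
 proof (rule pos_indexI[where W = "span {b1, b2}"])
  show "span {b1, b2} \<subseteq> span L" using frame_L by (intro span_mono) auto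
  have "subspace perp" unfolding subspace_def using perp_closed by (auto simp: perp_def subspace_0[OF subspace_tr0] bV_expand[of M 0])
  then have "span {b1, b2} \<subseteq> perp" using frame_perp by (intro span_minimal) auto
  then show "- qV M X > 0" if "X \<in> span {b1, b2}" "X \<noteq> 0" for X using that qV_perp[of X] by auto
  have "independent {b1, b2}"
  proof -
   have "b1 \<notin> span {b2}"
   proof
    assume "b1 \<in> span {b2}"
    then obtain c where "b1 = c *\<^sub>R b2" by (auto simp: span_singleton)
    then have "ip b1 b1 = c * ip b1 b2" by (metis bV_scale_right)
    then show False using d1 d_pos b12 by simp
   qed
   then show ?thesis using b2 by (simp add: independent_insert)
  qed
  moreover have "b1 \<noteq> b2" using b12 d1 d_pos by auto
  ultimately show "dim (span {b1, b2}) = 2" by (simp add: dim_span_eq_card_independent dim_eq_card_independent)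
  fix W assume W: "subspace W" "W \<subseteq> span L" "\<And>X. X \<in> W \<Longrightarrow> X \<noteq> 0 \<Longrightarrow> - qV M X > 0"
  define g where "g X = X - (ip X p / of_int d0) *\<^sub>R p" for X
  have lg: "linear g" by (rule linearI) (auto simp: g_def bV_simps algebra_simps add_divide_distrib)
  have "inj_on g (span W)"
  proof (rule inj_onI)
   fix X Y assume "X \<in> span W" "Y \<in> span W" and eq: "g X = g Y"
   then have XY: "X - Y \<in> W" using W(1) by (simp add: span_eq_iff[THEN iffD2] subspace_diff)
   have "X - Y = (ip (X - Y) p / of_int d0) *\<^sub>R p" using eq by (simp add: g_def bV_simps diff_divide_distrib algebra_simps)
   then show "X = Y" using W(3)[OF XY] qV_p[of "ip (X - Y) p / of_int d0"] by force
  qed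
  then have "dim W = dim (g ` W)" by (rule dim_image_eq[OF lg, symmetric])
  also have "g ` W \<subseteq> span {b1, b2}"
  proof clarify
   fix X assume "X \<in> W"
   then have "X \<in> tr0" using W(2) span_L by auto
   then have "g X = - (ip X b1 / of_int d1) *\<^sub>R b1 - (ip X b2 / of_int d2) *\<^sub>R b2"
    using frame_expansion[of X] by (simp add: g_def algebra_simps)
   then show "g X \<in> span {b1, b2}" by (simp only:) (intro span_diff span_scale span_base; simp)
  qed
  then have "dim (g ` W) \<le> card {b1, b2}" by (intro dim_le_card) auto
  also have "\<dots> \<le> 2" by (simp add: card_insert_if)
  finally show "dim W \<le> 2" .
 qed auto
 ultimately show ?thesis by (simp add: signature_def)
qed

lemma rep_DL: "\<mu> \<in> DL \<Longrightarrow> rep \<mu> \<in> \<mu>"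
 unfolding disc_group_def using rep_coset[OF L_closed(4)] by blast

lemma rep_LD: "\<mu> \<in> DL \<Longrightarrow> rep \<mu> \<in> LD"
 using rep_DL coset_subset_LD by blast

lemma rep_lam: "rep (lam r) - pt r \<in> L"
 using rep_coset[OF L_closed(4)] unfolding lam_def mem_coset[symmetric] by blast

lemma weil_T_lam: "r \<in> I0 \<Longrightarrow> er (qV M (rep (lam r))) = er (qV M (pt r))"
proof (rule e_of_real_cong)
 assume r: "r \<in> I0"
 define Y where "Y = rep (lam r) - pt r"
 have Y: "Y \<in> L" unfolding Y_def by (rule rep_lam)
 have "rep (lam r) = pt r + Y" by (simp add: Y_def)
 then have "qV M (rep (lam r)) - qV M (pt r) = ip (pt r) Y + qV M Y"
  using polar_tr0[OF pt_tr0[of r] L_tr0[OF Y], of M] by (simp add: polar_def)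
 also have "\<dots> \<in> \<int>" using r Y qV_L by (auto simp: I0_def mem_dual_L intro!: Ints_add)
 finally show "qV M (rep (lam r)) - qV M (pt r) \<in> \<int>" .
qed

text \<open>The factor e((s - r)/8) is e(1/8) for signature (1,2), and also for P^- with signature
  (0,1). The two unary theta series for N contribute e(-1/8) each, so all roots of unity cancel in
  \<open>PA_inversion\<close>.\<close>

lemma weil_S_lam:
 assumes r: "r \<in> I0"
 shows "weil_S (qV M) L h (lam r) = e (1 / 8) / of_real (sqrt (real (card DL))) *
  (\<Sum>\<mu>\<in>DL. e (- of_real (ip (pt r) (rep \<mu>))) * h \<mu>)"
proof -
 have "e (- of_real (polar (qV M) (rep (lam r)) (rep \<mu>))) = e (- of_real (ip (pt r) (rep \<mu>)))" if \<mu>: "\<mu> \<in> DL" for \<mu>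
 proof -
  have R: "rep (lam r) \<in> LD" "rep \<mu> \<in> LD" using rep_LD lam_DL r \<mu> by auto
  have "polar (qV M) (rep (lam r)) (rep \<mu>) = ip (rep (lam r)) (rep \<mu>)" using R by (intro polar_tr0) (auto simp: mem_dual_L)
  moreover have "ip (rep (lam r) - pt r) (rep \<mu>) \<in> \<int>" using rep_lam[of r] R bV_commute by (auto simp: mem_dual_L)
  ultimately have "- polar (qV M) (rep (lam r)) (rep \<mu>) - (- ip (pt r) (rep \<mu>)) \<in> \<int>"
   by (simp add: bV_simps) (metis Ints_minus minus_diff_eq)
  from e_of_real_cong[OF this] show ?thesis by simp
 qed
 then show ?thesis by (simp add: weil_S_def signature_L)
qed

lemma weil_S_mu:
 "weil_S (\<lambda>X. - qV M X) P h (mu r) = e (1 / 8) / of_real (sqrt (ri d0)) *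
  (\<Sum>s\<in>{0..<d0}. er (ri (r * s) / ri d0) * h (mu s))"
proof -
 have "e (- of_real (polar (\<lambda>X. - qV M X) (rep (mu r)) (rep (mu s)))) = er (ri (r * s) / ri d0)" for s
 proof -
  obtain x y where x: "rep (mu r) = pp x" "x mod d0 = r mod d0" and y: "rep (mu s) = pp y" "y mod d0 = s mod d0"
   using rep_mu by blast
  have "polar (\<lambda>X. - qV M X) (pp x) (pp y) = - polar (qV M) (pp x) (pp y)" by (simp add: polar_def)
  also have "polar (qV M) (pp x) (pp y) = of_int (x * y) / of_int d0"
   unfolding polar_tr0[OF pp_tr0 pp_tr0] ip_pp ..
  finally have 1: "- polar (\<lambda>X. - qV M X) (pp x) (pp y) = of_int (x * y) / of_int d0" by simp
  have "(x * y) mod d0 = (r * s) mod d0" using x(2) y(2) by (rule mod_mult_cong)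
  then obtain m where "x * y = r * s + d0 * m" by (metis mod_eqE mult.commute add.commute)
  then have "ri (x * y) / ri d0 - ri (r * s) / ri d0 = of_int m"
   using d_pos by (simp only: of_int_add of_int_mult) (simp add: add_divide_distrib)
  then have "- polar (\<lambda>X. - qV M X) (pp x) (pp y) - ri (r * s) / ri d0 \<in> \<int>" unfolding 1 by simp
  from e_of_real_cong[OF this] show ?thesis by (simp add: x y)
 qed
 then show ?thesis
  using d_pos by (simp add: weil_S_def signature_P disc_group_neg card_DP sum.reindex[OF inj_mu, folded DP_eq])
qed

text \<open>All S-transforms are written as characters of the residue r, and summing over r by
  \<open>character_sum\<close> matches the class of f with the residue s. The form is negative on N
  while the characters of the unary theta series have a positive sign; \<open>fl\<close> corrects
  this, and the evenness of \<open>g1\<close> and \<open>g2\<close> absorbs it.\<close>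

lemma weil_combination:
 assumes g1: "\<And>s. g1 ((- s) mod d1) = g1 s" and g2: "\<And>s. g2 ((- s) mod d2) = g2 s"
 shows "(\<Sum>r\<in>I0. (\<Sum>\<mu>\<in>DL. e (- of_real (ip (pt r) (rep \<mu>))) * q \<mu>) *
   ((\<Sum>s\<in>{0..<d0}. er (ri (fst r * s) / ri d0) * g0 s) *
   (\<Sum>s\<in>{0..<d1}. er (ri (fst (snd r) * s) / ri d1) * g1 s) *
   (\<Sum>s\<in>{0..<d2}. er (ri (snd (snd r) * s) / ri d2) * g2 s)))
  = of_nat (card I0) * (\<Sum>r\<in>I0. q (lam r) * (g0 (fst r) * g1 (fst (snd r)) * g2 (snd (snd r))))"
proof -
 define g where "g s = g0 (fst s) * g1 (fst (snd s)) * g2 (snd (snd s))" for s :: "int \<times> int \<times> int"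
 define fl where "fl s = (fst s, - fst (snd s), - snd (snd s))" for s :: "int \<times> int \<times> int"
 have prod: "(\<Sum>s\<in>{0..<d0}. er (ri (fst r * s) / ri d0) * g0 s) *
   (\<Sum>s\<in>{0..<d1}. er (ri (fst (snd r) * s) / ri d1) * g1 s) *
   (\<Sum>s\<in>{0..<d2}. er (ri (snd (snd r) * s) / ri d2) * g2 s)
   = (\<Sum>s\<in>rbox. er (ip (pt r) (pt (fl s))) * g s)" for r
 proof -
  have "(\<Sum>s\<in>rbox. er (ip (pt r) (pt (fl s))) * g s) = (\<Sum>s0\<in>{0..<d0}. \<Sum>s1\<in>{0..<d1}. \<Sum>s2\<in>{0..<d2}.
    (er (ri (fst r * s0) / ri d0) * g0 s0) * ((er (ri (fst (snd r) * s1) / ri d1) * g1 s1) *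
    (er (ri (snd (snd r) * s2) / ri d2) * g2 s2)))"
   unfolding rbox_def sum.cartesian_product'
   by (intro sum.cong refl) (simp add: ip_pt fl_def g_def e_add mult_ac)
  also have "\<dots> = (\<Sum>s\<in>{0..<d0}. er (ri (fst r * s) / ri d0) * g0 s) *
   ((\<Sum>s\<in>{0..<d1}. er (ri (fst (snd r) * s) / ri d1) * g1 s) *
   (\<Sum>s\<in>{0..<d2}. er (ri (snd (snd r) * s) / ri d2) * g2 s))"
   unfolding sum_distrib_left[symmetric] sum_distrib_right[symmetric] ..
  finally show ?thesis by (simp only: mult.assoc)
 qed
 have inner: "(\<Sum>r\<in>I0. e (- of_real (ip (pt r) (rep \<mu>))) * er (ip (pt r) (pt (fl s)))) =
   (if md (fl s) \<in> I0 \<and> lam (md (fl s)) = \<mu> then of_nat (card I0) else 0)" if \<mu>: "\<mu> \<in> DL" for \<mu> s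
 proof -
  obtain y where y: "rep \<mu> = pt y" using LD_range_pt[OF rep_LD[OF \<mu>]] by blast
  have "e (- of_real (ip (pt r) (rep \<mu>))) * er (ip (pt r) (pt (fl s))) = er (ip (pt r) (pt (fl s - y)))" for r
   by (simp add: e_add[symmetric] y pt_diff bV_simps)
  then have "(\<Sum>r\<in>I0. e (- of_real (ip (pt r) (rep \<mu>))) * er (ip (pt r) (pt (fl s)))) = 
   (if pt (fl s - y) \<in> L then of_nat (card I0) else 0)" by (simp add: character_sum)
  moreover have "pt (fl s - y) \<in> L \<longleftrightarrow> pt (fl s) \<in> \<mu>"
  proof -
   obtain X where X: "\<mu> = X +o L" using \<mu> by (auto simp: disc_group_def)
   have "pt y - X \<in> L" using rep_DL[OF \<mu>] unfolding y by (simp only: X mem_coset)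
   moreover have "pt (fl s) - X = pt (fl s - y) + (pt y - X)" by (simp add: pt_diff)
   ultimately show ?thesis unfolding X mem_coset using L_closed(1,3) by (metis add_diff_cancel_right')
  qed
  ultimately show ?thesis using mem_DL[OF \<mu>] by simp
 qed
 have "(\<Sum>r\<in>I0. (\<Sum>\<mu>\<in>DL. e (- of_real (ip (pt r) (rep \<mu>))) * q \<mu>) * (\<Sum>s\<in>rbox. er (ip (pt r) (pt (fl s))) * g s))
  = (\<Sum>r\<in>I0. \<Sum>\<mu>\<in>DL. \<Sum>s\<in>rbox. q \<mu> * g s * (e (- of_real (ip (pt r) (rep \<mu>))) * er (ip (pt r) (pt (fl s)))))"
  unfolding sum_product by (intro sum.cong refl) (simp add: mult_ac)
 also have "\<dots> = (\<Sum>s\<in>rbox. \<Sum>\<mu>\<in>DL. \<Sum>r\<in>I0. q \<mu> * g s * (e (- of_real (ip (pt r) (rep \<mu>))) * er (ip (pt r) (pt (fl s)))))"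
  by (subst sum.swap, subst sum.swap[of _ rbox], rule sum.cong[OF refl], rule sum.swap)
 also have "\<dots> = (\<Sum>s\<in>rbox. \<Sum>\<mu>\<in>DL. q \<mu> * g s * (if md (fl s) \<in> I0 \<and> lam (md (fl s)) = \<mu> then of_nat (card I0) else 0))"
  unfolding sum_distrib_left[symmetric] by (intro sum.cong refl) (simp only: inner)
 also have "\<dots> = (\<Sum>s\<in>rbox. if md (fl s) \<in> I0 then of_nat (card I0) * (q (lam (md (fl s))) * g (md (fl s))) else 0)"
 proof (rule sum.cong[OF refl])
  fix s assume s: "s \<in> rbox"
  have gg: "g (md (fl s)) = g s" using s by (simp add: g_def md_def fl_def g1 g2 rbox_def mod_pos_pos_trivial)
   (auto simp: rbox_def)
  show "(\<Sum>\<mu>\<in>DL. q \<mu> * g s * (if md (fl s) \<in> I0 \<and> lam (md (fl s)) = \<mu> then of_nat (card I0) else 0)) =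
    (if md (fl s) \<in> I0 then of_nat (card I0) * (q (lam (md (fl s))) * g (md (fl s))) else 0)"
  proof (cases "md (fl s) \<in> I0")
   case True
   have "(\<Sum>\<mu>\<in>DL. q \<mu> * g s * (if md (fl s) \<in> I0 \<and> lam (md (fl s)) = \<mu> then of_nat (card I0) else 0)) =
    (\<Sum>\<mu>\<in>DL. if \<mu> = lam (md (fl s)) then q (lam (md (fl s))) * g s * of_nat (card I0) else 0)"
    using True by (intro sum.cong refl) auto
   then show ?thesis using True lam_DL[OF True] finite_DL by (simp add: gg mult_ac)
  qed simp
 qed
 also have "\<dots> = (\<Sum>t\<in>rbox. if t \<in> I0 then of_nat (card I0) * (q (lam t) * g t) else 0)"
 proof (rule sum.reindex_bij_betw[where h = "\<lambda>s. md (fl s)" and T = rbox])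
  have "md (fl (md (fl s))) = s" if "s \<in> rbox" for s
   using md_id[OF that] by (simp add: md_def fl_def mod_minus_eq)
  then show "bij_betw (\<lambda>s. md (fl s)) rbox rbox"
   by (intro bij_betwI[where g = "\<lambda>s. md (fl s)"]) (auto simp: md_box)
 qed
 also have "\<dots> = (\<Sum>t\<in>I0. of_nat (card I0) * (q (lam t) * g t))"
  using I0_box finite_rbox by (simp add: sum.inter_restrict[symmetric] Int_absorb1)
 finally show ?thesis unfolding prod by (simp add: sum_distrib_left g_def)
qed

end

section \<open>Growth and decay at the cusp\<close>

lemma moderate_growth_ext:
 fixes F P :: "complex \<Rightarrow> complex"
 assumes O: "(\<lambda>z. F z - P z - d * of_real (Im z powr s)) \<in> O[filtercomap Im at_top](\<lambda>z. of_real (exp (- \<epsilon> * Im z)))"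
  and P: "moderate_growth P"
 shows "moderate_growth (\<lambda>z. F z - d * of_real (Im z powr s))"
proof -
 obtain c where "\<forall>\<^sub>F z in filtercomap Im at_top. cmod (F z - P z - d * of_real (Im z powr s)) \<le> c * cmod (of_real (exp (- \<epsilon> * Im z)))"
  using O by (elim landau_o.bigE)
 then obtain Q where Q: "eventually Q at_top" "\<And>z. Q (Im z) \<Longrightarrow> cmod (F z - P z - d * of_real (Im z powr s)) \<le> c * cmod (of_real (exp (- \<epsilon> * Im z)))"
  unfolding eventually_filtercomap by blast
 obtain B where B': "\<And>t. t \<ge> B \<Longrightarrow> Q t" using Q(1) unfolding eventually_at_top_linorder by blast
 have B: "cmod (F z - P z - d * of_real (Im z powr s)) \<le> c * exp (- \<epsilon> * Im z)" if "Im z \<ge> B" for z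
  using Q(2)[OF B'[OF that]] by (simp only: norm_of_real abs_exp_cancel)
 have "moderate_growth (\<lambda>z. F z - P z - d * of_real (Im z powr s))"
  by (rule moderate_growthI[where B = B and D = c and C = "- \<epsilon>"], rule B)
 from moderate_growth_add[OF this P] show ?thesis by (simp add: algebra_simps)
qed

lemma moderate_growth_cong:
 assumes "moderate_growth F" "\<And>z. z \<in> uhp \<Longrightarrow> F z = G z"
 shows "moderate_growth G"
proof -
 obtain C where C: "C \<ge> 0" "\<And>z. Im z \<ge> C \<Longrightarrow> cmod (F z) \<le> exp (C * Im z)"
  using assms unfolding moderate_growth_def by metis
 show ?thesis
 proof (rule moderate_growthI[where B = "C + 1" and D = 1 and C = C])
  fix z assume z: "C + 1 \<le> Im z"
  then have "z \<in> uhp" using C(1) by (simp add: uhp_def)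
  then show "cmod (G z) \<le> 1 * exp (C * Im z)" using C(2)[of z] assms(2)[of z] z by simp
 qed
qed

lemma moderate_growth_fourier_polynomial:
 assumes "fourier_polynomial q K P" "\<mu> \<in> disc_group q K"
 shows "moderate_growth (\<lambda>z. P z \<mu>)"
proof -
 obtain I c where "\<And>z. z \<in> uhp \<Longrightarrow> P z \<mu> = (\<Sum>n\<in>I \<mu>. c \<mu> n * e (of_real n * z))"
  using assms unfolding fourier_polynomial_def by metis
 note P = this
 have "moderate_growth (\<lambda>z. \<Sum>n\<in>I \<mu>. c \<mu> n * e (of_real n * z))"
  by (rule moderate_growth_sum, rule moderate_growth_mult, rule moderate_growth_const, rule moderate_growth_e)
 then show ?thesis by (rule moderate_growth_cong) (simp only: P)
qed

lemma Rpow_quasi_periodic: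
 assumes "\<And>i. D i (z + 1) = c * D i z"
 shows "Rpow wt D m (z + 1) = c * Rpow wt D m z"
 unfolding Rpow_def by (simp add: assms sum_distrib_left mult_ac)

lemma shadow_series_shift:
 assumes "\<And>x. w x \<noteq> 0 \<Longrightarrow> er (gq d x) = c"
 shows "shadow_series w wt d j (z + 1) = cnj c * shadow_series w wt d j z"
proof -
 have "of_real (w x * shadow_coeff wt d j x (Im z)) * cnj (e (of_real (gq d x) * (z + 1)))
  = cnj c * (of_real (w x * shadow_coeff wt d j x (Im z)) * cnj (e (of_real (gq d x) * z)))" for x
  using assms[of x] by (cases "w x = 0") (auto simp: distrib_left e_add)
 then have "(\<Sum>\<^sub>\<infinity>x. of_real (w x * shadow_coeff wt d j x (Im z)) * cnj (e (of_real (gq d x) * (z + 1))))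
  = cnj c * (\<Sum>\<^sub>\<infinity>x. of_real (w x * shadow_coeff wt d j x (Im z)) * cnj (e (of_real (gq d x) * z)))"
  by (simp only: infsum_cmult_right')
 then show ?thesis by (simp add: shadow_series_def)
qed

text \<open>\<open>shadow_coeff_bound\<close> supplies the factor v^(-1/2), and by
  \<open>mean_shadow_bound\<close> the growth of F at the cusp does no harm.\<close>

lemma mean_shadow_tendsto_0:
 assumes F: "F holomorphic_on uhp" "quasi_periodic c F" and d: "d > 0" and wt: "wt = 3 / 2 \<or> wt = 1 / 2 \<and> w 0 = 0"
  and w: "\<And>x. \<bar>w x\<bar> \<le> C * ab x"
  and c: "\<And>x. w x \<noteq> 0 \<Longrightarrow> er (gq d x) = c"
 shows "((\<lambda>T. mean (\<lambda>z. F z * shadow_series w wt d l z) T) \<longlongrightarrow> 0) at_top"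
proof -
 define q where "q x = gq d x" for x
 obtain K where K: "K \<ge> 0" "\<And>v q g B. v \<ge> 1 \<Longrightarrow> (\<forall>x::int. q x \<ge> 0 \<and> \<bar>g x\<bar> \<le> B x \<and> (g x \<noteq> 0 \<longrightarrow> c = er (q x))) \<Longrightarrow>
   (\<lambda>x. B x * exp (- 2 * pi * q x * v)) summable_on UNIV \<Longrightarrow>
   cmod (integral {-1/2..1/2} (\<lambda>u. F (Complex u v) * (\<Sum>\<^sub>\<infinity>x. of_real (g x) * cnj (e (of_real (q x) * Complex u v)))))
    \<le> K * (\<Sum>\<^sub>\<infinity>x. B x * exp (- 2 * pi * q x * v))"
  using mean_shadow_bound[OF F] by blast
 obtain K' where K': "K' \<ge> 0" "\<And>x v. v \<ge> 1 \<Longrightarrow> \<bar>w x * shadow_coeff wt d l x v\<bar> \<le> K' * ab x ^ (2 * l + 1) * v powr (- 1 / 2)"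
  using shadow_coeff_bound[where w = w and C = C and ?v0.0 = 1 and j = l, OF d wt w] by auto
 define E where "E v x = (1 + ri \<bar>x\<bar>) ^ (2 * l + 1) * exp (- (2 * pi * v / (2 * d)) * (ri x)\<^sup>2)" for v x
 have sE: "E v summable_on UNIV" if "v \<ge> 1" for v
  unfolding E_def by (rule summable_on_gauss) (use d that in simp)
 define S where "S = infsum (E 1) UNIV"
 have bound: "cmod (mean (\<lambda>z. F z * shadow_series w wt d l z) v) \<le> K * K' * S / 2 ^ l * v powr (- 1 / 2)" if v: "v \<ge> 1" for v
 proof -
  let ?g = "\<lambda>x. w x * shadow_coeff wt d l x v" and ?B = "\<lambda>x. K' * ab x ^ (2 * l + 1) * v powr (- 1 / 2)"
  have BE: "?B x * exp (- 2 * pi * q x * v) = K' * v powr (- 1 / 2) * E v x" for x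
  proof -
   have "- 2 * pi * q x * v = - (2 * pi * v / (2 * d)) * (ri x)\<^sup>2" by (simp add: q_def)
   then show ?thesis by (simp add: E_def)
  qed
  have "cmod (integral {-1/2..1/2} (\<lambda>u. F (Complex u v) * (\<Sum>\<^sub>\<infinity>x. of_real (?g x) * cnj (e (of_real (q x) * Complex u v)))))
    \<le> K * (\<Sum>\<^sub>\<infinity>x. ?B x * exp (- 2 * pi * q x * v))"
  proof (rule K(2)[OF v])
   show "\<forall>x. q x \<ge> 0 \<and> \<bar>?g x\<bar> \<le> ?B x \<and> (?g x \<noteq> 0 \<longrightarrow> c = er (q x))"
    using K'(2)[OF v] c d by (auto simp: q_def)
   show "(\<lambda>x. ?B x * exp (- 2 * pi * q x * v)) summable_on UNIV"
    unfolding BE by (intro summable_on_cmult_right sE v)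
  qed
  also have "(\<Sum>\<^sub>\<infinity>x. ?B x * exp (- 2 * pi * q x * v)) = K' * v powr (- 1 / 2) * infsum (E v) UNIV"
   unfolding BE by (rule infsum_cmult_right')
  also have "infsum (E v) UNIV \<le> S" unfolding S_def
  proof (rule infsum_mono[OF sE[OF v] sE])
   have "2 * pi * 1 / (2 * d) \<le> 2 * pi * v / (2 * d)" using d v by (intro divide_right_mono mult_left_mono) auto
   then have "2 * pi * 1 / (2 * d) * (ri x)\<^sup>2 \<le> 2 * pi * v / (2 * d) * (ri x)\<^sup>2" for x by (intro mult_right_mono) auto
   then have "exp (- (2 * pi * v / (2 * d)) * (ri x)\<^sup>2) \<le> exp (- (2 * pi * 1 / (2 * d)) * (ri x)\<^sup>2)" for x
    by (simp only: exp_le_cancel_iff mult_minus_left neg_le_iff_le)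
   then show "E v x \<le> E 1 x" for x unfolding E_def by (intro mult_left_mono) auto
  qed simp
  finally have "cmod (integral {-1/2..1/2} (\<lambda>u. F (Complex u v) * (\<Sum>\<^sub>\<infinity>x. of_real (?g x) * cnj (e (of_real (q x) * Complex u v)))))
    \<le> K * (K' * v powr (- 1 / 2) * S)" using K(1) K'(1) by (simp add: mult_left_mono)
  moreover have "mean (\<lambda>z. F z * shadow_series w wt d l z) v = (1 / (2 * \<i>) ^ l) *
    integral {-1/2..1/2} (\<lambda>u. F (Complex u v) * (\<Sum>\<^sub>\<infinity>x. of_real (?g x) * cnj (e (of_real (q x) * Complex u v))))"
   unfolding mean_def shadow_series_def q_def complex.sel
   by (subst integral_mult_right[symmetric], rule Henstock_Kurzweil_Integration.integral_cong) simp
  moreover have "cmod (1 / (2 * \<i>) ^ l) = 1 / 2 ^ l" by (simp add: norm_divide norm_power norm_mult)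
  ultimately have "cmod (mean (\<lambda>z. F z * shadow_series w wt d l z) v) \<le> 1 / 2 ^ l * (K * (K' * v powr (- 1 / 2) * S))"
   by (simp only: norm_mult) (intro mult_left_mono; simp)
  also have "\<dots> = K * K' * S / 2 ^ l * v powr (- 1 / 2)" by simp
  finally show ?thesis .
 qed
 show ?thesis
 proof (rule Lim_null_comparison)
  show "\<forall>\<^sub>F v in at_top. cmod (mean (\<lambda>z. F z * shadow_series w wt d l z) v) \<le> K * K' * S / 2 ^ l * v powr (- 1 / 2)"
   using eventually_ge_at_top[of 1] by eventually_elim (rule bound)
  show "((\<lambda>v. K * K' * S / 2 ^ l * v powr (- 1 / 2)) \<longlongrightarrow> 0) at_top"
   by (intro tendsto_mult_right_zero tendsto_neg_powr filterlim_ident) simp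
 qed
qed

section \<open>The lift\<close>

text \<open>\<open>w\<close> is the polynomial in the theta kernel as a function of the coordinate
  along \<open>p\<close>: the constant 1 for the Siegel kernel with \<open>wt\<close> = 3/2, a
  multiple of x for the Millson kernel with \<open>wt\<close> = 1/2, since p_X(zA) depends only on
  the component of X along X0. The linear bound covers both.\<close>

locale lift_data = framed_lattice +
 fixes wt :: real and n :: nat and f :: "(real^2^2) vvfun" and w :: "int \<Rightarrow> real" and C :: real
 assumes wt: "wt = 3 / 2 \<or> wt = 1 / 2 \<and> w 0 = 0" and w: "\<And>x. \<bar>w x\<bar> \<le> C * ab x"
  and f: "weakly_holomorphic (1 - 2 * real n - wt) (qV M) L f"
begin

abbreviation "rho \<equiv> 1 - 2 * real n - wt"

definition fd :: "(real^2^2) set \<Rightarrow> nat \<Rightarrow> complex \<Rightarrow> complex" where "fd \<mu> i = (deriv ^^ i) (\<lambda>z. f z \<mu>)"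
definition wr :: "int \<Rightarrow> int \<Rightarrow> real" where "wr a x = (if x mod d0 = a mod d0 then w x else 0)"
definition th :: "int \<times> int \<times> int \<Rightarrow> complex \<Rightarrow> complex" where
 "th r z = theta1 d1 (fst (snd r)) z * theta1 d2 (snd (snd r)) z"
abbreviation "thP a \<equiv> theta_series (wr a) (of_int d0)"
abbreviation "qP a \<equiv> gq (ri d0) a"
abbreviation "qN r \<equiv> (ri (fst (snd r)))\<^sup>2 / (2 * ri d1) + (ri (snd (snd r)))\<^sup>2 / (2 * ri d2)"

lemma wt_pos: "wt > 0" "wt \<noteq> 1" using wt by auto

lemma fd_0 [simp]: "fd \<mu> 0 z = f z \<mu>" by (simp add: fd_def)

lemma f_transforms: "transforms_with_weight rho (qV M) L f"
 using f by (auto simp: weakly_holomorphic_def harmonic_maass_form_def harmonic_of_weight_def)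

lemma f_holo: "\<mu> \<in> DL \<Longrightarrow> (\<lambda>z. f z \<mu>) holomorphic_on uhp"
 using f by (auto simp: weakly_holomorphic_def)

lemma f_growth: "\<mu> \<in> DL \<Longrightarrow> moderate_growth (\<lambda>z. f z \<mu>)"
proof -
 assume \<mu>: "\<mu> \<in> DL"
 obtain P \<epsilon> where P: "fourier_polynomial (qV M) L P" and "(\<lambda>z. f z \<mu> - P z \<mu>) \<in> O[filtercomap Im at_top](\<lambda>z. of_real (exp (- \<epsilon> * Im z)))"
  using f \<mu> unfolding weakly_holomorphic_def harmonic_maass_form_def by blast
 then show ?thesis
  using moderate_growth_ext[where d = 0, OF _ moderate_growth_fourier_polynomial[OF P \<mu>], of "\<lambda>z. f z \<mu>" 0 \<epsilon>] by simp
qed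

lemma fd_tower: "\<mu> \<in> DL \<Longrightarrow> z \<in> uhp \<Longrightarrow> has_wirtinger (fd \<mu> i) (fd \<mu> (Suc i) z) 0 z"
 unfolding fd_def by (intro has_wirtinger_holomorphic higher_deriv_field_derivative f_holo)

lemma f_quasi_periodic: "r \<in> I0 \<Longrightarrow> quasi_periodic (er (qV M (pt r))) (\<lambda>z. f z (lam r))"
 unfolding quasi_periodic_def using transforms_T[OF f_transforms _ lam_DL] weil_T_lam by simp

lemma wr_bound: "\<bar>wr a x\<bar> \<le> C * ab x"
 using w[of x] w[of 0] by (auto simp: wr_def intro: order_trans[OF abs_ge_zero])

lemma wr_wt: "wt = 3 / 2 \<or> wt = 1 / 2 \<and> wr a 0 = 0"
 using wt by (auto simp: wr_def)

lemma wr_phase: "wr a x \<noteq> 0 \<Longrightarrow> er (qP x) = er (qP a)"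
 by (intro e_of_real_cong square_residue_Ints d_even d_pos) (auto simp: wr_def split: if_splits)

lemma th_holo: "th r holomorphic_on uhp"
 unfolding th_def by (intro holomorphic_intros holomorphic_theta1 d_pos)

lemma th_quasi_periodic: "quasi_periodic (er (qN r)) (th r)"
 unfolding th_def of_real_add e_add by (intro quasi_periodic_mult theta1_shift d_even d_pos)

lemma th_growth: "moderate_growth (th r)"
 unfolding th_def by (intro moderate_growth_mult moderate_growth_theta1 d_pos)

lemma thP_holo: "thP a holomorphic_on uhp"
 by (rule holomorphic_theta_series[OF _ wr_bound]) (use d_pos in simp)

text \<open>On \<open>pt r\<close>, q is the form on P minus the one on N^-; therefore the three
  phases under T cancel and the products of f, G and theta components are periodic.\<close>

lemma phase: "er (qV M (pt r)) * er (- qP (fst r)) * er (qN r) = 1"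
 unfolding e_add[symmetric] of_real_add[symmetric] by (simp add: qV_pt)

text \<open>The integrand of the lift in frame coordinates, including the factor v^(-2) of the
  measure; all powers of v outside the raised form combine to v^(-\<open>wt\<close>).\<close>

definition integrand :: "complex \<Rightarrow> complex" where
 "integrand z = (\<Sum>r\<in>I0. of_real (Im z powr (- wt)) * Rpow rho (fd (lam r)) n z * cnj (thP (fst r) z) * th r z)"

lemma fd_continuous: "\<mu> \<in> DL \<Longrightarrow> continuous_on uhp (fd \<mu> i)"
 by (rule wirtinger_continuous_on, rule fd_tower)

lemma integrand_continuous: "continuous_on uhp integrand"
 unfolding integrand_def
 by (intro continuous_intros continuous_on_Rpow fd_continuous lam_DL holomorphic_on_imp_continuous_on th_holo thP_holo)
   (auto simp: uhp_def)

text \<open>A function whose antiholomorphic derivative is that of a preimage of the theta series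
  under \<xi>, together with its \<tau>-derivatives. The holomorphic summand \<open>Gp\<close> stays
  a parameter, so that differentiation and the limit are treated before a particular preimage is
  given.\<close>

definition GG :: "(int \<Rightarrow> complex \<Rightarrow> complex) \<Rightarrow> int \<Rightarrow> nat \<Rightarrow> complex \<Rightarrow> complex" where
 "GG Gp a l z = (deriv ^^ l) (Gp a) z + shadow_series (wr a) wt (of_int d0) l z"

definition PA :: "(int \<Rightarrow> complex \<Rightarrow> complex) \<Rightarrow> complex \<Rightarrow> complex" where
 "PA Gp z = (\<Sum>r\<in>I0. primitive_form n wt (fd (lam r)) (GG Gp (fst r)) (th r) z)"

lemma shadow_wirtinger: "z \<in> uhp \<Longrightarrow> has_wirtinger (shadow_series (wr a) wt (of_int d0) j) (shadow_series (wr a) wt (of_int d0) (Suc j) z)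
  (shadow_deriv wt (thP a) j z) z"
 by (rule shadow_series_wirtinger[OF _ wr_wt wr_bound]) (use d_pos in simp_all)

lemma GG_tower:
 assumes Gp: "\<And>a. Gp a holomorphic_on uhp" and z: "z \<in> uhp"
 shows "has_wirtinger (GG Gp a j) (GG Gp a (Suc j) z) (shadow_deriv wt (thP a) j z) z"
proof -
 have "has_wirtinger (GG Gp a j) ((deriv ^^ Suc j) (Gp a) z + shadow_series (wr a) wt (of_int d0) (Suc j) z)
   (0 + shadow_deriv wt (thP a) j z) z"
  unfolding GG_def[abs_def]
  by (intro has_wirtinger_add has_wirtinger_holomorphic higher_deriv_field_derivative shadow_wirtinger Gp z)
 then show ?thesis by (simp add: GG_def[abs_def])
qed

lemma PA_wirtinger:
 assumes Gp: "\<And>a. Gp a holomorphic_on uhp"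
 shows "\<exists>a. continuous_on uhp a \<and> (\<forall>z\<in>uhp. has_wirtinger (PA Gp) (a z) (\<i> / 2 * integrand z) z)"
proof -
 have "\<exists>a. continuous_on uhp a \<and> (\<forall>z\<in>uhp. has_wirtinger (primitive_form n wt (fd (lam r)) (GG Gp (fst r)) (th r)) (a z)
   (\<i> / 2 * of_real (Im z powr (- wt)) * Rpow rho (fd (lam r)) n z * cnj (thP (fst r) z) * th r z) z)" if "r \<in> I0" for r
  by (rule primitive_form_wirtinger[where f = "fd (lam r)" and G = "GG Gp (fst r)" and \<theta>P = "thP (fst r)", OF fd_tower GG_tower th_holo wt_pos(1)]) (use that lam_DL Gp in auto)
 then obtain a where a: "\<And>r. r \<in> I0 \<Longrightarrow> continuous_on uhp (a r)"
  "\<And>r z. r \<in> I0 \<Longrightarrow> z \<in> uhp \<Longrightarrow> has_wirtinger (primitive_form n wt (fd (lam r)) (GG Gp (fst r)) (th r)) (a r z)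
   (\<i> / 2 * of_real (Im z powr (- wt)) * Rpow rho (fd (lam r)) n z * cnj (thP (fst r) z) * th r z) z"
  by metis
 have "has_wirtinger (PA Gp) (\<Sum>r\<in>I0. a r z) (\<Sum>r\<in>I0. \<i> / 2 * of_real (Im z powr (- wt)) * Rpow rho (fd (lam r)) n z * cnj (thP (fst r) z) * th r z) z"
  if "z \<in> uhp" for z
  unfolding PA_def[abs_def] by (intro has_wirtinger_sum a that)
 moreover have "(\<Sum>r\<in>I0. \<i> / 2 * of_real (Im z powr (- wt)) * Rpow rho (fd (lam r)) n z * cnj (thP (fst r) z) * th r z) = \<i> / 2 * integrand z" for z
  unfolding integrand_def sum_distrib_left by (simp add: mult_ac)
 moreover have "continuous_on uhp (\<lambda>z. \<Sum>r\<in>I0. a r z)" by (intro continuous_intros a)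
 ultimately show ?thesis by (intro exI[of _ "\<lambda>z. \<Sum>r\<in>I0. a r z"] conjI ballI) (simp_all only:)
qed

lemma fd_shift: "r \<in> I0 \<Longrightarrow> z \<in> uhp \<Longrightarrow> fd (lam r) i (z + 1) = er (qV M (pt r)) * fd (lam r) i z"
 unfolding fd_def by (intro quasi_periodicD quasi_periodic_higher_deriv f_quasi_periodic f_holo lam_DL)

lemma cnj_phase: "cnj (er x) = er (- x)"
 by (simp add: cnj_e)

lemma PA_periodic:
 assumes Gp: "\<And>a. Gp a holomorphic_on uhp" "\<And>a. quasi_periodic (er (- qP a)) (Gp a)" and t: "t \<in> uhp"
 shows "PA Gp (t + 1) = PA Gp t"
proof -
 have sh: "shadow_series (wr a) wt (of_int d0) l (t + 1) = er (- qP a) * shadow_series (wr a) wt (of_int d0) l t" for a l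
  unfolding cnj_phase[symmetric] by (rule shadow_series_shift) (rule wr_phase)
 have GG1: "GG Gp a l (t + 1) = er (- qP a) * GG Gp a l t" for a l
  unfolding GG_def sh
   quasi_periodicD[OF quasi_periodic_higher_deriv[OF Gp(2) Gp(1)] t] by (simp only: distrib_left)
 have "primitive_form n wt (fd (lam r)) (GG Gp (fst r)) (th r) (t + 1) = primitive_form n wt (fd (lam r)) (GG Gp (fst r)) (th r) t"
  if r: "r \<in> I0" for r
 proof -
  let ?a = "er (qV M (pt r))" and ?b = "er (- qP (fst r))" and ?c = "er (qN r)"
  have "(?a * x) * (?b * y) * (?c * z) = (?a * ?b * ?c) * (x * y * z)" for x y z by (simp add: mult_ac)
  then have alg: "(?a * x) * (?b * y) * (?c * z) = x * y * z" for x y z by (simp only: phase mult_1)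
  show ?thesis
   unfolding primitive_form_def Rpow_quasi_periodic[of "fd (lam r)" t, OF fd_shift[OF r t]]
    Rpow_quasi_periodic[of "GG Gp (fst r)" t, OF GG1] quasi_periodicD[OF th_quasi_periodic t] alg ..
 qed
 then show ?thesis unfolding PA_def by (intro sum.cong refl)
qed

definition PL :: "(int \<Rightarrow> complex \<Rightarrow> complex) \<Rightarrow> complex" where
 "PL Gp = (\<Sum>r\<in>I0. \<Sum>j\<le>n. of_real (acoeff n wt j) * (2 * \<i>) ^ n *
   mean (\<lambda>z. (deriv ^^ (n - j)) (\<lambda>z. f z (lam r)) z * (deriv ^^ j) (Gp (fst r)) z * th r z) 1)"

lemma PA_limit:
 assumes Gp: "\<And>a. Gp a holomorphic_on uhp" "\<And>a. quasi_periodic (er (- qP a)) (Gp a)"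
 shows "((\<lambda>T. mean (PA Gp) T) \<longlongrightarrow> PL Gp) at_top"
proof -
 have lim: "((\<lambda>T. mean (primitive_form n wt (fd (lam r)) (GG Gp (fst r)) (th r)) T) \<longlongrightarrow>
   (\<Sum>j\<le>n. of_real (acoeff n wt j) * (2 * \<i>) ^ n *
   mean (\<lambda>z. (deriv ^^ (n - j)) (\<lambda>z. f z (lam r)) z * (deriv ^^ j) (Gp (fst r)) z * th r z) 1)) at_top" if r: "r \<in> I0" for r
  unfolding fd_def[abs_def] GG_def[abs_def]
 proof (rule primitive_form_limit[OF f_holo[OF lam_DL[OF r]] f_quasi_periodic[OF r] Gp th_holo th_quasi_periodic phase])
  show "continuous_on uhp (shadow_series (wr (fst r)) wt (of_int d0) l)" for l
   using shadow_wirtinger wirtinger_continuous_on by blast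
  fix i l
  show "((\<lambda>T. mean (\<lambda>z. (deriv ^^ i) (\<lambda>z. f z (lam r)) z * th r z * shadow_series (wr (fst r)) wt (of_int d0) l z) T) \<longlongrightarrow> 0) at_top"
  proof (rule mean_shadow_tendsto_0[OF _ _ _ wr_wt wr_bound wr_phase])
   show "(\<lambda>z. (deriv ^^ i) (\<lambda>z. f z (lam r)) z * th r z) holomorphic_on uhp"
    by (intro holomorphic_on_mult holomorphic_higher_deriv_uhp f_holo lam_DL r th_holo)
   have "quasi_periodic (er (qV M (pt r)) * er (qN r)) (\<lambda>z. (deriv ^^ i) (\<lambda>z. f z (lam r)) z * th r z)"
    by (intro quasi_periodic_mult quasi_periodic_higher_deriv f_quasi_periodic f_holo lam_DL r th_quasi_periodic)
   \<comment> \<open>By q = qP - qN the product of f and \<open>th\<close> has exactly the phase of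
     the exponentials in the shadow series, as \<open>mean_shadow_tendsto_0\<close> demands.\<close>
   moreover have "er (qV M (pt r)) * er (qN r) = er (qP (fst r))"
    unfolding e_add[symmetric] of_real_add[symmetric] by (simp add: qV_pt)
   ultimately show "quasi_periodic (er (qP (fst r))) (\<lambda>z. (deriv ^^ i) (\<lambda>z. f z (lam r)) z * th r z)" by (simp only:)
  qed (use d_pos in simp)
 qed simp
 have "((\<lambda>T. \<Sum>r\<in>I0. mean (primitive_form n wt (fd (lam r)) (GG Gp (fst r)) (th r)) T) \<longlongrightarrow> PL Gp) at_top"
  unfolding PL_def by (intro tendsto_sum lim)
 moreover have "\<forall>\<^sub>F T in at_top. (\<Sum>r\<in>I0. mean (primitive_form n wt (fd (lam r)) (GG Gp (fst r)) (th r)) T) = mean (PA Gp) T"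
  using eventually_gt_at_top[of 0]
 proof eventually_elim
  fix T :: real assume T: "T > 0"
  have cGG: "continuous_on uhp (GG Gp a l)" for a l by (rule wirtinger_continuous_on, rule GG_tower, rule Gp)
  have cth: "continuous_on uhp (th r)" for r by (rule holomorphic_on_imp_continuous_on, rule th_holo)
  have "continuous_on uhp (primitive_form n wt (fd (lam r)) (GG Gp (fst r)) (th r))" if "r \<in> I0" for r
   unfolding primitive_form_def[abs_def]
   by (intro continuous_intros continuous_on_Rpow fd_continuous lam_DL that cGG cth)
  then show "(\<Sum>r\<in>I0. mean (primitive_form n wt (fd (lam r)) (GG Gp (fst r)) (th r)) T) = mean (PA Gp) T"
   unfolding PA_def[abs_def] by (subst mean_sum) (use T in \<open>auto simp: finite_I0\<close>)
 qed
 ultimately show ?thesis by (rule Lim_transform_eventually)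
qed

text \<open>The integral over the arc does not depend on \<open>T\<close>.  So the choice \<open>Gp = 0\<close>, for which \<open>PA\<close> is not modular, already
  gives convergence without any preimage of the theta series.\<close>

lemma integral_integrand:
 assumes Gp: "\<And>a. Gp a holomorphic_on uhp" "\<And>a. quasi_periodic (er (- qP a)) (Gp a)"
 shows "((\<lambda>T. set_lebesgue_integral lborel (fund_dom T) integrand) \<longlongrightarrow> PL Gp
   - integral {-1/2..1/2} (\<lambda>u. PA Gp (Complex u (arc_height u)) * (1 + \<i> * of_real (- u / arc_height u)))) at_top"
  and "(\<And>z. z \<in> uhp \<Longrightarrow> PA Gp (- 1 / z) = z\<^sup>2 * PA Gp z) \<Longrightarrow>
   ((\<lambda>T. set_lebesgue_integral lborel (fund_dom T) integrand) \<longlongrightarrow> PL Gp) at_top"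
proof -
 obtain a where a: "continuous_on uhp a" "\<And>z. z \<in> uhp \<Longrightarrow> has_wirtinger (PA Gp) (a z) (\<i> / 2 * integrand z) z"
  using PA_wirtinger[of Gp, OF Gp(1)] by blast
 have cb: "continuous_on uhp (\<lambda>z. \<i> / 2 * integrand z)" by (intro continuous_intros integrand_continuous)
 have b: "- 2 * \<i> * (\<i> / 2 * integrand z) = integrand z" for z by simp
 note 1 = green_fund_dom[OF a(2,1) cb _ PA_periodic[of Gp, OF Gp], unfolded b mean_def[symmetric]]
 show "((\<lambda>T. set_lebesgue_integral lborel (fund_dom T) integrand) \<longlongrightarrow> PL Gp
   - integral {-1/2..1/2} (\<lambda>u. PA Gp (Complex u (arc_height u)) * (1 + \<i> * of_real (- u / arc_height u)))) at_top"
 proof (rule Lim_transform_eventually[OF tendsto_diff[OF PA_limit[of Gp, OF Gp] tendsto_const]])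
  show "\<forall>\<^sub>F T in at_top. mean (PA Gp) T - integral {-1/2..1/2} (\<lambda>u. PA Gp (Complex u (arc_height u)) * (1 + \<i> * of_real (- u / arc_height u)))
    = set_lebesgue_integral lborel (fund_dom T) integrand"
   using eventually_ge_at_top[of 1] by eventually_elim (rule 1[symmetric])
 qed
 assume inv: "\<And>z. z \<in> uhp \<Longrightarrow> PA Gp (- 1 / z) = z\<^sup>2 * PA Gp z"
 note 2 = stokes_fund_dom[OF a(2,1) cb _ PA_periodic[of Gp, OF Gp] inv, unfolded b mean_def[symmetric]]
 show "((\<lambda>T. set_lebesgue_integral lborel (fund_dom T) integrand) \<longlongrightarrow> PL Gp) at_top"
 proof (rule Lim_transform_eventually[OF PA_limit[of Gp, OF Gp]])
  show "\<forall>\<^sub>F T in at_top. mean (PA Gp) T = set_lebesgue_integral lborel (fund_dom T) integrand"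
   using eventually_ge_at_top[of 1] by eventually_elim (rule 2[symmetric])
 qed
qed

text \<open>Twice the weight \<open>wt\<close>, in the form of an integer exponent for
  \<open>csqrt\<close>.\<close>

definition NN :: int where "NN = (if wt = 3 / 2 then 3 else 1)"

lemma NN: "wt = of_int NN / 2" "\<lfloor>2 * wt\<rfloor> = NN" "rho = of_int (2 - 4 * int n - NN) / 2" "\<lfloor>2 * rho\<rfloor> = 2 - 4 * int n - NN"
proof -
 show wtN: "wt = of_int NN / 2" using wt by (auto simp: NN_def)
 then show r: "rho = of_int (2 - 4 * int n - NN) / 2" by (simp add: field_simps)
 have "2 * wt = of_int NN" using wtN by simp
 then show "\<lfloor>2 * wt\<rfloor> = NN" by (simp only: floor_of_int)
 have "2 * rho = of_int (2 - 4 * int n - NN)" using r by simp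
 then show "\<lfloor>2 * rho\<rfloor> = 2 - 4 * int n - NN" by (simp only: floor_of_int)
qed

lemma fd_inversion:
 assumes r: "r \<in> I0" and z: "z \<in> uhp"
 shows "Rpow rho (fd (lam r)) m (- 1 / z) = csqrt z powi (2 - 4 * int n - NN + 4 * int m) * (e (1 / 8) / of_real (sqrt (real (card DL)))) *
   (\<Sum>\<mu>\<in>DL. e (- of_real (ip (pt r) (rep \<mu>))) * Rpow rho (fd \<mu>) m z)"
proof -
 let ?c = "e (1 / 8) / of_real (sqrt (real (card DL)))"
 have "Rpow rho (fd (lam r)) m (- 1 / z) = csqrt z powi (2 - 4 * int n - NN + 4 * int m) *
   (\<Sum>\<mu>\<in>DL. ?c * e (- of_real (ip (pt r) (rep \<mu>))) * Rpow rho (fd \<mu>) m z)"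
 proof (rule Rpow_inversion[where DF = "fd (lam r)" and DG = fd and EF = "\<lambda>_ _. 0" and EG = "\<lambda>_ _ _. 0", OF fd_tower fd_tower _ NN(3) z])
  show "fd (lam r) 0 (- 1 / z) = csqrt z powi (2 - 4 * int n - NN) * (\<Sum>\<mu>\<in>DL. ?c * e (- of_real (ip (pt r) (rep \<mu>))) * fd \<mu> 0 z)"
   if "z \<in> uhp" for z
   using transforms_S[OF f_transforms that lam_DL[OF r]] unfolding NN(4) weil_S_lam[OF r] fd_0
   by (simp only: sum_distrib_left mult.assoc)
 qed (use lam_DL r in auto)
 then show ?thesis by (simp only: sum_distrib_left mult.assoc)
qed

lemma GG_inversion:
 assumes Gp: "\<And>a. Gp a holomorphic_on uhp"
  and S: "\<And>a z. z \<in> uhp \<Longrightarrow> GG Gp a 0 (- 1 / z) = csqrt z powi NN * (e (1 / 8) / of_real (sqrt (ri d0)) *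
   (\<Sum>s\<in>{0..<d0}. er (ri (a * s) / ri d0) * GG Gp s 0 z))"
  and z: "z \<in> uhp"
 shows "Rpow wt (GG Gp a) m (- 1 / z) = csqrt z powi (NN + 4 * int m) * (e (1 / 8) / of_real (sqrt (ri d0))) *
   (\<Sum>s\<in>{0..<d0}. er (ri (a * s) / ri d0) * Rpow wt (GG Gp s) m z)"
proof -
 let ?c = "e (1 / 8) / of_real (sqrt (ri d0))"
 have "Rpow wt (GG Gp a) m (- 1 / z) = csqrt z powi (NN + 4 * int m) *
   (\<Sum>s\<in>{0..<d0}. ?c * er (ri (a * s) / ri d0) * Rpow wt (GG Gp s) m z)"
  by (rule Rpow_inversion[where DF = "GG Gp a" and DG = "GG Gp", OF GG_tower[OF Gp] GG_tower[OF Gp] _ NN(1) z])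
    (simp_all only: S sum_distrib_left mult.assoc)
 then show ?thesis by (simp only: sum_distrib_left mult.assoc)
qed

text \<open>The constant \<open>cc\<close> in the proof is a quotient of lattice indices.  Its value is not needed: since \<open>S\<close> acts as an
  involution, \<open>cc\<^sup>2 = 1\<close> unless \<open>PA\<close> vanishes.\<close>

lemma PA_inversion:
 assumes Gp: "\<And>a. Gp a holomorphic_on uhp"
  and S: "\<And>a h. h \<in> uhp \<Longrightarrow> GG Gp a 0 (- 1 / h) = csqrt h powi NN * (e (1 / 8) / of_real (sqrt (ri d0)) *
   (\<Sum>s\<in>{0..<d0}. er (ri (a * s) / ri d0) * GG Gp s 0 h))"
  and h: "h \<in> uhp"
 shows "PA Gp (- 1 / h) = h\<^sup>2 * PA Gp h"
proof -
 define cc where "cc = real (card I0) / (sqrt (real (card DL)) * sqrt (ri d0) * sqrt (ri d1) * sqrt (ri d2))"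
 have cc: "cc \<ge> 0" using d_pos by (simp add: cc_def)
 have main: "PA Gp (- 1 / h) = of_real cc * h\<^sup>2 * PA Gp h" if h: "h \<in> uhp" for h
 proof -
  have nz: "csqrt h \<noteq> 0" using uhp_not_nonpos[OF h] by simp
  define cf where "cf = e (1 / 8) / of_real (sqrt (real (card DL)))"
  define cG where "cG = e (1 / 8) / of_real (sqrt (ri d0))"
  define k1 where "k1 = e (- 1 / 8) / of_real (sqrt (ri d1))"
  define k2 where "k2 = e (- 1 / 8) / of_real (sqrt (ri d2))"
  define Sf where "Sf j r = (\<Sum>\<mu>\<in>DL. e (- of_real (ip (pt r) (rep \<mu>))) * Rpow rho (fd \<mu>) (n - j) h)" for j r
  define SG where "SG j a = (\<Sum>s\<in>{0..<d0}. er (ri (a * s) / ri d0) * Rpow wt (GG Gp s) j h)" for j a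
  define S1 where "S1 a = (\<Sum>s\<in>{0..<d1}. er (ri (a * s) / ri d1) * theta1 d1 s h)" for a
  define S2 where "S2 a = (\<Sum>s\<in>{0..<d2}. er (ri (a * s) / ri d2) * theta1 d2 s h)" for a
  have const: "cf * cG * k1 * k2 * of_nat (card I0) = of_real cc"
  proof -
   have "e (1 / 8) * e (- 1 / 8) = 1" unfolding e_add[symmetric] by simp
   moreover have "(x / X) * (x / Y) * (y / Z) * (y / W) * c = (x * y) * (x * y) * c / (X * Y * Z * W)" for x y X Y Z W c :: complex
    by simp
   ultimately have "cf * cG * k1 * k2 * of_nat (card I0) = 1 * 1 * of_nat (card I0) / (of_real (sqrt (real (card DL))) * of_real (sqrt (ri d0)) * of_real (sqrt (ri d1)) * of_real (sqrt (ri d2)))"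
    unfolding cf_def cG_def k1_def k2_def by (simp only:)
   then show ?thesis by (simp add: cc_def)
  qed
  \<comment> \<open>The count of weights: the exponents belonging to f, to G and to the two unary
    theta series add up to 4, whatever j is, and the fourth power of \<open>csqrt h\<close> is
    h^2.\<close>
  have pw: "csqrt h powi (2 - 4 * int n - NN + 4 * int (n - j)) * csqrt h powi (NN + 4 * int j) * (csqrt h * csqrt h) = h\<^sup>2"
   if "j \<le> n" for j
  proof -
   have "csqrt h powi (2 - 4 * int n - NN + 4 * int (n - j)) * csqrt h powi (NN + 4 * int j) = csqrt h powi 2"
    unfolding power_int_add[OF disjI1[OF nz], symmetric] using that by (simp add: of_nat_diff)
   moreover have "csqrt h powi 2 = h" using power2_csqrt[of h] by (simp add: power_int_def)
   moreover have "csqrt h * csqrt h = h" using power2_csqrt[of h] by (simp add: power2_eq_square)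
   ultimately show ?thesis by (simp add: power2_eq_square)
  qed
  have summand: "(\<Sum>r\<in>I0. Rpow rho (fd (lam r)) (n - j) (- 1 / h) * Rpow wt (GG Gp (fst r)) j (- 1 / h) * th r (- 1 / h))
   = of_real cc * h\<^sup>2 * (\<Sum>r\<in>I0. Rpow rho (fd (lam r)) (n - j) h * Rpow wt (GG Gp (fst r)) j h * th r h)" if j: "j \<le> n" for j
  proof -
   let ?p = "csqrt h powi (2 - 4 * int n - NN + 4 * int (n - j))" and ?q = "csqrt h powi (NN + 4 * int j)"
   have alg: "(p * a * x) * (q * b * y) * ((s * c * z) * (s * d * t)) = (p * q * (s * s)) * (a * b * c * d) * (x * (y * z * t))"
    for p q s a b c d x y z t :: complex by (simp add: mult_ac)
   have GI: "Rpow wt (GG Gp a) j (- 1 / h) = ?q * cG * SG j a" for a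
    unfolding cG_def SG_def by (rule GG_inversion[OF Gp S h])
   have "Rpow rho (fd (lam r)) (n - j) (- 1 / h) * Rpow wt (GG Gp (fst r)) j (- 1 / h) * th r (- 1 / h)
    = h\<^sup>2 * (cf * cG * k1 * k2) * (Sf j r * (SG j (fst r) * S1 (fst (snd r)) * S2 (snd (snd r))))" if r: "r \<in> I0" for r
    unfolding fd_inversion[OF r h] GI th_def theta1_inversion[OF d_pos(2) h] theta1_inversion[OF d_pos(3) h]
     cf_def[symmetric] cG_def[symmetric] k1_def[symmetric] k2_def[symmetric]
     Sf_def[symmetric] SG_def[symmetric] S1_def[symmetric] S2_def[symmetric] alg pw[OF j] ..
   then have "(\<Sum>r\<in>I0. Rpow rho (fd (lam r)) (n - j) (- 1 / h) * Rpow wt (GG Gp (fst r)) j (- 1 / h) * th r (- 1 / h))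
    = h\<^sup>2 * (cf * cG * k1 * k2) * (\<Sum>r\<in>I0. Sf j r * (SG j (fst r) * S1 (fst (snd r)) * S2 (snd (snd r))))"
    by (simp add: sum_distrib_left)
   also have "(\<Sum>r\<in>I0. Sf j r * (SG j (fst r) * S1 (fst (snd r)) * S2 (snd (snd r)))) =
     of_nat (card I0) * (\<Sum>r\<in>I0. Rpow rho (fd (lam r)) (n - j) h * (Rpow wt (GG Gp (fst r)) j h * theta1 d1 (fst (snd r)) h * theta1 d2 (snd (snd r)) h))"
    unfolding Sf_def SG_def S1_def S2_def
    by (rule weil_combination) (simp_all only: theta1_mod theta1_uminus)
   finally show ?thesis unfolding const[symmetric] th_def by (simp only: mult_ac)
  qed
  have PA_swap: "PA Gp \<sigma> = (\<Sum>j\<le>n. of_real (acoeff n wt j) * (\<Sum>r\<in>I0. Rpow rho (fd (lam r)) (n - j) \<sigma> * Rpow wt (GG Gp (fst r)) j \<sigma> * th r \<sigma>))" for \<sigma>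
   unfolding PA_def primitive_form_def sum_distrib_left by (rule sum.swap)
  have alg: "a * (b * s) = b * (a * s)" for a b s :: complex by simp
  show ?thesis unfolding PA_swap sum_distrib_left[of "of_real cc * h\<^sup>2"]
  proof (rule sum.cong[OF refl])
   fix j assume "j \<in> {..n}"
   then have j: "j \<le> n" by simp
   show "of_real (acoeff n wt j) * (\<Sum>r\<in>I0. Rpow rho (fd (lam r)) (n - j) (- 1 / h) * Rpow wt (GG Gp (fst r)) j (- 1 / h) * th r (- 1 / h)) =
    of_real cc * h\<^sup>2 * (of_real (acoeff n wt j) * (\<Sum>r\<in>I0. Rpow rho (fd (lam r)) (n - j) h * Rpow wt (GG Gp (fst r)) j h * th r h))"
    unfolding summand[OF j] by (rule alg)
  qed
 qed
 have nz: "h \<noteq> 0" using uhp_not_nonpos[OF h] by simp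
 have "PA Gp h = PA Gp (- 1 / (- 1 / h))" by simp
 also have "\<dots> = of_real (cc * cc) * PA Gp h"
  unfolding main[OF minus_inverse_uhp[OF h]] main[OF h] using nz by (simp add: field_simps)
 finally have "(1 - of_real (cc * cc)) * PA Gp h = 0" by (simp add: algebra_simps)
 then have "PA Gp h = 0 \<or> of_real (cc * cc) = (1 :: complex)" by auto
 then have "PA Gp h = 0 \<or> cc * cc = 1" by (metis of_real_eq_1_iff)
 then have "PA Gp h = 0 \<or> cc = 1" using cc by (auto simp: square_eq_1_iff)
 then show ?thesis using main[OF h] by auto
qed

end

no_notation Infinite_Set_Sum.abs_summable_on (infix \<open>abs'_summable'_on\<close> 50)

section \<open>The theta kernels at the special point\<close>

lemma has_sum_times:
 fixes f :: "'a \<Rightarrow> complex" and g :: "'b \<Rightarrow> complex"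
 assumes f: "(f has_sum a) A" "f abs_summable_on A" and g: "(g has_sum b) B" "g abs_summable_on B"
 shows "((\<lambda>x. f (fst x) * g (snd x)) has_sum a * b) (A \<times> B)" "(\<lambda>x. f (fst x) * g (snd x)) abs_summable_on (A \<times> B)"
proof -
 show s: "(\<lambda>x. f (fst x) * g (snd x)) abs_summable_on (A \<times> B)"
 proof (rule summable_on_SigmaI)
  show "((\<lambda>y. cmod (f (fst (x, y)) * g (snd (x, y)))) has_sum cmod (f x) * (\<Sum>\<^sub>\<infinity>y\<in>B. cmod (g y))) B" for x
   unfolding fst_conv snd_conv norm_mult by (intro has_sum_cmult_right has_sum_infsum g(2))
  show "(\<lambda>x. cmod (f x) * (\<Sum>\<^sub>\<infinity>y\<in>B. cmod (g y))) summable_on A" by (intro summable_on_cmult_left f(2))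
 qed simp
 show "((\<lambda>x. f (fst x) * g (snd x)) has_sum a * b) (A \<times> B)"
  by (rule has_sum_SigmaI[where g = "\<lambda>x. f x * b"])
    (auto intro!: has_sum_cmult_right has_sum_cmult_left f g abs_summable_summable[OF s])
qed

lemma moderate_growth_powr:
 assumes "s \<le> 1" shows "moderate_growth (\<lambda>z. c * of_real (Im z powr s))"
proof (rule moderate_growthI[where B = 1 and D = "cmod c" and C = 1])
 fix z :: complex assume v: "1 \<le> Im z"
 have "Im z powr s \<le> Im z powr 1" using v assms by (intro powr_mono) auto
 also have "\<dots> \<le> exp (1 * Im z)" using v exp_ge_add_one_self[of "Im z"] by (simp; linarith)
 finally show "cmod (c * of_real (Im z powr s)) \<le> cmod c * exp (1 * Im z)" by (simp add: norm_mult mult_left_mono)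
qed

lemma moderate_growth_shadow:
 assumes d: "d > 0" and wt: "wt = 3 / 2 \<or> wt = 1 / 2 \<and> w 0 = 0" and w: "\<And>x. \<bar>w x\<bar> \<le> C * ab x"
 shows "moderate_growth (shadow_series w wt d 0)"
proof -
 obtain K where K: "K \<ge> 0" "\<And>x v. v \<ge> 1 \<Longrightarrow> \<bar>w x * shadow_coeff wt d 0 x v\<bar> \<le> K * ab x ^ (2 * 0 + 1) * v powr (- 1 / 2)"
  using shadow_coeff_bound[where w = w and C = C and ?v0.0 = 1 and j = 0, OF d wt w] by auto
 let ?E = "\<lambda>x::int. K * (ab x ^ (2 * 0 + 1) * exp (- (2 * pi * 1 / (2 * d)) * (ri x)\<^sup>2))"
 have sE: "?E summable_on UNIV" by (intro summable_on_cmult_right summable_on_gauss) (use d in simp)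
 have "cmod (shadow_series w wt d 0 z) \<le> infsum ?E UNIV" if v: "1 \<le> Im z" for z
 proof -
  have b: "cmod (of_real (w x * shadow_coeff wt d 0 x (Im z)) * cnj (e (of_real (gq d x) * z))) \<le> ?E x" for x
  proof -
   have "Im z powr (- 1 / 2) \<le> 1" using v powr_mono[of "- 1 / 2" 0 "Im z"] by simp
   then have "K * ab x ^ (2 * 0 + 1) * Im z powr (- 1 / 2) \<le> K * ab x ^ (2 * 0 + 1)"
    using K(1) mult_left_le[of "Im z powr (- 1 / 2)" "K * ab x ^ (2 * 0 + 1)"] by simp
   with K(2)[OF v, of x] have 1: "\<bar>w x * shadow_coeff wt d 0 x (Im z)\<bar> \<le> K * ab x ^ (2 * 0 + 1)" by linarith
   have 2: "cmod (e (of_real (gq d x) * z)) \<le> exp (- (2 * pi * 1 / (2 * d)) * (ri x)\<^sup>2)"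
    by (rule theta_term_mono[OF d v])
   show ?thesis unfolding norm_mult complex_mod_cnj norm_of_real mult.assoc[symmetric]
    by (rule mult_mono[OF 1 2]) (use K(1) in auto)
  qed
  then have "cmod (\<Sum>\<^sub>\<infinity>x. of_real (w x * shadow_coeff wt d 0 x (Im z)) * cnj (e (of_real (gq d x) * z))) \<le> infsum ?E UNIV"
   by (rule norm_infsum_le[OF has_sum_infsum[OF abs_summable_summable[OF summable_on_comparison_test[OF sE]]] has_sum_infsum[OF sE]])
     (simp_all only: b norm_ge_zero)
  then show ?thesis by (simp only: shadow_series_def power_0 div_by_1)
 qed
 then show ?thesis by (intro moderate_growthI[where B = 1 and D = "infsum ?E UNIV" and C = 0]) simp
qed

context lift_data
begin

lemma thP_has_sum:
 assumes "z \<in> uhp"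
 shows "((\<lambda>x. of_real (wr a x) * e (of_real (qP x) * z)) has_sum thP a z) UNIV"
  "(\<lambda>x. of_real (wr a x) * e (of_real (qP x) * z)) abs_summable_on UNIV"
proof -
 show s: "(\<lambda>x. of_real (wr a x) * e (of_real (qP x) * z)) abs_summable_on UNIV"
  by (rule theta_series_summable[OF _ wr_bound assms]) (use d_pos in simp)
 show "((\<lambda>x. of_real (wr a x) * e (of_real (qP x) * z)) has_sum thP a z) UNIV"
  unfolding theta_series_def by (rule has_sum_infsum, rule abs_summable_summable[OF s])
qed

definition ind :: "int \<Rightarrow> int \<Rightarrow> int \<Rightarrow> complex \<Rightarrow> complex" where
 "ind D r x z = of_real (if x mod D = r mod D then 1 else 0) * e (of_real (gq (ri D) x) * z)"

lemma ind_has_sum: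
 assumes "D > 0" "z \<in> uhp"
 shows "((\<lambda>x. ind D r x z) has_sum theta1 D r z) UNIV" "(\<lambda>x. ind D r x z) abs_summable_on UNIV"
 unfolding ind_def
 by (rule theta1_has_sum[OF assms], rule theta_series_summable[OF _ theta1_weight_bound assms(2)]) (use assms in simp)

lemma th_has_sum:
 assumes "z \<in> uhp"
 shows "((\<lambda>y. ind d1 (fst (snd r)) (fst y) z * ind d2 (snd (snd r)) (snd y) z) has_sum th r z) UNIV"
  "(\<lambda>y. ind d1 (fst (snd r)) (fst y) z * ind d2 (snd (snd r)) (snd y) z) abs_summable_on UNIV"
 using has_sum_times[OF ind_has_sum[OF d_pos(2) assms] ind_has_sum[OF d_pos(3) assms], of "fst (snd r)" "snd (snd r)"]
 by (simp_all add: th_def)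

text \<open>The common shape of the summands of the Siegel and Millson kernels; W is 1 or
  p_X(zA).\<close>

definition kernel_term :: "(real^2^2 \<Rightarrow> real) \<Rightarrow> complex \<Rightarrow> real^2^2 \<Rightarrow> complex" where
 "kernel_term W z X = of_real (W X) *
   e (of_real (qV M (proj_pos M zA X)) * z + of_real (qV M (proj_neg M zA X)) * cnj z)"

lemma proj_pt: "proj_pos M zA (pt x) = pp (fst x)" "proj_neg M zA (pt x) = pt (0, fst (snd x), snd (snd x))"
proof -
 obtain c where c: "c \<noteq> 0" "X1 M zA = c *\<^sub>R X0" using X1_X0 by blast
 obtain c' where c': "c' \<noteq> 0" "p = c' *\<^sub>R X0" using p_X0 by blast
 define k where "k = c / c'"
 have k: "k \<noteq> 0" "X1 M zA = k *\<^sub>R p" using c c' by (auto simp: k_def)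
 show 1: "proj_pos M zA (pt x) = pp (fst x)"
  unfolding proj_pos_def k(2) bV_simps ip_pt_frame d0(1) using k(1) d0 by (simp add: pp_def)
 show "proj_neg M zA (pt x) = pt (0, fst (snd x), snd (snd x))"
  unfolding proj_neg_def 1 by (simp add: pt_def pp_def)
qed

lemma cnj_kernel_pt:
 assumes "W (pt x) = w (fst x)"
 shows "cnj (kernel_term W z (pt x)) = cnj (of_real (w (fst x)) * e (of_real (qP (fst x)) * z)) *
  (e (of_real ((ri (fst (snd x)))\<^sup>2 / (2 * ri d1)) * z) * e (of_real ((ri (snd (snd x)))\<^sup>2 / (2 * ri d2)) * z))"
proof -
 define a b c where "a = qP (fst x)" and "b = (ri (fst (snd x)))\<^sup>2 / (2 * ri d1)" and "c = (ri (snd (snd x)))\<^sup>2 / (2 * ri d2)"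
 have q: "qV M (pt (0, fst (snd x), snd (snd x))) = - b - c" by (simp add: qV_pt b_def c_def)
 show ?thesis
  unfolding kernel_term_def proj_pt qV_pp q assms a_def[symmetric] b_def[symmetric] c_def[symmetric]
  by (simp add: cnj_e e_add[symmetric] algebra_simps)
qed

text \<open>At zA the two projections are the components along P and N, so conjugation turns a term
  of the kernel into a conjugated exponential for P times a holomorphic one for N^-. Within a
  residue class modulo the frame the three coordinates vary independently and the sum
  factors.\<close>

lemma kernel_coset_sum:
 assumes z: "z \<in> uhp" and \<mu>: "\<mu> \<in> DL" and W: "\<And>x. W (pt x) = w (fst x)"
 shows "((\<lambda>X. cnj (kernel_term W z X)) has_sum (\<Sum>r | r \<in> I0 \<and> lam r = \<mu>. cnj (thP (fst r) z) * th r z)) \<mu>"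
proof -
 define gr where "gr r x = cnj (of_real (wr (fst r) (fst x)) * e (of_real (qP (fst x)) * z)) *
   (ind d1 (fst (snd r)) (fst (snd x)) z * ind d2 (snd (snd r)) (snd (snd x)) z)" for r x :: "int \<times> int \<times> int"
 have gr: "(gr r has_sum cnj (thP (fst r) z) * th r z) UNIV" for r
 proof -
  have "((\<lambda>x. cnj (of_real (wr (fst r) x) * e (of_real (qP x) * z))) has_sum cnj (thP (fst r) z)) UNIV"
   unfolding has_sum_cnj_iff by (rule thP_has_sum[OF z])
  moreover have "(\<lambda>x. cnj (of_real (wr (fst r) x) * e (of_real (qP x) * z))) abs_summable_on UNIV"
   unfolding complex_mod_cnj by (rule thP_has_sum[OF z])
  ultimately have "((\<lambda>x. cnj (of_real (wr (fst r) (fst x)) * e (of_real (qP (fst x)) * z)) *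
   (ind d1 (fst (snd r)) (fst (snd x)) z * ind d2 (snd (snd r)) (snd (snd x)) z)) has_sum cnj (thP (fst r) z) * th r z) (UNIV \<times> UNIV)"
   by (rule has_sum_times(1)[OF _ _ th_has_sum[OF z]])
  then show ?thesis by (simp add: gr_def[abs_def])
 qed
 have gr_eq: "gr r x = (if md x = r then cnj (kernel_term W z (pt x)) else 0)" if "r \<in> rbox" for r x
 proof -
  have "md x = r \<longleftrightarrow> md x = md r" using md_id[OF that] by simp
  then have "md x = r \<longleftrightarrow> fst x mod d0 = fst r mod d0 \<and> fst (snd x) mod d1 = fst (snd r) mod d1 \<and> snd (snd x) mod d2 = snd (snd r) mod d2"
   by (simp add: md_def)
  then show ?thesis unfolding gr_def cnj_kernel_pt[of W x, OF W] ind_def wr_def by auto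
 qed
 have "((\<lambda>x. \<Sum>r | r \<in> I0 \<and> lam r = \<mu>. gr r x) has_sum (\<Sum>r | r \<in> I0 \<and> lam r = \<mu>. cnj (thP (fst r) z) * th r z)) UNIV"
  by (rule has_sum_sum) (rule gr)
 moreover have "(\<Sum>r | r \<in> I0 \<and> lam r = \<mu>. gr r x) = (if pt x \<in> \<mu> then cnj (kernel_term W z (pt x)) else 0)" for x
 proof -
  have "(\<Sum>r | r \<in> I0 \<and> lam r = \<mu>. gr r x) = (\<Sum>r | r \<in> I0 \<and> lam r = \<mu>. if r = md x then cnj (kernel_term W z (pt x)) else 0)"
  proof (rule sum.cong[OF refl])
   fix r assume "r \<in> {r. r \<in> I0 \<and> lam r = \<mu>}"
   then have "r \<in> rbox" using I0_box by blast
   then show "gr r x = (if r = md x then cnj (kernel_term W z (pt x)) else 0)" using gr_eq by (simp add: eq_commute)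
  qed
  also have "\<dots> = (if md x \<in> {r. r \<in> I0 \<and> lam r = \<mu>} then cnj (kernel_term W z (pt x)) else 0)"
   by (rule sum.delta) (simp add: finite_I0)
  finally show ?thesis by (simp add: mem_DL[OF \<mu>])
 qed
 ultimately have "((\<lambda>x. if pt x \<in> \<mu> then cnj (kernel_term W z (pt x)) else 0) has_sum (\<Sum>r | r \<in> I0 \<and> lam r = \<mu>. cnj (thP (fst r) z) * th r z)) UNIV"
  by (simp only:)
 then have "((\<lambda>x. cnj (kernel_term W z (pt x))) has_sum (\<Sum>r | r \<in> I0 \<and> lam r = \<mu>. cnj (thP (fst r) z) * th r z)) {x. pt x \<in> \<mu>}"
  by (rule has_sum_cong_neutral[THEN iffD1, rotated -1]) auto
 moreover have "bij_betw pt {x. pt x \<in> \<mu>} \<mu>"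
 proof (rule bij_betw_imageI)
  show "inj_on pt {x. pt x \<in> \<mu>}" by (rule inj_onI) (simp add: pt_inject)
  show "pt ` {x. pt x \<in> \<mu>} = \<mu>" using coset_subset_LD[OF \<mu>] LD_range_pt by blast
 qed
 ultimately show ?thesis using has_sum_reindex_bij_betw[of pt "{x. pt x \<in> \<mu>}" \<mu> "\<lambda>X. cnj (kernel_term W z X)"] by simp
qed

text \<open>Summing over the classes of L'/L and then over the residues above each of them is a
  single sum over \<open>I0\<close>.\<close>

lemma lift_pairing:
 assumes z: "z \<in> uhp" and W: "\<And>x. W (pt x) = w (fst x)"
 shows "pairing (qV M) L (\<lambda>\<mu>. raise_iter n rho (\<lambda>z. f z \<mu>) z) (\<lambda>\<mu>. cnj (of_real (Im z) * (\<Sum>\<^sub>\<infinity>X\<in>\<mu>. kernel_term W z X)))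
  = of_real (Im z powr (wt + 1)) * integrand z"
proof -
 have v: "Im z > 0" using z by (simp add: uhp_def)
 have R: "raise_iter n rho (\<lambda>z. f z \<mu>) z = Rpow rho (fd \<mu>) n z" if "\<mu> \<in> DL" for \<mu>
  by (rule raise_iter_Rpow[where D = "fd \<mu>" and E = "\<lambda>_ _. 0", OF fd_tower[OF that] _ z]) simp_all
 have K: "cnj (\<Sum>\<^sub>\<infinity>X\<in>\<mu>. kernel_term W z X) = (\<Sum>r | r \<in> I0 \<and> lam r = \<mu>. cnj (thP (fst r) z) * th r z)" if "\<mu> \<in> DL" for \<mu>
  unfolding infsum_cnj[symmetric] by (rule infsumI, rule kernel_coset_sum[of z \<mu> W, OF z that W])
 have "pairing (qV M) L (\<lambda>\<mu>. raise_iter n rho (\<lambda>z. f z \<mu>) z) (\<lambda>\<mu>. cnj (of_real (Im z) * (\<Sum>\<^sub>\<infinity>X\<in>\<mu>. kernel_term W z X)))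
  = (\<Sum>\<mu>\<in>DL. \<Sum>r | r \<in> I0 \<and> lam r = \<mu>. of_real (Im z) * (Rpow rho (fd (lam r)) n z * cnj (thP (fst r) z) * th r z))"
  unfolding pairing_def
 proof (rule sum.cong[OF refl])
  fix \<mu> assume \<mu>: "\<mu> \<in> DL"
  have "raise_iter n rho (\<lambda>z. f z \<mu>) z * cnj (of_real (Im z) * (\<Sum>\<^sub>\<infinity>X\<in>\<mu>. kernel_term W z X)) = 
   of_real (Im z) * Rpow rho (fd \<mu>) n z * (\<Sum>r | r \<in> I0 \<and> lam r = \<mu>. cnj (thP (fst r) z) * th r z)"
   unfolding complex_cnj_mult K[OF \<mu>] R[OF \<mu>] complex_cnj_complex_of_real by (simp only: mult_ac)
  also have "\<dots> = (\<Sum>r | r \<in> I0 \<and> lam r = \<mu>. of_real (Im z) * (Rpow rho (fd (lam r)) n z * cnj (thP (fst r) z) * th r z))"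
   unfolding sum_distrib_left by (intro sum.cong refl) (auto simp: mult_ac)
  finally show "raise_iter n rho (\<lambda>z. f z \<mu>) z * cnj (of_real (Im z) * (\<Sum>\<^sub>\<infinity>X\<in>\<mu>. kernel_term W z X)) =
    (\<Sum>r | r \<in> I0 \<and> lam r = \<mu>. of_real (Im z) * (Rpow rho (fd (lam r)) n z * cnj (thP (fst r) z) * th r z))" .
 qed
 also have "\<dots> = (\<Sum>r\<in>I0. of_real (Im z) * (Rpow rho (fd (lam r)) n z * cnj (thP (fst r) z) * th r z))"
  by (rule sum.group[OF finite_I0 finite_DL]) (use lam_DL in blast)
 also have "\<dots> = of_real (Im z powr (wt + 1)) * integrand z"
 proof -
  have "Im z = Im z powr (wt + 1) * Im z powr (- wt)" using v by (simp add: powr_add[symmetric])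
  then have "complex_of_real (Im z) = of_real (Im z powr (wt + 1)) * of_real (Im z powr (- wt))" by (metis of_real_mult)
  then have "of_real (Im z) * (a * b * c) = of_real (Im z powr (wt + 1)) * (of_real (Im z powr (- wt)) * a * b * c)" for a b c :: complex
   by (simp only: mult.assoc)
  then show ?thesis unfolding integrand_def sum_distrib_left by (intro sum.cong refl)
 qed
 finally show ?thesis .
qed

lemma reg_from_integrand:
 assumes h: "\<And>z. z \<in> uhp \<Longrightarrow> h z / of_real ((Im z)\<^sup>2) = integrand z"
 shows "reg_integrable h"
  and "((\<lambda>T. set_lebesgue_integral lborel (fund_dom T) integrand) \<longlongrightarrow> I) at_top \<Longrightarrow> reg_integral h = I"
proof -
 have sub: "z \<in> fund_dom T \<Longrightarrow> z \<in> uhp" for z T using fund_dom_subset_uhp by blast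
 have ind_eq: "indicator (fund_dom T) x *\<^sub>R (h x / of_real ((Im x)\<^sup>2)) = indicator (fund_dom T) x *\<^sub>R integrand x" for T x
  by (cases "x \<in> fund_dom T") (simp_all only: h[OF sub] indicator_simps scaleR_zero_left simp_thms)
 have eq: "truncated_integral h = (\<lambda>T. set_lebesgue_integral lborel (fund_dom T) integrand)"
  unfolding truncated_integral_def set_lebesgue_integral_def ind_eq ..
 have 1: "set_integrable lborel (fund_dom T) (\<lambda>z. h z / of_real ((Im z)\<^sup>2))" for T
  using set_integrable_fund_dom[OF integrand_continuous, of T] unfolding set_integrable_def ind_eq .
 have "\<exists>I. (truncated_integral h \<longlongrightarrow> I) at_top" unfolding eq
  by (rule exI, rule integral_integrand(1)[of "\<lambda>_ _. 0"]) (auto simp: quasi_periodic_def)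
 then show "reg_integrable h" using 1 by (simp add: reg_integrable_def)
 show "((\<lambda>T. set_lebesgue_integral lborel (fund_dom T) integrand) \<longlongrightarrow> I) at_top \<Longrightarrow> reg_integral h = I"
  unfolding reg_integral_def eq by (rule tendsto_Lim) simp
qed

lemma mu_sum:
 assumes z: "z \<in> uhp" and W: "\<And>x. W (pp x) = w x"
 shows "(\<Sum>\<^sub>\<infinity>X\<in>mu a. of_real (W X) * e (of_real (qV M X) * z)) = thP a z"
proof -
 have "((\<lambda>x. of_real (wr a x) * e (of_real (qP x) * z)) has_sum thP a z) UNIV" by (rule thP_has_sum[OF z])
 then have "((\<lambda>x. of_real (W (pp x)) * e (of_real (qV M (pp x)) * z)) has_sum thP a z) {x. x mod d0 = a mod d0}"
  by (rule has_sum_cong_neutral[THEN iffD1, rotated -1]) (auto simp: wr_def W qV_pp)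
 moreover have "bij_betw pp {x. x mod d0 = a mod d0} (mu a)"
 proof (rule bij_betw_imageI)
  have "x = y" if "pp x = pp y" for x y
  proof -
   have "ip (pp x) p = ip (pp y) p" using that by simp
   then show ?thesis by (simp add: ip_pp)
  qed
  then show "inj_on pp {x. x mod d0 = a mod d0}" by (auto intro: inj_onI)
  show "pp ` {x. x mod d0 = a mod d0} = mu a" using mu_subset mem_mu by blast
 qed
 ultimately have "((\<lambda>X. of_real (W X) * e (of_real (qV M X) * z)) has_sum thP a z) (mu a)"
  using has_sum_reindex_bij_betw[of pp "{x. x mod d0 = a mod d0}" "mu a" "\<lambda>X. of_real (W X) * e (of_real (qV M X) * z)"] by simp
 then show ?thesis by (rule infsumI)
qed

end

section \<open>The given preimage and its holomorphic part\<close>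

lemma has_wirtinger_0_imp_holomorphic:
 assumes "\<And>z. z \<in> uhp \<Longrightarrow> has_wirtinger F (a z) 0 z"
 shows "F holomorphic_on uhp"
proof -
 have "(F has_field_derivative a z) (at z)" if "z \<in> uhp" for z
  using assms[OF that] by (simp add: has_wirtinger_def has_field_derivative_def)
 then show ?thesis using open_uhp by (auto simp: holomorphic_on_open)
qed

locale maass_data = lift_data +
 fixes G :: "(real^2^2) vvfun"
 assumes G: "harmonic_maass_form_ext wt (\<lambda>X. - qV M X) P G"
  and xiG: "\<And>z a. z \<in> uhp \<Longrightarrow> xi wt (\<lambda>z. G z (mu a)) z = thP a z"
begin

abbreviation "sh a \<equiv> shadow_series (wr a) wt (of_int d0) 0"
text \<open>G minus an explicit function with the same image under \<xi>. This candidate for the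
  holomorphic part is seen to be holomorphic before anything is known about the Fourier expansion of
  G.\<close>

definition Gp :: "int \<Rightarrow> complex \<Rightarrow> complex" where "Gp a z = G z (mu a) - sh a z"

lemma GG_0: "GG Gp a 0 z = G z (mu a)"
 by (simp add: GG_def Gp_def)

lemma DP_neg: "disc_group (\<lambda>X. - qV M X) P = DP" by (rule disc_group_neg)

lemma G_transforms: "transforms_with_weight wt (\<lambda>X. - qV M X) P G"
 using G by (auto simp: harmonic_maass_form_ext_def harmonic_of_weight_def)

lemma Gp_holo: "Gp a holomorphic_on uhp"
proof (rule has_wirtinger_0_imp_holomorphic)
 fix z assume z: "z \<in> uhp"
 let ?F = "\<lambda>z. G z (mu a)"
 have v: "Im z > 0" using z by (simp add: uhp_def)
 have "smooth ?F" using G mu_DP unfolding harmonic_maass_form_ext_def harmonic_of_weight_def DP_neg by blast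
 then have "n_times_differentiable (Suc 0) ?F" unfolding smooth_def by blast
 then have "?F differentiable_on uhp" by simp
 then have "?F differentiable (at z)" using z open_uhp by (simp add: differentiable_on_eq_differentiable_at)
 then have 1: "has_wirtinger ?F (d_tau ?F z) (d_taubar ?F z) z" by (rule differentiable_imp_has_wirtinger)
 have "d_taubar ?F z = shadow_deriv wt (thP a) 0 z"
 proof -
  have "cnj (thP a z) = cnj (2 * \<i> * of_real (Im z powr wt) * cnj (d_taubar ?F z))"
   using xiG[OF z, of a] by (simp add: xi_def)
  then have c: "cnj (thP a z) = - 2 * \<i> * of_real (Im z powr wt) * d_taubar ?F z" by simp
  have one: "Im z powr wt * Im z powr - wt = 1" using v by (simp add: powr_minus)
  have "shadow_deriv wt (thP a) 0 z = (\<i> / 2 * (- 2 * \<i>)) * d_taubar ?F z * of_real (Im z powr wt * Im z powr - wt)"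
   unfolding shadow_deriv_def c by simp
  then show ?thesis unfolding one by simp
 qed
 then show "has_wirtinger (Gp a) (d_tau ?F z - shadow_series (wr a) wt (of_int d0) (Suc 0) z) 0 z"
  using has_wirtinger_diff[OF 1 shadow_wirtinger[OF z, of a 0]] by (simp add: Gp_def[abs_def])
qed

lemma sh_shift: "sh a (z + 1) = er (- qP a) * sh a z"
 unfolding cnj_phase[symmetric] by (rule shadow_series_shift) (rule wr_phase)

lemma Gp_quasi_periodic: "quasi_periodic (er (- qP a)) (Gp a)"
 unfolding quasi_periodic_def
proof
 fix z assume z: "z \<in> uhp"
 have "er (- qV M (rep (mu a))) = er (- qP a)"
 proof (rule e_of_real_cong)
  have "- qV M (rep (mu a)) - - qP a = - (qV M (rep (mu a)) - qP a)" by simp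
  then show "- qV M (rep (mu a)) - - qP a \<in> \<int>" using qV_rep_mu[of a] by (metis Ints_minus)
 qed
 then have "G (z + 1) (mu a) = er (- qP a) * G z (mu a)"
  using transforms_T[OF G_transforms z, of "mu a"] mu_DP unfolding DP_neg by simp
 then show "Gp a (z + 1) = er (- qP a) * Gp a z"
  unfolding Gp_def sh_shift by (simp only: right_diff_distrib)
qed

lemma Gp_growth: "moderate_growth (Gp a)"
proof -
 obtain F d \<epsilon> where F: "fourier_polynomial (\<lambda>X. - qV M X) P F"
  and O: "(\<lambda>z. G z (mu a) - F z (mu a) - d (mu a) * of_real (Im z powr (1 - wt))) \<in> O[filtercomap Im at_top](\<lambda>z. of_real (exp (- \<epsilon> * Im z)))"
  using G mu_DP[of a] unfolding harmonic_maass_form_ext_def DP_neg by blast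
 have 1: "moderate_growth (\<lambda>z. G z (mu a) - d (mu a) * of_real (Im z powr (1 - wt)))"
  by (rule moderate_growth_ext[OF O moderate_growth_fourier_polynomial[OF F]]) (simp add: DP_neg mu_DP)
 have 2: "moderate_growth (\<lambda>z. d (mu a) * of_real (Im z powr (1 - wt)))"
  by (rule moderate_growth_powr) (use wt_pos in simp)
 have 3: "moderate_growth (\<lambda>z. - 1 * sh a z)"
  by (rule moderate_growth_mult[OF moderate_growth_const moderate_growth_shadow[OF _ wr_wt wr_bound]]) (use d_pos in simp)
 show ?thesis using moderate_growth_add[OF moderate_growth_add[OF 1 2] 3] by (simp add: Gp_def[abs_def])
qed

lemma PA_Gp_inversion: "z \<in> uhp \<Longrightarrow> PA Gp (- 1 / z) = z\<^sup>2 * PA Gp z"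
proof (rule PA_inversion[OF Gp_holo])
 fix a z assume z: "z \<in> uhp"
 show "GG Gp a 0 (- 1 / z) = csqrt z powi NN * (e (1 / 8) / of_real (sqrt (ri d0)) *
   (\<Sum>s\<in>{0..<d0}. er (ri (a * s) / ri d0) * GG Gp s 0 z))"
  unfolding GG_0 using transforms_S[OF G_transforms z, of "mu a"] mu_DP unfolding DP_neg weil_S_mu NN(2) by simp
qed

lemma integral_PL: "((\<lambda>T. set_lebesgue_integral lborel (fund_dom T) integrand) \<longlongrightarrow> PL Gp) at_top"
 by (rule integral_integrand(2)[OF Gp_holo Gp_quasi_periodic PA_Gp_inversion])

lemma exponents_mu: "exponents (\<lambda>X. - qV M X) \<mu> = {n. n - (- qV M (rep \<mu>)) \<in> \<int>}"
 by (simp add: exponents_def)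

lemma Gp_fourier: "\<exists>n0 cp cm D. fourier_half wt (- qV M (rep (mu a))) n0 cp cm D (Gp a) (sh a)"
proof (rule fourier_half_shadow[OF _ wr_wt wr_bound _ Gp_holo _ Gp_growth])
 have m: "- qP a - (- qV M (rep (mu a))) \<in> \<int>" using qV_rep_mu[of a] by simp
 show "quasi_periodic (er (- qV M (rep (mu a)))) (Gp a)"
  using Gp_quasi_periodic[of a] unfolding e_of_real_cong[OF m] .
 show "- qP x - (- qV M (rep (mu a))) \<in> \<int>" if "wr a x \<noteq> 0" for x
 proof -
  have "qP x - qP a \<in> \<int>" using that by (intro square_residue_Ints d_even d_pos) (auto simp: wr_def split: if_splits)
  with m have "(- qP a - (- qV M (rep (mu a)))) - (qP x - qP a) \<in> \<int>" by (rule Ints_diff)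
  then show ?thesis by simp
 qed
qed (use d_pos in simp)

lemma fourier_half_lower:
 assumes "fourier_half k \<alpha> n0 cp cm D fp fm" "m0 \<le> n0"
 shows "fourier_half k \<alpha> m0 (\<lambda>n. if n \<ge> n0 then cp n else 0) cm D fp fm"
 unfolding fourier_half_def
proof (intro ballI conjI)
 fix z assume z: "z \<in> uhp"
 note F = assms(1)[unfolded fourier_half_def, rule_format, OF z]
 show "((\<lambda>n. (if n0 \<le> n then cp n else 0) * e (of_real n * z)) has_sum fp z) {n. n - \<alpha> \<in> \<int> \<and> m0 \<le> n}"
  by (rule has_sum_lower_bound_extend[OF conjunct1[OF F] assms(2)])
 show "((\<lambda>n. cm n * of_real (upper_Gamma (1 - k) (4 * pi * \<bar>n\<bar> * Im z)) * e (of_real n * z))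
    has_sum (fm z - D * of_real (Im z powr (1 - k)))) {n. n - \<alpha> \<in> \<int> \<and> n < 0}"
  by (rule conjunct2[OF F])
qed

text \<open>The holomorphic part is chosen by \<open>SOME\<close> for all components together.
  Exhibiting the decomposition into \<open>Gp\<close> and \<open>sh\<close> makes the choice
  meaningful, and \<open>fourier_half_unique\<close> then identifies its result component by
  component.\<close>

lemma holomorphic_part_eq:
 assumes z: "z \<in> uhp"
 shows "holomorphic_part wt (\<lambda>X. - qV M X) P G z (mu a) = Gp a z"
proof -
 let ?q = "\<lambda>X. - qV M X"
 \<comment> \<open>Selects a residue for each class, since \<open>maass_decomposition\<close> is
   indexed by cosets and \<open>Gp\<close> by integers.\<close>
 define ix where "ix = the_inv_into {0..<d0} mu"
 have mix: "mu (ix \<mu>) = \<mu>" if "\<mu> \<in> DP" for \<mu>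
  unfolding ix_def by (rule f_the_inv_into_f[OF inj_mu]) (use that DP_eq in simp)
 obtain n0 cp cm D where F: "fourier_half wt (- qV M (rep (mu b))) (n0 b) (cp b) (cm b) (D b) (Gp b) (sh b)" for b
  using Gp_fourier by metis
 \<comment> \<open>\<open>maass_decomposition\<close> has a single lower bound for the exponents of
   all components.\<close>
 define m0 where "m0 = Min (n0 ` {0..<d0})"
 have m0: "m0 \<le> n0 (ix \<mu>)" if "\<mu> \<in> DP" for \<mu>
 proof -
  have "ix \<mu> \<in> {0..<d0}" unfolding ix_def by (rule the_inv_into_into[OF inj_mu]) (use that DP_eq in auto)
  then show ?thesis by (simp add: m0_def)
 qed
 have F': "fourier_half wt (- qV M (rep \<mu>)) m0 (\<lambda>n. if n \<ge> n0 (ix \<mu>) then cp (ix \<mu>) n else 0) (cm (ix \<mu>)) (D (ix \<mu>)) (Gp (ix \<mu>)) (sh (ix \<mu>))"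
  if "\<mu> \<in> DP" for \<mu> using fourier_half_lower[OF F m0[OF that]] unfolding mix[OF that] .
 have "maass_decomposition wt ?q P G (\<lambda>z \<mu>. Gp (ix \<mu>) z) (\<lambda>z \<mu>. sh (ix \<mu>) z)"
  unfolding maass_decomposition_def DP_neg exponents_mu
 proof (rule exI[of _ "\<lambda>\<mu> n. if n \<ge> n0 (ix \<mu>) then cp (ix \<mu>) n else 0"], rule exI[of _ "\<lambda>\<mu>. cm (ix \<mu>)"], rule exI[of _ "\<lambda>\<mu>. D (ix \<mu>)"],
   rule exI[of _ m0], intro ballI)
  fix \<mu> z assume \<mu>: "\<mu> \<in> DP" and z: "z \<in> uhp"
  show "G z \<mu> = Gp (ix \<mu>) z + sh (ix \<mu>) z \<and>
    ((\<lambda>n. (if n0 (ix \<mu>) \<le> n then cp (ix \<mu>) n else 0) * e (of_real n * z)) has_sum Gp (ix \<mu>) z) {n \<in> {n. n - (- qV M (rep \<mu>)) \<in> \<int>}. m0 \<le> n} \<and>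
    ((\<lambda>n. cm (ix \<mu>) n * of_real (upper_Gamma (1 - wt) (4 * pi * \<bar>n\<bar> * Im z)) * e (of_real n * z))
      has_sum (sh (ix \<mu>) z - D (ix \<mu>) * of_real (Im z powr (1 - wt)))) {n \<in> {n. n - (- qV M (rep \<mu>)) \<in> \<int>}. n < 0}"
  proof
   show "G z \<mu> = Gp (ix \<mu>) z + sh (ix \<mu>) z" unfolding Gp_def mix[OF \<mu>] by (simp only: diff_add_cancel)
  qed (use F'[OF \<mu>, unfolded fourier_half_def, rule_format, OF z] in \<open>simp only: mem_Collect_eq\<close>)
 qed
 then have "\<exists>fp fm. maass_decomposition wt ?q P G fp fm" by blast
 then have "\<exists>fm. maass_decomposition wt ?q P G (holomorphic_part wt ?q P G) fm"
  unfolding holomorphic_part_def by (rule someI_ex)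
 then obtain fm where D': "maass_decomposition wt ?q P G (holomorphic_part wt ?q P G) fm" by blast
 obtain cp' cm' d' n0' where H': "\<forall>\<mu>\<in>DP. \<forall>z\<in>uhp. G z \<mu> = holomorphic_part wt ?q P G z \<mu> + fm z \<mu> \<and>
    ((\<lambda>n. cp' \<mu> n * e (of_real n * z)) has_sum holomorphic_part wt ?q P G z \<mu>) {n \<in> {n. n - (- qV M (rep \<mu>)) \<in> \<int>}. n \<ge> n0'} \<and>
    ((\<lambda>n. cm' \<mu> n * of_real (upper_Gamma (1 - wt) (4 * pi * \<bar>n\<bar> * Im z)) * e (of_real n * z))
      has_sum (fm z \<mu> - d' \<mu> * of_real (Im z powr (1 - wt)))) {n \<in> {n. n - (- qV M (rep \<mu>)) \<in> \<int>}. n < 0}"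
  using D' unfolding maass_decomposition_def DP_neg exponents_mu by (elim exE) (rule that)
 note H = H'[rule_format, OF mu_DP[of a]]
 have "fourier_half wt (- qV M (rep (mu a))) n0' (cp' (mu a)) (cm' (mu a)) (d' (mu a)) (\<lambda>z. holomorphic_part wt ?q P G z (mu a)) (\<lambda>z. fm z (mu a))"
  using H unfolding fourier_half_def mem_Collect_eq by blast
 then show ?thesis
 proof (rule fourier_half_unique[OF _ F[of a] _ wt_pos z])
  fix z assume "z \<in> uhp"
  from conjunct1[OF H[OF this]] show "holomorphic_part wt ?q P G z (mu a) + fm z (mu a) = Gp a z + sh a z"
   unfolding Gp_def by (simp only: diff_add_cancel)
 qed
qed

end

section \<open>The pairing with the Rankin-Cohen bracket\<close>

lemma higher_deriv_sum:
 assumes "\<And>i. i \<in> I \<Longrightarrow> f i holomorphic_on uhp" "z \<in> uhp"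
 shows "(deriv ^^ s) (\<lambda>w. \<Sum>i\<in>I. f i w) z = (\<Sum>i\<in>I. (deriv ^^ s) (f i) z)"
 using assms(1)
proof (induction I rule: infinite_finite_induct)
 case (insert i I)
 have "(deriv ^^ s) (\<lambda>w. f i w + (\<Sum>i\<in>I. f i w)) z = (deriv ^^ s) (f i) z + (deriv ^^ s) (\<lambda>w. \<Sum>i\<in>I. f i w) z"
  by (rule higher_deriv_add[OF _ _ open_uhp assms(2)]) (use insert in \<open>auto intro!: holomorphic_on_sum\<close>)
 then show ?case using insert by simp
qed simp_all

lemma constant_term_cong:
 assumes "\<And>z. z \<in> uhp \<Longrightarrow> g z = h z"
 shows "constant_term g = constant_term h"
proof -
 have "(\<forall>z\<in>uhp. ((\<lambda>n. a n * e (of_int n * z)) has_sum g z) UNIV) \<longleftrightarrow> (\<forall>z\<in>uhp. ((\<lambda>n. a n * e (of_int n * z)) has_sum h z) UNIV)" for a :: "int \<Rightarrow> complex"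
  using assms by simp
 then show ?thesis unfolding constant_term_def by (simp only:)
qed

context framed_lattice
begin

definition pn :: "int \<times> int \<Rightarrow> real^2^2" where "pn s = pt (0, s)"

lemma pn_perp: "pn s \<in> perp"
 by (rule ip_p_zero) (simp_all add: pn_def ip_pt_frame pt_tr0)

lemma pp_pn: "pt (a, s) = pp a + pn s"
 by (simp add: pt_def pn_def pp_def)

lemma ip_pn_p: "ip (pn s) p = 0" "ip (pn s) (pp a) = 0"
 using ip_p_perp[OF pn_perp] by (simp_all add: pp_def bV_simps)

lemma N_closed: "0 \<in> N" "X \<in> N \<Longrightarrow> Y \<in> N \<Longrightarrow> X - Y \<in> N"
 using L_closed by (auto simp: N_def bV_simps bV_expand[of M 0])

lemma span_N: "span N \<subseteq> perp"
proof (rule span_minimal)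
 show "N \<subseteq> perp" using N_perp by blast
 show "subspace perp" unfolding subspace_def using perp_closed by (auto simp: perp_def subspace_0[OF subspace_tr0] bV_expand[of M 0])
qed

lemma perp_tr0: "X \<in> perp \<Longrightarrow> X \<in> tr0" by (simp add: perp_def)

lemma mem_dual_N: "X \<in> dual_lattice (qV M) N \<longleftrightarrow> X \<in> span N \<and> (\<forall>Y\<in>N. ip X Y \<in> \<int>)"
proof -
 have "polar (qV M) X Y = ip X Y" if "X \<in> span N" "Y \<in> N" for Y
  using that span_N N_perp perp_tr0 by (intro polar_tr0) auto
 then show ?thesis unfolding dual_lattice_def by auto
qed

lemma dual_N_range: "X \<in> dual_lattice (qV M) N \<Longrightarrow> \<exists>s. X = pn s"
proof -
 assume X: "X \<in> dual_lattice (qV M) N"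
 then have Xp: "X \<in> perp" and i: "ip X b1 \<in> \<int>" "ip X b2 \<in> \<int>" using span_N b1 b2 by (auto simp: mem_dual_N)
 have "\<exists>x. X = pt x" by (rule in_range_pt) (use Xp i ip_p_perp perp_tr0 in auto)
 then obtain x where x: "X = pt x" ..
 have "of_int (fst x) = (0 :: real)" using ip_p_perp(1)[OF Xp] by (simp add: x ip_pt_frame)
 then have "X = pn (snd x)" by (simp add: x pn_def pt_def)
 then show ?thesis by blast
qed

lemma pn_span: "pn s \<in> span N"
proof -
 have "pn s = (of_int (fst s) / of_int d1) *\<^sub>R b1 + (of_int (snd s) / of_int d2) *\<^sub>R b2" by (simp add: pn_def pt_def)
 then show ?thesis by (simp only:) (intro span_add span_scale span_base b1(1) b2(1))
qed

lemma mem_PN: "X \<in> P \<Longrightarrow> Y \<in> N \<Longrightarrow> X + Y \<in> P + N" "X \<in> P \<Longrightarrow> X \<in> P + N" "Y \<in> N \<Longrightarrow> Y \<in> P + N"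
proof -
 show "X \<in> P \<Longrightarrow> Y \<in> N \<Longrightarrow> X + Y \<in> P + N" by (rule set_plus_intro)
 show "X \<in> P \<Longrightarrow> X \<in> P + N" using set_plus_intro[OF _ N_closed(1), of X P] by simp
 show "Y \<in> N \<Longrightarrow> Y \<in> P + N" using set_plus_intro[OF P_closed(2), of Y N] by simp
qed

lemma PN_L: "P + N \<subseteq> L"
 by (auto simp: set_plus_def P_def N_def L_closed)

lemma PN_plus_L: "P + N + L = L"
proof
 show "P + N + L \<subseteq> L" using PN_L L_closed(1) by (auto elim!: set_plus_elim)
 show "L \<subseteq> P + N + L"
 proof
  fix X assume "X \<in> L"
  then have "0 + X \<in> P + N + L" by (intro set_plus_intro mem_PN P_closed)
  then show "X \<in> P + N + L" by simp
 qed
qed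

lemma span_PN: "span (P + N) \<subseteq> tr0"
 using PN_L L_tr0 by (intro span_minimal subspace_tr0) auto

definition nu :: "int \<times> int \<Rightarrow> (real^2^2) set" where "nu s = pn s +o N"
definition md2 :: "int \<times> int \<Rightarrow> int \<times> int" where "md2 s = (fst s mod d1, snd s mod d2)"
text \<open>The analogue of \<open>I0\<close> for N: residues of N' modulo the span of
  \<open>b1\<close> and \<open>b2\<close>, again finer than N'/N.\<close>

definition NI :: "(int \<times> int) set" where "NI = {s \<in> {0..<d1} \<times> {0..<d2}. pn s \<in> dual_lattice (qV M) N}"

abbreviation "DN \<equiv> disc_group (qV M) N"

lemma pn_md2: "pn s - pn (md2 s) \<in> N"
proof -
 have "pn s - pn (md2 s) \<in> L" using pt_md[of "(0, s)"] by (simp add: pn_def md_def md2_def)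
 moreover have "pn s - pn (md2 s) \<in> perp" by (intro perp_closed pn_perp)
 ultimately show ?thesis by (simp add: N_def perp_def)
qed

lemma nu_eq_iff: "nu s = nu t \<longleftrightarrow> pn s - pn t \<in> N"
 unfolding nu_def by (rule coset_eq_iff) (auto simp: N_closed)

lemma nu_md2: "nu (md2 s) = nu s"
 using pn_md2[of s] N_closed(2)[OF N_closed(1), of "pn s - pn (md2 s)"] by (simp add: nu_eq_iff)

lemma dual_N_shift: "X \<in> dual_lattice (qV M) N \<Longrightarrow> Y \<in> N \<Longrightarrow> X - Y \<in> dual_lattice (qV M) N"
proof -
 assume X: "X \<in> dual_lattice (qV M) N" and Y: "Y \<in> N"
 have "ip Y Z \<in> \<int>" if "Z \<in> N" for Z using Y that by (intro ip_L) (auto simp: N_def)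
 then show "X - Y \<in> dual_lattice (qV M) N" using X Y by (auto simp: mem_dual_N bV_simps intro: span_diff span_base)
qed

lemma md2_NI: "pn s \<in> dual_lattice (qV M) N \<Longrightarrow> md2 s \<in> NI"
 using dual_N_shift[OF _ pn_md2[of s], of "pn s"] d_pos by (simp add: NI_def) (simp add: md2_def)

lemma finite_NI: "finite NI" by (simp add: NI_def)

lemma nu_DN: "t \<in> NI \<Longrightarrow> nu t \<in> DN"
 by (auto simp: NI_def nu_def disc_group_def)

lemma DN_eq: "DN = nu ` NI"
proof
 show "DN \<subseteq> nu ` NI"
 proof
  fix \<nu> assume "\<nu> \<in> DN"
  then obtain X where X: "X \<in> dual_lattice (qV M) N" "\<nu> = X +o N" by (auto simp: disc_group_def)
  obtain s where s: "X = pn s" using dual_N_range[OF X(1)] by blast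
  have "\<nu> = nu (md2 s)" unfolding nu_md2 by (simp add: X(2) s nu_def)
  then show "\<nu> \<in> nu ` NI" using md2_NI X(1) s by blast
 qed
qed (use nu_DN in auto)

lemma finite_DN: "finite DN" by (simp add: DN_eq finite_NI)

lemma finite_DP: "finite DP" by (simp add: DP_eq)

lemma mem_DN: assumes \<nu>: "\<nu> \<in> DN" shows "pn s \<in> \<nu> \<longleftrightarrow> md2 s \<in> NI \<and> nu (md2 s) = \<nu>"
proof -
 obtain t where t: "t \<in> NI" "\<nu> = nu t" using \<nu> by (auto simp: DN_eq)
 have "pn s \<in> \<nu> \<longleftrightarrow> nu s = \<nu>" unfolding t nu_eq_iff by (simp add: nu_def mem_coset)
 moreover have "md2 s \<in> NI" if m: "pn s \<in> \<nu>"
 proof (rule md2_NI)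
  have "pn t - (0 - (pn s - pn t)) \<in> dual_lattice (qV M) N"
   by (rule dual_N_shift[OF _ N_closed(2)[OF N_closed(1)]]) (use t m in \<open>simp_all add: NI_def nu_def mem_coset\<close>)
  then show "pn s \<in> dual_lattice (qV M) N" by simp
 qed
 ultimately show ?thesis by (auto simp: nu_md2)
qed

lemma DN_subset: "\<nu> \<in> DN \<Longrightarrow> X \<in> \<nu> \<Longrightarrow> \<exists>s. X = pn s"
proof -
 assume "\<nu> \<in> DN" "X \<in> \<nu>"
 then obtain t where t: "t \<in> NI" "X - pn t \<in> N" by (auto simp: DN_eq nu_def mem_coset)
 have "pn t - (0 - (X - pn t)) \<in> dual_lattice (qV M) N"
  by (rule dual_N_shift[OF _ N_closed(2)[OF N_closed(1)]]) (use t in \<open>simp_all add: NI_def\<close>)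
 then show ?thesis by (intro dual_N_range) simp
qed

lemma polar_PN: "X \<in> span (P + N) \<Longrightarrow> Y \<in> P + N \<Longrightarrow> polar (qV M) X Y = ip X Y"
 using span_PN span_base[of Y "P + N"] by (intro polar_tr0) auto

text \<open>Since P and N are orthogonal, integrality against P + N splits into integrality of the
  two components, so every class is a sum of a class of P and a class of N.\<close>

lemma DPN_image: "disc_group (qV M) (P + N) = (\<lambda>x. fst x + snd x) ` (DP \<times> DN)"
proof
 show "disc_group (qV M) (P + N) \<subseteq> (\<lambda>x. fst x + snd x) ` (DP \<times> DN)"
 proof
  fix \<gamma> assume "\<gamma> \<in> disc_group (qV M) (P + N)"
  then obtain X where X: "X \<in> dual_lattice (qV M) (P + N)" "\<gamma> = X +o (P + N)" by (auto simp: disc_group_def)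
  have Xs: "X \<in> span (P + N)" using X(1) by (simp add: dual_lattice_def)
  have i: "ip X Y \<in> \<int>" if "Y \<in> P + N" for Y
   using X(1) that polar_PN[OF Xs that] by (auto simp: dual_lattice_def)
  have "\<exists>x. X = pt x" by (rule in_range_pt) (use Xs span_PN i mem_PN p_in_P b1 b2 in auto)
  then obtain x where x: "X = pt x" ..
  have Xe: "X = pp (fst x) + pn (snd x)" using pp_pn[of "fst x" "snd x"] by (simp add: x)
  have "ip (pn (snd x)) Y \<in> \<int>" if "Y \<in> N" for Y
   using i[OF mem_PN(3)[OF that]] ip_p_perp(2)[OF N_perp[OF that]] by (simp add: Xe bV_simps pp_def)
  then have "pn (snd x) \<in> dual_lattice (qV M) N" by (simp add: mem_dual_N pn_span)
  then have "nu (snd x) \<in> DN" unfolding nu_def disc_group_def by blast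
  moreover have "\<gamma> = mu (fst x) + nu (snd x)"
   unfolding X(2) Xe mu_def nu_def by (rule set_plus_rearrange[symmetric])
  ultimately show "\<gamma> \<in> (\<lambda>x. fst x + snd x) ` (DP \<times> DN)"
   by (intro image_eqI[of _ _ "(mu (fst x), nu (snd x))"]) (auto simp: mu_DP)
 qed
 show "(\<lambda>x. fst x + snd x) ` (DP \<times> DN) \<subseteq> disc_group (qV M) (P + N)"
 proof clarify
  fix \<mu> \<nu> assume "\<mu> \<in> DP" "\<nu> \<in> DN"
  then obtain a t where a: "\<mu> = mu a" and t: "t \<in> NI" "\<nu> = nu t" by (auto simp: DP_eq DN_eq)
  have "pp a + pn t \<in> span (P + N)"
  proof (rule span_add)
   show "pp a \<in> span (P + N)" unfolding pp_def by (intro span_scale span_base mem_PN p_in_P)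
   show "pn t \<in> span (P + N)" using pn_span span_mono[of N "P + N"] mem_PN(3) by blast
  qed
  moreover have "ip (pp a + pn t) Y \<in> \<int>" if Y: "Y \<in> P + N" for Y
  proof -
   obtain A B where AB: "Y = A + B" "A \<in> P" "B \<in> N" using Y by (rule set_plus_elim)
   obtain m where m: "A = of_int m *\<^sub>R p" using AB(2) P_eq by auto
   have "ip (pp a + pn t) Y = of_int (m * a) + ip (pn t) B"
    using ip_p_perp(2)[OF N_perp[OF AB(3)]] by (simp add: AB(1) m bV_simps ip_pp ip_pn_p) (simp add: pp_def bV_simps)
   moreover have "ip (pn t) B \<in> \<int>" using t AB(3) by (auto simp: NI_def mem_dual_N)
   ultimately show ?thesis by simp
  qed
  ultimately have "pp a + pn t \<in> dual_lattice (qV M) (P + N)" using polar_PN by (simp add: dual_lattice_def)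
  moreover have "\<mu> + \<nu> = (pp a + pn t) +o (P + N)" unfolding a t(2) mu_def nu_def by (rule set_plus_rearrange)
  ultimately show "fst (\<mu>, \<nu>) + snd (\<mu>, \<nu>) \<in> disc_group (qV M) (P + N)" unfolding disc_group_def by simp
 qed
qed

text \<open>As P + N is contained in L, membership in L' and the class modulo L can be read off from
  one representative.\<close>

lemma restrict_mu_nu: "(if mu a + nu t \<subseteq> LD then h (mu a + nu t + L) else 0) = (if pt (a, t) \<in> LD then h (lam (a, t)) else (0 :: complex))"
proof -
 have e: "mu a + nu t = pt (a, t) +o (P + N)" unfolding mu_def nu_def pp_pn by (rule set_plus_rearrange)
 have "mu a + nu t \<subseteq> LD \<longleftrightarrow> pt (a, t) \<in> LD"
 proof
  assume "mu a + nu t \<subseteq> LD"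
  moreover have "pt (a, t) \<in> mu a + nu t" unfolding e mem_coset using mem_PN(2)[OF P_closed(2)] by simp
  ultimately show "pt (a, t) \<in> LD" by blast
 next
  assume "pt (a, t) \<in> LD"
  then show "mu a + nu t \<subseteq> LD" unfolding e elt_set_plus_def using PN_L L_subset_dual LD_closed(1) by blast
 qed
 moreover have "mu a + nu t + L = lam (a, t)" unfolding e lam_def set_plus_rearrange3 PN_plus_L ..
 ultimately show ?thesis by simp
qed

text \<open>The passage from discriminant groups back to residues: the tensor product is summed over
  all pairs of classes, each class of N is resolved into its residues, and the restriction of f to
  L' keeps exactly the residues in \<open>I0\<close>.\<close>

lemma tensor_sum:
 assumes B: "\<And>\<nu>. \<nu> \<in> DN \<Longrightarrow> Bf \<nu> = (\<Sum>t | t \<in> NI \<and> nu t = \<nu>. Bt t)"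
 shows "(\<Sum>\<gamma>\<in>disc_group (qV M) (P + N). (if \<gamma> \<subseteq> LD then h (\<gamma> + L) else 0) * tensor (qV M) P N A Bf \<gamma>)
  = (\<Sum>r\<in>I0. h (lam r) * (A (mu (fst r)) * Bt (snd r)))"
proof -
 define F where "F \<gamma> = (if \<gamma> \<subseteq> LD then h (\<gamma> + L) else 0)" for \<gamma>
 have "(\<Sum>\<gamma>\<in>disc_group (qV M) (P + N). F \<gamma> * tensor (qV M) P N A Bf \<gamma>)
  = (\<Sum>\<gamma>\<in>disc_group (qV M) (P + N). \<Sum>x | x \<in> DP \<times> DN \<and> fst x + snd x = \<gamma>. F (fst x + snd x) * (A (fst x) * Bf (snd x)))"
 proof (rule sum.cong[OF refl])
  fix \<gamma>
  have "{(\<mu>, \<nu>). \<mu> \<in> DP \<and> \<nu> \<in> DN \<and> \<mu> + \<nu> = \<gamma>} = {x. x \<in> DP \<times> DN \<and> fst x + snd x = \<gamma>}" by auto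
  then have "tensor (qV M) P N A Bf \<gamma> = (\<Sum>x | x \<in> DP \<times> DN \<and> fst x + snd x = \<gamma>. A (fst x) * Bf (snd x))"
   unfolding tensor_def by (simp only: case_prod_unfold)
  then have "F \<gamma> * tensor (qV M) P N A Bf \<gamma> = (\<Sum>x | x \<in> DP \<times> DN \<and> fst x + snd x = \<gamma>. F \<gamma> * (A (fst x) * Bf (snd x)))"
   by (simp only: sum_distrib_left)
  also have "\<dots> = (\<Sum>x | x \<in> DP \<times> DN \<and> fst x + snd x = \<gamma>. F (fst x + snd x) * (A (fst x) * Bf (snd x)))"
   by (intro sum.cong refl) auto
  finally show "F \<gamma> * tensor (qV M) P N A Bf \<gamma> = (\<Sum>x | x \<in> DP \<times> DN \<and> fst x + snd x = \<gamma>. F (fst x + snd x) * (A (fst x) * Bf (snd x)))" .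
 qed
 also have "\<dots> = (\<Sum>x\<in>DP \<times> DN. F (fst x + snd x) * (A (fst x) * Bf (snd x)))"
  by (rule sum.group) (auto simp: finite_DP finite_DN DPN_image)
 also have "\<dots> = (\<Sum>\<mu>\<in>DP. \<Sum>\<nu>\<in>DN. F (\<mu> + \<nu>) * (A \<mu> * Bf \<nu>))"
  by (simp add: sum.cartesian_product case_prod_unfold)
 also have "\<dots> = (\<Sum>a\<in>{0..<d0}. \<Sum>\<nu>\<in>DN. F (mu a + \<nu>) * (A (mu a) * Bf \<nu>))"
  unfolding DP_eq sum.reindex[OF inj_mu] o_def ..
 also have "\<dots> = (\<Sum>a\<in>{0..<d0}. \<Sum>\<nu>\<in>DN. \<Sum>t | t \<in> NI \<and> nu t = \<nu>. F (mu a + nu t) * (A (mu a) * Bt t))"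
  by (intro sum.cong refl) (simp add: B sum_distrib_left)
 also have "\<dots> = (\<Sum>a\<in>{0..<d0}. \<Sum>t\<in>NI. F (mu a + nu t) * (A (mu a) * Bt t))"
  by (intro sum.cong refl sum.group finite_NI finite_DN) (use nu_DN in blast)
 also have "\<dots> = (\<Sum>r\<in>{0..<d0} \<times> NI. if pt r \<in> LD then h (lam r) * (A (mu (fst r)) * Bt (snd r)) else 0)"
  unfolding sum.cartesian_product by (intro sum.cong refl) (auto simp: F_def restrict_mu_nu)
 also have "\<dots> = (\<Sum>r\<in>{r \<in> {0..<d0} \<times> NI. pt r \<in> LD}. h (lam r) * (A (mu (fst r)) * Bt (snd r)))"
  by (rule sum.inter_filter[symmetric]) (simp add: finite_NI)
 also have "{r \<in> {0..<d0} \<times> NI. pt r \<in> LD} = I0"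
 proof -
  \<comment> \<open>The N-component of a vector of L' lies in N', so among the residues in the box
    the condition on L' already implies the one in \<open>NI\<close>.\<close>
  have "pn s \<in> dual_lattice (qV M) N" if as: "pt (a, s) \<in> LD" for a s
  proof -
   have "ip (pn s) Y \<in> \<int>" if Y: "Y \<in> N" for Y
   proof -
    have "ip (pt (a, s)) Y \<in> \<int>" using as Y by (auto simp: mem_dual_L N_def)
    then show ?thesis using ip_p_perp(2)[OF N_perp[OF Y]] by (simp add: pp_pn bV_simps pp_def)
   qed
   then show ?thesis by (simp add: mem_dual_N pn_span)
  qed
  then show ?thesis unfolding I0_def rbox_def NI_def by auto
 qed
 finally show ?thesis unfolding F_def .
qed

end

context maass_data
begin

abbreviation "Hol \<equiv> holomorphic_part wt (\<lambda>X. - qV M X) P G"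

lemma th_snd: "th (a, t) = th (b, t)" by (simp add: th_def fun_eq_iff)

text \<open>A class of N'/N is the union of its residues modulo \<open>b1\<close> and
  \<open>b2\<close>. On each of them the form is diagonal and the series is a product of two unary
  ones.\<close>

lemma theta_N:
 assumes \<nu>: "\<nu> \<in> DN" and z: "z \<in> uhp"
 shows "theta (\<lambda>X. - qV M X) z \<nu> = (\<Sum>t | t \<in> NI \<and> nu t = \<nu>. th (0, t) z)"
proof -
 let ?E = "\<lambda>s. e (of_real (- qV M (pn s)) * z)"
 define gr where "gr t s = ind d1 (fst t) (fst s) z * ind d2 (snd t) (snd s) z" for t s :: "int \<times> int"
 have gr_eq: "gr t s = (if t = md2 s then ?E s else 0)" if "t \<in> NI" for t s
 proof -
  have "md2 t = t" using that by (auto simp: NI_def md2_def)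
  then have "t = md2 s \<longleftrightarrow> md2 s = md2 t" by auto
  then have "t = md2 s \<longleftrightarrow> fst s mod d1 = fst t mod d1 \<and> snd s mod d2 = snd t mod d2" by (simp add: md2_def)
  then show ?thesis by (simp add: gr_def ind_def pn_def qV_pt e_add distrib_right)
 qed
 have "((\<lambda>s. \<Sum>t | t \<in> NI \<and> nu t = \<nu>. gr t s) has_sum (\<Sum>t | t \<in> NI \<and> nu t = \<nu>. th (0, t) z)) UNIV"
  unfolding gr_def using th_has_sum(1)[OF z, of "(0, _)"] by (intro has_sum_sum) simp
 moreover have "(\<Sum>t | t \<in> NI \<and> nu t = \<nu>. gr t s) = (if pn s \<in> \<nu> then ?E s else 0)" for s
 proof -
  have "(\<Sum>t | t \<in> NI \<and> nu t = \<nu>. gr t s) = (\<Sum>t | t \<in> NI \<and> nu t = \<nu>. if t = md2 s then ?E s else 0)"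
   by (intro sum.cong refl gr_eq) simp
  also have "\<dots> = (if md2 s \<in> {t. t \<in> NI \<and> nu t = \<nu>} then ?E s else 0)"
   by (rule sum.delta) (simp add: finite_NI)
  finally show ?thesis by (simp add: mem_DN[OF \<nu>])
 qed
 ultimately have "((\<lambda>s. if pn s \<in> \<nu> then ?E s else 0) has_sum (\<Sum>t | t \<in> NI \<and> nu t = \<nu>. th (0, t) z)) UNIV"
  by (simp only:)
 then have "(?E has_sum (\<Sum>t | t \<in> NI \<and> nu t = \<nu>. th (0, t) z)) {s. pn s \<in> \<nu>}"
  by (rule has_sum_cong_neutral[THEN iffD1, rotated -1]) auto
 moreover have "bij_betw pn {s. pn s \<in> \<nu>} \<nu>"
 proof (rule bij_betw_imageI)
  show "inj_on pn {s. pn s \<in> \<nu>}" by (rule inj_onI) (simp add: pn_def pt_inject)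
  show "pn ` {s. pn s \<in> \<nu>} = \<nu>" using DN_subset[OF \<nu>] by blast
 qed
 ultimately have "((\<lambda>X. e (of_real (- qV M X) * z)) has_sum (\<Sum>t | t \<in> NI \<and> nu t = \<nu>. th (0, t) z)) \<nu>"
  using has_sum_reindex_bij_betw[of pn "{s. pn s \<in> \<nu>}" \<nu> "\<lambda>X. e (of_real (- qV M X) * z)"] by simp
 then show ?thesis unfolding theta_def by (rule infsumI)
qed

lemma theta_N_deriv:
 assumes \<nu>: "\<nu> \<in> DN" and z: "z \<in> uhp"
 shows "vv_deriv s (theta (\<lambda>X. - qV M X)) z \<nu> = (\<Sum>t | t \<in> NI \<and> nu t = \<nu>. (deriv ^^ s) (th (0, t)) z)"
proof -
 have h: "(\<lambda>z. \<Sum>t | t \<in> NI \<and> nu t = \<nu>. th (0, t) z) holomorphic_on uhp" by (intro holomorphic_on_sum th_holo)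
 have "vv_deriv s (theta (\<lambda>X. - qV M X)) z \<nu> = (deriv ^^ s) (\<lambda>z. \<Sum>t | t \<in> NI \<and> nu t = \<nu>. th (0, t) z) z"
  unfolding vv_deriv_def
  by (rule higher_deriv_transform_within_open[OF holomorphic_transform[OF h] h open_uhp z]) (simp_all add: theta_N[OF \<nu>])
 also have "\<dots> = (\<Sum>t | t \<in> NI \<and> nu t = \<nu>. (deriv ^^ s) (th (0, t)) z)"
  by (rule higher_deriv_sum[OF th_holo z])
 finally show ?thesis .
qed

lemma Hol_deriv: "z \<in> uhp \<Longrightarrow> vv_deriv s Hol z (mu a) = (deriv ^^ s) (Gp a) z"
 unfolding vv_deriv_def
 by (rule higher_deriv_transform_within_open[OF holomorphic_transform[OF Gp_holo] Gp_holo open_uhp]) (simp_all add: holomorphic_part_eq)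

abbreviation "rc_coeff r s \<equiv> (- 1) ^ r * of_real (Gamma (wt + real n) * Gamma (1 + real n) /
  (Gamma (real s + 1) * Gamma (wt + real n - real s) * Gamma (real r + 1) * Gamma (1 + real n - real r)))"

definition bracket :: "int \<times> int \<times> int \<Rightarrow> complex \<Rightarrow> complex" where
 "bracket r z = f z (lam r) * (1 / (2 * of_real pi * \<i>) ^ n * (\<Sum>(i, s)\<in>{(i, s). i + s = n}.
   rc_coeff i s * ((deriv ^^ i) (Gp (fst r)) z * (deriv ^^ s) (th r) z)))"

lemma pairing_bracket:
 assumes z: "z \<in> uhp"
 shows "pairing (qV M) (P + N) (restrict_to_sublattice (qV M) L f z)
   (rankin_cohen (qV M) P N wt 1 n Hol (theta (\<lambda>X. - qV M X)) z) = (\<Sum>r\<in>I0. bracket r z)"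
proof -
 define F where "F \<gamma> = (if \<gamma> \<subseteq> LD then f z (\<gamma> + L) else 0)" for \<gamma>
 define T where "T i s = tensor (qV M) P N (vv_deriv i Hol z) (vv_deriv s (theta (\<lambda>X. - qV M X)) z)" for i s
 define K where "K = 1 / (2 * of_real pi * \<i>) ^ n"
 have T: "(\<Sum>\<gamma>\<in>disc_group (qV M) (P + N). F \<gamma> * T i s \<gamma>) = (\<Sum>r\<in>I0. f z (lam r) * ((deriv ^^ i) (Gp (fst r)) z * (deriv ^^ s) (th r) z))" for i s
 proof -
  have "(\<Sum>\<gamma>\<in>disc_group (qV M) (P + N). F \<gamma> * T i s \<gamma>) = (\<Sum>r\<in>I0. f z (lam r) * (vv_deriv i Hol z (mu (fst r)) * (deriv ^^ s) (th (0, snd r)) z))"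
   unfolding F_def T_def by (rule tensor_sum) (rule theta_N_deriv[OF _ z])
  moreover have "th (0, snd r) = th r" for r using th_snd[of 0 "snd r" "fst r"] by simp
  ultimately show ?thesis by (simp add: Hol_deriv[OF z])
 qed
 have "pairing (qV M) (P + N) (restrict_to_sublattice (qV M) L f z)
   (rankin_cohen (qV M) P N wt 1 n Hol (theta (\<lambda>X. - qV M X)) z)
  = (\<Sum>\<gamma>\<in>disc_group (qV M) (P + N). \<Sum>x\<in>{(i, s). i + s = n}. K * (rc_coeff (fst x) (snd x) * (F \<gamma> * T (fst x) (snd x) \<gamma>)))"
  unfolding pairing_def restrict_to_sublattice_def rankin_cohen_def F_def[symmetric] T_def[symmetric] K_def[symmetric]
   sum_distrib_left case_prod_unfold by (simp only: mult_ac)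
 also have "\<dots> = (\<Sum>x\<in>{(i, s). i + s = n}. K * (rc_coeff (fst x) (snd x) * (\<Sum>\<gamma>\<in>disc_group (qV M) (P + N). F \<gamma> * T (fst x) (snd x) \<gamma>)))"
  unfolding sum_distrib_left by (rule sum.swap)
 also have "\<dots> = (\<Sum>r\<in>I0. \<Sum>x\<in>{(i, s). i + s = n}. K * (rc_coeff (fst x) (snd x) * (f z (lam r) * ((deriv ^^ fst x) (Gp (fst r)) z * (deriv ^^ snd x) (th r) z))))"
  unfolding T sum_distrib_left by (rule sum.swap)
 also have "\<dots> = (\<Sum>r\<in>I0. bracket r z)"
  unfolding bracket_def K_def[symmetric] sum_distrib_left case_prod_unfold by (simp only: mult_ac)
 finally show ?thesis .
qed

lemma bracket_holo: "r \<in> I0 \<Longrightarrow> bracket r holomorphic_on uhp"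
 unfolding bracket_def[abs_def] case_prod_unfold
 by (intro holomorphic_on_mult holomorphic_on_const holomorphic_on_sum holomorphic_higher_deriv_uhp f_holo lam_DL Gp_holo th_holo)

lemma bracket_periodic: "r \<in> I0 \<Longrightarrow> z \<in> uhp \<Longrightarrow> bracket r (z + 1) = bracket r z"
proof -
 assume r: "r \<in> I0" and z: "z \<in> uhp"
 let ?a = "er (qV M (pt r))" and ?b = "er (- qP (fst r))" and ?c = "er (qN r)"
 have D: "(deriv ^^ i) (Gp (fst r)) (z + 1) = ?b * (deriv ^^ i) (Gp (fst r)) z" "(deriv ^^ i) (th r) (z + 1) = ?c * (deriv ^^ i) (th r) z" for i
  by (intro quasi_periodicD quasi_periodic_higher_deriv Gp_quasi_periodic Gp_holo th_quasi_periodic th_holo z)+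
 have "bracket r (z + 1) = (?a * ?b * ?c) * bracket r z"
  unfolding bracket_def D quasi_periodicD[OF f_quasi_periodic[OF r] z] sum_distrib_left case_prod_unfold by (simp only: mult_ac)
 then show ?thesis by (simp only: phase mult_1)
qed

lemma bracket_growth: "r \<in> I0 \<Longrightarrow> moderate_growth (bracket r)"
 unfolding bracket_def[abs_def] case_prod_unfold
 by (intro moderate_growth_mult[OF f_growth[OF lam_DL]] moderate_growth_mult[OF moderate_growth_const] moderate_growth_sum
   moderate_growth_mult[OF moderate_growth_higher_deriv[OF Gp_growth Gp_holo] moderate_growth_higher_deriv[OF th_growth th_holo]])

text \<open>The constant term is a mean at height 1 by \<open>constant_term_eq\<close>, and
  \<open>bracket_mean\<close> evaluates it separately for each residue r, where only scalar
  functions occur.\<close>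

lemma PL_constant_term:
 "PL Gp = of_real ((4 * pi) ^ n * fact n / pochhammer wt n) *
   constant_term (\<lambda>z. pairing (qV M) (P + N) (restrict_to_sublattice (qV M) L f z)
   (rankin_cohen (qV M) P N wt 1 n Hol (theta (\<lambda>X. - qV M X)) z))"
proof -
 have "constant_term (\<lambda>z. pairing (qV M) (P + N) (restrict_to_sublattice (qV M) L f z)
   (rankin_cohen (qV M) P N wt 1 n Hol (theta (\<lambda>X. - qV M X)) z)) = constant_term (\<lambda>z. \<Sum>r\<in>I0. bracket r z)"
  by (rule constant_term_cong) (rule pairing_bracket)
 also have "\<dots> = mean (\<lambda>z. \<Sum>r\<in>I0. bracket r z) 1"
  unfolding mean_def
  by (rule constant_term_eq) (auto intro!: holomorphic_on_sum bracket_holo moderate_growth_sum bracket_growth sum.cong bracket_periodic)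
 also have "\<dots> = (\<Sum>r\<in>I0. mean (bracket r) 1)"
  by (rule mean_sum) (auto intro!: holomorphic_on_imp_continuous_on bracket_holo finite_I0)
 finally have ct: "constant_term (\<lambda>z. pairing (qV M) (P + N) (restrict_to_sublattice (qV M) L f z)
   (rankin_cohen (qV M) P N wt 1 n Hol (theta (\<lambda>X. - qV M X)) z)) = (\<Sum>r\<in>I0. mean (bracket r) 1)" .
 show ?thesis unfolding ct PL_def sum_distrib_left
 proof (rule sum.cong[OF refl])
  fix r assume r: "r \<in> I0"
  show "(\<Sum>j\<le>n. of_real (acoeff n wt j) * (2 * \<i>) ^ n *
   mean (\<lambda>z. (deriv ^^ (n - j)) (\<lambda>z. f z (lam r)) z * (deriv ^^ j) (Gp (fst r)) z * th r z) 1)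
   = of_real ((4 * pi) ^ n * fact n / pochhammer wt n) * mean (bracket r) 1"
   unfolding bracket_def[abs_def]
   by (rule bracket_mean[symmetric, OF f_holo[OF lam_DL[OF r]] f_quasi_periodic[OF r] Gp_holo Gp_quasi_periodic th_holo th_quasi_periodic phase wt_pos(1)]) simp
 qed
qed

end

section \<open>Gamma factors and the two parities\<close>

lemma constant_even:
 assumes "k = 2 * Suc n"
 shows "(4 * pi) ^ n * fact n / pochhammer (3 / 2) n =
  pi powr (1 / 2) * Gamma (real k / 2) / (2 * (4 * pi) powr (1 - real k / 2) * Gamma ((real k + 1) / 2))"
proof -
 have "real k / 2 = 1 + real n" using assms by simp
 then have a: "Gamma (real k / 2) = fact n" by (simp only: Gamma_fact)
 have "pochhammer (3 / 2) n = Gamma (3 / 2 + real n) / Gamma (3 / 2 :: real)"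
  by (rule pochhammer_Gamma) (auto elim!: nonpos_Ints_cases)
 \<comment> \<open>This value is the origin of the factor pi^(1/2)/2 in the even case; in the odd
   case Gamma(1/2) = sqrt(pi) takes its place.\<close>
 moreover have "Gamma (3 / 2 :: real) = sqrt pi / 2"
 proof -
  have "(1 / 2 :: real) \<notin> \<int>\<^sub>\<le>\<^sub>0" by (auto elim!: nonpos_Ints_cases)
  from Gamma_plus1[OF this] show ?thesis by (simp add: Gamma_one_half_real)
 qed
 moreover have "(real k + 1) / 2 = 3 / 2 + real n" using assms by simp
 ultimately have "pochhammer (3 / 2) n = Gamma ((real k + 1) / 2) / (sqrt pi / 2)" by (simp only:)
 then have b: "pochhammer (3 / 2) n = 2 * Gamma ((real k + 1) / 2) / sqrt pi" by simp
 have "1 - real k / 2 = - real n" using assms by (simp add: add_divide_distrib)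
 then have c: "(4 * pi) powr (1 - real k / 2) = inverse ((4 * pi) ^ n)" by (simp add: powr_minus powr_realpow)
 have d: "pi powr (1 / 2) = sqrt pi" by (simp add: powr_half_sqrt)
 show ?thesis unfolding a b c d by (simp add: field_simps)
qed

lemma constant_odd:
 assumes "k = 2 * n + 1"
 shows "(4 * pi) ^ n * fact n / pochhammer (1 / 2) n =
  pi powr (1 / 2) * Gamma ((real k + 1) / 2) / ((4 * pi) powr ((1 - real k) / 2) * Gamma (real k / 2))"
proof -
 have "(real k + 1) / 2 = 1 + real n" using assms by simp
 then have a: "Gamma ((real k + 1) / 2) = fact n" by (simp only: Gamma_fact)
 have "pochhammer (1 / 2) n = Gamma (1 / 2 + real n) / Gamma (1 / 2 :: real)"
  by (rule pochhammer_Gamma) (auto elim!: nonpos_Ints_cases)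
 moreover have "real k / 2 = 1 / 2 + real n" using assms by simp
 ultimately have b: "pochhammer (1 / 2) n = Gamma (real k / 2) / sqrt pi" by (simp only: Gamma_one_half_real)
 have "(1 - real k) / 2 = - real n" using assms by simp
 then have c: "(4 * pi) powr ((1 - real k) / 2) = inverse ((4 * pi) ^ n)" by (simp add: powr_minus powr_realpow)
 have d: "pi powr (1 / 2) = sqrt pi" by (simp add: powr_half_sqrt)
 show ?thesis unfolding a b c d by (simp add: field_simps)
qed

lemma lift_integrand_even:
 assumes "even k" "k \<ge> 2"
 shows "lift_integrand M L k f z t = pairing (qV M) L
  (\<lambda>\<mu>. raise_iter (k div 2 - 1) (1 - 2 * real (k div 2 - 1) - 3 / 2) (\<lambda>t. f t \<mu>) t)
  (\<lambda>\<mu>. cnj (of_real (Im t) * (\<Sum>\<^sub>\<infinity>X\<in>\<mu>. of_real 1 * e (of_real (qV M (proj_pos M z X)) * t + of_real (qV M (proj_neg M z X)) * cnj t)))) *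
  of_real (Im t powr (- 1 / 2))"
proof -
 obtain m where m: "k = 2 * m" using assms(1) by auto
 then have "3 / 2 - real k = 1 - 2 * real (k div 2 - 1) - 3 / 2" using assms(2) by (simp add: of_nat_diff)
 then show ?thesis using assms(1) by (simp add: lift_integrand_def siegel_theta_def)
qed

lemma lift_integrand_odd:
 assumes "odd k"
 shows "lift_integrand M L k f z t = pairing (qV M) L
  (\<lambda>\<mu>. raise_iter ((k - 1) div 2) (1 - 2 * real ((k - 1) div 2) - 1 / 2) (\<lambda>t. f t \<mu>) t)
  (\<lambda>\<mu>. cnj (of_real (Im t) * (\<Sum>\<^sub>\<infinity>X\<in>\<mu>. of_real (pX M X z) * e (of_real (qV M (proj_pos M z X)) * t + of_real (qV M (proj_neg M z X)) * cnj t)))) *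
  of_real (Im t powr (1 / 2))"
proof -
 obtain m where m: "k = 2 * m + 1" using assms by (elim oddE)
 then have "3 / 2 - real k = 1 - 2 * real ((k - 1) div 2) - 1 / 2" by simp
 then show ?thesis using assms by (simp add: lift_integrand_def millson_theta_def)
qed

lemma powr_quotient:
 assumes "v > 0" "a + b = 2"
 shows "of_real (v powr a) * X * of_real (v powr b) / of_real (v\<^sup>2) = (X :: complex)"
proof -
 have "v powr a * v powr b = v\<^sup>2" using assms by (simp add: powr_add[symmetric])
 then have "complex_of_real (v powr a) * of_real (v powr b) = of_real (v\<^sup>2)" by (metis of_real_mult)
 then have "of_real (v powr a) * X * of_real (v powr b) = of_real (v\<^sup>2) * X" by (simp only: mult_ac)
 moreover have "complex_of_real (v\<^sup>2) \<noteq> 0" using assms by simp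
 ultimately show ?thesis by (simp only:) (rule nonzero_mult_div_cancel_left)
qed

lemma (in framed_lattice) lift_formula_even:
 assumes k: "even k" "k \<ge> 2" and f: "weakly_holomorphic (3 / 2 - real k) (qV M) L f"
 shows "reg_integrable (lift_integrand M L k f zA) \<and> (\<forall>G.
    harmonic_maass_form_ext (3 / 2) (qV_neg M) P G \<and>
    (\<forall>z\<in>uhp. \<forall>\<mu>\<in>DP. xi (3 / 2) (\<lambda>z. G z \<mu>) z = theta (qV M) z \<mu>) \<longrightarrow>
    reg_lift M L k f zA =
     of_real (pi powr (1 / 2) * Gamma (real k / 2) /
      (2 * (4 * pi) powr (1 - real k / 2) * Gamma ((real k + 1) / 2))) *
     constant_term (\<lambda>z. pairing (qV M) (P + N) (restrict_to_sublattice (qV M) L f z)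
      (rankin_cohen (qV M) P N (3 / 2) 1 (k div 2 - 1)
       (holomorphic_part (3 / 2) (qV_neg M) P G) (theta (qV_neg M)) z)))"
proof -
 define n where "n = k div 2 - 1"
 have kn: "k = 2 * Suc n" using k by (auto simp: n_def)
 have w: "1 - 2 * real n - 3 / 2 = 3 / 2 - real k" by (simp add: kn)
 interpret D: lift_data M L X0 zA p b1 b2 d0 d1 d2 "3 / 2" n f "\<lambda>_. 1" 1
  by unfold_locales (use f in \<open>simp_all only: w, simp_all\<close>)
 have h: "lift_integrand M L k f zA z / of_real ((Im z)\<^sup>2) = D.integrand z" if z: "z \<in> uhp" for z
 proof -
  have v: "Im z > 0" using z by (simp add: uhp_def)
  have "lift_integrand M L k f zA z = of_real (Im z powr (3 / 2 + 1)) * D.integrand z * of_real (Im z powr (- 1 / 2))"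
   unfolding lift_integrand_even[OF k] n_def[symmetric]
   using D.lift_pairing[OF z, of "\<lambda>_. 1"] unfolding D.kernel_term_def by simp
  then show ?thesis by (simp only: powr_quotient[OF v])
 qed
 show ?thesis
 proof (intro conjI allI impI, goal_cases)
  case 1
  show ?case by (rule D.reg_from_integrand(1)[OF h])
 next
  case (2 G)
  interpret E: maass_data M L X0 zA p b1 b2 d0 d1 d2 "3 / 2" n f "\<lambda>_. 1" 1 G
  proof unfold_locales
   fix z a assume z: "z \<in> uhp"
   show "xi (3 / 2) (\<lambda>z. G z (mu a)) z = D.thP a z"
    unfolding 2[THEN conjunct2, rule_format, OF z mu_DP] theta_def using D.mu_sum[OF z, of "\<lambda>_. 1" a] by simp
  qed (use 2 in blast)
  have PL: "reg_integral (lift_integrand M L k f zA) = D.PL E.Gp" by (rule D.reg_from_integrand(2)[OF h E.integral_PL])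
  show ?case
   unfolding n_def[symmetric] reg_lift_def PL E.PL_constant_term constant_even[OF kn] ..
 qed
qed

lemma (in framed_lattice) lift_formula_odd:
 assumes k: "odd k" and f: "weakly_holomorphic (3 / 2 - real k) (qV M) L f"
 shows "reg_integrable (lift_integrand M L k f zA) \<and> (\<forall>G.
    harmonic_maass_form_ext (1 / 2) (qV_neg M) P G \<and>
    (\<forall>z\<in>uhp. \<forall>\<mu>\<in>DP. xi (1 / 2) (\<lambda>z. G z \<mu>) z = theta_star M zA z \<mu>) \<longrightarrow>
    reg_lift M L k f zA =
     of_real (pi powr (1 / 2) * Gamma ((real k + 1) / 2) /
      ((4 * pi) powr ((1 - real k) / 2) * Gamma (real k / 2))) *
     constant_term (\<lambda>z. pairing (qV M) (P + N) (restrict_to_sublattice (qV M) L f z)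
      (rankin_cohen (qV M) P N (1 / 2) 1 ((k - 1) div 2)
       (holomorphic_part (1 / 2) (qV_neg M) P G) (theta (qV_neg M)) z)))"
proof -
 define n where "n = (k - 1) div 2"
 have kn: "k = 2 * n + 1" using k by (auto simp: n_def elim!: oddE)
 have w: "1 - 2 * real n - 1 / 2 = 3 / 2 - real k" by (simp add: kn)
 obtain c where c: "X1 M zA = c *\<^sub>R X0" using X1_X0 by blast
 obtain c' where c': "c' \<noteq> 0" "p = c' *\<^sub>R X0" using p_X0 by blast
 \<comment> \<open>p_X(zA) is s times the coordinate of X along \<open>p\<close>; in particular it
   vanishes at 0, as \<open>wt\<close> = 1/2 requires.\<close>
 define s where "s = - sqrt (2 * real M) * (c / c')"
 have X1: "X1 M zA = (c / c') *\<^sub>R p" using c c' by simp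
 have W: "pX M (pt x) zA = s * of_int (fst x)" "pX M (pp a) zA = s * of_int a" for x a
  unfolding pX_def X1 bV_simps ip_pt_frame ip_pp by (simp_all add: s_def)
 interpret D: lift_data M L X0 zA p b1 b2 d0 d1 d2 "1 / 2" n f "\<lambda>x. s * of_int x" "\<bar>s\<bar>"
 proof unfold_locales
  show "\<bar>s * of_int x\<bar> \<le> \<bar>s\<bar> * ab x" for x by (simp add: abs_mult distrib_left)
  show "weakly_holomorphic (1 - 2 * real n - 1 / 2) (qV M) L f" unfolding w by (rule f)
 qed simp
 have h: "lift_integrand M L k f zA z / of_real ((Im z)\<^sup>2) = D.integrand z" if z: "z \<in> uhp" for z
 proof -
  have v: "Im z > 0" using z by (simp add: uhp_def)
  have "lift_integrand M L k f zA z = of_real (Im z powr (1 / 2 + 1)) * D.integrand z * of_real (Im z powr (1 / 2))"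
   unfolding lift_integrand_odd[OF k] n_def[symmetric]
   using D.lift_pairing[OF z, of "\<lambda>X. pX M X zA", OF W(1)] unfolding D.kernel_term_def by simp
  then show ?thesis by (simp only: powr_quotient[OF v])
 qed
 show ?thesis
 proof (intro conjI allI impI, goal_cases)
  case 1
  show ?case by (rule D.reg_from_integrand(1)[OF h])
 next
  case (2 G)
  interpret E: maass_data M L X0 zA p b1 b2 d0 d1 d2 "1 / 2" n f "\<lambda>x. s * of_int x" "\<bar>s\<bar>" G
  proof unfold_locales
   fix z a assume z: "z \<in> uhp"
   show "xi (1 / 2) (\<lambda>z. G z (mu a)) z = D.thP a z"
    unfolding 2[THEN conjunct2, rule_format, OF z mu_DP] theta_star_def by (rule D.mu_sum[OF z]) (rule W(2))
  qed (use 2 in blast)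
  have PL: "reg_integral (lift_integrand M L k f zA) = D.PL E.Gp" by (rule D.reg_from_integrand(2)[OF h E.integral_PL])
  show ?case
   unfolding n_def[symmetric] reg_lift_def PL E.PL_constant_term constant_odd[OF kn] ..
 qed
qed

theorem theorem4p1:
  fixes M k :: nat and L P N :: "(real^2^2) set" and X0 :: "real^2^2" and zA :: complex
    and f :: "(real^2^2) vvfun"
  assumes "M > 0"
    and "even_lattice (qV M) L" and "L \<subseteq> V M" and "span L = span (V M)"
    and "k \<ge> 2"
    and "X0 \<in> dual_lattice (qV M) L" and "qV M X0 > 0"
    and "zA \<in> uhp" and "span {X1 M zA} = span {X0}"
    and "P = L \<inter> span {X0}" and "N = L \<inter> {X. bV M X X0 = 0}"
    and "weakly_holomorphic (3 / 2 - real k) (qV M) L f"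
  shows "reg_integrable (lift_integrand M L k f zA) \<and>
    (even k \<longrightarrow> (\<forall>G.
       harmonic_maass_form_ext (3 / 2) (qV_neg M) P G \<and>
       (\<forall>\<tau>\<in>uhp. \<forall>\<mu>\<in>disc_group (qV M) P. xi (3 / 2) (\<lambda>\<tau>. G \<tau> \<mu>) \<tau> = theta (qV M) \<tau> \<mu>) \<longrightarrow>
       reg_lift M L k f zA =
         of_real (pi powr (1 / 2) * Gamma (real k / 2) /
           (2 * (4 * pi) powr (1 - real k / 2) * Gamma ((real k + 1) / 2))) *
         constant_term (\<lambda>\<tau>. pairing (qV M) (P + N) (restrict_to_sublattice (qV M) L f \<tau>)
           (rankin_cohen (qV M) P N (3 / 2) 1 (k div 2 - 1)
              (holomorphic_part (3 / 2) (qV_neg M) P G) (theta (qV_neg M)) \<tau>)))) \<and>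
    (odd k \<longrightarrow> (\<forall>G.
       harmonic_maass_form (1 / 2) (qV_neg M) P G \<and>
       (\<forall>\<tau>\<in>uhp. \<forall>\<mu>\<in>disc_group (qV M) P. xi (1 / 2) (\<lambda>\<tau>. G \<tau> \<mu>) \<tau> = theta_star M zA \<tau> \<mu>) \<longrightarrow>
       reg_lift M L k f zA =
         of_real (pi powr (1 / 2) * Gamma ((real k + 1) / 2) /
           ((4 * pi) powr ((1 - real k) / 2) * Gamma (real k / 2))) *
         constant_term (\<lambda>\<tau>. pairing (qV M) (P + N) (restrict_to_sublattice (qV M) L f \<tau>)
           (rankin_cohen (qV M) P N (1 / 2) 1 ((k - 1) div 2)
              (holomorphic_part (1 / 2) (qV_neg M) P G) (theta (qV_neg M)) \<tau>))))"
proof -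
  interpret A: special_lattice M L X0 zA by unfold_locales (fact assms)+
  obtain p b1 b2 d0 d1 d2 where "framed_lattice M L X0 zA p b1 b2 d0 d1 d2" using A.exists_framed by blast
  then interpret B: framed_lattice M L X0 zA p b1 b2 d0 d1 d2 .
  have P: "P = A.P" and N: "N = A.N" unfolding A.P_def A.N_def by (fact assms)+
  have f: "weakly_holomorphic (3 / 2 - real k) (qV M) L f" by fact
  \<comment> \<open>The formula was proved for \<open>harmonic_maass_form_ext\<close> in both
    parities; for odd k it is specialized to the subclass
    \<open>harmonic_maass_form\<close>.\<close>
  show ?thesis unfolding P N
    using B.lift_formula_even[OF _ \<open>k \<ge> 2\<close> f] B.lift_formula_odd[OF _ f] harmonic_maass_form_imp_ext by blast
qed

end
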